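(* Let $M,N$ be positive integers, let $\mathbf a\in\overline{\mathbb Q}^N$, and let $T$ be a homogeneous polynomial of degree $M$ in $N$ variables with coefficients in $\overline{\mathbb Q}$ such that $T(\mathbf a)\neq 0$. Then $$1=H(\mathbf a)^M\cdot U(\mathbf a,T).$$
   Context: Let $K$ be a number field containing the entries of $\mathbf a$ and the coefficients of $T$. For a place $v$ of $K$ over the place $p$ of $\mathbb Q$, let $d=[K:\mathbb Q]$, $d_v=[K_v:\mathbb Q_p]$, $\|\cdot\|_v$ the unique extension to $K_v$ of the usual absolute value on $\mathbb Q_p$, and $|x|_v=\|x\|_v^{d_v/d}$; these extend uniquely to $\Omega_v$, the completion of an algebraic closure of $K_v$. For $\mathbf a=(a_1,\dots,a_N)$ put $H_v(\mathbf a)=\max_n|a_n|_v$ and $H(\mathbf a)=\prod_v H_v(\mathbf a)$ (product over all places of $K$). Let $\mathcal L_v$ be the space of homogeneous polynomials of degree $M$ in $N$ variables over $\Omega_v$ together with $0$; for $S\in\mathcal L_v$ let $\nu_v(S)=\sup\{|S(\mathbf z)|_v:\mathbf z\in\Omega_v^N,\ H_v(\mathbf z)\le1\}$ and $U_v(\mathbf a,S)=\inf\{\nu_v(S-f):f\in\mathcal L_v,\ f(\mathbf a)=0\}$. Define $U(\mathbf a,T)=\prod_v U_v(\mathbf a,T)$, the product over all places $v$ of $K$ (all but finitely many factors equal $1$, and the product is independent of the choice of $K$). *)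

theory Defs
  imports
    Complex_Main
    "HOL-Computational_Algebra.Computational_Algebra"
    "HOL-Algebra.Algebraic_Closure_Type"
begin

section \<open>Number fields\<close>

text \<open>Number fields are taken inside the complex numbers, and algebraic numbers are the
  algebraic complex numbers.\<close>

abbreviation complex_field :: "complex ring" where
  "complex_field \<equiv> ring_of_type_algebra"

definition number_field :: "complex set \<Rightarrow> bool" where
  "number_field K \<longleftrightarrow> subfield K complex_field \<and> ring.finite_dimension complex_field \<rat> K"

abbreviation field_of :: "complex set \<Rightarrow> complex ring" where
  "field_of K \<equiv> complex_field \<lparr> carrier := K \<rparr>"

definition degree_nf :: "complex set \<Rightarrow> nat" where
  "degree_nf K = ring.dim complex_field \<rat> K"


section \<open>Absolute values and places\<close>

text \<open>Absolute values are required to be \<^const>\<open>extensional\<close>, so that two of them are equal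
  as functions as soon as they agree on the carrier.\<close>

definition abs_values :: "('a, 'b) ring_scheme \<Rightarrow> ('a \<Rightarrow> real) set" where
  "abs_values R = {\<phi> \<in> extensional (carrier R).
     (\<forall>x\<in>carrier R. \<phi> x \<ge> 0 \<and> (\<phi> x = 0 \<longleftrightarrow> x = \<zero>\<^bsub>R\<^esub>)) \<and>
     (\<forall>x\<in>carrier R. \<forall>y\<in>carrier R. \<phi> (x \<otimes>\<^bsub>R\<^esub> y) = \<phi> x * \<phi> y) \<and>
     (\<forall>x\<in>carrier R. \<forall>y\<in>carrier R. \<phi> (x \<oplus>\<^bsub>R\<^esub> y) \<le> \<phi> x + \<phi> y)}"

definition nontrivial_abs_values :: "('a, 'b) ring_scheme \<Rightarrow> ('a \<Rightarrow> real) set" where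
  "nontrivial_abs_values R =
     {\<phi> \<in> abs_values R. \<exists>x\<in>carrier R. x \<noteq> \<zero>\<^bsub>R\<^esub> \<and> \<phi> x \<noteq> 1}"

definition abs_equiv :: "('a, 'b) ring_scheme \<Rightarrow> (('a \<Rightarrow> real) \<times> ('a \<Rightarrow> real)) set" where
  "abs_equiv R = {(\<phi>, \<psi>). \<phi> \<in> nontrivial_abs_values R \<and> \<psi> \<in> nontrivial_abs_values R \<and>
     (\<exists>s>0. \<forall>x\<in>carrier R. \<psi> x = \<phi> x powr s)}"

type_synonym place = "(complex \<Rightarrow> real) set"

definition places :: "complex set \<Rightarrow> place set" where
  "places K = nontrivial_abs_values (field_of K) // abs_equiv (field_of K)"

definition padic_abs :: "nat \<Rightarrow> rat \<Rightarrow> real" where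
  "padic_abs p x = (if x = 0 then 0 else case quotient_of x of (n, d) \<Rightarrow>
     real p powi (int (multiplicity (int p) d) - int (multiplicity (int p) n)))"

definition usual_abs_rat :: "(rat \<Rightarrow> real) set" where
  "usual_abs_rat = insert (\<lambda>x. real_of_rat \<bar>x\<bar>) (padic_abs ` {p. Factorial_Ring.prime p})"

text \<open>The normalised representative of a place: the one which restricts to a usual absolute
  value on the rationals.\<close>

definition norm_at :: "place \<Rightarrow> complex \<Rightarrow> real" where
  "norm_at v = (THE \<phi>. \<phi> \<in> v \<and> (\<exists>\<alpha>\<in>usual_abs_rat. \<forall>x. \<phi> (of_rat x) = \<alpha> x))"


section \<open>Completions\<close>

definition cauchy_ring :: "('a, 'b) ring_scheme \<Rightarrow> ('a \<Rightarrow> real) \<Rightarrow> (nat \<Rightarrow> 'a) ring" where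
  "cauchy_ring R \<phi> =
     \<lparr> carrier = {f. range f \<subseteq> carrier R \<and>
                    (\<forall>e>0. \<exists>k. \<forall>m\<ge>k. \<forall>n\<ge>k. \<phi> (f m \<ominus>\<^bsub>R\<^esub> f n) < e)},
       monoid.mult = (\<lambda>f g n. f n \<otimes>\<^bsub>R\<^esub> g n),
       one = (\<lambda>n. \<one>\<^bsub>R\<^esub>),
       zero = (\<lambda>n. \<zero>\<^bsub>R\<^esub>),
       add = (\<lambda>f g n. f n \<oplus>\<^bsub>R\<^esub> g n) \<rparr>"

definition null_seqs :: "('a, 'b) ring_scheme \<Rightarrow> ('a \<Rightarrow> real) \<Rightarrow> (nat \<Rightarrow> 'a) set" where
  "null_seqs R \<phi> = {f \<in> carrier (cauchy_ring R \<phi>). (\<lambda>n. \<phi> (f n)) \<longlonglongrightarrow> 0}"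

definition field_completion :: "('a, 'b) ring_scheme \<Rightarrow> ('a \<Rightarrow> real) \<Rightarrow> (nat \<Rightarrow> 'a) set ring" where
  "field_completion R \<phi> = cauchy_ring R \<phi> Quot null_seqs R \<phi>"

definition completion_abs :: "('a \<Rightarrow> real) \<Rightarrow> (nat \<Rightarrow> 'a) set \<Rightarrow> real" where
  "completion_abs \<phi> C = (THE r. \<forall>f\<in>C. (\<lambda>n. \<phi> (f n)) \<longlonglongrightarrow> r)"

definition completion_embed ::
    "('a, 'b) ring_scheme \<Rightarrow> ('a \<Rightarrow> real) \<Rightarrow> 'a \<Rightarrow> (nat \<Rightarrow> 'a) set" where
  "completion_embed R \<phi> x = null_seqs R \<phi> +>\<^bsub>cauchy_ring R \<phi>\<^esub> (\<lambda>n. x)"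

definition local_field :: "complex set \<Rightarrow> place \<Rightarrow> (nat \<Rightarrow> complex) set ring" where
  "local_field K v = field_completion (field_of K) (norm_at v)"

text \<open>The field of \<open>p\<close>-adic (or real) numbers, as the closure of the rationals in the
  completion of \<open>K\<close> at \<open>v\<close>.\<close>

definition local_base :: "complex set \<Rightarrow> place \<Rightarrow> (nat \<Rightarrow> complex) set set" where
  "local_base K v = {C \<in> carrier (local_field K v). \<exists>f\<in>C. range f \<subseteq> \<rat>}"

definition local_degree :: "complex set \<Rightarrow> place \<Rightarrow> nat" where
  "local_degree K v = ring.dim (local_field K v) (local_base K v) (carrier (local_field K v))"


section \<open>The complete algebraically closed fields at the places\<close>

definition alg_closure_abs ::
    "'a ring \<Rightarrow> ('a \<Rightarrow> real) \<Rightarrow> (('a list \<times> nat) multiset \<Rightarrow> 'a) \<Rightarrow> real" where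
  "alg_closure_abs F \<phi> = (THE \<psi>. \<psi> \<in> abs_values (field.alg_closure F) \<and>
     (\<forall>x\<in>carrier F. \<psi> (ring.indexed_const F x) = \<phi> x))"

type_synonym local_alg =
  "((nat \<Rightarrow> complex) set list \<times> nat) multiset \<Rightarrow> (nat \<Rightarrow> complex) set"

type_synonym omega = "(nat \<Rightarrow> local_alg) set"

definition local_closure :: "complex set \<Rightarrow> place \<Rightarrow> local_alg ring" where
  "local_closure K v = field.alg_closure (local_field K v)"

definition local_closure_abs :: "complex set \<Rightarrow> place \<Rightarrow> local_alg \<Rightarrow> real" where
  "local_closure_abs K v = alg_closure_abs (local_field K v) (completion_abs (norm_at v))"

definition Omega :: "complex set \<Rightarrow> place \<Rightarrow> omega ring" where
  "Omega K v = field_completion (local_closure K v) (local_closure_abs K v)"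

definition embed_at :: "complex set \<Rightarrow> place \<Rightarrow> complex \<Rightarrow> omega" where
  "embed_at K v x = completion_embed (local_closure K v) (local_closure_abs K v)
     (ring.indexed_const (local_field K v) (completion_embed (field_of K) (norm_at v) x))"

definition abs_at :: "complex set \<Rightarrow> place \<Rightarrow> omega \<Rightarrow> real" where
  "abs_at K v x = completion_abs (local_closure_abs K v) x
     powr (real (local_degree K v) / real (degree_nf K))"


section \<open>Homogeneous polynomials\<close>

text \<open>As in \<^theory>\<open>HOL-Algebra.Indexed_Polynomials\<close>, monomials are multisets of variables and
  a polynomial maps each monomial to its coefficient. The variables are indexed by \<open>{..<N}\<close>, and
  points are functions of which only the values on \<open>{..<N}\<close> are relevant.\<close>

definition monomials :: "nat \<Rightarrow> nat \<Rightarrow> nat multiset set" where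
  "monomials N M = {m. set_mset m \<subseteq> {..<N} \<and> size m = M}"

definition forms :: "('a, 'b) ring_scheme \<Rightarrow> nat \<Rightarrow> nat \<Rightarrow> (nat multiset \<Rightarrow> 'a) set" where
  "forms R N M = {S. (\<forall>m. S m \<in> carrier R) \<and> (\<forall>m. m \<notin> monomials N M \<longrightarrow> S m = \<zero>\<^bsub>R\<^esub>)}"

definition form_eval ::
    "('a, 'b) ring_scheme \<Rightarrow> nat \<Rightarrow> nat \<Rightarrow> (nat multiset \<Rightarrow> 'a) \<Rightarrow> (nat \<Rightarrow> 'a) \<Rightarrow> 'a" where
  "form_eval R N M S z =
     (\<Oplus>\<^bsub>R\<^esub>m\<in>monomials N M. S m \<otimes>\<^bsub>R\<^esub> (\<Otimes>\<^bsub>R\<^esub>i\<in>{..<N}. z i [^]\<^bsub>R\<^esub> count m i))"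


section \<open>Heights and the invariant \<open>U\<close>\<close>

definition local_height :: "('a \<Rightarrow> real) \<Rightarrow> nat \<Rightarrow> (nat \<Rightarrow> 'a) \<Rightarrow> real" where
  "local_height \<alpha> N z = Max ((\<lambda>n. \<alpha> (z n)) ` {..<N})"

definition form_norm ::
    "('a, 'b) ring_scheme \<Rightarrow> ('a \<Rightarrow> real) \<Rightarrow> nat \<Rightarrow> nat \<Rightarrow> (nat multiset \<Rightarrow> 'a) \<Rightarrow> real" where
  "form_norm R \<alpha> N M S =
     Sup {\<alpha> (form_eval R N M S z) | z. z \<in> {..<N} \<rightarrow> carrier R \<and> local_height \<alpha> N z \<le> 1}"

definition local_U ::
    "('a, 'b) ring_scheme \<Rightarrow> ('a \<Rightarrow> real) \<Rightarrow> nat \<Rightarrow> nat \<Rightarrow> (nat \<Rightarrow> 'a) \<Rightarrow>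
     (nat multiset \<Rightarrow> 'a) \<Rightarrow> real" where
  "local_U R \<alpha> N M z S =
     Inf {form_norm R \<alpha> N M (\<lambda>m. S m \<ominus>\<^bsub>R\<^esub> f m) | f.
            f \<in> forms R N M \<and> form_eval R N M f z = \<zero>\<^bsub>R\<^esub>}"

definition height_at :: "complex set \<Rightarrow> place \<Rightarrow> nat \<Rightarrow> (nat \<Rightarrow> complex) \<Rightarrow> real" where
  "height_at K v N a = local_height (abs_at K v) N (\<lambda>n. embed_at K v (a n))"

definition U_at ::
    "complex set \<Rightarrow> place \<Rightarrow> nat \<Rightarrow> nat \<Rightarrow> (nat \<Rightarrow> complex) \<Rightarrow> (nat multiset \<Rightarrow> complex) \<Rightarrow> real" where
  "U_at K v N M a T =
     local_U (Omega K v) (abs_at K v) N M (\<lambda>n. embed_at K v (a n)) (\<lambda>m. embed_at K v (T m))"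

text \<open>There are infinitely many places, but only finitely many factors of the products
  below differ from \<open>1\<close>.\<close>

definition prod_places :: "complex set \<Rightarrow> (place \<Rightarrow> real) \<Rightarrow> real" where
  "prod_places K g = (\<Prod>v\<in>{v \<in> places K. g v \<noteq> 1}. g v)"

definition global_height :: "complex set \<Rightarrow> nat \<Rightarrow> (nat \<Rightarrow> complex) \<Rightarrow> real" where
  "global_height K N a = prod_places K (\<lambda>v. height_at K v N a)"

definition U_global ::
    "complex set \<Rightarrow> nat \<Rightarrow> nat \<Rightarrow> (nat \<Rightarrow> complex) \<Rightarrow> (nat multiset \<Rightarrow> complex) \<Rightarrow> real" where
  "U_global K N M a T = prod_places K (\<lambda>v. U_at K v N M a T)"

end

theory Submission
  imports Defs
begin

text \<open>
  At a place \<open>v\<close> one has \<open>H\<^sub>v(a)\<^sup>M U\<^sub>v(a,T) = |T(a)|\<^sub>v\<close>: dividing \<open>a\<close> by a coordinate of maximal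
  absolute value bounds \<open>T(a) = (T - f)(a)\<close> by the norm of \<open>T - f\<close>, and a multiple of the
  \<open>M\<close>-th power of that coordinate attains the bound. The theorem is therefore the product
  formula for the number \<open>T(a)\<close>.

  An absolute value of a complete field extends to the algebraic closure because a minimal
  power-multiplicative seminorm below the spectral seminorm is multiplicative, and it extends
  uniquely because norms on finite-dimensional spaces are equivalent. For the product formula
  write \<open>K = \<rat>(\<theta>)\<close> and extend an absolute value \<open>\<alpha>\<close> of the rationals to an absolute value \<open>w\<close> of the
  algebraic numbers. By weak approximation the absolute values of \<open>K\<close> above \<open>\<alpha>\<close> are the \<open>w \<circ> \<sigma>\<close> for
  the embeddings \<open>\<sigma>\<close> of \<open>K\<close>, and the local degree of each of them is the number of \<open>\<sigma>\<close> which yield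
  it; so their product at \<open>x\<close>, with these exponents, is \<open>\<alpha>(N x)\<close> for the norm \<open>N x\<close>.
\<close>

text \<open>The definitions dictate what must be shown. \<open>norm_at\<close> and
  \<open>alg_closure_abs\<close> are definite descriptions, so existence and uniqueness are both
  required: Ostrowski's theorem supplies the normalised representative of a place, and the spectral
  seminorm characterises the extension to an algebraic closure. Local degrees are dimensions over
  the closure of the rationals in a completion, so the product formula needs an explicit basis of
  the completion. Extensions are built from seminorms because this treats archimedean and
  ultrametric places alike; the formula through norms would call for Hensel's lemma on one side and
  the classification of complete archimedean fields on the other. Counting conjugates among the
  algebraic numbers under one fixed extension \<open>w\<close> replaces the factorisation of the
  minimal polynomial over a completion. Newton's identities appear because weak approximation
  controls traces, hence power sums of the conjugates, and not the coefficients of their polynomial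
  directly.\<close>

locale abs_valued_field = field R for R (structure) +
  fixes \<phi> :: "'a \<Rightarrow> real"
  assumes abs_nonneg: "x \<in> carrier R \<Longrightarrow> 0 \<le> \<phi> x"
    and abs_eq_0_iff: "x \<in> carrier R \<Longrightarrow> \<phi> x = 0 \<longleftrightarrow> x = \<zero>"
    and abs_mult: "\<lbrakk>x \<in> carrier R; y \<in> carrier R\<rbrakk> \<Longrightarrow> \<phi> (x \<otimes> y) = \<phi> x * \<phi> y"
    and abs_add: "\<lbrakk>x \<in> carrier R; y \<in> carrier R\<rbrakk> \<Longrightarrow> \<phi> (x \<oplus> y) \<le> \<phi> x + \<phi> y"
begin

lemma abs_zero [simp]: "\<phi> \<zero> = 0"
  using abs_eq_0_iff by blast

lemma abs_one [simp]: "\<phi> \<one> = 1"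
proof -
  have "\<phi> \<one> * \<phi> \<one> = \<phi> \<one>" using abs_mult[of \<one> \<one>] by simp
  moreover have "\<phi> \<one> \<noteq> 0" using abs_eq_0_iff[of \<one>] by simp
  ultimately show ?thesis by simp
qed

lemma abs_uminus [simp]: "x \<in> carrier R \<Longrightarrow> \<phi> (\<ominus> x) = \<phi> x"
proof -
  assume x: "x \<in> carrier R"
  have "\<phi> (\<ominus> \<one>) * \<phi> (\<ominus> \<one>) = \<phi> ((\<ominus> \<one>) \<otimes> (\<ominus> \<one>))" by (simp add: abs_mult)
  also have "(\<ominus> \<one>) \<otimes> (\<ominus> \<one>) = \<one>" by algebra
  finally have "\<phi> (\<ominus> \<one>) ^ 2 = 1" by (simp add: power2_eq_square)
  hence "\<phi> (\<ominus> \<one>) = 1" using abs_nonneg[of "\<ominus> \<one>"] by (simp add: power2_eq_1_iff)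
  moreover have "\<ominus> x = (\<ominus> \<one>) \<otimes> x" using x by algebra
  ultimately show ?thesis using x by (simp add: abs_mult)
qed

lemma abs_pow: "x \<in> carrier R \<Longrightarrow> \<phi> (x [^] (n::nat)) = \<phi> x ^ n"
  by (induction n) (auto simp: abs_mult)

lemma abs_minus_le: "\<lbrakk>x \<in> carrier R; y \<in> carrier R\<rbrakk> \<Longrightarrow> \<phi> (x \<ominus> y) \<le> \<phi> x + \<phi> y"
  using abs_add[of x "\<ominus> y"] by (simp add: a_minus_def)

lemma abs_minus_commute: "\<lbrakk>x \<in> carrier R; y \<in> carrier R\<rbrakk> \<Longrightarrow> \<phi> (x \<ominus> y) = \<phi> (y \<ominus> x)"
proof -
  assume "x \<in> carrier R" "y \<in> carrier R"
  moreover from this have "x \<ominus> y = \<ominus> (y \<ominus> x)" by algebra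
  ultimately show ?thesis by simp
qed

lemma abs_diff_triangle:
  "\<lbrakk>x \<in> carrier R; y \<in> carrier R; z \<in> carrier R\<rbrakk> \<Longrightarrow> \<phi> (x \<ominus> z) \<le> \<phi> (x \<ominus> y) + \<phi> (y \<ominus> z)"
proof -
  assume a: "x \<in> carrier R" "y \<in> carrier R" "z \<in> carrier R"
  moreover from this have "x \<ominus> z = (x \<ominus> y) \<oplus> (y \<ominus> z)" by algebra
  ultimately show ?thesis using abs_add[of "x \<ominus> y" "y \<ominus> z"] by simp
qed

lemma abs_diff_le: "\<lbrakk>x \<in> carrier R; y \<in> carrier R\<rbrakk> \<Longrightarrow> \<bar>\<phi> x - \<phi> y\<bar> \<le> \<phi> (x \<ominus> y)"
proof -
  assume a: "x \<in> carrier R" "y \<in> carrier R"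
  have "x = (x \<ominus> y) \<oplus> y" "y = (y \<ominus> x) \<oplus> x" using a by algebra+
  hence "\<phi> x \<le> \<phi> (x \<ominus> y) + \<phi> y" "\<phi> y \<le> \<phi> (y \<ominus> x) + \<phi> x"
    using a by (metis abs_add minus_closed)+
  thus ?thesis using a abs_minus_commute by fastforce
qed

lemma abs_inv: "\<lbrakk>x \<in> carrier R; x \<noteq> \<zero>\<rbrakk> \<Longrightarrow> \<phi> (inv x) = inverse (\<phi> x)"
proof -
  assume a: "x \<in> carrier R" "x \<noteq> \<zero>"
  hence u: "x \<in> Units R" by (simp add: field_Units)
  have "\<phi> x * \<phi> (inv x) = 1" using a u abs_mult[of x "inv x"] by simp
  thus ?thesis by (metis inverse_unique)
qed

lemma restrict_in_abs_values: "restrict \<phi> (carrier R) \<in> abs_values R"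
  unfolding abs_values_def by (auto simp: abs_nonneg abs_eq_0_iff abs_mult abs_add)

end

lemma abs_valued_field_iff:
  "field R \<Longrightarrow> \<phi> \<in> abs_values R \<longleftrightarrow> abs_valued_field R \<phi> \<and> \<phi> \<in> extensional (carrier R)"
  unfolding abs_values_def abs_valued_field_def abs_valued_field_axioms_def by auto

section \<open>Extension of absolute values\<close>

text \<open>Completeness of the base is deliberately absent: extensions are also needed from the
  rationals to the algebraic numbers. It enters only with uniqueness.\<close>

locale abs_extension = field L + subfield F L for L (structure) and F +
  fixes \<alpha> :: "'a \<Rightarrow> real"
  assumes abs_valued_base: "abs_valued_field (L\<lparr>carrier := F\<rparr>) \<alpha>"
    and algebraic: "x \<in> carrier L \<Longrightarrow> (algebraic over F) x"
begin

interpretation F: abs_valued_field "L\<lparr>carrier := F\<rparr>" \<alpha>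
  by (rule abs_valued_base)

lemma sub: "subfield F L" by (rule subfield_axioms)

lemma F_carrier: "c \<in> F \<Longrightarrow> c \<in> carrier L"
  using subset by blast

lemma base_props:
  "c \<in> F \<Longrightarrow> 0 \<le> \<alpha> c" "c \<in> F \<Longrightarrow> \<alpha> c = 0 \<longleftrightarrow> c = \<zero>"
  "\<lbrakk>c \<in> F; d \<in> F\<rbrakk> \<Longrightarrow> \<alpha> (c \<otimes> d) = \<alpha> c * \<alpha> d"
  "\<lbrakk>c \<in> F; d \<in> F\<rbrakk> \<Longrightarrow> \<alpha> (c \<oplus> d) \<le> \<alpha> c + \<alpha> d"
  "\<alpha> \<one> = 1" "\<alpha> \<zero> = 0"
  using F.abs_nonneg F.abs_eq_0_iff F.abs_mult F.abs_add F.abs_one F.abs_zero by simp_all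

lemma base_closed:
  "\<zero> \<in> F" "\<one> \<in> F" "c \<in> F \<Longrightarrow> d \<in> F \<Longrightarrow> c \<otimes> d \<in> F" "c \<in> F \<Longrightarrow> d \<in> F \<Longrightarrow> c \<oplus> d \<in> F"
  "c \<in> F \<Longrightarrow> \<ominus> c \<in> F" "c \<in> F \<Longrightarrow> d \<in> F \<Longrightarrow> c \<ominus> d \<in> F"
  "c \<in> F \<Longrightarrow> c \<noteq> \<zero> \<Longrightarrow> inv c \<in> F"
  using subringE[OF subfieldE(1)[OF sub]] subfield_m_inv[OF sub] by (auto simp: a_minus_def)

lemma base_uminus: "c \<in> F \<Longrightarrow> \<alpha> (\<ominus> c) = \<alpha> c"
proof -
  assume c: "c \<in> F"
  have m: "\<ominus> \<one> \<in> F" by (simp add: base_closed)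
  have "\<alpha> (\<ominus> \<one>) * \<alpha> (\<ominus> \<one>) = \<alpha> ((\<ominus> \<one>) \<otimes> (\<ominus> \<one>))" using m base_props by simp
  also have "(\<ominus> \<one>) \<otimes> (\<ominus> \<one>) = \<one>" by algebra
  finally have "\<alpha> (\<ominus> \<one>) ^ 2 = 1" by (simp add: power2_eq_square base_props)
  hence "\<alpha> (\<ominus> \<one>) = 1" using base_props(1)[OF m] by (simp add: power2_eq_1_iff)
  moreover have "\<ominus> c = (\<ominus> \<one>) \<otimes> c" using F_carrier[OF c] by algebra
  ultimately show ?thesis using c m by (simp add: base_props)
qed

text \<open>\<open>gauge E x t\<close> says that \<open>x\<close> is a combination of elements of \<open>E\<close> whose coefficients
  have absolute values of sum at most \<open>t\<close>.\<close>

inductive gauge :: "'a set \<Rightarrow> 'a \<Rightarrow> real \<Rightarrow> bool" for E where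
  gauge_zero: "0 \<le> t \<Longrightarrow> gauge E \<zero> t"
| gauge_step: "\<lbrakk>c \<in> F; e \<in> E; gauge E x t\<rbrakk> \<Longrightarrow> gauge E (c \<otimes> e \<oplus> x) (\<alpha> c + t)"

lemma gauge_nonneg: "gauge E x t \<Longrightarrow> 0 \<le> t"
  by (induction rule: gauge.induct) (auto simp: base_props)

lemma gauge_carrier: "gauge E x t \<Longrightarrow> E \<subseteq> carrier L \<Longrightarrow> x \<in> carrier L"
  by (induction rule: gauge.induct) (auto intro: F_carrier)

lemma gauge_mono: "gauge E x t \<Longrightarrow> E \<subseteq> E' \<Longrightarrow> t \<le> t' \<Longrightarrow> gauge E' x t'"
proof (induction arbitrary: t' rule: gauge.induct)
  case (gauge_step c e x t)
  have "gauge E' (c \<otimes> e \<oplus> x) (\<alpha> c + (t' - \<alpha> c))"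
    using gauge_step by (intro gauge.gauge_step) auto
  thus ?case by simp
qed (auto intro: gauge.intros)

lemma gauge_add: "gauge E x s \<Longrightarrow> gauge E y t \<Longrightarrow> E \<subseteq> carrier L \<Longrightarrow> gauge E (x \<oplus> y) (s + t)"
proof (induction rule: gauge.induct)
  case (gauge_zero s)
  thus ?case using gauge_mono[of E y t E "s + t"] gauge_carrier by simp
next
  case (gauge_step c e x s)
  have "gauge E (c \<otimes> e \<oplus> (x \<oplus> y)) (\<alpha> c + (s + t))"
    using gauge_step by (intro gauge.gauge_step) auto
  moreover have "c \<otimes> e \<oplus> (x \<oplus> y) = c \<otimes> e \<oplus> x \<oplus> y"
    using gauge_step gauge_carrier[of E x s] gauge_carrier[of E y t] F_carrier
    by (auto intro!: a_assoc[symmetric])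
  ultimately show ?case by (simp add: add.assoc)
qed

lemma gauge_smult: "gauge E x t \<Longrightarrow> c \<in> F \<Longrightarrow> E \<subseteq> carrier L \<Longrightarrow> gauge E (c \<otimes> x) (\<alpha> c * t)"
proof (induction rule: gauge.induct)
  case (gauge_zero s)
  thus ?case by (auto intro!: gauge.intros simp: F_carrier base_props)
next
  case (gauge_step d e x t)
  have "gauge E ((c \<otimes> d) \<otimes> e \<oplus> c \<otimes> x) (\<alpha> (c \<otimes> d) + \<alpha> c * t)"
    using gauge_step by (intro gauge.gauge_step) (auto intro: base_closed)
  moreover have "(c \<otimes> d) \<otimes> e \<oplus> c \<otimes> x = c \<otimes> (d \<otimes> e \<oplus> x)"
    using gauge_step gauge_carrier[of E x t] F_carrier by (auto simp: r_distr m_assoc subset_iff)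
  ultimately show ?case using gauge_step by (simp add: base_props algebra_simps)
qed

lemma gauge_gen: "e \<in> E \<Longrightarrow> E \<subseteq> carrier L \<Longrightarrow> gauge E e 1"
  using gauge_step[of \<one> e E \<zero> 0] gauge_zero[of 0 E] by (auto simp: base_closed base_props)

lemma gauge_uminus: "gauge E x t \<Longrightarrow> E \<subseteq> carrier L \<Longrightarrow> gauge E (\<ominus> x) t"
  using gauge_smult[of E x t "\<ominus> \<one>"] gauge_carrier[of E x t] base_uminus[of \<one>]
  by (auto simp: base_closed base_props l_minus)

lemma gauge_minus: "gauge E x s \<Longrightarrow> gauge E y t \<Longrightarrow> E \<subseteq> carrier L \<Longrightarrow> gauge E (x \<ominus> y) (s + t)"
  unfolding a_minus_def by (intro gauge_add gauge_uminus)

text \<open>An operator norm estimate: by linearity it is enough to bound multiplication by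
  \<open>y\<close> on the generators. The submultiplicative bounds and the growth of powers reduce
  to it.\<close>

lemma gauge_image:
  assumes "gauge E x t" "E \<subseteq> carrier L" "E' \<subseteq> carrier L" "y \<in> carrier L" "0 \<le> B"
    and "\<And>e. e \<in> E \<Longrightarrow> gauge E' (e \<otimes> y) B"
  shows "gauge E' (x \<otimes> y) (t * B)"
  using assms
proof (induction rule: gauge.induct)
  case (gauge_zero t)
  thus ?case by (auto intro!: gauge.intros)
next
  case (gauge_step c e x t)
  have "gauge E' (c \<otimes> (e \<otimes> y) \<oplus> x \<otimes> y) (\<alpha> c * B + t * B)"
    using gauge_step by (intro gauge_add gauge_smult) auto
  moreover have "c \<otimes> (e \<otimes> y) \<oplus> x \<otimes> y = (c \<otimes> e \<oplus> x) \<otimes> y"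
    using gauge_step gauge_carrier[of E x t] F_carrier by (auto simp: l_distr m_assoc subset_iff)
  ultimately show ?case by (simp add: algebra_simps)
qed
end

context abs_extension begin

definition mult_set :: "'a set \<Rightarrow> 'a set \<Rightarrow> 'a set" where
  "mult_set E E' = (\<lambda>(e, e'). e \<otimes> e') ` (E \<times> E')"

lemma mult_set_props:
  "finite E \<Longrightarrow> finite E' \<Longrightarrow> finite (mult_set E E')"
  "E \<subseteq> carrier L \<Longrightarrow> E' \<subseteq> carrier L \<Longrightarrow> mult_set E E' \<subseteq> carrier L"
  unfolding mult_set_def by auto

lemma gauge_mult:
  assumes x: "gauge E x s" and y: "gauge E' y t" and E: "E \<subseteq> carrier L" "E' \<subseteq> carrier L"
  shows "gauge (mult_set E E') (x \<otimes> y) (s * t)"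
proof (rule gauge_image[OF x E(1) mult_set_props(2)[OF E]])
  show yc: "y \<in> carrier L" using gauge_carrier[OF y E(2)] .
  show "0 \<le> t" using gauge_nonneg[OF y] .
  fix e assume e: "e \<in> E"
  have "gauge (mult_set E E') (y \<otimes> e) (t * 1)"
  proof (rule gauge_image[OF y E(2) mult_set_props(2)[OF E]])
    show "e \<in> carrier L" using e E by blast
    fix e' assume e': "e' \<in> E'"
    have "e' \<otimes> e = e \<otimes> e'" using e e' E by (auto intro: m_comm)
    hence "e' \<otimes> e \<in> mult_set E E'" using e e' unfolding mult_set_def by force
    thus "gauge (mult_set E E') (e' \<otimes> e) 1" using gauge_gen mult_set_props(2)[OF E] by blast
  qed simp
  moreover have "y \<otimes> e = e \<otimes> y" using e E yc by (auto intro: m_comm)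
  ultimately show "gauge (mult_set E E') (e \<otimes> y) t" by simp
qed

text \<open>The predicate does not store the combination behind a gauge, so the coefficient of one
  generator is recovered by induction. Repeated occurrences of \<open>e\<close> are merged by the
  triangle inequality, which keeps the total within \<open>t\<close>.\<close>

lemma gauge_insert:
  assumes "gauge (insert e E) x t" "E \<subseteq> carrier L" "e \<in> carrier L"
  shows "\<exists>c\<in>F. \<exists>u. x = c \<otimes> e \<oplus> u \<and> \<alpha> c \<le> t \<and> gauge E u (t - \<alpha> c)"
  using assms
proof (induction rule: gauge.induct)
  case (gauge_zero t)
  have z: "\<alpha> \<zero> = 0" by (rule base_props(6))
  have "\<zero> \<otimes> e = \<zero>" by (rule l_null) (rule gauge_zero(3))
  hence "\<zero> = \<zero> \<otimes> e \<oplus> \<zero>" by (metis l_zero zero_closed)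
  moreover have "\<alpha> \<zero> \<le> t" using z gauge_zero(1) by linarith
  moreover have "gauge E \<zero> (t - \<alpha> \<zero>)" using z gauge_zero(1) gauge.gauge_zero[of t E] by (metis diff_zero)
  ultimately show ?case using base_closed(1) by blast
next
  case (gauge_step c e' x t)
  then obtain d u where d: "d \<in> F" "x = d \<otimes> e \<oplus> u" "\<alpha> d \<le> t" "gauge E u (t - \<alpha> d)" by auto
  have cl: "c \<in> carrier L" "d \<in> carrier L" "u \<in> carrier L" "e' \<in> carrier L"
    using gauge_step d gauge_carrier[OF d(4)] F_carrier by auto
  show ?case
  proof (cases "e' = e")
    case True
    have "c \<otimes> e' \<oplus> x = (c \<oplus> d) \<otimes> e \<oplus> u"
      using cl gauge_step(6) unfolding d(2) True by algebra
    moreover have "\<alpha> (c \<oplus> d) \<le> \<alpha> c + \<alpha> d" using base_props(4)[OF gauge_step(1) d(1)] .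
    ultimately show ?thesis
      using d gauge_step base_closed(4)[OF gauge_step(1) d(1)]
      by (intro bexI[of _ "c \<oplus> d"] exI[of _ u]) (auto intro: gauge_mono[OF d(4)])
  next
    case False
    have "c \<otimes> e' \<oplus> x = d \<otimes> e \<oplus> (c \<otimes> e' \<oplus> u)"
      using cl gauge_step(6) unfolding d(2) by algebra
    moreover have "gauge E (c \<otimes> e' \<oplus> u) (\<alpha> c + (t - \<alpha> d))"
      using False gauge_step d by (intro gauge.gauge_step) auto
    ultimately show ?thesis
      using d gauge_step base_props(1)[of c] by (intro bexI[of _ d] exI[of _ "c \<otimes> e' \<oplus> u"])
        (auto simp: algebra_simps)
  qed
qed

lemma gauge_cancel:
  assumes "gauge E (c \<otimes> e) t" "c \<in> F" "c \<noteq> \<zero>" "e \<in> carrier L" "E \<subseteq> carrier L"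
  shows "\<exists>s. gauge E e s"
proof -
  have "gauge E (inv c \<otimes> (c \<otimes> e)) (\<alpha> (inv c) * t)"
    using assms by (intro gauge_smult base_closed)
  moreover have "inv c \<otimes> (c \<otimes> e) = e"
    using assms F_carrier[of c] subfield_m_inv[OF sub, of c] F_carrier[of "inv c"]
    by (simp add: m_assoc[symmetric])
  ultimately show ?thesis by metis
qed

lemma gauge_empty: "gauge {} x t \<Longrightarrow> x = \<zero>"
  by (erule gauge.cases) auto

text \<open>Lets inductions over generating sets assume independence: a generator in the span of the
  others is removed at the cost of the factor \<open>max 1 s\<close>, where the 1 accounts for the
  generators that stay.\<close>

lemma gauge_insert_redundant:
  assumes "gauge E e s" "gauge (insert e E) x t" "E \<subseteq> carrier L" "e \<in> carrier L"
  shows "gauge E x (t * max 1 s)"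
proof -
  have "gauge E (x \<otimes> \<one>) (t * max 1 s)"
  proof (rule gauge_image[OF assms(2) _ assms(3)])
    fix e' assume "e' \<in> insert e E"
    thus "gauge E (e' \<otimes> \<one>) (max 1 s)"
      using assms gauge_mono[OF assms(1)] gauge_mono[OF gauge_gen[of e' E]] by (auto simp: subset_iff)
  qed (use assms in auto)
  moreover have "x \<in> carrier L" using gauge_carrier[OF assms(2)] assms by blast
  ultimately show ?thesis by simp
qed

text \<open>Positivity of gauges on nonzero elements, for dependent generators and an incomplete
  base alike. If \<open>e\<close> is outside the span of \<open>E\<close>, its coefficient in a
  representation of \<open>x\<close> is determined by \<open>x\<close>; either it vanishes and the
  induction hypothesis applies, or its absolute value bounds the gauge from below.\<close>

lemma gauge_separation:
  assumes "finite E" "E \<subseteq> carrier L" "x \<in> carrier L" "x \<noteq> \<zero>"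
  shows "\<exists>\<epsilon>>0. \<not> gauge E x \<epsilon>"
  using assms
proof (induction arbitrary: x rule: finite_induct)
  case empty
  thus ?case using gauge_empty by (intro exI[of _ 1]) auto
next
  case (insert e E)
  have E: "E \<subseteq> carrier L" "e \<in> carrier L" using insert by auto
  show ?case
  proof (rule ccontr)
    assume "\<not> ?thesis"
    hence *: "gauge (insert e E) x \<epsilon>" if "\<epsilon> > 0" for \<epsilon> using that by blast
    have "\<exists>s. gauge E e s"
    proof (rule ccontr)
      assume ne: "\<not> ?thesis"
      show False
      proof (cases "\<exists>s. gauge E x s")
        case True
        then obtain s where s: "gauge E x s" by blast
        have "gauge E x \<epsilon>" if eps: "\<epsilon> > 0" for \<epsilon>
        proof -
          obtain c u where c: "c \<in> F" "x = c \<otimes> e \<oplus> u" "gauge E u (\<epsilon> - \<alpha> c)"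
            using gauge_insert[OF *[OF eps] E] by blast
          have cl: "c \<in> carrier L" "u \<in> carrier L" using c F_carrier gauge_carrier[OF c(3) E(1)] by auto
          have "c \<otimes> e = x \<ominus> u" using cl E unfolding c(2) by algebra
          hence "gauge E (c \<otimes> e) (s + (\<epsilon> - \<alpha> c))" using gauge_minus[OF s c(3) E(1)] by simp
          hence "c = \<zero>" using gauge_cancel c(1) E ne by blast
          thus ?thesis using c cl E by (simp add: base_props)
        qed
        thus False using insert.IH[OF E(1) insert.prems(2,3)] by blast
      next
        case False
        obtain c u where c: "c \<in> F" "x = c \<otimes> e \<oplus> u" "gauge E u (1 - \<alpha> c)"
          using gauge_insert[OF *[of 1] E] by auto
        have cl: "c \<in> carrier L" "u \<in> carrier L" using c F_carrier gauge_carrier[OF c(3) E(1)] by auto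
        have "c \<noteq> \<zero>" using c cl E False by (metis l_null l_zero)
        hence cpos: "\<alpha> c / 2 > 0" using c(1) base_props(1,2)[of c] by fastforce
        \<comment> \<open>A budget below \<open>\<alpha> c\<close> forces a second coefficient
          \<open>d\<close> different from \<open>c\<close>; subtracting the two representations then
          expresses a nonzero multiple of \<open>e\<close> through \<open>E\<close>.\<close>
        obtain d v where d: "d \<in> F" "x = d \<otimes> e \<oplus> v" "\<alpha> d \<le> \<alpha> c / 2" "gauge E v (\<alpha> c / 2 - \<alpha> d)"
          using gauge_insert[OF *[OF cpos] E] by blast
        have dl: "d \<in> carrier L" "v \<in> carrier L" using d F_carrier gauge_carrier[OF d(4) E(1)] by auto
        have "c \<noteq> d" using d cpos by auto
        hence cd: "c \<ominus> d \<noteq> \<zero>" using cl dl by simp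
        have "(c \<ominus> d) \<otimes> e = (c \<otimes> e \<oplus> u) \<ominus> (d \<otimes> e \<oplus> v) \<oplus> (v \<ominus> u)"
          using cl dl E by algebra
        also have "\<dots> = (x \<ominus> x) \<oplus> (v \<ominus> u)" using c d by metis
        also have "\<dots> = v \<ominus> u" using cl dl insert.prems by algebra
        finally have "gauge E ((c \<ominus> d) \<otimes> e) (\<alpha> c / 2 - \<alpha> d + (1 - \<alpha> c))"
          using gauge_minus[OF d(4) c(3) E(1)] by simp
        thus False using gauge_cancel cd base_closed(6)[OF c(1) d(1)] E ne by blast
      qed
    qed
    then obtain s where s: "gauge E e s" by blast
    have "gauge E x \<epsilon>" if "\<epsilon> > 0" for \<epsilon>
    proof -
      have "gauge E x (\<epsilon> / max 1 s * max 1 s)"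
        by (rule gauge_insert_redundant[OF s * E]) (use that in \<open>simp add: max_def\<close>)
      moreover have "\<epsilon> / max 1 s * max 1 s = \<epsilon>" by (simp add: max_def)
      ultimately show ?thesis by simp
    qed
    thus False using insert.IH[OF E(1) insert.prems(2,3)] by blast
  qed
qed

lemma eval_gauge:
  assumes "set p \<subseteq> F" "x \<in> carrier L"
  shows "\<exists>t. gauge ((\<lambda>i. x [^] i) ` {..<length p}) (eval p x) t"
  using assms
proof (induction p)
  case Nil
  thus ?case by (auto intro: gauge.gauge_zero)
next
  case (Cons a p)
  let ?E = "(\<lambda>i. x [^] i) ` {..<length (a # p)}"
  obtain t where "gauge ((\<lambda>i. x [^] i) ` {..<length p}) (eval p x) t" using Cons by auto
  hence "gauge ?E (eval p x) t" by (rule gauge_mono) auto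
  hence "gauge ?E (a \<otimes> x [^] length p \<oplus> eval p x) (\<alpha> a + t)"
    using Cons by (intro gauge.gauge_step) auto
  thus ?case by auto
qed

text \<open>The powers of an algebraic \<open>x\<close> stay in the span of finitely many of them,
  and multiplication by \<open>x\<close> is bounded on that span. Any annihilating polynomial
  serves.\<close>

lemma power_gauge:
  assumes x: "x \<in> carrier L"
  shows "\<exists>E B. finite E \<and> E \<subseteq> carrier L \<and> 0 < B \<and> (\<forall>n::nat. gauge E (x [^] n) (B ^ n))"
proof -
  obtain p where p: "p \<in> carrier (F [X])" "p \<noteq> []" "eval p x = \<zero>"
    using algebraicE[OF subfieldE(1)[OF sub] x algebraic[OF x]] by blast
  then obtain a q where aq: "p = a # q" by (cases p) auto
  have aF: "a \<in> F" "a \<noteq> \<zero>" "set q \<subseteq> F"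
    using p unfolding aq univ_poly_def polynomial_def by auto
  define d where "d = length q"
  define E where "E = (\<lambda>i::nat. x [^] i) ` {..<d}"
  have E: "E \<subseteq> carrier L" "finite E" using x by (auto simp: E_def)
  obtain t where t: "gauge E (eval q x) t" using eval_gauge[OF aF(3) x] by (auto simp: E_def d_def)
  have qc: "eval q x \<in> carrier L" using gauge_carrier[OF t E(1)] .
  have ac: "a \<in> carrier L" using aF F_carrier by blast
  have xd: "x [^] d \<in> carrier L" using x by simp
  have "a \<otimes> x [^] d \<oplus> eval q x = \<zero>" using p(3) by (simp add: aq d_def)
  hence "a \<otimes> x [^] d = \<ominus> (eval q x)" using ac xd qc by (simp add: minus_equality[symmetric])
  hence "gauge E (a \<otimes> x [^] d) t" using gauge_uminus[OF t E(1)] by simp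
  then obtain s where s: "gauge E (x [^] d) s" using gauge_cancel aF xd E by blast
  \<comment> \<open>An annihilating polynomial of degree 0 would place \<open>\<one>\<close> in the
    span of the empty set.\<close>
  have "d \<noteq> 0"
  proof
    assume d0: "d = 0"
    hence "\<one> = \<zero>" using s gauge_empty[of "\<one>"] by (simp add: E_def)
    thus False by simp
  qed
  hence one: "\<one> \<in> E" unfolding E_def by (force intro: image_eqI[of _ _ 0])
  \<comment> \<open>Multiplication by \<open>x\<close> moves each generator to the next one at cost
    1, except the last, which becomes \<open>x [^] d\<close> at cost \<open>s\<close>.\<close>
  define B where "B = max 1 s"
  have step: "gauge E (e \<otimes> x) B" if e: "e \<in> E" for e
  proof -
    obtain i where i: "i < d" "e = x [^] i" using e unfolding E_def by blast
    have ex: "e \<otimes> x = x [^] (Suc i)" using i by simp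
    show ?thesis
    proof (cases "Suc i = d")
      case True
      thus ?thesis using gauge_mono[OF s] ex by (simp add: B_def)
    next
      case False
      hence "x [^] (Suc i) \<in> E" unfolding E_def using i by (intro imageI) auto
      from gauge_mono[OF gauge_gen[OF this E(1)] order.refl, of B] show ?thesis using ex by (simp add: B_def)
    qed
  qed
  have "gauge E (x [^] n) (B ^ n)" for n :: nat
  proof (induction n)
    case 0
    show ?case using gauge_gen[OF one E(1)] by simp
  next
    case (Suc n)
    have "gauge E (x [^] n \<otimes> x) (B ^ n * B)"
      by (rule gauge_image[OF Suc E(1) E(1) x _ step]) (auto simp: B_def)
    thus ?case by (simp add: mult.commute)
  qed
  thus ?thesis using E by (intro exI[of _ E] exI[of _ B]) (auto simp: B_def)
qed
end

section \<open>The spectral seminorm and the existence of extensions\<close>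

context abs_extension begin

text \<open>The spectral seminorm: its value at \<open>x\<close> is the exponential rate of growth of the powers
  of \<open>x\<close>, measured by gauges.\<close>

definition growth_rates :: "'a \<Rightarrow> real set" where
  "growth_rates x = {r. 0 < r \<and> (\<exists>E C. finite E \<and> E \<subseteq> carrier L \<and> 0 \<le> C \<and>
     (\<forall>n::nat. gauge E (x [^] n) (C * r ^ n)))}"

definition spectral :: "'a \<Rightarrow> real" where
  "spectral x = Inf (growth_rates x)"

definition pm_seminorm :: "('a \<Rightarrow> real) \<Rightarrow> bool" where
  "pm_seminorm q \<longleftrightarrow> (\<forall>x\<in>carrier L. 0 \<le> q x) \<and>
     (\<forall>x\<in>carrier L. \<forall>y\<in>carrier L. q (x \<oplus> y) \<le> q x + q y) \<and>
     (\<forall>x\<in>carrier L. \<forall>y\<in>carrier L. q (x \<otimes> y) \<le> q x * q y) \<and>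
     (\<forall>x\<in>carrier L. \<forall>n::nat. q (x [^] n) = q x ^ n)"

lemma growth_ratesI:
  "\<lbrakk>0 < r; finite E; E \<subseteq> carrier L; 0 \<le> C; \<And>n::nat. gauge E (x [^] n) (C * r ^ n)\<rbrakk>
     \<Longrightarrow> r \<in> growth_rates x"
  unfolding growth_rates_def by blast

lemma growth_ratesE:
  assumes "r \<in> growth_rates x"
  obtains E C where "0 < r" "finite E" "E \<subseteq> carrier L" "0 \<le> C"
    "\<And>n::nat. gauge E (x [^] n) (C * r ^ n)"
  using assms unfolding growth_rates_def by blast

lemma growth_rates_ne: "x \<in> carrier L \<Longrightarrow> growth_rates x \<noteq> {}"
proof -
  assume "x \<in> carrier L"
  from power_gauge[OF this] obtain E B
    where "finite E \<and> E \<subseteq> carrier L \<and> 0 < B \<and> (\<forall>n::nat. gauge E (x [^] n) (B ^ n))"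
    by (elim exE)
  hence "B \<in> growth_rates x" by (intro growth_ratesI[of B E 1 x]) simp_all
  thus ?thesis by blast
qed

lemma growth_rates_pos: "r \<in> growth_rates x \<Longrightarrow> 0 < r"
  unfolding growth_rates_def by blast

lemma growth_rates_bdd: "bdd_below (growth_rates x)"
  unfolding growth_rates_def by (intro bdd_belowI[of _ 0]) auto

lemma spectral_le: "r \<in> growth_rates x \<Longrightarrow> spectral x \<le> r"
  unfolding spectral_def by (intro cInf_lower growth_rates_bdd)

lemma spectral_less:
  assumes "x \<in> carrier L" "spectral x < t"
  obtains r where "r \<in> growth_rates x" "r < t"
  using assms cInf_lessD[OF growth_rates_ne] unfolding spectral_def by blast

lemma spectral_nonneg: "x \<in> carrier L \<Longrightarrow> 0 \<le> spectral x"
  unfolding spectral_def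
  by (intro cInf_greatest growth_rates_ne) (auto simp: growth_rates_def)

lemma growth_rates_mult:
  assumes "r \<in> growth_rates x" "s \<in> growth_rates y" "x \<in> carrier L" "y \<in> carrier L"
  shows "r * s \<in> growth_rates (x \<otimes> y)"
proof -
  obtain E C where E: "0 < r" "finite E" "E \<subseteq> carrier L" "0 \<le> C"
    "\<And>n::nat. gauge E (x [^] n) (C * r ^ n)" using growth_ratesE[OF assms(1)] by blast
  obtain G D where G: "0 < s" "finite G" "G \<subseteq> carrier L" "0 \<le> D"
    "\<And>n::nat. gauge G (y [^] n) (D * s ^ n)" using growth_ratesE[OF assms(2)] by blast
  show ?thesis
  proof (rule growth_ratesI[of _ "mult_set E G" "C * D"])
    fix n :: nat
    have "(x \<otimes> y) [^] n = x [^] n \<otimes> y [^] n" using assms nat_pow_distrib by blast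
    thus "gauge (mult_set E G) ((x \<otimes> y) [^] n) (C * D * (r * s) ^ n)"
      using gauge_mult[OF E(5)[of n] G(5)[of n] E(3) G(3)] by (simp add: power_mult_distrib mult_ac)
  qed (use E(1-4) G(1-4) mult_set_props in auto)
qed

text \<open>The binomial expansion without binomial coefficients: with \<open>x [^] i\<close> and
  \<open>y [^] j\<close> as prefactors, one more factor \<open>x \<oplus> y\<close> splits into two
  instances of the same claim, and the factor \<open>r + s\<close> splits the bound in the same
  way.\<close>

lemma growth_rates_add:
  assumes "r \<in> growth_rates x" "s \<in> growth_rates y" "x \<in> carrier L" "y \<in> carrier L"
  shows "r + s \<in> growth_rates (x \<oplus> y)"
proof -
  obtain E C where E: "0 < r" "finite E" "E \<subseteq> carrier L" "0 \<le> C"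
    "\<And>n::nat. gauge E (x [^] n) (C * r ^ n)" using growth_ratesE[OF assms(1)] by blast
  obtain G D where G: "0 < s" "finite G" "G \<subseteq> carrier L" "0 \<le> D"
    "\<And>n::nat. gauge G (y [^] n) (D * s ^ n)" using growth_ratesE[OF assms(2)] by blast
  have EG: "mult_set E G \<subseteq> carrier L" using mult_set_props(2)[OF E(3) G(3)] .
  have *: "gauge (mult_set E G) (x [^] i \<otimes> y [^] j \<otimes> (x \<oplus> y) [^] n)
             (C * D * (r ^ i * s ^ j * (r + s) ^ n))" for i j n :: nat
  proof (induction n arbitrary: i j)
    case 0
    show ?case using gauge_mult[OF E(5)[of i] G(5)[of j] E(3) G(3)] assms by (simp add: mult_ac)
  next
    case (Suc n)
    define z where "z = (x \<oplus> y) [^] n"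
    define u where "u = x [^] i"
    define v where "v = y [^] j"
    have cl: "z \<in> carrier L" "u \<in> carrier L" "v \<in> carrier L" using assms by (auto simp: z_def u_def v_def)
    have "x [^] i \<otimes> y [^] j \<otimes> (x \<oplus> y) [^] Suc n = u \<otimes> v \<otimes> (z \<otimes> (x \<oplus> y))"
      by (simp add: z_def u_def v_def)
    also have "\<dots> = (u \<otimes> x) \<otimes> v \<otimes> z \<oplus> u \<otimes> (v \<otimes> y) \<otimes> z"
      using cl assms(3,4) by algebra
    also have "\<dots> = x [^] Suc i \<otimes> y [^] j \<otimes> (x \<oplus> y) [^] n \<oplus> x [^] i \<otimes> y [^] Suc j \<otimes> (x \<oplus> y) [^] n"
      by (simp add: z_def u_def v_def)
    finally show ?case
      using gauge_add[OF Suc[of "Suc i" j] Suc[of i "Suc j"] EG] by (simp add: algebra_simps)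
  qed
  show ?thesis
  proof (rule growth_ratesI[of _ "mult_set E G" "C * D"])
    fix n :: nat
    show "gauge (mult_set E G) ((x \<oplus> y) [^] n) (C * D * (r + s) ^ n)"
      using *[of 0 0 n] assms by simp
  qed (use E(1-4) G(1-4) mult_set_props in auto)
qed

text \<open>Division with remainder of the exponent by \<open>k\<close>: the powers of
  \<open>x\<close> below \<open>k\<close> become finitely many additional generators. This is the
  source of power-multiplicativity.\<close>

lemma growth_rates_root:
  assumes "r \<in> growth_rates (x [^] k)" "x \<in> carrier L" "k > 0"
  shows "root k r \<in> growth_rates x"
proof -
  obtain E C where E: "0 < r" "finite E" "E \<subseteq> carrier L" "0 \<le> C"
    "\<And>n::nat. gauge E ((x [^] k) [^] n) (C * r ^ n)" using growth_ratesE[OF assms(1)] by blast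
  define s where "s = root k r"
  have s: "s > 0" "s ^ k = r" using assms E by (auto simp: s_def)
  define P where "P = (\<lambda>b::nat. x [^] b) ` {..<k}"
  \<comment> \<open>Passing from \<open>r ^ m\<close> to \<open>root k r ^ n\<close> costs a factor
    \<open>inverse s ^ b\<close> with \<open>b < k\<close>; the sum over all such \<open>b\<close>
    bounds it uniformly in \<open>n\<close>.\<close>
  define D where "D = (\<Sum>b<k. inverse s ^ b)"
  have P: "finite P" "P \<subseteq> carrier L" using assms by (auto simp: P_def)
  have D: "D \<ge> 0" using s by (auto simp: D_def intro: sum_nonneg)
  show ?thesis
  proof (rule growth_ratesI[of _ "mult_set E P" "C * D"])
    fix n :: nat
    define b where "b = n mod k"
    define m where "m = n div k"
    have n: "n = k * m + b" and b: "b < k" using assms by (auto simp: m_def b_def)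
    have "gauge (mult_set E P) ((x [^] k) [^] m \<otimes> x [^] b) (C * r ^ m * 1)"
      using b by (intro gauge_mult E gauge_gen P) (auto simp: P_def assms)
    moreover have "(x [^] k) [^] m \<otimes> x [^] b = x [^] n"
      using assms by (simp add: n nat_pow_pow nat_pow_mult)
    moreover have "C * r ^ m * 1 \<le> C * D * root k r ^ n"
    proof -
      have "r ^ m = s ^ n * inverse s ^ b"
        using s by (simp add: n power_add power_mult power_mult_distrib[symmetric] field_simps)
      also have "\<dots> \<le> s ^ n * D"
        unfolding D_def using s b member_le_sum[of b "{..<k}" "\<lambda>b. inverse s ^ b"]
        by (intro mult_left_mono) auto
      finally show ?thesis using E(4) by (simp add: s_def mult_left_mono mult_ac)
    qed
    ultimately show "gauge (mult_set E P) (x [^] n) (C * D * root k r ^ n)"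
      using gauge_mono by (metis order.refl)
  qed (use E(1-4) P D s mult_set_props s_def in auto)
qed

lemma spectral_base: "c \<in> F \<Longrightarrow> spectral c \<le> \<alpha> c"
proof (rule field_le_epsilon)
  fix e :: real assume c: "c \<in> F" and e: "e > 0"
  \<comment> \<open>\<open>c [^] n\<close> is itself a coefficient of the generator
    \<open>\<one>\<close>; the summand \<open>e\<close> keeps the rate positive when
    \<open>c\<close> is zero.\<close>
  have "\<alpha> c + e \<in> growth_rates c"
  proof (rule growth_ratesI[of _ "{\<one>}" 1])
    fix n :: nat
    have cn: "c [^] n \<in> F \<and> \<alpha> (c [^] n) = \<alpha> c ^ n"
      using c by (induction n) (auto simp: base_closed base_props)
    have "gauge {\<one>} (c [^] n) (\<alpha> c ^ n)"
      using gauge_step[of "c [^] n" \<one> "{\<one>}" \<zero> 0] gauge_zero[of 0 "{\<one>}"] cn F_carrier[OF c] by simp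
    thus "gauge {\<one>} (c [^] n) (1 * (\<alpha> c + e) ^ n)"
      using base_props(1)[OF c] e by (elim gauge_mono) (auto intro!: power_mono)
  qed (use c e base_props(1)[OF c] in auto)
  thus "spectral c \<le> \<alpha> c + e" by (rule spectral_le)
qed

text \<open>The lower bound makes the construction nontrivial: a rate below 1 would give
  \<open>\<one>\<close> arbitrarily small gauges over one finite set, against
  \<open>gauge_separation\<close>.\<close>

lemma spectral_one: "spectral \<one> = 1"
proof (rule antisym)
  show "spectral \<one> \<le> 1" using spectral_base[of \<one>] by (simp add: base_closed base_props)
  show "1 \<le> spectral \<one>"
  proof (rule ccontr)
    assume "\<not> ?thesis"
    then obtain r where r: "r \<in> growth_rates \<one>" "r < 1"
      using spectral_less[of \<one> 1] by auto
    obtain E C where E: "0 < r" "finite E" "E \<subseteq> carrier L" "0 \<le> C"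
      "\<And>n::nat. gauge E (\<one> [^] n) (C * r ^ n)" using growth_ratesE[OF r(1)] by blast
    obtain e where e: "e > 0" "\<not> gauge E \<one> e"
      using gauge_separation[OF E(2,3), of \<one>] by auto
    have "(\<lambda>n. C * r ^ n) \<longlonglongrightarrow> C * 0"
      using E r by (intro tendsto_intros LIMSEQ_realpow_zero) auto
    hence "eventually (\<lambda>n. C * r ^ n < e) sequentially"
      using e by (intro order_tendstoD) auto
    then obtain n where "C * r ^ n < e" by (auto simp: eventually_sequentially)
    hence "gauge E \<one> e" using gauge_mono[OF E(5)[of n], of E e] by simp
    thus False using e by blast
  qed
qed

text \<open>Submultiplicativity gives one half of the power law; the other half is the extraction of
  roots in \<open>growth_rates_root\<close>.\<close>

lemma pm_seminorm_spectral: "pm_seminorm spectral"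
proof -
  have add: "spectral (x \<oplus> y) \<le> spectral x + spectral y"
    if xy: "x \<in> carrier L" "y \<in> carrier L" for x y
  proof (rule field_le_epsilon)
    fix e :: real assume e: "e > 0"
    obtain r where r: "r \<in> growth_rates x" "r < spectral x + e / 2"
      using spectral_less[of x "spectral x + e / 2"] xy e by auto
    obtain s where s: "s \<in> growth_rates y" "s < spectral y + e / 2"
      using spectral_less[of y "spectral y + e / 2"] xy e by auto
    show "spectral (x \<oplus> y) \<le> spectral x + spectral y + e"
      using spectral_le[OF growth_rates_add[OF r(1) s(1) xy]] r s by linarith
  qed
  have mult: "spectral (x \<otimes> y) \<le> spectral x * spectral y"
    if xy: "x \<in> carrier L" "y \<in> carrier L" for x y
  proof (rule tendsto_lowerbound)
    show "((\<lambda>e. (spectral x + e) * (spectral y + e)) \<longlongrightarrow> spectral x * spectral y) (at_right 0)"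
      by (auto intro!: tendsto_eq_intros)
    show "\<forall>\<^sub>F e in at_right 0. spectral (x \<otimes> y) \<le> (spectral x + e) * (spectral y + e)"
      unfolding eventually_at_right_field
    proof (intro exI[of _ 1] conjI allI impI)
      fix e :: real assume e: "0 < e"
      obtain r where r: "r \<in> growth_rates x" "r < spectral x + e"
        using spectral_less[of x "spectral x + e"] xy e by auto
      obtain s where s: "s \<in> growth_rates y" "s < spectral y + e"
        using spectral_less[of y "spectral y + e"] xy e by auto
      have "spectral (x \<otimes> y) \<le> r * s" using spectral_le[OF growth_rates_mult[OF r(1) s(1) xy]] .
      also have "\<dots> \<le> (spectral x + e) * (spectral y + e)"
        using r s growth_rates_pos[OF r(1)] growth_rates_pos[OF s(1)] by (intro mult_mono) auto
      finally show "spectral (x \<otimes> y) \<le> (spectral x + e) * (spectral y + e)" .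
    qed simp
  qed simp
  have pow_le: "spectral (x [^] n) \<le> spectral x ^ n" if x: "x \<in> carrier L" for x and n :: nat
  proof (induction n)
    case (Suc n)
    have "spectral (x [^] Suc n) \<le> spectral (x [^] n) * spectral x" using mult[of "x [^] n" x] x by simp
    also have "\<dots> \<le> spectral x ^ n * spectral x"
      using Suc spectral_nonneg[OF x] by (intro mult_right_mono)
    finally show ?case by (simp add: mult.commute)
  qed (simp add: spectral_one)
  have pow_ge: "spectral x ^ n \<le> spectral (x [^] n)" if x: "x \<in> carrier L" for x and n :: nat
  proof (cases "n = 0")
    case False
    show ?thesis unfolding spectral_def[of "x [^] n"]
    proof (rule cInf_greatest[OF growth_rates_ne])
      fix r assume r: "r \<in> growth_rates (x [^] n)"
      have "0 < r" using growth_rates_pos[OF r] .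
      have "spectral x \<le> root n r" using spectral_le[OF growth_rates_root[OF r x]] False by simp
      hence "spectral x ^ n \<le> root n r ^ n" using spectral_nonneg[OF x] by (rule power_mono)
      thus "spectral x ^ n \<le> r" using False \<open>0 < r\<close> by simp
    qed (use x in simp)
  qed (simp add: spectral_one)
  show ?thesis unfolding pm_seminorm_def
    using spectral_nonneg add mult pow_le pow_ge by (meson antisym)
qed

lemma pm_seminormD:
  assumes "pm_seminorm q"
  shows "x \<in> carrier L \<Longrightarrow> 0 \<le> q x"
    "\<lbrakk>x \<in> carrier L; y \<in> carrier L\<rbrakk> \<Longrightarrow> q (x \<oplus> y) \<le> q x + q y"
    "\<lbrakk>x \<in> carrier L; y \<in> carrier L\<rbrakk> \<Longrightarrow> q (x \<otimes> y) \<le> q x * q y"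
    "x \<in> carrier L \<Longrightarrow> q (x [^] (n::nat)) = q x ^ n"
    "q \<one> = 1"
proof -
  have "q (\<one> [^] (0::nat)) = q \<one> ^ 0" using assms one_closed unfolding pm_seminorm_def by blast
  thus "q \<one> = 1" by simp
qed (use assms in \<open>auto simp: pm_seminorm_def\<close>)

lemma pm_seminorm_pos: "pm_seminorm q \<Longrightarrow> c \<in> carrier L \<Longrightarrow> c \<noteq> \<zero> \<Longrightarrow> 0 < q c"
proof -
  assume a: "pm_seminorm q" "c \<in> carrier L" "c \<noteq> \<zero>"
  hence u: "c \<in> Units L" by (simp add: field_Units)
  have "1 \<le> q c * q (inv c)" using pm_seminormD(3)[OF a(1,2), of "inv c"] pm_seminormD(5)[OF a(1)] u by simp
  thus ?thesis using pm_seminormD(1)[OF a(1,2)] by (cases "q c = 0") auto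
qed

text \<open>Smoothing of \<open>q\<close> at \<open>c\<close>: the quotients
  \<open>q (x \<otimes> c [^] n) / q c ^ n\<close> decrease in \<open>n\<close> by
  submultiplicativity, and \<open>q'\<close> is their limit. A minimal \<open>q\<close> must
  coincide with its smoothing, and the bound by the quotient for \<open>n = 1\<close> then says
  \<open>q x * q c \<le> q (x \<otimes> c)\<close>.\<close>

lemma pm_seminorm_smooth:
  assumes q: "pm_seminorm q" and c: "c \<in> carrier L" "c \<noteq> \<zero>"
  shows "\<exists>q'. pm_seminorm q' \<and> (\<forall>x\<in>carrier L. q' x \<le> q (x \<otimes> c) / q c) \<and>
     (\<forall>x\<in>carrier L. q' x \<le> q x) \<and> (\<forall>x. x \<notin> carrier L \<longrightarrow> q' x = 0)"
proof -
  note qD = pm_seminormD[OF q]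
  have qc: "q c > 0" using pm_seminorm_pos[OF q c] .
  define a where "a = (\<lambda>x (n::nat). q (x \<otimes> c [^] n) / q c ^ n)"
  define q' where "q' = (\<lambda>x. if x \<in> carrier L then lim (a x) else 0)"
  have a0: "a x n \<ge> 0" if "x \<in> carrier L" for x n using qD(1)[of "x \<otimes> c [^] n"] that c qc by (simp add: a_def)
  have dec: "decseq (a x)" if x: "x \<in> carrier L" for x
  proof (rule decseq_SucI)
    fix n
    have "x \<otimes> c [^] Suc n = (x \<otimes> c [^] n) \<otimes> c" using x c by (simp add: m_assoc)
    hence "q (x \<otimes> c [^] Suc n) \<le> q (x \<otimes> c [^] n) * q c" using qD(3)[of "x \<otimes> c [^] n" c] x c by simp
    thus "a x (Suc n) \<le> a x n" unfolding a_def using qc by (simp add: field_simps)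
  qed
  have lim: "a x \<longlonglongrightarrow> q' x" if x: "x \<in> carrier L" for x
  proof -
    obtain l where "a x \<longlonglongrightarrow> l"
      using decseq_convergent[OF dec[OF x], of 0] a0[OF x] by blast
    thus ?thesis using x limI[of "a x" l] by (simp add: q'_def)
  qed
  have le: "q' x \<le> a x n" if x: "x \<in> carrier L" for x n
    using decseq_ge[OF dec[OF x] lim[OF x]] .
  have "pm_seminorm q'" unfolding pm_seminorm_def
  proof (intro conjI ballI allI)
    fix x assume x: "x \<in> carrier L"
    show "0 \<le> q' x" using a0[OF x] LIMSEQ_le_const[OF lim[OF x]] by blast
    fix n :: nat
    show "q' (x [^] n) = q' x ^ n"
    proof (cases "n = 0")
      case True
      have "a \<one> = (\<lambda>n. 1)" using qc c qD by (simp add: a_def)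
      hence "q' \<one> = 1" using lim[of \<one>] by (simp add: LIMSEQ_const_iff)
      thus ?thesis using True by simp
    next
      case False
      \<comment> \<open>Along the multiples of \<open>n\<close> the quotient for
        \<open>x [^] n\<close> is the \<open>n\<close>-th power of the quotient for
        \<open>x\<close>, since \<open>c [^] (n * k)\<close> splits evenly over the \<open>n\<close>
        factors.\<close>
      have "(\<lambda>k. a (x [^] n) (n * k)) \<longlonglongrightarrow> q' (x [^] n)"
        using LIMSEQ_subseq_LIMSEQ[OF lim[of "x [^] n"], of "\<lambda>k. n * k"] False x
        by (simp add: strict_mono_def o_def)
      moreover have "a (x [^] n) (n * k) = a x k ^ n" for k
      proof -
        have "(x \<otimes> c [^] k) [^] n = x [^] n \<otimes> c [^] (n * k)"
          using x c by (simp add: nat_pow_distrib nat_pow_pow mult.commute)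
        hence "q (x [^] n \<otimes> c [^] (n * k)) = q (x \<otimes> c [^] k) ^ n"
          using qD(4)[of "x \<otimes> c [^] k" n] x c by simp
        thus ?thesis by (simp add: a_def power_divide power_mult mult.commute)
      qed
      ultimately have "(\<lambda>k. a x k ^ n) \<longlonglongrightarrow> q' (x [^] n)" by simp
      thus ?thesis using LIMSEQ_unique tendsto_power[OF lim[OF x]] by blast
    qed
  next
    fix x y assume x: "x \<in> carrier L" and y: "y \<in> carrier L"
    have "a (x \<oplus> y) n \<le> a x n + a y n" for n
      using qD(2)[of "x \<otimes> c [^] n" "y \<otimes> c [^] n"] x y c qc
      by (simp add: a_def l_distr add_divide_distrib[symmetric] divide_right_mono)
    thus "q' (x \<oplus> y) \<le> q' x + q' y"
      using LIMSEQ_le[OF lim[of "x \<oplus> y"] tendsto_add[OF lim[OF x] lim[OF y]]] x y by blast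
    \<comment> \<open>An even exponent of \<open>c\<close> can be shared equally between the two
      factors.\<close>
    have "(\<lambda>k. a (x \<otimes> y) (2 * k)) \<longlonglongrightarrow> q' (x \<otimes> y)"
      using LIMSEQ_subseq_LIMSEQ[OF lim[of "x \<otimes> y"], of "\<lambda>k. 2 * k"] x y
      by (simp add: strict_mono_def o_def)
    moreover have "a (x \<otimes> y) (2 * n) \<le> a x n * a y n" for n
    proof -
      define d where "d = c [^] n"
      have d: "d \<in> carrier L" using c by (simp add: d_def)
      have "c [^] (2 * n) = d \<otimes> d" using c by (simp add: d_def nat_pow_mult mult_2)
      hence "(x \<otimes> y) \<otimes> c [^] (2 * n) = (x \<otimes> d) \<otimes> (y \<otimes> d)" using x y d by algebra
      hence "q ((x \<otimes> y) \<otimes> c [^] (2 * n)) \<le> q (x \<otimes> c [^] n) * q (y \<otimes> c [^] n)"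
        using qD(3)[of "x \<otimes> d" "y \<otimes> d"] x y d by (simp add: d_def)
      thus ?thesis unfolding a_def using qc by (simp add: power_mult power2_eq_square power_mult_distrib divide_right_mono mult_2 power_add)
    qed
    ultimately show "q' (x \<otimes> y) \<le> q' x * q' y"
      using LIMSEQ_le tendsto_mult[OF lim[OF x] lim[OF y]] by blast
  qed
  moreover have "q' x \<le> q (x \<otimes> c) / q c" "q' x \<le> q x" if x: "x \<in> carrier L" for x
    using le[OF x, of 1] le[OF x, of 0] x c by (auto simp: a_def)
  moreover have "\<forall>x. x \<notin> carrier L \<longrightarrow> q' x = 0" by (simp add: q'_def)
  ultimately show ?thesis by blast
qed

text \<open>Provides the bounds of chains for Zorn's lemma. The chain condition yields a single
  member that is nearly minimal at two points at once, and this is how the triangle inequality and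
  submultiplicativity pass to the infimum.\<close>

lemma pm_seminorm_Inf:
  assumes C: "C \<noteq> {}" "\<And>q. q \<in> C \<Longrightarrow> pm_seminorm q"
    and chain: "\<And>q q'. q \<in> C \<Longrightarrow> q' \<in> C \<Longrightarrow> (\<forall>x\<in>carrier L. q x \<le> q' x) \<or> (\<forall>x\<in>carrier L. q' x \<le> q x)"
  shows "pm_seminorm (\<lambda>x. Inf ((\<lambda>q. q x) ` C))"
proof -
  define I where "I = (\<lambda>x. Inf ((\<lambda>q. q x) ` C))"
  note qD = pm_seminormD[OF C(2)]
  have le: "I x \<le> q x" if "x \<in> carrier L" "q \<in> C" for x q
    unfolding I_def using that qD(1) by (intro cInf_lower bdd_belowI[of _ 0]) auto
  have ge: "b \<le> I x" if "\<And>q. q \<in> C \<Longrightarrow> b \<le> q x" for x b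
    unfolding I_def using that C(1) by (intro cInf_greatest) auto
  have nn: "0 \<le> I x" if "x \<in> carrier L" for x using ge qD(1) that by blast
  have close: "\<exists>q\<in>C. q x < I x + e \<and> q y < I y + e"
    if e: "e > 0" and xy: "x \<in> carrier L" "y \<in> carrier L" for e x y
  proof -
    have "\<exists>q\<in>C. q z < I z + e" for z
    proof (rule ccontr)
      assume "\<not> ?thesis"
      hence "I z + e \<le> I z" by (intro ge) force
      thus False using e by simp
    qed
    then obtain q q' where "q \<in> C" "q x < I x + e" "q' \<in> C" "q' y < I y + e" by metis
    thus ?thesis using chain[of q q'] xy by (metis order.strict_trans1)
  qed
  have mult: "I (x \<otimes> y) \<le> I x * I y" if xy: "x \<in> carrier L" "y \<in> carrier L" for x y
  proof (rule tendsto_lowerbound)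
    show "((\<lambda>e. (I x + e) * (I y + e)) \<longlongrightarrow> I x * I y) (at_right 0)"
      by (auto intro!: tendsto_eq_intros)
    show "\<forall>\<^sub>F e in at_right 0. I (x \<otimes> y) \<le> (I x + e) * (I y + e)"
      unfolding eventually_at_right_field
    proof (intro exI[of _ 1] conjI allI impI)
      fix e :: real assume e: "0 < e"
      obtain q where q: "q \<in> C" "q x < I x + e" "q y < I y + e" using close[OF e xy] by blast
      have "I (x \<otimes> y) \<le> q x * q y" using le[of "x \<otimes> y" q] qD(3)[OF q(1) xy] q xy by force
      also have "\<dots> \<le> (I x + e) * (I y + e)"
        using q qD(1)[OF q(1)] xy nn e by (intro mult_mono) (auto simp: less_imp_le add_nonneg_nonneg)
      finally show "I (x \<otimes> y) \<le> (I x + e) * (I y + e)" .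
    qed simp
  qed simp
  have one: "I \<one> = 1" unfolding I_def 
  proof -
    have "(\<lambda>q. q \<one>) ` C = {1}" using C(1) qD(5) by force
    thus "Inf ((\<lambda>q. q \<one>) ` C) = 1" by simp
  qed
  have pow_le: "I (x [^] n) \<le> I x ^ n" if x: "x \<in> carrier L" for x and n :: nat
  proof (induction n)
    case (Suc n)
    have "I (x [^] Suc n) \<le> I (x [^] n) * I x" using mult[of "x [^] n" x] x by simp
    also have "\<dots> \<le> I x ^ n * I x" using Suc nn[OF x] by (intro mult_right_mono)
    finally show ?case by (simp add: mult.commute)
  qed (simp add: one)
  have "pm_seminorm I" unfolding pm_seminorm_def
  proof (intro conjI ballI allI)
    fix x assume x: "x \<in> carrier L"
    show "0 \<le> I x" using nn[OF x] .
    fix n :: nat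
    have "I x ^ n \<le> I (x [^] n)"
    proof (rule ge)
      fix q assume q: "q \<in> C"
      show "I x ^ n \<le> q (x [^] n)" using qD(4)[OF q x] power_mono[OF le[OF x q] nn[OF x]] by simp
    qed
    thus "I (x [^] n) = I x ^ n" using pow_le[OF x] by (intro antisym)
  next
    fix x y assume xy: "x \<in> carrier L" "y \<in> carrier L"
    show "I (x \<otimes> y) \<le> I x * I y" using mult[OF xy] .
    show "I (x \<oplus> y) \<le> I x + I y"
    proof (rule field_le_epsilon)
      fix e :: real assume "e > 0"
      then obtain q where q: "q \<in> C" "q x < I x + e / 2" "q y < I y + e / 2"
        using close[of "e / 2"] xy by fastforce
      thus "I (x \<oplus> y) \<le> I x + I y + e"
        using le[of "x \<oplus> y" q] qD(2)[OF q(1) xy] xy by force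
    qed
  qed
  thus ?thesis by (simp add: I_def)
qed

text \<open>A seminorm below \<open>spectral\<close> is at most \<alpha> on \<open>F\<close>;
  applied to an element and to its inverse this becomes equality for a multiplicative one. Hence the
  construction only has to control seminorms from above.\<close>

theorem abs_extension_exists:
  "\<exists>\<psi>. abs_valued_field L \<psi> \<and> (\<forall>c\<in>F. \<psi> c = \<alpha> c)"
proof -
  define A where "A = {q. pm_seminorm q \<and> (\<forall>x\<in>carrier L. q x \<le> spectral x) \<and>
     (\<forall>x. x \<notin> carrier L \<longrightarrow> q x = 0)}"
  \<comment> \<open>The order is reversed, so that the maximal element of Zorn's lemma is a minimal
    seminorm. The value 0 off the carrier in \<open>A\<close> makes this order antisymmetric on
    functions.\<close>
  define P where "P = (\<lambda>q q'. \<forall>x\<in>carrier L. q' x \<le> (q x :: real))"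
  define \<rho> where "\<rho> = (\<lambda>x. if x \<in> carrier L then spectral x else 0)"
  have eqI: "q = q'" if "q \<in> A" "q' \<in> A" "P q q'" "P q' q" for q q'
    using that unfolding A_def P_def by (intro ext) (metis (mono_tags, lifting) antisym mem_Collect_eq)
  have "pm_seminorm \<rho>" using pm_seminorm_spectral unfolding pm_seminorm_def \<rho>_def by simp
  hence rho: "\<rho> \<in> A" by (simp add: A_def \<rho>_def)
  have "\<exists>q\<in>A. \<forall>q'\<in>A. P q q' \<longrightarrow> q' = q"
  proof (rule predicate_Zorn)
    show "partial_order_on A (relation_of P A)"
      by (rule partial_order_on_relation_ofI) (auto simp: P_def intro: order_trans eqI)
    fix C assume "C \<in> Chains (relation_of P A)"
    hence C: "C \<subseteq> A" "\<And>q q'. q \<in> C \<Longrightarrow> q' \<in> C \<Longrightarrow> P q q' \<or> P q' q"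
      unfolding Chains_def relation_of_def by auto
    show "\<exists>u\<in>A. \<forall>q\<in>C. P q u"
    proof (cases "C = {}")
      case True thus ?thesis using rho by blast
    next
      case False
      define I where "I = (\<lambda>x. Inf ((\<lambda>q. q x) ` C))"
      have "pm_seminorm I" unfolding I_def
        using C by (intro pm_seminorm_Inf[OF False]) (auto simp: A_def P_def)
      moreover have IC: "I x \<le> q x" if "x \<in> carrier L" "q \<in> C" for x q
        unfolding I_def using that C pm_seminormD(1)
        by (intro cInf_lower bdd_belowI[of _ 0]) (auto simp: A_def)
      moreover have "I x = 0" if "x \<notin> carrier L" for x
      proof -
        have "(\<lambda>q. q x) ` C = {0}" using C False that unfolding A_def by force
        thus ?thesis by (simp add: I_def)
      qed
      moreover have "I x \<le> spectral x" if x: "x \<in> carrier L" for x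
      proof -
        obtain q where "q \<in> C" using False by blast
        thus ?thesis using IC[OF x, of q] C x unfolding A_def by force
      qed
      ultimately have "I \<in> A" by (simp add: A_def)
      thus ?thesis using IC by (auto simp: P_def)
    qed
  qed
  then obtain q where q: "q \<in> A" "\<And>q'. q' \<in> A \<Longrightarrow> P q q' \<Longrightarrow> q' = q" by blast
  have pq: "pm_seminorm q" and qle: "\<And>x. x \<in> carrier L \<Longrightarrow> q x \<le> spectral x" using q(1) by (auto simp: A_def)
  note qD = pm_seminormD[OF pq]
  have q0: "q \<zero> = 0" using qle[of \<zero>] spectral_base[of \<zero>] qD(1)[of \<zero>] by (simp add: base_closed base_props)
  have mult: "q (x \<otimes> c) = q x * q c" if x: "x \<in> carrier L" and c: "c \<in> carrier L" for x c
  proof (cases "c = \<zero>")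
    case False
    obtain q' where q': "pm_seminorm q'" "\<And>x. x \<in> carrier L \<Longrightarrow> q' x \<le> q (x \<otimes> c) / q c"
      "\<And>x. x \<in> carrier L \<Longrightarrow> q' x \<le> q x" "\<And>x. x \<notin> carrier L \<Longrightarrow> q' x = 0"
      using pm_seminorm_smooth[OF pq c False] by blast
    have "q' \<in> A" using q' qle unfolding A_def by force
    moreover have "P q q'" using q' by (simp add: P_def)
    ultimately have "q' = q" using q(2) by blast
    hence "q x \<le> q (x \<otimes> c) / q c" using q'(2)[OF x] by simp
    hence "q x * q c \<le> q (x \<otimes> c)" using pm_seminorm_pos[OF pq c False] by (simp add: field_simps)
    thus ?thesis using qD(3)[OF x c] by linarith
  qed (use q0 x in simp)
  have "abs_valued_field L q"
  proof unfold_locales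
    fix x assume x: "x \<in> carrier L"
    show "0 \<le> q x" using qD(1)[OF x] .
    show "q x = 0 \<longleftrightarrow> x = \<zero>" using q0 pm_seminorm_pos[OF pq x] by force
  qed (use mult qD in auto)
  moreover have "q c = \<alpha> c" if c: "c \<in> F" for c
  proof (cases "c = \<zero>")
    case False
    have ic: "inv c \<in> F" "c \<otimes> inv c = \<one>" using subfield_m_inv[OF sub, of c] c False by auto
    have "q c * q (inv c) = 1" using mult[of c "inv c"] ic F_carrier c qD(5) by simp
    moreover have "\<alpha> c * \<alpha> (inv c) = 1" using base_props(3)[OF c ic(1)] ic base_props(5) by simp
    moreover have "q c \<le> \<alpha> c" "q (inv c) \<le> \<alpha> (inv c)"
      using qle spectral_base F_carrier c ic by (meson order_trans)+
    moreover have "\<alpha> (inv c) > 0"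
      using calculation(2) base_props(1)[OF ic(1)] by (cases "\<alpha> (inv c) = 0") auto
    ultimately show ?thesis
      by (smt (verit) mult_left_mono mult_right_mono mult_strict_right_mono qD(1) F_carrier c)
  qed (simp add: q0 base_props)
  ultimately show ?thesis by blast
qed
end

section \<open>Uniqueness of the extension over a complete base field\<close>

lemma power_bound_imp_le:
  fixes a r K :: real
  assumes "0 \<le> a" "0 < r" "\<And>n::nat. a ^ n \<le> K * r ^ n"
  shows "a \<le> r"
proof (rule ccontr)
  assume "\<not> ?thesis"
  hence "1 < a / r" using assms by (simp add: field_simps)
  then obtain n where "K < (a / r) ^ n" using real_arch_pow by blast
  thus False using assms(3)[of n] assms(2) by (simp add: power_divide field_simps)
qed

definition complete_abs :: "('a, 'b) ring_scheme \<Rightarrow> ('a \<Rightarrow> real) \<Rightarrow> bool" where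
  "complete_abs R \<phi> \<longleftrightarrow> (\<forall>f. range f \<subseteq> carrier R \<longrightarrow>
     (\<forall>e>0. \<exists>k. \<forall>m\<ge>k. \<forall>n\<ge>k. \<phi> (f m \<ominus>\<^bsub>R\<^esub> f n) < e) \<longrightarrow>
     (\<exists>c\<in>carrier R. (\<lambda>n. \<phi> (f n \<ominus>\<^bsub>R\<^esub> c)) \<longlonglongrightarrow> 0))"

lemma (in abs_valued_field) geometric_Cauchy:
  assumes f: "range f \<subseteq> carrier R" and step: "\<And>n. \<phi> (f (Suc n) \<ominus> f n) \<le> (1/2) ^ n"
  shows "\<forall>e>0. \<exists>k. \<forall>m\<ge>k. \<forall>n\<ge>k. \<phi> (f m \<ominus> f n) < e"
proof (intro allI impI)
  have fc: "f n \<in> carrier R" for n using f by auto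
  have bd: "\<phi> (f (n + k) \<ominus> f n) \<le> (1/2) ^ n * (2 - 2 * (1/2) ^ k)" for n k
  proof (induction k)
    case 0
    have "f n \<ominus> f n = \<zero>" using fc by simp
    thus ?case by simp
  next
    case (Suc k)
    have "\<phi> (f (n + Suc k) \<ominus> f n) \<le> \<phi> (f (Suc (n + k)) \<ominus> f (n + k)) + \<phi> (f (n + k) \<ominus> f n)"
      using abs_diff_triangle[of "f (Suc (n + k))" "f (n + k)" "f n"] fc by simp
    also have "\<dots> \<le> (1/2) ^ (n + k) + (1/2) ^ n * (2 - 2 * (1/2) ^ k)"
      by (intro add_mono step Suc)
    also have "\<dots> = (1/2) ^ n * (2 - 2 * (1/2) ^ Suc k)"
      by (simp add: power_add algebra_simps)
    finally show ?case .
  qed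
  fix e :: real assume e: "e > 0"
  obtain k where k: "(1/2::real) ^ k < e / 4" using real_arch_pow_inv[of "e / 4" "1/2"] e by auto
  have near: "\<phi> (f n \<ominus> f k) < e / 2" if n: "n \<ge> k" for n
  proof -
    have "\<phi> (f n \<ominus> f k) \<le> (1/2) ^ k * (2 - 2 * (1/2) ^ (n - k))" using bd[of k "n - k"] n by simp
    also have "\<dots> \<le> (1/2) ^ k * 2" by (intro mult_left_mono) auto
    finally show ?thesis using k by simp
  qed
  have "\<phi> (f m \<ominus> f n) < e" if mn: "m \<ge> k" "n \<ge> k" for m n
    using abs_diff_triangle[of "f m" "f k" "f n"] near[OF mn(1)] near[OF mn(2)]
      abs_minus_commute[of "f k" "f n"] fc by force
  thus "\<exists>k. \<forall>m\<ge>k. \<forall>n\<ge>k. \<phi> (f m \<ominus> f n) < e" by blast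
qed

locale complete_abs_extension = abs_extension L F \<alpha> + psi: abs_valued_field L \<psi>
  for L (structure) and F and \<alpha> \<psi> :: "'a \<Rightarrow> real" +
  assumes complete: "complete_abs (L\<lparr>carrier := F\<rparr>) \<alpha>"
    and extends: "c \<in> F \<Longrightarrow> \<psi> c = \<alpha> c"
begin

lemma base_limit:
  assumes f: "range f \<subseteq> F" and step: "\<And>n. \<alpha> (f (Suc n) \<ominus> f n) \<le> (1/2) ^ n"
  shows "\<exists>c\<in>F. (\<lambda>n. \<psi> (f n \<ominus> c)) \<longlonglongrightarrow> 0"
proof -
  interpret F: abs_valued_field "L\<lparr>carrier := F\<rparr>" \<alpha> by (rule abs_valued_base)
  have fc: "f n \<in> F" for n using f by auto
  have minus: "c \<ominus>\<^bsub>L\<lparr>carrier := F\<rparr>\<^esub> d = c \<ominus> d" if "d \<in> F" for c d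
  proof -
    have "\<ominus>\<^bsub>L\<lparr>carrier := F\<rparr>\<^esub> d = \<ominus> d"
    proof (rule F.minus_equality)
      show "(\<ominus> d) \<oplus>\<^bsub>L\<lparr>carrier := F\<rparr>\<^esub> d = \<zero>\<^bsub>L\<lparr>carrier := F\<rparr>\<^esub>"
        using F_carrier[OF that] by (simp add: l_neg)
    qed (use that base_closed in auto)
    thus ?thesis by (simp add: a_minus_def)
  qed
  have "\<exists>c\<in>F. (\<lambda>n. \<alpha> (f n \<ominus>\<^bsub>L\<lparr>carrier := F\<rparr>\<^esub> c)) \<longlonglongrightarrow> 0"
    using complete F.geometric_Cauchy[of f] f step unfolding complete_abs_def
    by (auto simp: minus[OF fc])
  then obtain c where c: "c \<in> F" "(\<lambda>n. \<alpha> (f n \<ominus>\<^bsub>L\<lparr>carrier := F\<rparr>\<^esub> c)) \<longlonglongrightarrow> 0" by blast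
  thus ?thesis using fc base_closed(6) extends by (intro bexI[of _ c]) (auto simp: minus)
qed

text \<open>Finite spans are complete along sequences whose increments have geometrically small
  gauges: the coefficients of \<open>e\<close> are summed in the complete field \<open>F\<close>,
  and what remains is a sequence over \<open>E\<close>. Smallness is measured by gauges because at
  this point nothing relates them to \<psi> from above.\<close>

lemma span_complete:
  assumes "finite E" "E \<subseteq> carrier L" "range s \<subseteq> carrier L" "s 0 = \<zero>"
    and "\<And>n. gauge E (s (Suc n) \<ominus> s n) ((1/2) ^ n)"
  shows "\<exists>u t. gauge E u t \<and> (\<lambda>n. \<psi> (s n \<ominus> u)) \<longlonglongrightarrow> 0"
  using assms
proof (induction arbitrary: s rule: finite_induct)
  case empty
  have sc: "s n \<in> carrier L" for n using empty by auto
  have "s n = \<zero>" for n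
  proof (induction n)
    case (Suc n)
    have "s (Suc n) \<ominus> s n = \<zero>" using gauge_empty[OF empty(4)] .
    thus ?case using Suc sc by (simp add: a_minus_def)
  qed (use empty in simp)
  hence "(\<lambda>n. \<psi> (s n \<ominus> \<zero>)) \<longlonglongrightarrow> 0" by (simp add: a_minus_def)
  moreover have "gauge {} \<zero> 0" by (intro gauge.gauge_zero) simp
  ultimately show ?case by blast
next
  case (insert e E)
  have E: "E \<subseteq> carrier L" "e \<in> carrier L" using insert by auto
  have sc: "s n \<in> carrier L" for n using insert by auto
  have "\<forall>n. \<exists>c u. c \<in> F \<and> s (Suc n) \<ominus> s n = c \<otimes> e \<oplus> u \<and> \<alpha> c \<le> (1/2) ^ n \<and> gauge E u ((1/2) ^ n - \<alpha> c)"
    using gauge_insert[OF insert.prems(4) E] by blast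
  then obtain c u where c: "\<And>n. c n \<in> F" "\<And>n. s (Suc n) \<ominus> s n = c n \<otimes> e \<oplus> u n"
    "\<And>n. \<alpha> (c n) \<le> (1/2) ^ n" "\<And>n. gauge E (u n) ((1/2) ^ n - \<alpha> (c n))" by metis
  have uc: "u n \<in> carrier L" "c n \<in> carrier L" for n using gauge_carrier[OF c(4) E(1)] c F_carrier by auto
  \<comment> \<open>The partial sums of the coefficients of \<open>e\<close> in the increments;
    subtracting them leaves a sequence with increments \<open>u n\<close>, which involve
    \<open>E\<close> only.\<close>
  define C where "C = rec_nat \<zero> (\<lambda>n x. x \<oplus> c n)"
  have C: "C 0 = \<zero>" "C (Suc n) = C n \<oplus> c n" for n by (simp_all add: C_def)
  have CF: "C n \<in> F" for n by (induction n) (auto simp: C base_closed c)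
  have Cc: "C n \<in> carrier L" for n using CF F_carrier by blast
  define S where "S = (\<lambda>n. s n \<ominus> C n \<otimes> e)"
  have Sc: "S n \<in> carrier L" for n using sc Cc E by (simp add: S_def)
  have "S (Suc n) \<ominus> S n = u n" for n
  proof -
    have "S (Suc n) \<ominus> S n = (s (Suc n) \<ominus> s n) \<ominus> c n \<otimes> e"
      unfolding S_def C using sc Cc E uc by algebra
    also have "\<dots> = u n" unfolding c(2) using uc E by algebra
    finally show ?thesis .
  qed
  moreover have "S 0 = \<zero>" using insert E by (simp add: S_def C a_minus_def)
  moreover have "gauge E (u n) ((1/2) ^ n)" for n
    using gauge_mono[OF c(4)[of n]] base_props(1)[OF c(1)[of n]] by simp
  ultimately obtain v t where v: "gauge E v t" "(\<lambda>n. \<psi> (S n \<ominus> v)) \<longlonglongrightarrow> 0"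
    using insert.IH[OF E(1), of S] Sc by fastforce
  have vc: "v \<in> carrier L" using gauge_carrier[OF v(1) E(1)] .
  have "C (Suc n) \<ominus> C n = c n" for n unfolding C using Cc uc by algebra
  then obtain d where d: "d \<in> F" "(\<lambda>n. \<psi> (C n \<ominus> d)) \<longlonglongrightarrow> 0"
    using base_limit[of C] CF c(3) by auto
  have dc: "d \<in> carrier L" using d F_carrier by blast
  have "(\<lambda>n. \<psi> (C n \<ominus> d) * \<psi> e + \<psi> (S n \<ominus> v)) \<longlonglongrightarrow> 0 * \<psi> e + 0"
    by (intro tendsto_intros d v)
  hence lim: "(\<lambda>n. \<psi> (C n \<ominus> d) * \<psi> e + \<psi> (S n \<ominus> v)) \<longlonglongrightarrow> 0" by simp
  have "(\<lambda>n. \<psi> (s n \<ominus> (d \<otimes> e \<oplus> v))) \<longlonglongrightarrow> 0"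
  proof (rule tendsto_sandwich[OF _ _ tendsto_const lim]; intro always_eventually allI)
    fix n
    show "0 \<le> \<psi> (s n \<ominus> (d \<otimes> e \<oplus> v))" using sc dc E vc by (intro psi.abs_nonneg) auto
    have "s n \<ominus> (d \<otimes> e \<oplus> v) = (C n \<ominus> d) \<otimes> e \<oplus> (S n \<ominus> v)"
      unfolding S_def using sc dc E vc Cc by algebra
    thus "\<psi> (s n \<ominus> (d \<otimes> e \<oplus> v)) \<le> \<psi> (C n \<ominus> d) * \<psi> e + \<psi> (S n \<ominus> v)"
      using psi.abs_add[of "(C n \<ominus> d) \<otimes> e" "S n \<ominus> v"] psi.abs_mult[of "C n \<ominus> d" e] Cc dc E Sc vc by simp
  qed
  moreover have "gauge (insert e E) (d \<otimes> e \<oplus> v) (\<alpha> d + t)"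
    using d gauge_mono[OF v(1), of "insert e E" t] by (intro gauge_step) auto
  ultimately show ?case by blast
qed

text \<open>Equivalence of norms in finite dimension, by induction on the generators: the span of
  \<open>E\<close> is complete, hence closed, so an \<open>e\<close> outside it has a positive
  distance \<delta> from it, and \<delta> controls the coefficient of \<open>e\<close>.\<close>

lemma gauge_norm_equiv:
  assumes "finite E" "E \<subseteq> carrier L"
  shows "\<exists>C\<ge>0. \<forall>x t. gauge E x t \<longrightarrow> gauge E x (C * \<psi> x)"
  using assms
proof (induction rule: finite_induct)
  case empty
  have "gauge {} x (0 * \<psi> x)" if "gauge {} x t" for x t
    using gauge_empty[OF that] gauge.gauge_zero[of 0 "{}"] by simp
  thus ?case by blast
next
  case (insert e E)
  have E: "E \<subseteq> carrier L" "e \<in> carrier L" using insert by auto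
  obtain C where C: "C \<ge> 0" "\<And>x t. gauge E x t \<Longrightarrow> gauge E x (C * \<psi> x)"
    using insert.IH[OF E(1)] by metis
  show ?case
  proof (cases "\<exists>s. gauge E e s")
    case True
    then obtain s where s: "gauge E e s" by blast
    have "gauge (insert e E) x (C * \<psi> x)" if "gauge (insert e E) x t" for x t
      by (rule gauge_mono[OF C(2)[OF gauge_insert_redundant[OF s that E]]]) auto
    thus ?thesis using C(1) by blast
  next
    case ne: False
    have "\<exists>\<delta>>0. \<forall>u t. gauge E u t \<longrightarrow> \<delta> \<le> \<psi> (e \<ominus> u)"
    proof (rule ccontr)
      assume "\<not> ?thesis"
      hence ex: "\<And>\<delta>. \<delta> > 0 \<Longrightarrow> \<exists>u t. gauge E u t \<and> \<psi> (e \<ominus> u) < \<delta>" by (meson not_le)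
      \<comment> \<open>Chosen with \<open>C * (2 * \<epsilon>) \<le> 1\<close>, so that consecutive
        approximations of \<open>e\<close> differ by a gauge of at most \<open>(1/2) ^ n\<close>, as
        \<open>span_complete\<close> demands.\<close>
      define \<epsilon> where "\<epsilon> = 1 / (2 * (C + 1))"
      have eps: "\<epsilon> > 0" "C * (2 * \<epsilon>) \<le> 1" using C(1) by (auto simp: \<epsilon>_def field_simps)
      have "\<forall>n. \<exists>u. (\<exists>t. gauge E u t) \<and> \<psi> (e \<ominus> u) < \<epsilon> * (1/2) ^ n"
        using ex eps by (metis mult_pos_pos zero_less_power half_gt_zero_iff zero_less_one)
      then obtain u where u: "\<And>n. \<exists>t. gauge E (u n) t" "\<And>n. \<psi> (e \<ominus> u n) < \<epsilon> * (1/2) ^ n" by metis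
      have uc: "u n \<in> carrier L" for n using u(1)[of n] gauge_carrier E by blast
      define s where "s = (\<lambda>n. u n \<ominus> u 0)"
      have "gauge E (s (Suc n) \<ominus> s n) ((1/2) ^ n)" for n
      proof -
        have eq: "s (Suc n) \<ominus> s n = u (Suc n) \<ominus> u n" unfolding s_def using uc by algebra
        have "\<exists>t. gauge E (u (Suc n) \<ominus> u n) t" using u(1) gauge_minus E by blast
        hence "gauge E (u (Suc n) \<ominus> u n) (C * \<psi> (u (Suc n) \<ominus> u n))" using C(2) by blast
        moreover have "C * \<psi> (u (Suc n) \<ominus> u n) \<le> (1/2) ^ n"
        proof -
          have "\<psi> (u (Suc n) \<ominus> u n) \<le> \<psi> (e \<ominus> u (Suc n)) + \<psi> (e \<ominus> u n)"
            using psi.abs_diff_triangle[of "u (Suc n)" e "u n"] psi.abs_minus_commute[of "u (Suc n)" e] uc E by simp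
          also have "\<dots> \<le> \<epsilon> * (1/2) ^ Suc n + \<epsilon> * (1/2) ^ n" using u(2)[of n] u(2)[of "Suc n"] by linarith
          also have "\<dots> \<le> 2 * \<epsilon> * (1/2) ^ n" using eps by simp
          finally have "C * \<psi> (u (Suc n) \<ominus> u n) \<le> C * (2 * \<epsilon>) * (1/2) ^ n"
            using C(1) mult_left_mono by fastforce
          also have "\<dots> \<le> 1 * (1/2) ^ n" using eps by (intro mult_right_mono) auto
          finally show ?thesis by simp
        qed
        ultimately show ?thesis using gauge_mono eq by (metis order.refl)
      qed
      moreover have "range s \<subseteq> carrier L" "s 0 = \<zero>" using uc by (auto simp: s_def)
      ultimately obtain v t where v: "gauge E v t" "(\<lambda>n. \<psi> (s n \<ominus> v)) \<longlonglongrightarrow> 0"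
        using span_complete[OF insert.hyps(1) E(1), of s] by blast
      have vc: "v \<in> carrier L" using gauge_carrier[OF v(1) E(1)] .
      define w where "w = u 0 \<oplus> v"
      have wc: "w \<in> carrier L" using uc vc by (simp add: w_def)
      have "(\<lambda>n. \<epsilon> * (1/2) ^ n + \<psi> (s n \<ominus> v)) \<longlonglongrightarrow> \<epsilon> * 0 + 0"
        by (intro tendsto_intros v LIMSEQ_realpow_zero) auto
      moreover have "\<psi> (e \<ominus> w) \<le> \<epsilon> * (1/2) ^ n + \<psi> (s n \<ominus> v)" for n
      proof -
        have "u n \<ominus> w = s n \<ominus> v" unfolding w_def s_def using uc vc by algebra
        thus ?thesis using psi.abs_diff_triangle[of e "u n" w] u(2)[of n] uc wc E by simp
      qed
      ultimately have "\<psi> (e \<ominus> w) \<le> 0" using LIMSEQ_le_const by fastforce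
      hence "e \<ominus> w = \<zero>" using psi.abs_nonneg psi.abs_eq_0_iff E wc by (metis antisym minus_closed)
      hence "e = u 0 \<oplus> v" using E wc by (simp add: w_def)
      moreover obtain t' where "gauge E (u 0) t'" using u(1) by blast
      ultimately have "gauge E e (t' + t)" using gauge_add[OF _ v(1) E(1)] by simp
      thus False using ne by blast
    qed
    then obtain \<delta> where d: "\<delta> > 0" "\<And>u t. gauge E u t \<Longrightarrow> \<delta> \<le> \<psi> (e \<ominus> u)" by blast
    \<comment> \<open>\<open>1 / \<delta>\<close> pays for the coefficient of \<open>e\<close>; the
      rest \<open>v\<close> satisfies
      \<open>\<psi> v \<le> \<psi> x * (1 + \<psi> e / \<delta>)\<close> and is paid for through
      \<open>C\<close>.\<close>
    define D where "D = 1 / \<delta> + C * (1 + \<psi> e / \<delta>)"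
    have "gauge (insert e E) x (D * \<psi> x)" if x: "gauge (insert e E) x t" for x t
    proof -
      obtain c v where c: "c \<in> F" "x = c \<otimes> e \<oplus> v" "gauge E v (t - \<alpha> c)"
        using gauge_insert[OF x E] by blast
      have cl: "c \<in> carrier L" "v \<in> carrier L" "x \<in> carrier L"
        using F_carrier c gauge_carrier[OF c(3) E(1)] E by auto
      have ac: "\<alpha> c \<le> \<psi> x / \<delta>"
      proof (cases "c = \<zero>")
        case False
        have ic: "inv c \<in> F" "c \<otimes> inv c = \<one>" using subfield_m_inv[OF sub, of c] c False by auto
        have icc: "inv c \<in> carrier L" using ic F_carrier by blast
        \<comment> \<open>Dividing the representation of \<open>x\<close> by \<open>c\<close> gives
          \<open>e\<close> minus an element of the span of \<open>E\<close>, to which the distance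
          \<delta> applies.\<close>
        have "gauge E (\<ominus> (inv c \<otimes> v)) (\<alpha> (inv c) * (t - \<alpha> c))"
          by (intro gauge_uminus gauge_smult c ic E)
        hence "\<delta> \<le> \<psi> (e \<ominus> (\<ominus> (inv c \<otimes> v)))" using d by blast
        moreover have "c \<otimes> (e \<ominus> (\<ominus> (inv c \<otimes> v))) = c \<otimes> e \<oplus> (c \<otimes> inv c) \<otimes> v"
          using cl E icc by algebra
        hence "c \<otimes> (e \<ominus> (\<ominus> (inv c \<otimes> v))) = x" using ic cl c by simp
        hence "\<psi> x = \<alpha> c * \<psi> (e \<ominus> (\<ominus> (inv c \<otimes> v)))"
          using psi.abs_mult[of c "e \<ominus> (\<ominus> (inv c \<otimes> v))"] cl E icc extends[OF c(1)] by simp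
        ultimately have "\<alpha> c * \<delta> \<le> \<psi> x" using base_props(1)[OF c(1)] by (simp add: mult_left_mono)
        thus ?thesis using d by (simp add: field_simps)
      qed (use psi.abs_nonneg[OF cl(3)] d base_props in simp)
      have "v = x \<ominus> c \<otimes> e" unfolding c(2) using cl E by algebra
      hence "\<psi> v \<le> \<psi> x + \<alpha> c * \<psi> e"
        using psi.abs_minus_le[of x "c \<otimes> e"] psi.abs_mult[of c e] cl E extends[OF c(1)] by simp
      also have "\<dots> \<le> \<psi> x + \<psi> x / \<delta> * \<psi> e"
        using mult_right_mono[OF ac psi.abs_nonneg[OF E(2)]] by simp
      finally have "C * \<psi> v \<le> C * (\<psi> x + \<psi> x / \<delta> * \<psi> e)" using C(1) by (rule mult_left_mono)
      hence le: "\<alpha> c + C * \<psi> v \<le> D * \<psi> x"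
        using ac by (simp add: D_def algebra_simps)
      have "gauge (insert e E) (c \<otimes> e \<oplus> v) (\<alpha> c + C * \<psi> v)"
        by (intro gauge_step c(1) gauge_mono[OF C(2)[OF c(3)]]) auto
      thus ?thesis using gauge_mono[OF _ order.refl le] c(2) by simp
    qed
    moreover have "D \<ge> 0" using d C psi.abs_nonneg[OF E(2)] by (simp add: D_def)
    ultimately show ?thesis by blast
  qed
qed

lemma psi_le_gauge:
  assumes "gauge E x t" "E \<subseteq> carrier L" "\<And>e. e \<in> E \<Longrightarrow> \<psi> e \<le> M" "0 \<le> M"
  shows "\<psi> x \<le> M * t"
  using assms
proof (induction rule: gauge.induct)
  case (gauge_step c e x t)
  have cl: "c \<in> carrier L" "e \<in> carrier L" "x \<in> carrier L"
    using gauge_step F_carrier gauge_carrier[OF gauge_step(3)] by auto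
  have "\<psi> (c \<otimes> e \<oplus> x) \<le> \<alpha> c * \<psi> e + \<psi> x"
    using psi.abs_add[of "c \<otimes> e" x] psi.abs_mult[of c e] extends gauge_step(1) cl by simp
  also have "\<dots> \<le> \<alpha> c * M + M * t"
    using gauge_step base_props(1) by (intro add_mono mult_left_mono) auto
  finally show ?case by (simp add: algebra_simps)
qed simp

text \<open>\<open>spectral\<close> does not mention \<psi>, so this is uniqueness. Extracting
  \<open>n\<close>-th roots from any gauge bound on powers gives
  \<open>\<psi> x \<le> spectral x\<close>; conversely the equivalence of norms turns any gauge of
  \<open>x [^] n\<close> over a fixed finite set into \<open>C * \<psi> x ^ n\<close>, so that
  \<open>\<psi> x\<close> is a growth rate.\<close>

theorem abs_extension_unique: "x \<in> carrier L \<Longrightarrow> \<psi> x = spectral x"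
proof (rule antisym)
  assume x: "x \<in> carrier L"
  show "\<psi> x \<le> spectral x" unfolding spectral_def
  proof (rule cInf_greatest[OF growth_rates_ne[OF x]])
    fix r assume "r \<in> growth_rates x"
    from growth_ratesE[OF this] obtain E C where E: "0 < r" "finite E" "E \<subseteq> carrier L" "0 \<le> C"
      "\<And>n::nat. gauge E (x [^] n) (C * r ^ n)" by metis
    define M where "M = (\<Sum>e\<in>E. \<psi> e)"
    have M: "\<psi> e \<le> M" if "e \<in> E" for e
      unfolding M_def using that E psi.abs_nonneg by (intro member_le_sum) auto
    have M0: "0 \<le> M" unfolding M_def using E psi.abs_nonneg by (intro sum_nonneg) auto
    show "\<psi> x \<le> r"
    proof (rule power_bound_imp_le[of _ _ "M * C"])
      fix n :: nat
      show "\<psi> x ^ n \<le> M * C * r ^ n"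
        using psi_le_gauge[OF E(5)[of n] E(3) M M0] psi.abs_pow[OF x, of n] by (simp add: mult.assoc)
    qed (use psi.abs_nonneg[OF x] E(1) in auto)
  qed
  show "spectral x \<le> \<psi> x"
  proof (cases "x = \<zero>")
    case True
    thus ?thesis using spectral_base[of \<zero>] by (simp add: base_closed base_props)
  next
    case False
    obtain E B where E: "finite E" "E \<subseteq> carrier L" "\<And>n::nat. gauge E (x [^] n) (B ^ n)"
      using power_gauge[OF x] by metis
    obtain C where C: "C \<ge> 0" "\<And>x t. gauge E x t \<Longrightarrow> gauge E x (C * \<psi> x)"
      using gauge_norm_equiv[OF E(1,2)] by metis
    have "\<psi> x \<in> growth_rates x"
    proof (rule growth_ratesI[OF _ E(1,2) C(1)])
      show "0 < \<psi> x" using psi.abs_nonneg[OF x] psi.abs_eq_0_iff[OF x] False by linarith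
      fix n :: nat
      show "gauge E (x [^] n) (C * \<psi> x ^ n)" using C(2)[OF E(3)[of n]] psi.abs_pow[OF x, of n] by simp
    qed
    thus ?thesis by (rule spectral_le)
  qed
qed
end

section \<open>Completions\<close>

context abs_valued_field begin

abbreviation "cauchy_seqs \<equiv> cauchy_ring R \<phi>"
abbreviation "compl \<equiv> field_completion R \<phi>"
abbreviation "cls f \<equiv> null_seqs R \<phi> +>\<^bsub>cauchy_seqs\<^esub> f"

lemma cauchy_carrier:
  "f \<in> carrier cauchy_seqs \<longleftrightarrow> (\<forall>n. f n \<in> carrier R) \<and>
     (\<forall>e>0. \<exists>k. \<forall>m\<ge>k. \<forall>n\<ge>k. \<phi> (f m \<ominus> f n) < e)"
  unfolding cauchy_ring_def by auto

lemma cauchy_simps [simp]: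
  "f \<otimes>\<^bsub>cauchy_seqs\<^esub> g = (\<lambda>n. f n \<otimes> g n)" "f \<oplus>\<^bsub>cauchy_seqs\<^esub> g = (\<lambda>n. f n \<oplus> g n)"
  "\<one>\<^bsub>cauchy_seqs\<^esub> = (\<lambda>n. \<one>)" "\<zero>\<^bsub>cauchy_seqs\<^esub> = (\<lambda>n. \<zero>)"
  unfolding cauchy_ring_def by simp_all

lemma cauchyD: "f \<in> carrier cauchy_seqs \<Longrightarrow> f n \<in> carrier R"
  by (simp add: cauchy_carrier)

lemma cauchyE:
  assumes "f \<in> carrier cauchy_seqs" "e > 0"
  obtains k where "\<And>m n. m \<ge> k \<Longrightarrow> n \<ge> k \<Longrightarrow> \<phi> (f m \<ominus> f n) < e"
  using assms unfolding cauchy_carrier by blast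

lemma cauchy_bounded:
  assumes f: "f \<in> carrier cauchy_seqs"
  obtains B where "B > 0" "\<And>n. \<phi> (f n) \<le> B"
proof -
  obtain k where k: "\<And>m n. m \<ge> k \<Longrightarrow> n \<ge> k \<Longrightarrow> \<phi> (f m \<ominus> f n) < 1" using cauchyE[OF f, of 1] by auto
  have *: "0 \<le> \<phi> (f i)" for i using abs_nonneg cauchyD[OF f] by blast
  define B where "B = (\<Sum>i\<le>k. \<phi> (f i)) + 1"
  have le: "\<phi> (f i) \<le> (\<Sum>i\<le>k. \<phi> (f i))" if "i \<le> k" for i
    using that * by (intro member_le_sum) auto
  have "\<phi> (f n) \<le> B" for n
  proof (cases "n \<le> k")
    case False
    have "\<phi> (f n) \<le> \<phi> (f n \<ominus> f k) + \<phi> (f k)"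
      using abs_diff_le[of "f n" "f k"] cauchyD[OF f] by force
    thus ?thesis using k[of n k] False le[of k] by (simp add: B_def)
  qed (use le[of n] in \<open>simp add: B_def\<close>)
  moreover have "B > 0" unfolding B_def using * by (simp add: sum_nonneg add_nonneg_pos)
  ultimately show ?thesis using that by blast
qed

lemma cauchy_const: "x \<in> carrier R \<Longrightarrow> (\<lambda>n. x) \<in> carrier cauchy_seqs"
  by (simp add: cauchy_carrier a_minus_def r_neg)

lemma cauchy_add:
  assumes f: "f \<in> carrier cauchy_seqs" and g: "g \<in> carrier cauchy_seqs"
  shows "(\<lambda>n. f n \<oplus> g n) \<in> carrier cauchy_seqs"
  unfolding cauchy_carrier
proof (intro conjI allI impI)
  note fc = cauchyD[OF f] and gc = cauchyD[OF g]
  show "f n \<oplus> g n \<in> carrier R" for n using fc gc by simp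
  fix e :: real assume e: "e > 0"
  obtain k where k: "\<And>m n. m \<ge> k \<Longrightarrow> n \<ge> k \<Longrightarrow> \<phi> (f m \<ominus> f n) < e / 2" using cauchyE[OF f, of "e / 2"] e by auto
  obtain l where l: "\<And>m n. m \<ge> l \<Longrightarrow> n \<ge> l \<Longrightarrow> \<phi> (g m \<ominus> g n) < e / 2" using cauchyE[OF g, of "e / 2"] e by auto
  have "\<phi> (f m \<oplus> g m \<ominus> (f n \<oplus> g n)) < e" if "m \<ge> max k l" "n \<ge> max k l" for m n
  proof -
    have "f m \<oplus> g m \<ominus> (f n \<oplus> g n) = (f m \<ominus> f n) \<oplus> (g m \<ominus> g n)" using fc gc by algebra
    thus ?thesis using abs_add[of "f m \<ominus> f n" "g m \<ominus> g n"] k[of m n] l[of m n] that fc gc by simp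
  qed
  thus "\<exists>k. \<forall>m\<ge>k. \<forall>n\<ge>k. \<phi> (f m \<oplus> g m \<ominus> (f n \<oplus> g n)) < e" by blast
qed

lemma cauchy_mult:
  assumes f: "f \<in> carrier cauchy_seqs" and g: "g \<in> carrier cauchy_seqs"
  shows "(\<lambda>n. f n \<otimes> g n) \<in> carrier cauchy_seqs"
  unfolding cauchy_carrier
proof (intro conjI allI impI)
  note fc = cauchyD[OF f] and gc = cauchyD[OF g]
  show "f n \<otimes> g n \<in> carrier R" for n using fc gc by simp
  obtain B where B: "B > 0" "\<And>n. \<phi> (f n) \<le> B" using cauchy_bounded[OF f] by blast
  obtain D where D: "D > 0" "\<And>n. \<phi> (g n) \<le> D" using cauchy_bounded[OF g] by blast
  fix e :: real assume e: "e > 0"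
  obtain k where k: "\<And>m n. m \<ge> k \<Longrightarrow> n \<ge> k \<Longrightarrow> \<phi> (f m \<ominus> f n) < e / 2 / D"
    using cauchyE[OF f, of "e / 2 / D"] e D by auto
  obtain l where l: "\<And>m n. m \<ge> l \<Longrightarrow> n \<ge> l \<Longrightarrow> \<phi> (g m \<ominus> g n) < e / 2 / B"
    using cauchyE[OF g, of "e / 2 / B"] e B by auto
  have "\<phi> (f m \<otimes> g m \<ominus> (f n \<otimes> g n)) < e" if "m \<ge> max k l" "n \<ge> max k l" for m n
  proof -
    have "f m \<otimes> g m \<ominus> (f n \<otimes> g n) = f m \<otimes> (g m \<ominus> g n) \<oplus> (f m \<ominus> f n) \<otimes> g n" using fc gc by algebra
    hence "\<phi> (f m \<otimes> g m \<ominus> (f n \<otimes> g n)) \<le> \<phi> (f m) * \<phi> (g m \<ominus> g n) + \<phi> (f m \<ominus> f n) * \<phi> (g n)"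
      using abs_add[of "f m \<otimes> (g m \<ominus> g n)" "(f m \<ominus> f n) \<otimes> g n"] fc gc by (simp add: abs_mult)
    also have "\<dots> \<le> B * \<phi> (g m \<ominus> g n) + \<phi> (f m \<ominus> f n) * D"
      using B D fc gc by (intro add_mono mult_left_mono mult_right_mono abs_nonneg) auto
    also have "\<dots> < B * (e / 2 / B) + (e / 2 / D) * D"
      using B D k[of m n] l[of m n] that by (intro add_strict_mono mult_strict_left_mono mult_strict_right_mono) auto
    also have "\<dots> = e" using B D by simp
    finally show ?thesis .
  qed
  thus "\<exists>k. \<forall>m\<ge>k. \<forall>n\<ge>k. \<phi> (f m \<otimes> g m \<ominus> (f n \<otimes> g n)) < e" by blast
qed

lemma cauchy_uminus:
  assumes f: "f \<in> carrier cauchy_seqs"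
  shows "(\<lambda>n. \<ominus> f n) \<in> carrier cauchy_seqs"
proof -
  have "(\<lambda>n. (\<ominus> \<one>) \<otimes> f n) \<in> carrier cauchy_seqs" by (intro cauchy_mult cauchy_const f) simp
  moreover have "(\<ominus> \<one>) \<otimes> f n = \<ominus> f n" for n using cauchyD[OF f, of n] by (simp add: l_minus)
  ultimately show ?thesis by simp
qed

lemma cring_cauchy: "cring cauchy_seqs"
proof (rule cringI)
  show "abelian_group cauchy_seqs"
  proof (rule abelian_groupI)
    fix f assume f: "f \<in> carrier cauchy_seqs"
    show "\<exists>g\<in>carrier cauchy_seqs. g \<oplus>\<^bsub>cauchy_seqs\<^esub> f = \<zero>\<^bsub>cauchy_seqs\<^esub>"
      using cauchy_uminus[OF f] cauchyD[OF f] by (intro bexI[of _ "\<lambda>n. \<ominus> f n"]) (auto simp: l_neg)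
  qed (auto simp: cauchy_add cauchy_const cauchyD a_ac)
  show "comm_monoid cauchy_seqs"
    by (rule comm_monoidI) (auto simp: cauchy_mult cauchy_const cauchyD m_ac)
qed (auto simp: cauchyD l_distr)

interpretation C: cring cauchy_seqs by (rule cring_cauchy)

lemma cauchy_a_inv: "f \<in> carrier cauchy_seqs \<Longrightarrow> \<ominus>\<^bsub>cauchy_seqs\<^esub> f = (\<lambda>n. \<ominus> f n)"
  by (rule C.minus_equality) (auto simp: cauchy_uminus cauchyD l_neg)

lemma cauchy_a_minus:
  "f \<in> carrier cauchy_seqs \<Longrightarrow> g \<in> carrier cauchy_seqs \<Longrightarrow> f \<ominus>\<^bsub>cauchy_seqs\<^esub> g = (\<lambda>n. f n \<ominus> g n)"
  by (simp add: a_minus_def cauchy_a_inv)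

lemma null_seqs_iff: "f \<in> null_seqs R \<phi> \<longleftrightarrow> f \<in> carrier cauchy_seqs \<and> (\<lambda>n. \<phi> (f n)) \<longlonglongrightarrow> 0"
  unfolding null_seqs_def by simp

lemma null_mult:
  assumes f: "f \<in> null_seqs R \<phi>" and g: "g \<in> carrier cauchy_seqs"
  shows "(\<lambda>n. g n \<otimes> f n) \<in> null_seqs R \<phi>"
proof -
  have fC: "f \<in> carrier cauchy_seqs" and f0: "(\<lambda>n. \<phi> (f n)) \<longlonglongrightarrow> 0" using f by (auto simp: null_seqs_iff)
  note fc = cauchyD[OF fC] and gc = cauchyD[OF g]
  obtain B where B: "B > 0" "\<And>n. \<phi> (g n) \<le> B" using cauchy_bounded[OF g] by blast
  have "(\<lambda>n. \<phi> (g n \<otimes> f n)) \<longlonglongrightarrow> 0"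
  proof (rule tendsto_sandwich[OF _ _ tendsto_const]; (intro always_eventually allI)?)
    show "(\<lambda>n. B * \<phi> (f n)) \<longlonglongrightarrow> 0" using tendsto_mult[OF tendsto_const f0, of B] by simp
    show "0 \<le> \<phi> (g n \<otimes> f n)" for n using fc gc abs_nonneg by simp
    show "\<phi> (g n \<otimes> f n) \<le> B * \<phi> (f n)" for n
      using fc gc abs_mult B abs_nonneg by (simp add: mult_right_mono)
  qed
  thus ?thesis using cauchy_mult[OF g fC] by (simp add: null_seqs_iff)
qed

lemma ideal_null: "ideal (null_seqs R \<phi>) cauchy_seqs"
proof (rule idealI)
  show "ring cauchy_seqs" by (rule C.ring_axioms)
  show "subgroup (null_seqs R \<phi>) (add_monoid cauchy_seqs)"
  proof (rule C.add.subgroupI)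
    show "null_seqs R \<phi> \<subseteq> carrier cauchy_seqs" by (auto simp: null_seqs_iff)
    show "null_seqs R \<phi> \<noteq> {}" 
    proof -
      have "(\<lambda>n. \<zero>) \<in> null_seqs R \<phi>" by (simp add: null_seqs_iff cauchy_const)
      thus ?thesis by blast
    qed
    fix f g assume f: "f \<in> null_seqs R \<phi>"
    show "\<ominus>\<^bsub>cauchy_seqs\<^esub> f \<in> null_seqs R \<phi>"
      using f cauchy_uminus[of f] by (simp add: null_seqs_iff cauchy_a_inv cauchyD)
    assume g: "g \<in> null_seqs R \<phi>"
    have fg: "f \<in> carrier cauchy_seqs" "g \<in> carrier cauchy_seqs" using f g by (auto simp: null_seqs_iff)
    have "(\<lambda>n. \<phi> (f n \<oplus> g n)) \<longlonglongrightarrow> 0"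
    proof (rule tendsto_sandwich[OF _ _ tendsto_const]; (intro always_eventually allI)?)
      show "(\<lambda>n. \<phi> (f n) + \<phi> (g n)) \<longlonglongrightarrow> 0"
        using tendsto_add[of "\<lambda>n. \<phi> (f n)" 0 _ "\<lambda>n. \<phi> (g n)" 0] f g by (simp add: null_seqs_iff)
      show "0 \<le> \<phi> (f n \<oplus> g n)" for n using fg abs_nonneg cauchyD by simp
      show "\<phi> (f n \<oplus> g n) \<le> \<phi> (f n) + \<phi> (g n)" for n using fg abs_add cauchyD by simp
    qed
    thus "f \<oplus>\<^bsub>cauchy_seqs\<^esub> g \<in> null_seqs R \<phi>" using cauchy_add[OF fg] by (simp add: null_seqs_iff)
  qed
  fix f g assume f: "f \<in> null_seqs R \<phi>" and g: "g \<in> carrier cauchy_seqs"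
  show "g \<otimes>\<^bsub>cauchy_seqs\<^esub> f \<in> null_seqs R \<phi>" using null_mult[OF f g] by simp
  thus "f \<otimes>\<^bsub>cauchy_seqs\<^esub> g \<in> null_seqs R \<phi>" using C.m_comm f g by (metis null_seqs_iff)
qed

interpretation N: ideal "null_seqs R \<phi>" cauchy_seqs by (rule ideal_null)

lemma compl_simps:
  "f \<in> carrier cauchy_seqs \<Longrightarrow> g \<in> carrier cauchy_seqs \<Longrightarrow> cls f \<otimes>\<^bsub>compl\<^esub> cls g = cls (\<lambda>n. f n \<otimes> g n)"
  "f \<in> carrier cauchy_seqs \<Longrightarrow> g \<in> carrier cauchy_seqs \<Longrightarrow> cls f \<oplus>\<^bsub>compl\<^esub> cls g = cls (\<lambda>n. f n \<oplus> g n)"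
  "\<one>\<^bsub>compl\<^esub> = cls (\<lambda>n. \<one>)" "\<zero>\<^bsub>compl\<^esub> = null_seqs R \<phi>"
  unfolding field_completion_def FactRing_def
  using N.rcoset_mult_add[of f g] N.a_rcos_sum[of f g] by simp_all

lemma compl_carrier: "carrier compl = {cls f |f. f \<in> carrier cauchy_seqs}"
  unfolding field_completion_def FactRing_def A_RCOSETS_def' by auto

lemma cls_in: "f \<in> carrier cauchy_seqs \<Longrightarrow> cls f \<in> carrier compl"
  unfolding compl_carrier by blast

lemma mem_cls:
  assumes f: "f \<in> carrier cauchy_seqs"
  shows "g \<in> cls f \<longleftrightarrow> g \<in> carrier cauchy_seqs \<and> (\<lambda>n. \<phi> (g n \<ominus> f n)) \<longlonglongrightarrow> 0"
proof
  assume "g \<in> cls f"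
  then obtain h where h: "h \<in> null_seqs R \<phi>" "g = (\<lambda>n. h n \<oplus> f n)"
    unfolding a_r_coset_def r_coset_def by auto
  have hc: "h \<in> carrier cauchy_seqs" using h by (simp add: null_seqs_iff)
  have "g n \<ominus> f n = h n" for n unfolding h(2) using cauchyD[OF hc, of n] cauchyD[OF f, of n] by algebra
  thus "g \<in> carrier cauchy_seqs \<and> (\<lambda>n. \<phi> (g n \<ominus> f n)) \<longlonglongrightarrow> 0"
    using h cauchy_add[OF hc f] by (simp add: null_seqs_iff)
next
  assume g: "g \<in> carrier cauchy_seqs \<and> (\<lambda>n. \<phi> (g n \<ominus> f n)) \<longlonglongrightarrow> 0"
  have "(\<lambda>n. g n \<ominus> f n) \<in> carrier cauchy_seqs"
    using C.minus_closed[of g f] g f by (simp add: cauchy_a_minus)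
  hence "(\<lambda>n. g n \<ominus> f n) \<in> null_seqs R \<phi>" using g by (simp add: null_seqs_iff)
  moreover have "g = (\<lambda>n. (g n \<ominus> f n) \<oplus> f n)"
  proof
    fix n have "g n \<in> carrier R" "f n \<in> carrier R" using g f cauchyD by auto
    thus "g n = (g n \<ominus> f n) \<oplus> f n" by algebra
  qed
  ultimately show "g \<in> cls f" unfolding a_r_coset_def r_coset_def by auto
qed

lemma cls_eq_iff:
  assumes "f \<in> carrier cauchy_seqs" "g \<in> carrier cauchy_seqs"
  shows "cls f = cls g \<longleftrightarrow> (\<lambda>n. \<phi> (f n \<ominus> g n)) \<longlonglongrightarrow> 0"
proof
  assume "cls f = cls g"
  hence "f \<in> cls g" using N.a_rcos_self[OF assms(1)] by simp
  thus "(\<lambda>n. \<phi> (f n \<ominus> g n)) \<longlonglongrightarrow> 0" using mem_cls assms by blast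
next
  assume "(\<lambda>n. \<phi> (f n \<ominus> g n)) \<longlonglongrightarrow> 0"
  hence "f \<in> cls g" using mem_cls assms by blast
  thus "cls f = cls g" using C.a_repr_independence[of f "null_seqs R \<phi>" g] assms N.a_subgroup by simp
qed

lemma cls_zero_iff: "f \<in> carrier cauchy_seqs \<Longrightarrow> cls f = \<zero>\<^bsub>compl\<^esub> \<longleftrightarrow> (\<lambda>n. \<phi> (f n)) \<longlonglongrightarrow> 0"
proof -
  assume f: "f \<in> carrier cauchy_seqs"
  have z: "(\<lambda>n. \<zero>) \<in> null_seqs R \<phi>" using cauchy_const[of \<zero>] by (simp add: null_seqs_iff)
  have "cls (\<lambda>n. \<zero>) = \<zero>\<^bsub>compl\<^esub>"
    using C.a_coset_join2[of "\<lambda>n. \<zero>" "null_seqs R \<phi>"] z N.a_subgroup by (simp add: compl_simps null_seqs_iff)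
  hence "cls f = \<zero>\<^bsub>compl\<^esub> \<longleftrightarrow> (\<lambda>n. \<phi> (f n \<ominus> \<zero>)) \<longlonglongrightarrow> 0"
    using cls_eq_iff[OF f cauchy_const[of \<zero>]] by simp
  thus ?thesis using cauchyD[OF f] by (simp add: a_minus_def)
qed

lemma abs_Cauchy:
  assumes f: "f \<in> carrier cauchy_seqs"
  shows "Cauchy (\<lambda>n. \<phi> (f n))"
proof (rule metric_CauchyI)
  fix e :: real assume "e > 0"
  then obtain k where k: "\<And>m n. m \<ge> k \<Longrightarrow> n \<ge> k \<Longrightarrow> \<phi> (f m \<ominus> f n) < e" using cauchyE[OF f] by blast
  have "dist (\<phi> (f m)) (\<phi> (f n)) < e" if "m \<ge> k" "n \<ge> k" for m n
    using abs_diff_le[of "f m" "f n"] k[OF that] cauchyD[OF f] by (force simp: dist_real_def)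
  thus "\<exists>M. \<forall>m\<ge>M. \<forall>n\<ge>M. dist (\<phi> (f m)) (\<phi> (f n)) < e" by blast
qed

text \<open>Makes the definite description \<open>completion_abs\<close> meaningful: representatives
  that differ by a null sequence have absolute values with the same limit.\<close>

lemma completion_abs_lim:
  assumes f: "f \<in> carrier cauchy_seqs"
  shows "(\<lambda>n. \<phi> (f n)) \<longlonglongrightarrow> completion_abs \<phi> (cls f)"
proof -
  obtain r where r: "(\<lambda>n. \<phi> (f n)) \<longlonglongrightarrow> r"
    using abs_Cauchy[OF f] by (auto simp: Cauchy_convergent_iff convergent_def)
  have all: "(\<lambda>n. \<phi> (g n)) \<longlonglongrightarrow> r" if g: "g \<in> cls f" for g
  proof -
    have gc: "g \<in> carrier cauchy_seqs" and gf: "(\<lambda>n. \<phi> (g n \<ominus> f n)) \<longlonglongrightarrow> 0"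
      using g mem_cls[OF f] by auto
    have "(\<lambda>n. \<phi> (g n) - \<phi> (f n)) \<longlonglongrightarrow> 0"
      using abs_diff_le cauchyD[OF gc] cauchyD[OF f]
      by (intro tendsto_rabs_zero_cancel[OF tendsto_sandwich[OF _ _ tendsto_const gf]] always_eventually) auto
    from tendsto_add[OF this r] show ?thesis by simp
  qed
  have "completion_abs \<phi> (cls f) = r" unfolding completion_abs_def
  proof (rule the_equality)
    show "\<forall>f\<in>cls f. (\<lambda>n. \<phi> (f n)) \<longlonglongrightarrow> r" using all by blast
    fix s assume "\<forall>f\<in>cls f. (\<lambda>n. \<phi> (f n)) \<longlonglongrightarrow> s"
    thus "s = r" using N.a_rcos_self[OF f] LIMSEQ_unique[OF _ r] by blast
  qed
  thus ?thesis using r by simp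
qed

text \<open>A nonzero class is eventually bounded away from zero, so its termwise inverse from some
  index on is Cauchy. The last conjunct exposes the terms of the inverse; it keeps inverses of
  rational sequences rational in \<open>base_field_subfield\<close>.\<close>

lemma cls_inverse:
  assumes f: "f \<in> carrier cauchy_seqs" and "cls f \<noteq> \<zero>\<^bsub>compl\<^esub>"
  shows "\<exists>g\<in>carrier cauchy_seqs. cls f \<otimes>\<^bsub>compl\<^esub> cls g = \<one>\<^bsub>compl\<^esub> \<and> (\<forall>n. g n = \<zero> \<or> f n \<noteq> \<zero> \<and> g n = inv (f n))"
proof -
  note fc = cauchyD[OF f]
  define r where "r = completion_abs \<phi> (cls f)"
  have lim: "(\<lambda>n. \<phi> (f n)) \<longlonglongrightarrow> r" using completion_abs_lim[OF f] by (simp add: r_def)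
  have "r \<ge> 0" using LIMSEQ_le_const[OF lim] abs_nonneg fc by blast
  moreover have "r \<noteq> 0" using lim assms(2) cls_zero_iff[OF f] by auto
  ultimately have r: "r > 0" by simp
  then obtain N where N: "\<And>n. n \<ge> N \<Longrightarrow> \<phi> (f n) > r / 2"
    using order_tendstoD(1)[OF lim, of "r / 2"] unfolding eventually_sequentially by auto
  define g where "g = (\<lambda>n. if n \<ge> N then inv (f n) else \<zero>)"
  have nz: "f n \<noteq> \<zero>" if "n \<ge> N" for n using N[OF that] r by auto
  have gc: "g n \<in> carrier R" for n using nz fc by (auto simp: g_def field_Units)
  have fg: "f n \<otimes> g n = \<one>" if "n \<ge> N" for n using nz[OF that] fc that by (simp add: g_def field_Units)
  have gbd: "\<phi> (g n) \<le> 2 / r" if "n \<ge> N" for n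
  proof -
    have "\<phi> (g n) = inverse (\<phi> (f n))" using abs_inv[OF fc nz[OF that]] that by (simp add: g_def)
    thus ?thesis using N[OF that] r le_imp_inverse_le[of "r / 2" "\<phi> (f n)"] by simp
  qed
  have gC: "g \<in> carrier cauchy_seqs" unfolding cauchy_carrier
  proof (intro conjI allI impI gc)
    fix e :: real assume e: "e > 0"
    obtain k where k: "\<And>m n. m \<ge> k \<Longrightarrow> n \<ge> k \<Longrightarrow> \<phi> (f m \<ominus> f n) < e * (r / 2) ^ 2"
      using cauchyE[OF f, of "e * (r / 2) ^ 2"] e r by auto
    have "\<phi> (g m \<ominus> g n) < e" if mn: "m \<ge> max k N" "n \<ge> max k N" for m n
    proof -
      have "g m \<ominus> g n = (f n \<otimes> g n) \<otimes> g m \<ominus> (f m \<otimes> g m) \<otimes> g n" using fg[of m] fg[of n] mn gc by simp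
      also have "\<dots> = (g m \<otimes> g n) \<otimes> (f n \<ominus> f m)" using gc fc by algebra
      finally have "\<phi> (g m \<ominus> g n) = (\<phi> (g m) * \<phi> (g n)) * \<phi> (f n \<ominus> f m)" using gc fc by (simp add: abs_mult)
      also have "\<dots> \<le> ((2 / r) * (2 / r)) * \<phi> (f n \<ominus> f m)"
        using gbd[of m] gbd[of n] mn r gc fc abs_nonneg by (intro mult_right_mono mult_mono) auto
      also have "\<dots> < ((2 / r) * (2 / r)) * (e * (r / 2) ^ 2)"
        using k[of n m] mn r by (intro mult_strict_left_mono) auto
      also have "\<dots> = e" using r by (simp add: power2_eq_square)
      finally show ?thesis .
    qed
    thus "\<exists>k. \<forall>m\<ge>k. \<forall>n\<ge>k. \<phi> (g m \<ominus> g n) < e" by blast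
  qed
  have "(\<lambda>n. \<phi> (f n \<otimes> g n \<ominus> \<one>)) \<longlonglongrightarrow> 0"
  proof (rule tendsto_eventually)
    have "\<phi> (f n \<otimes> g n \<ominus> \<one>) = 0" if "n \<ge> N" for n using fg[OF that] by (simp add: a_minus_def r_neg)
    thus "\<forall>\<^sub>F n in sequentially. \<phi> (f n \<otimes> g n \<ominus> \<one>) = 0" unfolding eventually_sequentially by blast
  qed
  hence "cls (\<lambda>n. f n \<otimes> g n) = cls (\<lambda>n. \<one>)"
    using cls_eq_iff[OF cauchy_mult[OF f gC] cauchy_const[of \<one>]] by simp
  hence "cls f \<otimes>\<^bsub>compl\<^esub> cls g = \<one>\<^bsub>compl\<^esub>" using f gC by (simp add: compl_simps)
  moreover have "\<forall>n. g n = \<zero> \<or> f n \<noteq> \<zero> \<and> g n = inv (f n)" using nz by (simp add: g_def)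
  ultimately show ?thesis using gC by blast
qed

lemma field_compl: "field compl"
proof -
  have cr: "cring compl"
    unfolding field_completion_def by (rule N.quotient_is_cring[OF cring_cauchy])
  show ?thesis
  proof (rule cring.cring_fieldI2[OF cr])
    show "\<zero>\<^bsub>compl\<^esub> \<noteq> \<one>\<^bsub>compl\<^esub>"
      using cls_zero_iff[OF cauchy_const[of \<one>]] by (auto simp: compl_simps(3) LIMSEQ_const_iff)
    fix A assume A: "A \<in> carrier compl" "A \<noteq> \<zero>\<^bsub>compl\<^esub>"
    then obtain f where f: "f \<in> carrier cauchy_seqs" "A = cls f" unfolding compl_carrier by blast
    thus "\<exists>b\<in>carrier compl. A \<otimes>\<^bsub>compl\<^esub> b = \<one>\<^bsub>compl\<^esub>"
      using A cls_inverse[OF f(1)] cls_in by metis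
  qed
qed

lemma abs_valued_compl: "abs_valued_field compl (completion_abs \<phi>)"
proof -
  interpret K: field compl by (rule field_compl)
  have nn: "0 \<le> completion_abs \<phi> (cls f)" if f: "f \<in> carrier cauchy_seqs" for f
    using LIMSEQ_le_const[OF completion_abs_lim[OF f]] abs_nonneg cauchyD[OF f] by blast
  have mult: "completion_abs \<phi> (cls f \<otimes>\<^bsub>compl\<^esub> cls g) = completion_abs \<phi> (cls f) * completion_abs \<phi> (cls g)"
    if f: "f \<in> carrier cauchy_seqs" and g: "g \<in> carrier cauchy_seqs" for f g
  proof -
    have "(\<lambda>n. \<phi> (f n) * \<phi> (g n)) \<longlonglongrightarrow> completion_abs \<phi> (cls (\<lambda>n. f n \<otimes> g n))"
      using completion_abs_lim[OF cauchy_mult[OF f g]] cauchyD[OF f] cauchyD[OF g] by (simp add: abs_mult)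
    thus ?thesis
      using tendsto_mult[OF completion_abs_lim[OF f] completion_abs_lim[OF g]] LIMSEQ_unique
      by (simp add: compl_simps f g) blast
  qed
  have add: "completion_abs \<phi> (cls f \<oplus>\<^bsub>compl\<^esub> cls g) \<le> completion_abs \<phi> (cls f) + completion_abs \<phi> (cls g)"
    if f: "f \<in> carrier cauchy_seqs" and g: "g \<in> carrier cauchy_seqs" for f g
    using LIMSEQ_le[OF completion_abs_lim[OF cauchy_add[OF f g]]
        tendsto_add[OF completion_abs_lim[OF f] completion_abs_lim[OF g]]]
      abs_add cauchyD[OF f] cauchyD[OF g] by (simp add: compl_simps f g)
  have zero: "completion_abs \<phi> (cls f) = 0 \<longleftrightarrow> cls f = \<zero>\<^bsub>compl\<^esub>" if f: "f \<in> carrier cauchy_seqs" for f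
    using completion_abs_lim[OF f] cls_zero_iff[OF f] LIMSEQ_unique by metis
  show ?thesis
  proof unfold_locales
    fix A assume "A \<in> carrier compl"
    then obtain f where f: "f \<in> carrier cauchy_seqs" "A = cls f" unfolding compl_carrier by blast
    show "0 \<le> completion_abs \<phi> A" using nn[OF f(1)] f(2) by simp
    show "completion_abs \<phi> A = 0 \<longleftrightarrow> A = \<zero>\<^bsub>compl\<^esub>" using zero[OF f(1)] f(2) by simp
    fix A2 assume "A2 \<in> carrier compl"
    then obtain g where g: "g \<in> carrier cauchy_seqs" "A2 = cls g" unfolding compl_carrier by blast
    show "completion_abs \<phi> (A \<otimes>\<^bsub>compl\<^esub> A2) = completion_abs \<phi> A * completion_abs \<phi> A2"
      using mult[OF f(1) g(1)] unfolding f(2) g(2) .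
    show "completion_abs \<phi> (A \<oplus>\<^bsub>compl\<^esub> A2) \<le> completion_abs \<phi> A + completion_abs \<phi> A2"
      using add[OF f(1) g(1)] unfolding f(2) g(2) .
  qed
qed

lemma embed_eq: "completion_embed R \<phi> x = cls (\<lambda>n. x)"
  by (simp add: completion_embed_def)

lemma embed_hom: "completion_embed R \<phi> \<in> ring_hom R compl"
  by (rule ring_hom_memI) (auto simp: embed_eq compl_simps cls_in cauchy_const)

lemma completion_abs_embed: "x \<in> carrier R \<Longrightarrow> completion_abs \<phi> (completion_embed R \<phi> x) = \<phi> x"
  using completion_abs_lim[OF cauchy_const[of x]] by (simp add: embed_eq LIMSEQ_const_iff)

lemma compl_a_minus:
  assumes f: "f \<in> carrier cauchy_seqs" and g: "g \<in> carrier cauchy_seqs"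
  shows "cls f \<ominus>\<^bsub>compl\<^esub> cls g = cls (\<lambda>n. f n \<ominus> g n)"
proof -
  interpret K: field compl by (rule field_compl)
  have fgC: "(\<lambda>n. f n \<ominus> g n) \<in> carrier cauchy_seqs"
    using C.minus_closed[of f g] f g by (simp add: cauchy_a_minus)
  have "(f n \<ominus> g n) \<oplus> g n = f n" for n
    using cauchyD[OF f, of n] cauchyD[OF g, of n] by algebra
  hence "cls (\<lambda>n. f n \<ominus> g n) \<oplus>\<^bsub>compl\<^esub> cls g = cls f" using fgC g by (simp add: compl_simps)
  moreover have "cls (\<lambda>n. f n \<ominus> g n) = (cls (\<lambda>n. f n \<ominus> g n) \<oplus>\<^bsub>compl\<^esub> cls g) \<ominus>\<^bsub>compl\<^esub> cls g"
    using cls_in[OF fgC] cls_in[OF g] by (simp add: a_minus_def K.a_assoc K.r_neg)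
  ultimately show ?thesis by simp
qed

lemma cauchy_minus:
  "f \<in> carrier cauchy_seqs \<Longrightarrow> g \<in> carrier cauchy_seqs \<Longrightarrow> (\<lambda>n. f n \<ominus> g n) \<in> carrier cauchy_seqs"
  using C.minus_closed[of f g] by (simp add: cauchy_a_minus)

lemma embed_lim:
  assumes f: "f \<in> carrier cauchy_seqs"
  shows "(\<lambda>n. completion_abs \<phi> (completion_embed R \<phi> (f n) \<ominus>\<^bsub>compl\<^esub> cls f)) \<longlonglongrightarrow> 0"
proof (rule LIMSEQ_I)
  interpret K: abs_valued_field compl "completion_abs \<phi>" by (rule abs_valued_compl)
  note fc = cauchyD[OF f]
  fix e :: real assume e: "e > 0"
  obtain k where k: "\<And>m n. m \<ge> k \<Longrightarrow> n \<ge> k \<Longrightarrow> \<phi> (f m \<ominus> f n) < e / 2" using cauchyE[OF f, of "e / 2"] e by auto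
  have "norm (completion_abs \<phi> (completion_embed R \<phi> (f n) \<ominus>\<^bsub>compl\<^esub> cls f) - 0) < e" if n: "n \<ge> k" for n
  proof -
    have eq: "completion_embed R \<phi> (f n) \<ominus>\<^bsub>compl\<^esub> cls f = cls (\<lambda>m. f n \<ominus> f m)"
      using compl_a_minus[OF cauchy_const[OF fc] f] by (simp add: embed_eq)
    have C: "(\<lambda>m. f n \<ominus> f m) \<in> carrier cauchy_seqs" by (rule cauchy_minus[OF cauchy_const[OF fc] f])
    have "completion_abs \<phi> (cls (\<lambda>m. f n \<ominus> f m)) \<le> e / 2"
      using LIMSEQ_le_const2[OF completion_abs_lim[OF C], of "e / 2"] k[OF n] by (meson less_imp_le)
    moreover have "0 \<le> completion_abs \<phi> (cls (\<lambda>m. f n \<ominus> f m))" using K.abs_nonneg[OF cls_in[OF C]] .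
    ultimately show ?thesis using e by (simp add: eq)
  qed
  thus "\<exists>no. \<forall>n\<ge>no. norm (completion_abs \<phi> (completion_embed R \<phi> (f n) \<ominus>\<^bsub>compl\<^esub> cls f) - 0) < e" by blast
qed

text \<open>By density each \<open>F n\<close> is approximated by the class of a constant
  \<open>x n\<close> within \<open>(1/2) ^ n\<close>; then \<open>x\<close> is itself Cauchy in
  \<open>R\<close> and its class is the limit.\<close>

theorem compl_complete: "complete_abs compl (completion_abs \<phi>)"
  unfolding complete_abs_def
proof (intro allI impI)
  interpret K: abs_valued_field compl "completion_abs \<phi>" by (rule abs_valued_compl)
  interpret h: ring_hom_cring R compl "completion_embed R \<phi>"
    using embed_hom is_cring K.is_cring by (simp add: ring_hom_cring_def ring_hom_cring_axioms_def)
  fix F :: "nat \<Rightarrow> (nat \<Rightarrow> 'a) set" assume F: "range F \<subseteq> carrier compl"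
    and cau: "\<forall>e>0. \<exists>k. \<forall>m\<ge>k. \<forall>n\<ge>k. completion_abs \<phi> (F m \<ominus>\<^bsub>compl\<^esub> F n) < e"
  let ?e = "completion_embed R \<phi>" and ?N = "completion_abs \<phi>"
  have Fc: "F n \<in> carrier compl" for n using F by auto
  have "\<forall>n::nat. \<exists>x\<in>carrier R. ?N (?e x \<ominus>\<^bsub>compl\<^esub> F n) < (1/2) ^ n"
  proof
    fix n
    obtain f where f: "f \<in> carrier cauchy_seqs" "F n = cls f" using Fc[of n] unfolding compl_carrier by blast
    have "\<forall>\<^sub>F k in sequentially. ?N (?e (f k) \<ominus>\<^bsub>compl\<^esub> F n) < (1/2) ^ n"
      using order_tendstoD(2)[OF embed_lim[OF f(1)], of "(1/2) ^ n"] f by simp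
    thus "\<exists>x\<in>carrier R. ?N (?e x \<ominus>\<^bsub>compl\<^esub> F n) < (1/2) ^ n"
      using cauchyD[OF f(1)] unfolding eventually_sequentially by (meson order.refl)
  qed
  then obtain x where x: "\<And>n. x n \<in> carrier R" "\<And>n. ?N (?e (x n) \<ominus>\<^bsub>compl\<^esub> F n) < (1/2) ^ n" by metis
  have ex: "?e (x n) \<in> carrier compl" for n using x by simp
  have small: "\<exists>k. \<forall>n\<ge>k. (1/2::real) ^ (n::nat) < e" if e0: "e > 0" for e
  proof -
    obtain k where "(1/2::real) ^ k < e" using real_arch_pow_inv[of e "1/2"] e0 by auto
    moreover have "(1/2::real) ^ n \<le> (1/2) ^ k" if "n \<ge> k" for n using that by (intro power_decreasing) auto
    ultimately show ?thesis by (meson order.strict_trans1)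
  qed
  have xC: "x \<in> carrier cauchy_seqs" unfolding cauchy_carrier
  proof (intro conjI allI impI x)
    fix e :: real assume e: "e > 0"
    obtain k where k: "\<And>m n. m \<ge> k \<Longrightarrow> n \<ge> k \<Longrightarrow> ?N (F m \<ominus>\<^bsub>compl\<^esub> F n) < e / 3"
      using cau e by (meson zero_less_divide_iff zero_less_numeral)
    obtain l where l: "\<And>n. n \<ge> l \<Longrightarrow> (1/2::real) ^ n < e / 3" using small[of "e / 3"] e by auto
    have "\<phi> (x m \<ominus> x n) < e" if mn: "m \<ge> max k l" "n \<ge> max k l" for m n
    proof -
      have "?e (x m \<ominus> x n) = ?e (x m) \<ominus>\<^bsub>compl\<^esub> ?e (x n)" using x by (simp add: a_minus_def)
      hence "\<phi> (x m \<ominus> x n) = ?N (?e (x m) \<ominus>\<^bsub>compl\<^esub> ?e (x n))"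
        using completion_abs_embed[of "x m \<ominus> x n"] x by simp
      also have "\<dots> \<le> ?N (?e (x m) \<ominus>\<^bsub>compl\<^esub> F m) + ?N (F m \<ominus>\<^bsub>compl\<^esub> ?e (x n))"
        by (intro K.abs_diff_triangle ex Fc)
      also have "?N (F m \<ominus>\<^bsub>compl\<^esub> ?e (x n)) \<le> ?N (F m \<ominus>\<^bsub>compl\<^esub> F n) + ?N (F n \<ominus>\<^bsub>compl\<^esub> ?e (x n))"
        by (intro K.abs_diff_triangle ex Fc)
      finally show ?thesis
        using x(2)[of m] x(2)[of n] l[of m] l[of n] k[of m n] mn K.abs_minus_commute[OF Fc[of n] ex[of n]] by simp
    qed
    thus "\<exists>k. \<forall>m\<ge>k. \<forall>n\<ge>k. \<phi> (x m \<ominus> x n) < e" by blast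
  qed
  have "(\<lambda>n. (1/2) ^ n + ?N (?e (x n) \<ominus>\<^bsub>compl\<^esub> cls x)) \<longlonglongrightarrow> 0 + 0"
    by (intro tendsto_intros embed_lim xC LIMSEQ_realpow_zero) auto
  hence lim: "(\<lambda>n. (1/2) ^ n + ?N (?e (x n) \<ominus>\<^bsub>compl\<^esub> cls x)) \<longlonglongrightarrow> 0" by simp
  have "(\<lambda>n. ?N (F n \<ominus>\<^bsub>compl\<^esub> cls x)) \<longlonglongrightarrow> 0"
  proof (rule tendsto_sandwich[OF _ _ tendsto_const lim]; intro always_eventually allI)
    show "0 \<le> ?N (F n \<ominus>\<^bsub>compl\<^esub> cls x)" for n by (intro K.abs_nonneg K.minus_closed Fc cls_in xC)
    show "?N (F n \<ominus>\<^bsub>compl\<^esub> cls x) \<le> (1/2) ^ n + ?N (?e (x n) \<ominus>\<^bsub>compl\<^esub> cls x)" for n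
      using K.abs_diff_triangle[OF Fc[of n] ex[of n] cls_in[OF xC]] x(2)[of n]
        K.abs_minus_commute[OF Fc[of n] ex[of n]] by simp
  qed
  thus "\<exists>c\<in>carrier compl. (\<lambda>n. ?N (F n \<ominus>\<^bsub>compl\<^esub> c)) \<longlonglongrightarrow> 0" using cls_in[OF xC] by blast
qed

end

section \<open>Absolute values on subfields and Ostrowski's theorem\<close>

text \<open>Estimates obtained by expanding \<open>n\<close>-th powers carry a factor that counts
  terms or digits; linear growth disappears after extracting roots.\<close>

lemma power_linear_bound_imp_le:
  fixes a M A B :: real
  assumes "0 \<le> a" "0 \<le> M" "\<And>n::nat. a ^ n \<le> (A * real n + B) * M ^ n"
  shows "a \<le> M"
proof (rule ccontr)
  assume n: "\<not> ?thesis"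
  hence a: "a > 0" "M < a" using assms(2) by auto
  define x where "x = M / a"
  have x: "norm x < 1" using a assms(2) by (simp add: x_def)
  have "(\<lambda>n. A * (of_nat n * x ^ n) + B * x ^ n) \<longlonglongrightarrow> A * 0 + B * 0"
    using x by (intro tendsto_intros powser_times_n_limit_0 LIMSEQ_power_zero) auto
  hence "\<forall>\<^sub>F n in sequentially. A * (of_nat n * x ^ n) + B * x ^ n < 1"
    by (intro order_tendstoD) auto
  then obtain n where n: "A * (of_nat n * x ^ n) + B * x ^ n < 1" by (auto simp: eventually_sequentially)
  have "a ^ n * 1 \<le> (A * real n + B) * M ^ n" using assms(3)[of n] by simp
  also have "M ^ n = a ^ n * x ^ n" using a by (simp add: x_def power_divide)
  also have "(A * real n + B) * (a ^ n * x ^ n) = a ^ n * (A * (of_nat n * x ^ n) + B * x ^ n)"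
    by (simp add: algebra_simps)
  finally have "1 \<le> A * (of_nat n * x ^ n) + B * x ^ n" using a by (subst (asm) mult_le_cancel_left_pos) auto
  thus False using n by simp
qed

text \<open>The notion \<open>subfield\<close> phrased with type class operations, so that the sums,
  products and polynomials of the type classes apply; \<open>subfield_complex_iff\<close> connects
  the two.\<close>

locale subfield_set =
  fixes K :: "'a :: field_char_0 set"
  assumes K_zero: "0 \<in> K" and K_one: "1 \<in> K"
    and K_add: "x \<in> K \<Longrightarrow> y \<in> K \<Longrightarrow> x + y \<in> K"
    and K_mult: "x \<in> K \<Longrightarrow> y \<in> K \<Longrightarrow> x * y \<in> K"
    and K_uminus: "x \<in> K \<Longrightarrow> - x \<in> K"
    and K_inverse: "x \<in> K \<Longrightarrow> inverse x \<in> K"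
begin

lemma K_diff: "x \<in> K \<Longrightarrow> y \<in> K \<Longrightarrow> x - y \<in> K"
  using K_add[of x "- y"] K_uminus by simp

lemma K_divide: "x \<in> K \<Longrightarrow> y \<in> K \<Longrightarrow> x / y \<in> K"
  unfolding divide_inverse by (intro K_mult K_inverse)

lemma K_power: "x \<in> K \<Longrightarrow> x ^ n \<in> K"
  by (induction n) (auto intro: K_mult K_one)

lemma K_sum: "(\<And>i. i \<in> A \<Longrightarrow> f i \<in> K) \<Longrightarrow> sum f A \<in> K"
  by (induction A rule: infinite_finite_induct) (auto intro: K_zero K_add)

lemma K_prod: "(\<And>i. i \<in> A \<Longrightarrow> f i \<in> K) \<Longrightarrow> prod f A \<in> K"
  by (induction A rule: infinite_finite_induct) (auto intro: K_one K_mult)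

lemma K_of_nat: "of_nat n \<in> K"
  by (induction n) (auto intro: K_zero K_add K_one)

lemma K_of_int: "of_int n \<in> K"
  by (cases n rule: int_cases2) (auto intro: K_of_nat K_uminus)

lemma K_of_rat: "of_rat q \<in> K"
  by (cases q) (auto simp: of_rat_rat intro: K_divide K_of_int)

end

locale subfield_abs = subfield_set K for K :: "'a :: field_char_0 set" +
  fixes \<phi> :: "'a \<Rightarrow> real"
  assumes nonneg: "x \<in> K \<Longrightarrow> 0 \<le> \<phi> x"
    and eq_0_iff: "x \<in> K \<Longrightarrow> \<phi> x = 0 \<longleftrightarrow> x = 0"
    and mult: "x \<in> K \<Longrightarrow> y \<in> K \<Longrightarrow> \<phi> (x * y) = \<phi> x * \<phi> y"
    and add: "x \<in> K \<Longrightarrow> y \<in> K \<Longrightarrow> \<phi> (x + y) \<le> \<phi> x + \<phi> y"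
begin

lemma zero [simp]: "\<phi> 0 = 0"
  using eq_0_iff K_zero by blast

lemma one [simp]: "\<phi> 1 = 1"
  using mult[OF K_one K_one] eq_0_iff[OF K_one] by simp

lemma pos: "x \<in> K \<Longrightarrow> x \<noteq> 0 \<Longrightarrow> 0 < \<phi> x"
  using nonneg eq_0_iff by (metis less_eq_real_def)

lemma power: "x \<in> K \<Longrightarrow> \<phi> (x ^ n) = \<phi> x ^ n"
  by (induction n) (auto simp: mult K_power)

lemma uminus [simp]: "x \<in> K \<Longrightarrow> \<phi> (- x) = \<phi> x"
proof -
  assume x: "x \<in> K"
  have "\<phi> (- 1) ^ 2 = 1" using power[of "- 1" 2] K_uminus[OF K_one] by simp
  hence "\<phi> (- 1) = 1" using nonneg[OF K_uminus[OF K_one]] by (simp add: power2_eq_1_iff)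
  thus ?thesis using mult[of "- 1" x] K_uminus[OF K_one] x by simp
qed

lemma of_int_eq: "\<phi> (of_int n) = \<phi> (of_nat (nat \<bar>n\<bar>))"
proof (cases "n \<ge> 0")
  case False
  hence "of_nat (nat \<bar>n\<bar>) = - (of_int n :: 'a)" by simp
  thus ?thesis using uminus[OF K_of_int] by simp
qed simp

lemma diff: "x \<in> K \<Longrightarrow> y \<in> K \<Longrightarrow> \<phi> (x - y) \<le> \<phi> x + \<phi> y"
  using add[of x "- y"] K_uminus by simp

lemma inverse: "x \<in> K \<Longrightarrow> \<phi> (inverse x) = inverse (\<phi> x)"
proof (cases "x = 0")
  case False
  assume x: "x \<in> K"
  have "\<phi> x * \<phi> (inverse x) = 1" using mult[of x "inverse x"] K_inverse x False by simp
  thus ?thesis by (metis inverse_unique)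
qed simp

lemma divide: "x \<in> K \<Longrightarrow> y \<in> K \<Longrightarrow> \<phi> (x / y) = \<phi> x / \<phi> y"
  by (simp add: divide_inverse mult K_inverse inverse)

lemma sum_le: "(\<And>i. i \<in> A \<Longrightarrow> f i \<in> K) \<Longrightarrow> \<phi> (sum f A) \<le> (\<Sum>i\<in>A. \<phi> (f i))"
proof (induction A rule: infinite_finite_induct)
  case (insert i A)
  have "\<phi> (f i + sum f A) \<le> \<phi> (f i) + \<phi> (sum f A)" using insert by (intro add K_sum) auto
  thus ?case using insert by force
qed auto

lemma prod_eq: "(\<And>i. i \<in> A \<Longrightarrow> f i \<in> K) \<Longrightarrow> \<phi> (prod f A) = (\<Prod>i\<in>A. \<phi> (f i))"
  by (induction A rule: infinite_finite_induct) (auto simp: mult K_prod)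

lemma of_nat_le: "\<phi> (of_nat n) \<le> real n"
proof (induction n)
  case (Suc n)
  thus ?case using add[OF K_one K_of_nat[of n]] by simp
qed simp

text \<open>Since an absolute value is bounded by \<open>n\<close> on \<open>n\<close>, the \<open>n + 1\<close> terms of a binomial
  expansion cost only a factor that disappears after extracting \<open>n\<close>-th roots.\<close>

lemma binomial_bound:
  assumes xy: "x \<in> K" "y \<in> K" and bound: "\<And>n k. k \<le> n \<Longrightarrow> \<phi> (of_nat (n choose k)) * \<phi> x ^ k * \<phi> y ^ (n - k) \<le> M ^ n"
    and M: "0 \<le> M"
  shows "\<phi> (x + y) \<le> M"
proof (rule power_linear_bound_imp_le[of _ _ 1 1])
  fix n :: nat
  have "\<phi> (x + y) ^ n = \<phi> (\<Sum>k\<le>n. of_nat (n choose k) * x ^ k * y ^ (n - k))"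
    using xy by (simp add: power[symmetric] K_add binomial_ring)
  also have "\<dots> \<le> (\<Sum>k\<le>n. \<phi> (of_nat (n choose k) * x ^ k * y ^ (n - k)))"
    using xy by (intro sum_le K_mult K_power K_of_nat)
  also have "\<dots> = (\<Sum>k\<le>n. \<phi> (of_nat (n choose k)) * \<phi> x ^ k * \<phi> y ^ (n - k))"
    using xy by (simp add: mult power K_mult K_power K_of_nat)
  also have "\<dots> \<le> (\<Sum>k\<le>n. M ^ n)" by (intro sum_mono bound) auto
  finally show "\<phi> (x + y) ^ n \<le> (1 * real n + 1) * M ^ n" by (simp add: algebra_simps)
qed (use xy M in \<open>auto intro: nonneg K_add\<close>)

text \<open>Bounded on the naturals means bounded on binomial coefficients, so each term of the
  expansion is at most the \<open>n\<close>-th power of the maximum.\<close>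

lemma ultrametric:
  assumes bd: "\<And>n. \<phi> (of_nat n) \<le> 1" and xy: "x \<in> K" "y \<in> K"
  shows "\<phi> (x + y) \<le> max (\<phi> x) (\<phi> y)"
proof (rule binomial_bound[OF xy])
  fix n k :: nat assume k: "k \<le> n"
  let ?M = "max (\<phi> x) (\<phi> y)"
  have "\<phi> (of_nat (n choose k)) * \<phi> x ^ k * \<phi> y ^ (n - k) \<le> 1 * ?M ^ k * ?M ^ (n - k)"
    using xy bd nonneg K_of_nat by (intro mult_mono power_mono mult_nonneg_nonneg zero_le_power) (auto simp: le_max_iff_disj)
  thus "\<phi> (of_nat (n choose k)) * \<phi> x ^ k * \<phi> y ^ (n - k) \<le> ?M ^ n"
    using k by (simp add: power_add[symmetric])
qed (use xy nonneg in \<open>auto simp: le_max_iff_disj\<close>)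

lemma ultrametric_sum:
  assumes bd: "\<And>n. \<phi> (of_nat n) \<le> 1" and A: "\<And>i. i \<in> A \<Longrightarrow> f i \<in> K" "\<And>i. i \<in> A \<Longrightarrow> \<phi> (f i) \<le> B" and B: "0 \<le> B"
  shows "\<phi> (sum f A) \<le> B"
  using A
proof (induction A rule: infinite_finite_induct)
  case (insert i A)
  have "\<phi> (f i + sum f A) \<le> max (\<phi> (f i)) (\<phi> (sum f A))" using insert by (intro ultrametric bd K_sum) auto
  also have "\<dots> \<le> B" using insert by simp
  finally show ?case using insert by simp
qed (use B in auto)

text \<open>For \<open>s < 1\<close> the exponent \<open>1 / s\<close> exceeds 1 and the triangle
  inequality is not automatic. The bound on natural numbers saves it: it compares the expansion of a
  power of \<open>x + y\<close> with the real expansion of \<open>(u + v) ^ n\<close>. This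
  normalises an arbitrary representative of a place.\<close>

lemma powr_subfield_abs:
  assumes s: "s > 0" and nat: "\<And>n. \<phi> (of_nat n) \<le> real n powr s"
  shows "subfield_abs K (\<lambda>x. \<phi> x powr (1 / s))"
proof
  fix x y assume x: "x \<in> K" and y: "y \<in> K"
  define u where "u = \<phi> x powr (1 / s)"
  define v where "v = \<phi> y powr (1 / s)"
  have uv: "u \<ge> 0" "v \<ge> 0" "\<phi> x = u powr s" "\<phi> y = v powr s"
    using s nonneg[OF x] nonneg[OF y] by (auto simp: u_def v_def powr_powr)
  have pw: "(Z powr s) ^ k = (Z ^ k) powr s" if "Z \<ge> 0" for Z :: real and k
    using that by (induction k) (auto simp: powr_mult)
  have "\<phi> (x + y) \<le> (u + v) powr s"
  proof (rule binomial_bound[OF x y])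
    fix n k :: nat assume k: "k \<le> n"
    have "\<phi> (of_nat (n choose k)) * \<phi> x ^ k * \<phi> y ^ (n - k)
       \<le> real (n choose k) powr s * (u ^ k) powr s * (v ^ (n - k)) powr s"
      using nat uv pw by (intro mult_mono) (auto intro: nonneg K_of_nat)
    also have "\<dots> = (real (n choose k) * u ^ k * v ^ (n - k)) powr s"
      using uv by (simp add: powr_mult)
    also have "\<dots> \<le> ((u + v) ^ n) powr s"
    proof (rule powr_mono2)
      have "real (n choose k) * u ^ k * v ^ (n - k) \<le> (\<Sum>k\<le>n. real (n choose k) * u ^ k * v ^ (n - k))"
        using uv k by (intro member_le_sum) auto
      thus "real (n choose k) * u ^ k * v ^ (n - k) \<le> (u + v) ^ n" by (simp add: binomial_ring)
    qed (use s uv in auto)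
    also have "\<dots> = ((u + v) powr s) ^ n" using pw uv by simp
    finally show "\<phi> (of_nat (n choose k)) * \<phi> x ^ k * \<phi> y ^ (n - k) \<le> ((u + v) powr s) ^ n" .
  qed simp
  hence "\<phi> (x + y) powr (1 / s) \<le> ((u + v) powr s) powr (1 / s)"
    using s nonneg[OF K_add[OF x y]] by (intro powr_mono2) auto
  also have "\<dots> = u + v" using s uv by (simp add: powr_powr)
  finally show "\<phi> (x + y) powr (1 / s) \<le> \<phi> x powr (1 / s) + \<phi> y powr (1 / s)" by (simp add: u_def v_def)
  show "\<phi> (x * y) powr (1 / s) = \<phi> x powr (1 / s) * \<phi> y powr (1 / s)"
    using x y nonneg by (simp add: mult powr_mult)
qed (auto simp: eq_0_iff intro: K_zero K_one K_add K_mult K_uminus K_inverse)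

end

section \<open>Ostrowski's theorem for the rational numbers\<close>

lemma (in subfield_abs) Ostrowski_digits:
  assumes n: "n \<ge> 2" and m: "m < n ^ j"
  shows "\<phi> (of_nat m) \<le> real j * real n * max 1 (\<phi> (of_nat n)) ^ j"
  using m
proof (induction j arbitrary: m)
  case (Suc j)
  define M where "M = max 1 (\<phi> (of_nat n))"
  have M: "M \<ge> 1" "\<phi> (of_nat n) \<le> M" by (auto simp: M_def)
  \<comment> \<open>The last digit of \<open>m\<close> in base \<open>n\<close> is split off; each
    of the \<open>j\<close> digits costs at most \<open>n\<close>, and each power of
    \<open>n\<close> at most \<open>M ^ j\<close>.\<close>
  have q: "m div n < n ^ j" using Suc.prems n by (simp add: less_mult_imp_div_less mult.commute)
  have "\<phi> (of_nat m) = \<phi> (of_nat n * of_nat (m div n) + of_nat (m mod n))"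
    by (metis mult_div_mod_eq of_nat_add of_nat_mult)
  also have "\<dots> \<le> \<phi> (of_nat n) * \<phi> (of_nat (m div n)) + \<phi> (of_nat (m mod n))"
    using add[of "of_nat n * of_nat (m div n)" "of_nat (m mod n)"] by (simp add: mult K_mult K_of_nat)
  also have "\<dots> \<le> M * (real j * real n * M ^ j) + real n"
  proof (intro add_mono mult_mono)
    show "\<phi> (of_nat (m div n)) \<le> real j * real n * M ^ j" using Suc.IH[OF q] by (simp add: M_def)
    have "\<phi> (of_nat (m mod n)) \<le> real (m mod n)" by (rule of_nat_le)
    also have "\<dots> \<le> real n" using n by (simp add: less_imp_le)
    finally show "\<phi> (of_nat (m mod n)) \<le> real n" .
  qed (use M in \<open>auto intro: nonneg K_of_nat\<close>)
  also have "\<dots> \<le> real j * real n * M ^ Suc j + real n * M ^ Suc j"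
    using mult_left_mono[OF one_le_power[OF M(1), of "Suc j"], of "real n"] by (simp add: mult_ac)
  finally show ?case by (simp add: algebra_simps M_def)
qed simp

text \<open>The digit estimate is applied to \<open>m ^ k\<close>, which has about
  \<open>k * log n m\<close> digits in base \<open>n\<close>; extracting \<open>k\<close>-th roots
  removes the linear factor.\<close>

lemma (in subfield_abs) Ostrowski_compare:
  assumes n: "n \<ge> 2" and m: "m \<ge> 1"
  shows "\<phi> (of_nat m) \<le> max 1 (\<phi> (of_nat n)) powr log n m"
proof (rule power_linear_bound_imp_le)
  define M where "M = max 1 (\<phi> (of_nat n))"
  define l where "l = log n m"
  have M: "M \<ge> 1" by (auto simp: M_def)
  have l: "l \<ge> 0" using n m by (simp add: l_def)
  fix k :: nat
  \<comment> \<open>One more than the integer part, which makes \<open>m ^ k < n ^ j\<close>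
    strict.\<close>
  define j where "j = nat \<lfloor>l * k\<rfloor> + 1"
  have j: "l * k < real j" "real j \<le> l * k + 1" using l by (auto simp: j_def) linarith+
  have "real (m ^ k) = real n powr (l * k)"
    using n m by (simp add: l_def powr_powr[symmetric] powr_realpow)
  also have "\<dots> < real n powr real j" using n j by simp
  also have "\<dots> = real (n ^ j)" using n by (simp add: powr_realpow)
  finally have "m ^ k < n ^ j" by linarith
  hence "\<phi> (of_nat (m ^ k)) \<le> real j * real n * M ^ j" using Ostrowski_digits[OF n] unfolding M_def by blast
  also have "M ^ j = M powr real j" using M by (simp add: powr_realpow)
  also have "real j * real n * M powr real j \<le> (l * k + 1) * real n * M powr (l * k + 1)"
    using j M l by (intro mult_mono powr_mono) auto
  also have "M powr (l * k + 1) = M * (M powr l) ^ k"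
    using M by (simp add: powr_add powr_powr[symmetric] powr_realpow)
  finally show "\<phi> (of_nat m) ^ k \<le> (l * n * M * real k + n * M) * (max 1 (\<phi> (of_nat n)) powr log n m) ^ k"
    by (simp add: power K_of_nat M_def l_def algebra_simps)
qed (auto intro: nonneg K_of_nat)

text \<open>No natural number from 2 on has value at most 1, since comparison would bound the value
  at \<open>n0\<close> by 1. Comparing \<open>m\<close> with \<open>n\<close> in both directions
  then makes \<open>ln (f (of_nat m)) / ln m\<close> a constant, which is the exponent
  \<open>s\<close>.\<close>

lemma Ostrowski_archimedean:
  fixes f :: "rat \<Rightarrow> real"
  assumes f: "subfield_abs UNIV f" and big: "f (of_nat n0) > 1"
  shows "\<exists>s>0. \<forall>x. f x = \<bar>real_of_rat x\<bar> powr s"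
proof -
  interpret f: subfield_abs UNIV f by (rule f)
  have n0: "n0 \<ge> 2"
  proof (rule ccontr)
    assume "\<not> ?thesis"
    hence "n0 = 0 \<or> n0 = 1" by auto
    thus False using big by auto
  qed
  have gt: "f (of_nat n) > 1" if n: "n \<ge> 2" for n
  proof (rule ccontr)
    assume "\<not> ?thesis"
    hence "f (of_nat n0) \<le> 1 powr log n n0" using f.Ostrowski_compare[OF n, of n0] n0 by simp
    thus False using big by simp
  qed
  define s where "s = ln (f (of_nat n0)) / ln n0"
  have le: "ln (f (of_nat m)) / ln m \<le> ln (f (of_nat n)) / ln n" if "m \<ge> 2" "n \<ge> 2" for m n
  proof -
    have "f (of_nat m) \<le> f (of_nat n) powr log n m"
      using f.Ostrowski_compare[of n m] gt[OF that(2)] that by simp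
    hence "ln (f (of_nat m)) \<le> log n m * ln (f (of_nat n))"
      using gt[OF that(1)] gt[OF that(2)] by (subst (asm) ln_le_cancel_iff[symmetric]) (auto simp: ln_powr)
    thus ?thesis using that by (simp add: log_def field_simps)
  qed
  have s: "s > 0" using big n0 by (simp add: s_def)
  have nat: "f (of_nat n) = real n powr s" for n
  proof -
    consider "n = 0" | "n = 1" | "n \<ge> 2" by linarith
    thus ?thesis
    proof cases
      case 3
      have "ln (f (of_nat n)) / ln n = s" using le[OF 3 n0] le[OF n0 3] by (simp add: s_def)
      hence "ln (f (of_nat n)) = s * ln n" using 3 by (auto simp: field_simps)
      hence "exp (ln (f (of_nat n))) = exp (s * ln n)" by simp
      thus ?thesis using gt[OF 3] 3 by (simp add: powr_def)
    qed auto
  qed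
  have int: "f (of_int n) = \<bar>of_int n\<bar> powr s" for n
    using nat by (cases n rule: int_cases2) auto
  have "f x = \<bar>real_of_rat x\<bar> powr s" for x
  proof -
    obtain a b where "quotient_of x = (a, b)" by force
    hence x: "x = of_int a / of_int b" by (rule quotient_of_div)
    thus ?thesis by (simp add: f.divide int of_rat_divide powr_divide)
  qed
  thus ?thesis using s by blast
qed

text \<open>\<open>padic_abs\<close> is defined through the reduced fraction; independence of the
  fraction is what makes products and common denominators accessible.\<close>

lemma padic_abs_fraction:
  assumes p: "Factorial_Ring.prime p" and ab: "a \<noteq> 0" "b \<noteq> 0"
  shows "padic_abs p (of_int a / of_int b) = real p powi (int (multiplicity (int p) b) - int (multiplicity (int p) a))"
proof -
  have pe: "prime_elem (int p)" using p by auto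
  obtain n d where nd: "quotient_of (of_int a / of_int b :: rat) = (n, d)" by force
  have d: "d > 0" using quotient_of_denom_pos[OF nd] .
  have "of_int a / of_int b = (of_int n / of_int d :: rat)" using quotient_of_div[OF nd] .
  hence "(of_int (a * d) :: rat) = of_int (n * b)" using ab d by (simp add: field_simps)
  hence eq: "a * d = n * b" using of_int_eq_iff by blast
  hence n: "n \<noteq> 0" using ab d by auto
  have "multiplicity (int p) a + multiplicity (int p) d = multiplicity (int p) n + multiplicity (int p) b"
    using arg_cong[OF eq, of "multiplicity (int p)"] pe ab d n by (simp add: prime_elem_multiplicity_mult_distrib)
  hence "int (multiplicity (int p) d) - int (multiplicity (int p) n) =
    int (multiplicity (int p) b) - int (multiplicity (int p) a)" by linarith
  thus ?thesis using ab by (simp add: padic_abs_def nd)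
qed

lemma rat_fraction:
  obtains a b where "b \<noteq> 0" "(x :: rat) = of_int a / of_int b"
proof -
  obtain a b where ab: "quotient_of x = (a, b)" by force
  show ?thesis using that[of b a] quotient_of_div[OF ab] quotient_of_denom_pos[OF ab] by simp
qed

lemma padic_abs_int_le: 
  assumes p: "Factorial_Ring.prime p"
  shows "padic_abs p (of_int a) \<le> 1"
proof (cases "a = 0")
  case False
  have p1: "real p \<ge> 1" using p prime_ge_1_nat by simp
  have "padic_abs p (of_int a / of_int 1) = real p powi (- int (multiplicity (int p) a))"
    using padic_abs_fraction[OF p False, of 1] by simp
  also have "\<dots> = inverse (real p ^ multiplicity (int p) a)" by (simp add: power_int_minus)
  also have "\<dots> \<le> 1" using p1 by (intro inverse_le_1_iff[THEN iffD2]) auto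
  finally show ?thesis by simp
qed (simp add: padic_abs_def)

lemma padic_subfield_abs:
  assumes p: "Factorial_Ring.prime p"
  shows "subfield_abs UNIV (padic_abs p)"
proof
  have p0: "real p > 0" and p1: "real p > 1" using p prime_gt_1_nat by (auto simp: prime_gt_0_nat)
  have pe: "prime_elem (int p)" using p by auto
  fix x y :: rat
  show "0 \<le> padic_abs p x" using p0 by (auto simp: padic_abs_def split: prod.splits)
  show "padic_abs p x = 0 \<longleftrightarrow> x = 0" using p0 by (auto simp: padic_abs_def split: prod.splits)
  show mult: "padic_abs p (x * y) = padic_abs p x * padic_abs p y" for x y
  proof (cases "x = 0 \<or> y = 0")
    case False
    obtain a b where ab: "b \<noteq> 0" "x = of_int a / of_int b" by (rule rat_fraction)
    obtain c d where cd: "d \<noteq> 0" "y = of_int c / of_int d" by (rule rat_fraction)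
    have nz: "a \<noteq> 0" "c \<noteq> 0" using ab cd False by auto
    have "padic_abs p (x * y) = padic_abs p (of_int (a * c) / of_int (b * d))" by (simp add: ab cd)
    also have "\<dots> = padic_abs p x * padic_abs p y"
      using padic_abs_fraction[OF p, of "a * c" "b * d"] padic_abs_fraction[OF p nz(1) ab(1)]
        padic_abs_fraction[OF p nz(2) cd(1)] nz ab cd pe p0
      by (simp add: prime_elem_multiplicity_mult_distrib power_int_add[symmetric] algebra_simps)
    finally show ?thesis .
  qed (auto simp: padic_abs_def)
  have int: "padic_abs p (of_int (a + c)) \<le> max (padic_abs p (of_int a)) (padic_abs p (of_int c))" for a c
  proof (cases "a = 0 \<or> c = 0 \<or> a + c = 0")
    case False
    have eq: "padic_abs p (of_int a) = inverse (real p ^ multiplicity (int p) a)" if "a \<noteq> 0" for a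
      using padic_abs_fraction[OF p that, of 1] by (simp add: power_int_minus)
    define m where "m = min (multiplicity (int p) a) (multiplicity (int p) c)"
    have "int p ^ m dvd a" "int p ^ m dvd c" by (auto simp: m_def intro: multiplicity_dvd')
    hence "int p ^ m dvd a + c" by simp
    hence "m \<le> multiplicity (int p) (a + c)"
      using False p by (intro multiplicity_geI) (auto simp: not_prime_unit)
    hence "real p ^ m \<le> real p ^ multiplicity (int p) (a + c)" using p1 by simp
    hence "padic_abs p (of_int (a + c)) \<le> inverse (real p ^ m)"
      using False eq[of "a + c"] p0 by (simp add: le_imp_inverse_le)
    also have "\<dots> \<le> max (padic_abs p (of_int a)) (padic_abs p (of_int c))"
      using eq[of a] eq[of c] False by (auto simp: m_def min_def)
    finally show ?thesis .
  next
    case True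
    have "0 \<le> padic_abs p z" for z using p0 by (auto simp: padic_abs_def split: prod.splits)
    thus ?thesis using True by (auto simp: padic_abs_def le_max_iff_disj simp flip: of_int_add)
  qed
  obtain a b where ab: "b \<noteq> 0" "x = of_int a / of_int b" by (rule rat_fraction)
  obtain c d where cd: "d \<noteq> 0" "y = of_int c / of_int d" by (rule rat_fraction)
  \<comment> \<open>Clearing denominators reduces the triangle inequality to the ultrametric
    inequality for integers.\<close>
  define q :: rat where "q = of_int (b * d)"
  have q: "q \<noteq> 0" using ab cd by (simp add: q_def)
  have xq: "x * q = of_int (a * d)" "y * q = of_int (c * b)" "(x + y) * q = of_int (a * d + c * b)"
    using ab cd by (simp_all add: q_def field_simps)
  have nn: "0 \<le> padic_abs p z" for z using p0 by (auto simp: padic_abs_def split: prod.splits)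
  have qp: "padic_abs p q > 0" using q p0 by (auto simp: padic_abs_def split: prod.splits)
  have "padic_abs p (x + y) * padic_abs p q \<le> max (padic_abs p x * padic_abs p q) (padic_abs p y * padic_abs p q)"
    using int[of "a * d" "c * b"] unfolding mult[symmetric] xq .
  also have "\<dots> \<le> (padic_abs p x + padic_abs p y) * padic_abs p q"
    using nn qp by (simp add: algebra_simps)
  finally show "padic_abs p (x + y) \<le> padic_abs p x + padic_abs p y" using qp by simp
qed (auto)

lemma abs_rat_subfield_abs: "subfield_abs UNIV (\<lambda>x. real_of_rat \<bar>x\<bar>)"
proof unfold_locales
  fix x y :: rat
  have "real_of_rat \<bar>x + y\<bar> \<le> real_of_rat (\<bar>x\<bar> + \<bar>y\<bar>)" unfolding of_rat_less_eq by (rule abs_triangle_ineq)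
  thus "real_of_rat \<bar>x + y\<bar> \<le> real_of_rat \<bar>x\<bar> + real_of_rat \<bar>y\<bar>" by (simp only: of_rat_add)
qed (auto simp: of_rat_mult abs_mult)

lemma usual_subfield_abs: "\<alpha> \<in> usual_abs_rat \<Longrightarrow> subfield_abs UNIV \<alpha>"
  unfolding usual_abs_rat_def using padic_subfield_abs abs_rat_subfield_abs by auto

lemma padic_abs_prime: "Factorial_Ring.prime p \<Longrightarrow> padic_abs p (of_nat p) = 1 / real p"
  using padic_abs_fraction[of p "int p" 1] prime_gt_0_nat[of p]
  by (simp add: power_int_minus inverse_eq_divide not_prime_unit multiplicity_prime)

lemma padic_abs_coprime:
  assumes p: "Factorial_Ring.prime p" and q: "Factorial_Ring.prime q" "p \<noteq> q"
  shows "padic_abs p (of_nat q) = 1"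
proof -
  have "multiplicity (int p) (int q) = 0"
    using primes_dvd_imp_eq[OF p q(1)] q(2) by (intro not_dvd_imp_multiplicity_0) auto
  thus ?thesis using padic_abs_fraction[OF p, of "int q" 1] q prime_gt_0_nat[of q] by simp
qed

lemma Ostrowski_nonarchimedean:
  fixes f :: "rat \<Rightarrow> real"
  assumes f: "subfield_abs UNIV f" and bd: "\<And>n. f (of_nat n) \<le> 1" and nt: "x0 \<noteq> 0" "f x0 \<noteq> 1"
  shows "\<exists>p s. Factorial_Ring.prime p \<and> s > 0 \<and> (\<forall>x. f x = padic_abs p x powr s)"
proof -
  interpret f: subfield_abs UNIV f by (rule f)
  have int_le: "f (of_int n) \<le> 1" for n unfolding f.of_int_eq by (rule bd)
  have ex: "\<exists>n>0. f (of_nat n) < 1"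
  proof (rule ccontr)
    assume "\<not> ?thesis"
    hence n1: "f (of_nat n) = 1" if "n > 0" for n using bd[of n] that by (meson antisym not_less)
    have i1: "f (of_int n) = 1" if "n \<noteq> 0" for n unfolding f.of_int_eq by (rule n1) (use that in simp)
    obtain a b where ab: "b \<noteq> 0" "x0 = of_int a / of_int b" by (rule rat_fraction)
    thus False using i1[of a] i1[of b] nt by (auto simp: f.divide)
  qed
  \<comment> \<open>The least positive number of value below 1 is prime: in a proper factorisation
    both factors would have value 1.\<close>
  define p where "p = (LEAST n. n > 0 \<and> f (of_nat n) < 1)"
  have p: "p > 0" "f (of_nat p) < 1" using LeastI_ex[OF ex] by (auto simp: p_def)
  have less: "f (of_nat n) = 1" if "n > 0" "n < p" for n
    using not_less_Least[of n "\<lambda>n. n > 0 \<and> f (of_nat n) < 1"] that bd[of n] unfolding p_def by linarith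
  have "p \<noteq> 1" using p by auto
  have prime: "Factorial_Ring.prime p" unfolding prime_nat_iff
  proof (intro conjI allI impI)
    show "1 < p" using p \<open>p \<noteq> 1\<close> by linarith
    fix m assume "m dvd p"
    then obtain k where k: "p = m * k" by blast
    show "m = 1 \<or> m = p"
    proof (rule ccontr)
      assume "\<not> ?thesis"
      hence "m < p" "k < p" "m > 0" "k > 0" using k p by auto
      hence "f (of_nat p) = 1" using less[of m] less[of k] by (simp add: k f.mult)
      thus False using p by simp
    qed
  qed
  have coprime: "f (of_int a) = 1" if a: "\<not> int p dvd a" for a
  proof (rule ccontr)
    assume "f (of_int a) \<noteq> 1"
    hence fa: "f (of_int a) < 1" using int_le[of a] by simp
    have "gcd a (int p) = 1" using a prime by (metis coprime_commute coprime_iff_gcd_eq_1 prime_imp_coprime prime_nat_int_transfer)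
    \<comment> \<open>By Bezout, 1 would be a sum of two terms of value below 1, against the
      ultrametric inequality.\<close>
    then obtain u v where "u * a + v * int p = 1" using bezout_int[of a "int p"] by auto
    hence "of_int (u * a + v * int p) = (1::rat)" by simp
    hence "1 = f (of_int u * of_int a + of_int v * of_nat p)" by simp
    also have "\<dots> \<le> max (f (of_int u * of_int a)) (f (of_int v * of_nat p))"
      by (rule f.ultrametric[OF bd]) auto
    also have "\<dots> < 1"
    proof -
      have lt: "f (of_int w) * y < 1" if "0 \<le> y" "y < 1" for w y
        using mult_right_mono[OF int_le[of w] that(1)] that by simp
      show ?thesis using lt[of "f (of_int a)" u] lt[of "f (of_nat p)" v] fa p f.nonneg by (simp add: f.mult)
    qed
    finally show False by simp
  qed
  \<comment> \<open>Normalised so that \<open>f (of_nat p) = real p powr (- s)\<close>, the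
    \<open>s\<close>-th power of the p-adic value \<open>1 / real p\<close>.\<close>
  define s where "s = - log p (f (of_nat p))"
  have p1: "real p > 1" using prime prime_gt_1_nat by simp
  have fp: "f (of_nat p) > 0" using f.pos[of "of_nat p"] p by simp
  have s: "s > 0" using p fp p1 by (simp add: s_def)
  have fps: "f (of_nat p) = real p powr (- s)" using p1 fp by (simp add: s_def)
  have int: "f (of_int a) = f (of_nat p) ^ multiplicity (int p) a" if a: "a \<noteq> 0" for a
  proof -
    obtain c where c: "a = int p ^ multiplicity (int p) a * c" "\<not> int p dvd c"
      using multiplicity_decompose'[of a "int p"] a prime_gt_1_nat[OF prime] by (auto simp: not_prime_unit)
    have "f (of_int a) = f (of_nat p ^ multiplicity (int p) a * of_int c)"
      by (subst c(1)) simp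
    thus ?thesis using coprime[OF c(2)] by (simp add: f.mult f.power)
  qed
  have pw: "f (of_nat p) ^ k = inverse ((real p ^ k) powr s)" for k
    unfolding fps using p1 by (simp add: powr_realpow[symmetric] powr_powr powr_minus[symmetric] mult.commute)
  have "f x = padic_abs p x powr s" for x
  proof (cases "x = 0")
    case False
    obtain a b where ab: "b \<noteq> 0" "x = of_int a / of_int b" by (rule rat_fraction)
    hence a: "a \<noteq> 0" using False by auto
    have "padic_abs p x = real p ^ multiplicity (int p) b / real p ^ multiplicity (int p) a"
      using padic_abs_fraction[OF prime a ab(1)] ab p1 by (simp add: power_int_diff)
    moreover have "f x = inverse ((real p ^ multiplicity (int p) a) powr s) / inverse ((real p ^ multiplicity (int p) b) powr s)"
      using int[OF a] int[OF ab(1)] by (simp add: ab(2) f.divide pw)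
    ultimately show ?thesis by (simp add: powr_divide field_simps)
  qed (use s in \<open>simp add: padic_abs_def\<close>)
  thus ?thesis using prime s by blast
qed

theorem Ostrowski:
  fixes f :: "rat \<Rightarrow> real"
  assumes f: "subfield_abs UNIV f" and nt: "x0 \<noteq> 0" "f x0 \<noteq> 1"
  shows "\<exists>\<alpha>\<in>usual_abs_rat. \<exists>s>0. \<forall>x. f x = \<alpha> x powr s"
proof (cases "\<forall>n. f (of_nat n) \<le> 1")
  case True
  thus ?thesis using Ostrowski_nonarchimedean[OF f _ nt] unfolding usual_abs_rat_def by blast
next
  case False
  then obtain n where "f (of_nat n) > 1" by (meson not_le)
  from Ostrowski_archimedean[OF f this] obtain s where "s > 0" "\<forall>x. f x = \<bar>real_of_rat x\<bar> powr s" by blast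
  moreover have "(\<lambda>x. real_of_rat \<bar>x\<bar>) \<in> usual_abs_rat" unfolding usual_abs_rat_def by blast
  ultimately show ?thesis by (intro bexI[of _ "\<lambda>x. real_of_rat \<bar>x\<bar>"]) auto
qed

text \<open>Such a rational number has one and the same value above 1 under every absolute value
  extending \<alpha>; it shows that these are nontrivial and serves as the common scale in weak
  approximation.\<close>

lemma usual_abs_rat_witness:
  assumes "\<alpha> \<in> usual_abs_rat"
  obtains b where "\<alpha> b > 1"
proof -
  consider "\<alpha> = (\<lambda>x. real_of_rat \<bar>x\<bar>)" | p where "Factorial_Ring.prime p" "\<alpha> = padic_abs p"
    using assms unfolding usual_abs_rat_def by blast
  thus ?thesis
  proof cases
    case (2 p)
    interpret subfield_abs UNIV \<alpha> using usual_subfield_abs[OF assms] .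
    have "\<alpha> (inverse (of_nat p)) = real p" using inverse[of "of_nat p"] 2 padic_abs_prime[of p] by simp
    thus ?thesis using that[of "inverse (of_nat p)"] 2 prime_gt_1_nat by simp
  qed (use that[of 2] in simp)
qed

text \<open>A prime \<open>p\<close> has ordinary value above 1, p-adic value below 1 and value 1 at
  the other primes, which tells the kinds apart; evaluating at 2 or at \<open>p\<close> then fixes
  the exponent. Hence a place has at most one normalised representative.\<close>

lemma usual_abs_rat_unique:
  assumes "\<alpha> \<in> usual_abs_rat" "\<beta> \<in> usual_abs_rat" and s: "s > 0" "\<And>x. \<beta> x = \<alpha> x powr s"
  shows "\<beta> = \<alpha> \<and> s = 1"
proof -
  have np: "\<not> (\<exists>p t. Factorial_Ring.prime p \<and> t > 0 \<and> (\<forall>x. real_of_rat \<bar>x\<bar> powr t = padic_abs p x))"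
  proof
    assume "\<exists>p t. Factorial_Ring.prime p \<and> t > 0 \<and> (\<forall>x. real_of_rat \<bar>x\<bar> powr t = padic_abs p x)"
    then obtain p t where p: "Factorial_Ring.prime p" "t > 0" "real_of_rat \<bar>of_nat p\<bar> powr t = padic_abs p (of_nat p)" by blast
    have "real p powr t = 1 / real p" using p padic_abs_prime by simp
    moreover have "real p powr t > 1" using p(1,2) prime_gt_1_nat[of p] by simp
    moreover have "1 / real p < 1" using p(1) prime_gt_1_nat[of p] by simp
    ultimately show False by linarith
  qed
  have inv: "\<alpha> x = \<beta> x powr (1 / s)" for x
    using s(1) s(2)[of x] subfield_abs.nonneg[OF usual_subfield_abs[OF assms(1)], of x] by (simp add: powr_powr)
  consider "\<alpha> = (\<lambda>x. real_of_rat \<bar>x\<bar>)" "\<beta> = (\<lambda>x. real_of_rat \<bar>x\<bar>)"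
    | p q where "Factorial_Ring.prime p" "\<alpha> = padic_abs p" "Factorial_Ring.prime q" "\<beta> = padic_abs q"
  proof -
    let ?i = "\<lambda>x. real_of_rat \<bar>x\<bar>"
    have cases: "\<gamma> = ?i \<or> (\<exists>p. Factorial_Ring.prime p \<and> \<gamma> = padic_abs p)" if "\<gamma> \<in> usual_abs_rat" for \<gamma>
      using that unfolding usual_abs_rat_def by blast
    have "\<not> (\<alpha> = ?i \<and> \<beta> = padic_abs q)" if "Factorial_Ring.prime q" for q
    proof
      assume "\<alpha> = ?i \<and> \<beta> = padic_abs q"
      hence "\<forall>x. real_of_rat \<bar>x\<bar> powr s = padic_abs q x" using s(2) by metis
      thus False using np s(1) that by blast
    qed
    moreover have "\<not> (\<beta> = ?i \<and> \<alpha> = padic_abs q)" if "Factorial_Ring.prime q" for q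
    proof
      assume "\<beta> = ?i \<and> \<alpha> = padic_abs q"
      hence "\<forall>x. real_of_rat \<bar>x\<bar> powr (1 / s) = padic_abs q x" using inv by metis
      moreover have "1 / s > 0" using s(1) by simp
      ultimately show False using np that by blast
    qed
    ultimately show ?thesis using cases[OF assms(1)] cases[OF assms(2)] that by metis
  qed
  thus ?thesis
  proof cases
    case 1
    have "real 2 powr s = real 2 powr 1" using s(2)[of 2] 1 by simp
    hence "s = 1" by (subst (asm) powr_inj) auto
    thus ?thesis using 1 by simp
  next
    case (2 p q)
    have "p = q"
    proof (rule ccontr)
      assume "p \<noteq> q"
      hence "padic_abs q (of_nat q) = 1" using s(2)[of "of_nat q"] 2 padic_abs_coprime[of p q] by simp
      thus False using 2 padic_abs_prime[of q] prime_gt_1_nat[of q] by simp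
    qed
    hence "(1 / real p) powr s = 1 / real p" using s(2)[of "of_nat p"] 2 padic_abs_prime[of p] by simp
    hence "real p powr s = real p powr 1" using prime_gt_1_nat[of p] 2 by (simp add: powr_divide)
    hence "s = 1" using prime_gt_1_nat[of p] 2 by (subst (asm) powr_inj) auto
    thus ?thesis using 2 \<open>p = q\<close> by simp
  qed
qed

section \<open>The product formula over the rationals\<close>

lemma rat_product_formula:
  assumes x: "x \<noteq> 0"
  shows "finite {\<alpha> \<in> usual_abs_rat. \<alpha> x \<noteq> 1} \<and> (\<Prod>\<alpha>\<in>{\<alpha> \<in> usual_abs_rat. \<alpha> x \<noteq> 1}. \<alpha> x) = 1"
proof -
  define P where "P = (\<lambda>x. finite {\<alpha> \<in> usual_abs_rat. \<alpha> x \<noteq> 1} \<and> (\<Prod>\<alpha>\<in>{\<alpha> \<in> usual_abs_rat. \<alpha> x \<noteq> 1}. \<alpha> x) = 1)"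
  \<comment> \<open>A finite superset \<open>A\<close> in place of the exact support lets two
    supports be merged when \<open>P\<close> is shown to be multiplicative.\<close>
  have sup: "P x \<longleftrightarrow> (\<exists>A. finite A \<and> A \<subseteq> usual_abs_rat \<and> (\<forall>\<alpha>\<in>usual_abs_rat - A. \<alpha> x = 1) \<and> (\<Prod>\<alpha>\<in>A. \<alpha> x) = 1)" for x
  proof
    assume "\<exists>A. finite A \<and> A \<subseteq> usual_abs_rat \<and> (\<forall>\<alpha>\<in>usual_abs_rat - A. \<alpha> x = 1) \<and> (\<Prod>\<alpha>\<in>A. \<alpha> x) = 1"
    then obtain A where A: "finite A" "A \<subseteq> usual_abs_rat" "\<forall>\<alpha>\<in>usual_abs_rat - A. \<alpha> x = 1" "(\<Prod>\<alpha>\<in>A. \<alpha> x) = 1" by blast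
    have sub: "{\<alpha> \<in> usual_abs_rat. \<alpha> x \<noteq> 1} \<subseteq> A" using A by blast
    have "(\<Prod>\<alpha>\<in>{\<alpha> \<in> usual_abs_rat. \<alpha> x \<noteq> 1}. \<alpha> x) = (\<Prod>\<alpha>\<in>A. \<alpha> x)"
      using A sub by (intro prod.mono_neutral_left) auto
    thus "P x" using A finite_subset[OF sub] by (simp add: P_def)
  qed (unfold P_def, rule exI[of _ "{\<alpha> \<in> usual_abs_rat. \<alpha> x \<noteq> 1}"], auto)
  have mult: "P (x * y)" if Px: "P x" and Py: "P y" for x y
  proof -
    obtain A where A: "finite A" "A \<subseteq> usual_abs_rat" "\<forall>\<alpha>\<in>usual_abs_rat - A. \<alpha> x = 1" "(\<Prod>\<alpha>\<in>A. \<alpha> x) = 1" using Px unfolding sup by blast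
    obtain B where B: "finite B" "B \<subseteq> usual_abs_rat" "\<forall>\<alpha>\<in>usual_abs_rat - B. \<alpha> y = 1" "(\<Prod>\<alpha>\<in>B. \<alpha> y) = 1" using Py unfolding sup by blast
    have m: "\<alpha> (x * y) = \<alpha> x * \<alpha> y" if "\<alpha> \<in> usual_abs_rat" for \<alpha>
      using subfield_abs.mult[OF usual_subfield_abs[OF that]] by simp
    have "(\<Prod>\<alpha>\<in>A \<union> B. \<alpha> x) = (\<Prod>\<alpha>\<in>A. \<alpha> x)" "(\<Prod>\<alpha>\<in>A \<union> B. \<alpha> y) = (\<Prod>\<alpha>\<in>B. \<alpha> y)"
      using A B by (intro prod.mono_neutral_right; force)+
    moreover have "(\<Prod>\<alpha>\<in>A \<union> B. \<alpha> (x * y)) = (\<Prod>\<alpha>\<in>A \<union> B. \<alpha> x) * (\<Prod>\<alpha>\<in>A \<union> B. \<alpha> y)"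
      unfolding prod.distrib[symmetric] using A B m by (intro prod.cong) auto
    ultimately have "(\<Prod>\<alpha>\<in>A \<union> B. \<alpha> (x * y)) = 1" using A B by simp
    moreover have "\<forall>\<alpha>\<in>usual_abs_rat - (A \<union> B). \<alpha> (x * y) = 1" using A(3) B(3) m by (metis Diff_iff Un_iff mult_1)
    ultimately show ?thesis unfolding sup using A B by (intro exI[of _ "A \<union> B"]) auto
  qed
  have one: "P 1" unfolding sup
    by (intro exI[of _ "{}"]) (auto simp: subfield_abs.one[OF usual_subfield_abs])
  have prime: "P (of_nat q)" if q: "Factorial_Ring.prime q" for q
  proof -
    let ?i = "\<lambda>x. real_of_rat \<bar>x\<bar>"
    have ne: "?i \<noteq> padic_abs q"
    proof
      assume "?i = padic_abs q"
      from fun_cong[OF this, of "of_nat q"] have "real q = 1 / real q" using padic_abs_prime[OF q] by simp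
      moreover have "1 / real q < 1" "1 < real q" using prime_gt_1_nat[OF q] by simp_all
      ultimately show False by linarith
    qed
    \<comment> \<open>At a prime \<open>q\<close> only the ordinary and the q-adic absolute value
      differ from 1, with values \<open>q\<close> and \<open>1 / q\<close>.\<close>
    show ?thesis unfolding sup
      using q ne padic_abs_prime[OF q] prime_gt_0_nat[OF q] padic_abs_coprime[OF _ q]
      by (intro exI[of _ "{?i, padic_abs q}"]) (auto simp: usual_abs_rat_def)
  qed
  have nat: "P (of_nat n)" if "n > 0" for n
    using that
  proof (induction n rule: prime_divisors_induct)
    case (factor p n)
    thus ?case using mult[OF prime[of p], of "of_nat n"] by simp
  qed (use one in auto)
  have inv: "P (inverse x)" if Px: "P x" for x
  proof -
    obtain A where A: "finite A" "A \<subseteq> usual_abs_rat" "\<forall>\<alpha>\<in>usual_abs_rat - A. \<alpha> x = 1" "(\<Prod>\<alpha>\<in>A. \<alpha> x) = 1" using Px unfolding sup by blast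
    have m: "\<alpha> (inverse x) = inverse (\<alpha> x)" if "\<alpha> \<in> usual_abs_rat" for \<alpha>
      using subfield_abs.inverse[OF usual_subfield_abs[OF that]] by simp
    have "(\<Prod>\<alpha>\<in>A. \<alpha> (inverse x)) = (\<Prod>\<alpha>\<in>A. inverse (\<alpha> x))" using A m by (intro prod.cong) auto
    also have "\<dots> = inverse (\<Prod>\<alpha>\<in>A. \<alpha> x)" using prod_inversef[of "\<lambda>\<alpha>. \<alpha> x" A] by (simp add: o_def)
    finally have "(\<Prod>\<alpha>\<in>A. \<alpha> (inverse x)) = 1" using A(4) by simp
    moreover have "\<forall>\<alpha>\<in>usual_abs_rat - A. \<alpha> (inverse x) = 1" using A(3) m by (metis Diff_iff inverse_1)
    ultimately show ?thesis unfolding sup using A(1,2) by (intro exI[of _ A]) simp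
  qed
  have "\<alpha> (- 1) = 1" if "\<alpha> \<in> usual_abs_rat" for \<alpha>
    using subfield_abs.uminus[OF usual_subfield_abs[OF that], of 1]
      subfield_abs.one[OF usual_subfield_abs[OF that]] by simp
  hence "P (- 1)" unfolding sup by (intro exI[of _ "{}"]) simp
  hence um: "P (- x)" if "P x" for x using mult[of "- 1" x] that by simp
  have int: "P (of_int a)" if "a \<noteq> 0" for a
    using nat um that by (cases a rule: int_cases2) auto
  obtain a b where ab: "b \<noteq> 0" "x = of_int a / of_int b" by (rule rat_fraction)
  hence "P (of_int a * inverse (of_int b))" using x by (intro mult int inv) auto
  hence "P x" using ab by (simp add: divide_inverse)
  thus ?thesis by (simp add: P_def)
qed

section \<open>Minimal polynomials and primitive elements\<close>

abbreviation (input) "pcoeff \<equiv> Polynomial.coeff"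
abbreviation (input) "pdeg \<equiv> Polynomial.degree"

definition poly_over :: "'a::field_char_0 set \<Rightarrow> 'a poly \<Rightarrow> bool" where
  "poly_over K p \<longleftrightarrow> (\<forall>i. pcoeff p i \<in> K)"

lemma poly_over_mono: "poly_over K p \<Longrightarrow> K \<subseteq> K' \<Longrightarrow> poly_over K' p"
  unfolding poly_over_def by blast

context subfield_set begin

lemma poly_over_0 [simp]: "poly_over K 0" and poly_over_1 [simp]: "poly_over K 1"
  unfolding poly_over_def by (auto simp: K_zero K_one Polynomial.coeff_1)

lemma poly_over_pCons [simp]: "poly_over K (pCons a p) \<longleftrightarrow> a \<in> K \<and> poly_over K p"
proof
  assume *: "poly_over K (pCons a p)"
  have "pcoeff (pCons a p) 0 \<in> K" "pcoeff (pCons a p) (Suc i) \<in> K" for i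
    using * unfolding poly_over_def by blast+
  thus "a \<in> K \<and> poly_over K p" unfolding poly_over_def by simp
next
  assume "a \<in> K \<and> poly_over K p"
  thus "poly_over K (pCons a p)" unfolding poly_over_def by (auto simp: coeff_pCons split: nat.split)
qed

lemma poly_over_add: "poly_over K p \<Longrightarrow> poly_over K q \<Longrightarrow> poly_over K (p + q)"
  and poly_over_diff: "poly_over K p \<Longrightarrow> poly_over K q \<Longrightarrow> poly_over K (p - q)"
  and poly_over_smult: "c \<in> K \<Longrightarrow> poly_over K p \<Longrightarrow> poly_over K (Polynomial.smult c p)"
  unfolding poly_over_def by (auto intro: K_add K_diff K_mult)

lemma poly_over_mult: "poly_over K p \<Longrightarrow> poly_over K q \<Longrightarrow> poly_over K (p * q)"
  unfolding poly_over_def coeff_mult by (auto intro!: K_sum K_mult)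

lemma poly_over_pderiv: "poly_over K p \<Longrightarrow> poly_over K (pderiv p)"
  unfolding poly_over_def coeff_pderiv by (auto intro!: K_mult K_of_nat simp del: of_nat_Suc)

lemma poly_over_pcompose: "poly_over K p \<Longrightarrow> poly_over K q \<Longrightarrow> poly_over K (pcompose p q)"
  by (induction p) (auto simp: pcompose_pCons poly_over_add poly_over_mult)

lemma poly_closed: "poly_over K p \<Longrightarrow> x \<in> K \<Longrightarrow> poly p x \<in> K"
  by (induction p) (auto intro: K_add K_mult K_zero)

text \<open>Long division in the manner of Horner's scheme. The remainder is restricted through its
  coefficients because the zero polynomial has degree 0, which would spoil a strict degree bound for
  constant \<open>m\<close>.\<close>

lemma poly_over_division:
  assumes m: "poly_over K m" "Polynomial.lead_coeff m = 1" and p: "poly_over K p"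
  shows "\<exists>q r. p = m * q + r \<and> poly_over K q \<and> poly_over K r \<and> (\<forall>i\<ge>pdeg m. pcoeff r i = 0)"
  using p
proof (induction p)
  case 0
  thus ?case by (intro exI[of _ 0]) simp
next
  case (pCons a p)
  then obtain q r where qr: "p = m * q + r" "poly_over K q" "poly_over K r" "\<forall>i\<ge>pdeg m. pcoeff r i = 0" by auto
  define r' where "r' = pCons a r"
  define c where "c = pcoeff r' (pdeg m)"
  have r': "poly_over K r'" using pCons qr by (simp add: r'_def)
  hence c: "c \<in> K" by (simp add: c_def poly_over_def)
  have "pCons a p = m * (pCons 0 q) + r'" by (simp add: r'_def qr(1))
  also have "\<dots> = m * (pCons 0 q + [:c:]) + (r' - Polynomial.smult c m)" by (simp add: algebra_simps)
  finally have "pCons a p = m * (pCons 0 q + [:c:]) + (r' - Polynomial.smult c m)" .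
  moreover have "pcoeff (r' - Polynomial.smult c m) i = 0" if "i \<ge> pdeg m" for i
  proof (cases "i = pdeg m")
    case False
    hence i: "i > pdeg m" using that by simp
    then obtain j where j: "i = Suc j" by (cases i) auto
    thus ?thesis using i qr(4) by (simp add: r'_def coeff_eq_0)
  qed (use m in \<open>simp add: c_def\<close>)
  moreover have "poly_over K (pCons 0 q + [:c:])" "poly_over K (r' - Polynomial.smult c m)"
    using qr(2) c r' m(1) by (simp_all add: poly_over_add poly_over_diff poly_over_smult K_zero)
  ultimately show ?case by metis
qed

definition is_min_poly :: "'a \<Rightarrow> 'a poly \<Rightarrow> bool" where
  "is_min_poly x \<mu> \<longleftrightarrow> poly_over K \<mu> \<and> Polynomial.lead_coeff \<mu> = 1 \<and> poly \<mu> x = 0 \<and>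
     (\<forall>p. poly_over K p \<and> poly p x = 0 \<longrightarrow> (\<exists>q. poly_over K q \<and> p = \<mu> * q))"

lemma min_poly_exists:
  assumes p: "poly_over K p" "p \<noteq> 0" "poly p x = 0"
  shows "\<exists>\<mu>. is_min_poly x \<mu>"
proof -
  define P where "P = (\<lambda>n. \<exists>p. poly_over K p \<and> p \<noteq> 0 \<and> poly p x = 0 \<and> pdeg p = n)"
  have P: "P (pdeg q)" if "poly_over K q" "q \<noteq> 0" "poly q x = 0" for q
    unfolding P_def using that by blast
  have "P (LEAST n. P n)" by (rule LeastI[of P, OF P[OF p]])
  then obtain m where m: "poly_over K m" "m \<noteq> 0" "poly m x = 0" "pdeg m = (LEAST n. P n)" unfolding P_def by blast
  have least: "pdeg m \<le> pdeg q" if "poly_over K q" "q \<noteq> 0" "poly q x = 0" for q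
    unfolding m(4) by (rule Least_le[of P, OF P[OF that]])
  define \<mu> where "\<mu> = Polynomial.smult (inverse (Polynomial.lead_coeff m)) m"
  have lc: "Polynomial.lead_coeff m \<noteq> 0" "Polynomial.lead_coeff m \<in> K"
    using m(1,2) by (simp_all add: poly_over_def leading_coeff_0_iff)
  have mu: "poly_over K \<mu>" "Polynomial.lead_coeff \<mu> = 1" "poly \<mu> x = 0" "pdeg \<mu> = pdeg m"
    unfolding \<mu>_def using m(1,3) lc(1) poly_over_smult[OF K_inverse[OF lc(2)] m(1)]
    by simp_all
  have "\<exists>q. poly_over K q \<and> p = \<mu> * q" if p: "poly_over K p" "poly p x = 0" for p
  proof -
    obtain q r where qr: "p = \<mu> * q + r" "poly_over K q" "poly_over K r" "\<forall>i\<ge>pdeg \<mu>. pcoeff r i = 0"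
      using poly_over_division[OF mu(1,2) p(1)] by blast
    have "poly r x = 0" using p mu by (simp add: qr(1))
    have "r = 0"
    proof (rule ccontr)
      assume "r \<noteq> 0"
      hence "pdeg m \<le> pdeg r" using least qr(3) \<open>poly r x = 0\<close> by blast
      hence "Polynomial.lead_coeff r = 0" using qr(4) mu(4) by simp
      thus False using \<open>r \<noteq> 0\<close> by simp
    qed
    thus ?thesis using qr by auto
  qed
  thus ?thesis using mu unfolding is_min_poly_def by blast
qed

lemma min_polyD:
  assumes "is_min_poly x \<mu>"
  shows "poly_over K \<mu>" "Polynomial.lead_coeff \<mu> = 1" "poly \<mu> x = 0" "\<mu> \<noteq> 0" "pdeg \<mu> > 0"
    "\<And>p. poly_over K p \<Longrightarrow> poly p x = 0 \<Longrightarrow> \<exists>q. poly_over K q \<and> p = \<mu> * q"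
proof -
  show m: "poly_over K \<mu>" "Polynomial.lead_coeff \<mu> = 1" "poly \<mu> x = 0" using assms by (auto simp: is_min_poly_def)
  show "\<mu> \<noteq> 0" using m by auto
  show "pdeg \<mu> > 0"
  proof (rule ccontr)
    assume "\<not> ?thesis"
    hence d: "pdeg \<mu> = 0" by simp
    then obtain a where "\<mu> = [:a:]" by (rule degree_eq_zeroE)
    thus False using m by simp
  qed
qed (use assms in \<open>auto simp: is_min_poly_def\<close>)

lemma min_poly_degree_less:
  assumes "is_min_poly x \<mu>" "poly_over K p" "poly p x = 0" "pdeg p < pdeg \<mu>"
  shows "p = 0"
proof (rule ccontr)
  assume "p \<noteq> 0"
  obtain q where q: "p = \<mu> * q" using min_polyD(6)[OF assms(1-3)] by blast
  hence "q \<noteq> 0" using \<open>p \<noteq> 0\<close> by auto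
  hence "pdeg p = pdeg \<mu> + pdeg q" using q min_polyD(4)[OF assms(1)] by (simp add: degree_mult_eq)
  thus False using assms(4) by simp
qed

text \<open>Irreducibility in disguise: the cofactor of \<nu> in \<mu> has too small a degree to
  vanish at \<open>x\<close>, so \<nu> vanishes there and the degrees agree.\<close>

lemma min_poly_of_root:
  assumes "is_min_poly x \<mu>" "poly \<mu> z = 0"
  shows "is_min_poly z \<mu>"
proof -
  note m = min_polyD[OF assms(1)]
  obtain \<nu> where nu: "is_min_poly z \<nu>" using min_poly_exists[OF m(1,4) assms(2)] by blast
  note n = min_polyD[OF nu]
  obtain q where q: "poly_over K q" "\<mu> = \<nu> * q" using n(6)[OF m(1) assms(2)] by blast
  have q0: "q \<noteq> 0" using q m(4) by auto
  have deg: "pdeg \<mu> = pdeg \<nu> + pdeg q" using q q0 n(4) by (simp add: degree_mult_eq)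
  have "Polynomial.lead_coeff \<mu> = Polynomial.lead_coeff \<nu> * Polynomial.lead_coeff q" by (simp add: q Polynomial.lead_coeff_mult)
  hence lq: "Polynomial.lead_coeff q = 1" using m(2) n(2) by simp
  have "poly q x \<noteq> 0" using min_poly_degree_less[OF assms(1) q(1)] q0 deg n(5) by auto
  hence "poly \<nu> x = 0" using m(3) q by simp
  hence "pdeg \<mu> \<le> pdeg \<nu>" using min_poly_degree_less[OF assms(1) n(1)] n(4) by force
  hence "pdeg q = 0" using deg by simp
  then obtain a where "q = [:a:]" by (rule degree_eq_zeroE)
  hence "q = 1" using lq by (simp add: one_pCons)
  thus ?thesis using nu q by simp
qed

text \<open>A multiple root would have \<mu> as its minimal polynomial and be a root of the
  derivative, which has smaller degree and is nonzero in characteristic 0.\<close>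

lemma min_poly_rsquarefree:
  assumes "is_min_poly x \<mu>"
  shows "rsquarefree \<mu>"
  unfolding rsquarefree_roots
proof (intro allI notI)
  fix z assume z: "poly \<mu> z = 0 \<and> poly (pderiv \<mu>) z = 0"
  note m = min_polyD[OF assms]
  have "is_min_poly z \<mu>" using min_poly_of_root[OF assms] z by blast
  moreover have "pdeg (pderiv \<mu>) < pdeg \<mu>" using m(5) by (simp add: degree_pderiv)
  ultimately have "pderiv \<mu> = 0" using min_poly_degree_less poly_over_pderiv[OF m(1)] z by blast
  thus False using m(5) by (simp add: pderiv_eq_0_iff)
qed

text \<open>The minimal polynomial is read as \<open>c + x * poly h x = 0\<close>, where
  \<open>c\<close> is nonzero because \<open>h\<close> has too small a degree to vanish at
  \<open>x\<close>.\<close>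

lemma min_poly_inverse:
  assumes "is_min_poly x \<mu>" "x \<noteq> 0"
  shows "\<exists>h. poly_over K h \<and> inverse x = poly h x"
proof -
  note m = min_polyD[OF assms(1)]
  obtain c h where ch: "\<mu> = pCons c h" by (rule pCons_cases)
  have h: "poly_over K h" "c \<in> K" using m(1) ch by auto
  have deg: "pdeg h < pdeg \<mu>"
  proof -
    have "h \<noteq> 0" using m(5) ch by auto
    thus ?thesis using ch by simp
  qed
  have hx: "c + x * poly h x = 0" using m(3) ch by simp
  have "c \<noteq> 0"
  proof
    assume "c = 0"
    hence "poly h x = 0" using hx assms by simp
    hence "h = 0" using min_poly_degree_less[OF assms(1) h(1) _ deg] by simp
    thus False using m(5) ch by simp
  qed
  hence "inverse x = poly (Polynomial.smult (- inverse c) h) x" using hx assms(2) by (simp add: field_simps add_eq_0_iff)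
  moreover have "poly_over K (Polynomial.smult (- inverse c) h)" using h by (intro poly_over_smult K_uminus K_inverse)
  ultimately show ?thesis by blast
qed

definition adjoin :: "'a \<Rightarrow> 'a set" where
  "adjoin x = {poly p x |p. poly_over K p}"

lemma adjoin_base: "K \<subseteq> adjoin x"
proof
  fix c assume "c \<in> K"
  hence "c = poly [:c:] x" "poly_over K [:c:]" by auto
  thus "c \<in> adjoin x" unfolding adjoin_def by blast
qed

lemma adjoin_self: "x \<in> adjoin x"
proof -
  have "x = poly [:0, 1:] x" "poly_over K [:0, 1:]" by (auto simp: K_zero K_one)
  thus ?thesis unfolding adjoin_def by blast
qed

text \<open>The inverse of an element is a polynomial in that element, by its own minimal
  polynomial; hence algebraicity is assumed of every element of \<open>adjoin x\<close>.\<close>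

lemma adjoin_subfield:
  assumes alg: "\<And>y. y \<in> adjoin x \<Longrightarrow> \<exists>\<mu>. is_min_poly y \<mu>"
  shows "subfield_set (adjoin x)"
proof
  show "0 \<in> adjoin x" "1 \<in> adjoin x" using adjoin_base K_zero K_one by auto
  fix y assume y: "y \<in> adjoin x"
  then obtain p where p: "y = poly p x" "poly_over K p" unfolding adjoin_def by blast
  have "- y = poly (0 - p) x" "poly_over K (0 - p)" using p by (auto intro!: poly_over_diff simp del: diff_0)
  thus "- y \<in> adjoin x" unfolding adjoin_def by blast
  show "inverse y \<in> adjoin x"
  proof (cases "y = 0")
    case True thus ?thesis using y by simp
  next
    case False
    obtain \<mu> where "is_min_poly y \<mu>" using alg[OF y] by blast
    then obtain h where "poly_over K h" "inverse y = poly h y" using min_poly_inverse False by blast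
    hence "inverse y = poly (pcompose h p) x" "poly_over K (pcompose h p)"
      using p by (auto simp: poly_pcompose intro: poly_over_pcompose)
    thus ?thesis unfolding adjoin_def by blast
  qed
  fix z assume "z \<in> adjoin x"
  then obtain q where q: "z = poly q x" "poly_over K q" unfolding adjoin_def by blast
  have "y + z = poly (p + q) x" "poly_over K (p + q)" "y * z = poly (p * q) x" "poly_over K (p * q)"
    using p q by (auto intro: poly_over_add poly_over_mult)
  thus "y + z \<in> adjoin x" "y * z \<in> adjoin x" unfolding adjoin_def by blast+
qed

end

section \<open>Primitive elements\<close>

lemma rsquarefree_roots_card:
  fixes \<mu> :: "complex poly"
  assumes "rsquarefree \<mu>" "Polynomial.lead_coeff \<mu> = 1"
  shows "\<mu> = (\<Prod>z\<in>{z. poly \<mu> z = 0}. [:- z, 1:])" "finite {z. poly \<mu> z = 0}" "card {z. poly \<mu> z = 0} = pdeg \<mu>"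
proof -
  have "\<mu> \<noteq> 0" using assms(2) by auto
  thus fin: "finite {z. poly \<mu> z = 0}" by (rule poly_roots_finite)
  show eq: "\<mu> = (\<Prod>z\<in>{z. poly \<mu> z = 0}. [:- z, 1:])"
    using complex_poly_decompose_rsquarefree[OF assms(1)] assms(2) by simp
  have "pdeg (\<Prod>z\<in>{z. poly \<mu> z = 0}. [:- z, 1:]) = card {z. poly \<mu> z = 0}"
    by (simp add: degree_prod_eq_sum_degree)
  thus "card {z. poly \<mu> z = 0} = pdeg \<mu>" using eq by simp
qed

text \<open>In place of the usual gcd of \<open>g\<close> and \<open>pcompose f [:c, - t:]\<close>
  stands the minimal polynomial \<nu> of \<open>b\<close> over \<open>B.adjoin c\<close>: it divides
  both, so \<open>b\<close> is its only root, and being squarefree it is linear. Its constant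
  coefficient puts \<open>b\<close> into \<open>B.adjoin c\<close>.\<close>

lemma primitive_pair:
  fixes K :: "complex set"
  assumes K: "subfield_set K" and B: "subfield_set B" "B \<subseteq> K"
    and alg: "\<And>y. y \<in> K \<Longrightarrow> \<exists>\<mu>. subfield_set.is_min_poly B y \<mu>" and ab: "a \<in> K" "b \<in> K"
  shows "\<exists>c\<in>K. a \<in> subfield_set.adjoin B c \<and> b \<in> subfield_set.adjoin B c"
proof -
  interpret K: subfield_set K by (rule K)
  interpret B: subfield_set B by (rule B(1))
  obtain f where f: "B.is_min_poly a f" using alg ab by blast
  obtain g where g: "B.is_min_poly b g" using alg ab by blast
  note fD = B.min_polyD[OF f] and gD = B.min_polyD[OF g]
  \<comment> \<open>The values of \<open>t\<close> for which another pair of roots satisfies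
    \<open>u + t * v = a + t * b\<close>. Pairs with \<open>v = b\<close> contribute 0, the value of
    a division by zero.\<close>
  define Z where "Z = (\<lambda>(u, v). (u - a) / (b - v)) ` ({z. poly f z = 0} \<times> {z. poly g z = 0})"
  have "finite Z" unfolding Z_def using poly_roots_finite[OF fD(4)] poly_roots_finite[OF gD(4)] by simp
  moreover have "infinite (range (of_nat :: nat \<Rightarrow> complex))" using infinite_UNIV_char_0 by (simp add: finite_image_iff)
  ultimately obtain n :: nat where n: "of_nat n \<notin> Z" by (meson finite_subset image_subsetI)
  define t :: complex where "t = of_nat n"
  define c where "c = a + t * b"
  have cK: "c \<in> K" unfolding c_def t_def using ab by (intro K.K_add K.K_mult K.K_of_nat)
  have sub: "B.adjoin c \<subseteq> K"
    unfolding B.adjoin_def using cK B(2) K.poly_closed poly_over_mono by blast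
  interpret E: subfield_set "B.adjoin c" by (rule B.adjoin_subfield) (use sub alg in blast)
  have tE: "t \<in> B.adjoin c" using B.adjoin_base B.K_of_nat by (auto simp: t_def)
  have cE: "c \<in> B.adjoin c" by (rule B.adjoin_self)
  have gE: "poly_over (B.adjoin c) g" and fE: "poly_over (B.adjoin c) f"
    using poly_over_mono[OF _ B.adjoin_base] fD gD by auto
  obtain \<nu> where nu: "E.is_min_poly b \<nu>" using E.min_poly_exists[OF gE gD(4,3)] by blast
  note nD = E.min_polyD[OF nu]
  define h where "h = pcompose f [:c, - t:]"
  have hE: "poly_over (B.adjoin c) h" unfolding h_def using fE cE tE by (auto intro!: E.poly_over_pcompose E.K_uminus)
  have "poly h b = 0" using fD(3) by (simp add: h_def poly_pcompose c_def algebra_simps)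
  then obtain q where q: "h = \<nu> * q" using nD(6)[OF hE] by blast
  obtain q' where q': "g = \<nu> * q'" using nD(6)[OF gE gD(3)] by blast
  have root: "z = b" if z: "poly \<nu> z = 0" for z
  proof (rule ccontr)
    assume zb: "z \<noteq> b"
    have "poly h z = poly f (c - t * z)" by (simp add: h_def poly_pcompose algebra_simps)
    moreover have "poly h z = 0" using q z by simp
    ultimately have "poly g z = 0" "poly f (c - t * z) = 0" using q' z by auto
    hence "(\<lambda>(u, v). (u - a) / (b - v)) (c - t * z, z) \<in> Z" unfolding Z_def by (intro imageI) simp
    moreover have "((c - t * z) - a) / (b - z) = t" using zb by (simp add: c_def field_simps)
    ultimately have "t \<in> Z" by simp
    thus False using n by (simp add: t_def)
  qed
  have "{z. poly \<nu> z = 0} = {b}" using root nD(3) by blast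
  hence "\<nu> = [:- b, 1:]" using rsquarefree_roots_card(1)[OF E.min_poly_rsquarefree[OF nu] nD(2)] by simp
  hence "- b \<in> B.adjoin c" using nD(1) by simp
  hence bE: "b \<in> B.adjoin c" using E.K_uminus by force
  have "a = c - t * b" by (simp add: c_def)
  hence "a \<in> B.adjoin c" using E.K_diff E.K_mult bE tE cE by simp
  thus ?thesis using bE cK by blast
qed

lemma primitive_list:
  fixes K :: "complex set"
  assumes K: "subfield_set K" and B: "subfield_set B" "B \<subseteq> K"
    and alg: "\<And>y. y \<in> K \<Longrightarrow> \<exists>\<mu>. subfield_set.is_min_poly B y \<mu>" and us: "set us \<subseteq> K"
  shows "\<exists>c\<in>K. set us \<subseteq> subfield_set.adjoin B c"
  using us
proof (induction us)
  case Nil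
  thus ?case using subfield_set.K_zero[OF K] by auto
next
  case (Cons u us)
  interpret B: subfield_set B by (rule B(1))
  obtain c where c: "c \<in> K" "set us \<subseteq> B.adjoin c" using Cons by auto
  obtain d where d: "d \<in> K" "c \<in> B.adjoin d" "u \<in> B.adjoin d"
    using primitive_pair[OF K B alg c(1), of u] Cons by auto
  obtain p where p: "c = poly p d" "poly_over B p" using d unfolding B.adjoin_def by blast
  have "B.adjoin c \<subseteq> B.adjoin d"
  proof
    fix y assume "y \<in> B.adjoin c"
    then obtain q where "y = poly q c" "poly_over B q" unfolding B.adjoin_def by blast
    hence "y = poly (pcompose q p) d" "poly_over B (pcompose q p)"
      using p by (auto simp: poly_pcompose B.poly_over_pcompose)
    thus "y \<in> B.adjoin d" unfolding B.adjoin_def by blast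
  qed
  thus ?case using c d by auto
qed

section \<open>Newton's identities\<close>

text \<open>The logarithmic derivative of the reversed polynomial with denominators cleared: each
  factor contributes a geometric series in its \<open>y j\<close>. The series of power sums starts
  at exponent 1 because \<open>fps_X * fps_deriv F\<close> has no constant term.\<close>

lemma Newton_identity:
  fixes y :: "'b \<Rightarrow> 'a::field_char_0"
  assumes "finite A"
  shows "fps_X * fps_deriv (\<Prod>j\<in>A. 1 - fps_const (y j) * fps_X) =
    - (\<Prod>j\<in>A. 1 - fps_const (y j) * fps_X) * Abs_fps (\<lambda>n. if n = 0 then 0 else \<Sum>j\<in>A. y j ^ n)"
  using assms
proof (induction A rule: finite_induct)
  case empty
  have "Abs_fps (\<lambda>n. if n = 0 then 0 else \<Sum>j\<in>{}. y j ^ n) = 0" by (rule fps_ext) simp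
  thus ?case by simp
next
  case (insert i A)
  define G where "G = (\<Prod>j\<in>A. 1 - fps_const (y j) * fps_X)"
  define P where "P = Abs_fps (\<lambda>n. if n = 0 then 0 else \<Sum>j\<in>A. y j ^ n)"
  define Q where "Q = Abs_fps (\<lambda>n. if n = 0 then 0 else y i ^ n)"
  define L where "L = 1 - fps_const (y i) * fps_X"
  have IH: "fps_X * fps_deriv G = - G * P" using insert.IH by (simp add: G_def P_def)
  have PQ: "Abs_fps (\<lambda>n. if n = 0 then 0 else \<Sum>j\<in>insert i A. y j ^ n) = Q + P"
    by (rule fps_ext) (use insert in \<open>auto simp: P_def Q_def\<close>)
  have LQ: "L * Q = fps_const (y i) * fps_X"
  proof (rule fps_ext)
    fix n
    have "(L * Q) $ n = Q $ n - y i * (fps_X * Q) $ n"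
      by (simp add: L_def left_diff_distrib mult.assoc)
    also have "\<dots> = (fps_const (y i) * fps_X) $ n"
      by (cases n) (auto simp: Q_def)
    finally show "(L * Q) $ n = (fps_const (y i) * fps_X) $ n" .
  qed
  have "fps_X * fps_deriv (L * G) = - (fps_const (y i) * fps_X) * G + L * (fps_X * fps_deriv G)"
    by (simp add: L_def algebra_simps)
  also have "\<dots> = - (L * G) * (Q + P)" unfolding IH LQ[symmetric] by (simp add: algebra_simps)
  finally show ?case using insert PQ by (simp add: L_def G_def)
qed

lemma Newton_recurrence:
  fixes y :: "'b \<Rightarrow> 'a::field_char_0"
  assumes A: "finite A" and F: "F = (\<Prod>j\<in>A. 1 - fps_const (y j) * fps_X)"
  shows "of_nat n * F $ n = - (\<Sum>i<n. F $ i * (\<Sum>j\<in>A. y j ^ (n - i)))" "F $ 0 = 1"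
proof -
  define P where "P = Abs_fps (\<lambda>n. if n = 0 then 0 else \<Sum>j\<in>A. y j ^ n)"
  have "fps_X * fps_deriv F = - (F * P)" using Newton_identity[OF A, of y] by (simp add: F P_def)
  hence "(fps_X * fps_deriv F) $ n = (- (F * P)) $ n" by simp
  moreover have "(fps_X * fps_deriv F) $ n = of_nat n * F $ n" by (cases n) auto
  moreover have "(F * P) $ n = (\<Sum>i\<le>n. F $ i * P $ (n - i))" by (simp add: fps_mult_nth atLeast0AtMost)
  moreover have "\<dots> = (\<Sum>i<n. F $ i * P $ (n - i))"
    by (simp add: lessThan_Suc_atMost[symmetric] P_def)
  moreover have "\<dots> = (\<Sum>i<n. F $ i * (\<Sum>j\<in>A. y j ^ (n - i)))" by (intro sum.cong) (auto simp: P_def)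
  ultimately show "of_nat n * F $ n = - (\<Sum>i<n. F $ i * (\<Sum>j\<in>A. y j ^ (n - i)))" by simp
  show "F $ 0 = 1" unfolding F using A by (induction A rule: finite_induct) (auto simp: fps_mult_nth)
qed

text \<open>An algebra rather than a field: the set of limits of rationals in
  \<open>conjs_coeff_limit\<close> is readily closed under sums and products, and Newton's
  recurrence divides by natural numbers only.\<close>

locale rat_algebra =
  fixes S :: "'a::field_char_0 set"
  assumes S_rat: "of_rat q \<in> S" and S_add: "x \<in> S \<Longrightarrow> y \<in> S \<Longrightarrow> x + y \<in> S"
    and S_mult: "x \<in> S \<Longrightarrow> y \<in> S \<Longrightarrow> x * y \<in> S"
begin

lemma S_basic: "0 \<in> S" "1 \<in> S" "x \<in> S \<Longrightarrow> - x \<in> S" "of_nat n \<in> S" "x \<in> S \<Longrightarrow> y \<in> S \<Longrightarrow> x - y \<in> S"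
proof -
  show "0 \<in> S" "1 \<in> S" "of_nat n \<in> S" using S_rat[of 0] S_rat[of 1] S_rat[of "of_nat n"] by auto
  have um: "- x \<in> S" if "x \<in> S" for x using S_mult[OF S_rat[of "- 1"] that] by simp
  thus "x \<in> S \<Longrightarrow> - x \<in> S" .
  show "x \<in> S \<Longrightarrow> y \<in> S \<Longrightarrow> x - y \<in> S" using S_add[of x "- y"] um by simp
qed

lemma S_sum: "(\<And>i. i \<in> A \<Longrightarrow> f i \<in> S) \<Longrightarrow> sum f A \<in> S"
  by (induction A rule: infinite_finite_induct) (auto intro: S_basic S_add)

text \<open>\<open>F\<close> is the reversed polynomial, so both have the same coefficients in
  opposite order.\<close>

lemma coeffs_iff_fps:
  fixes y :: "'b \<Rightarrow> 'a"
  assumes A: "finite A" and F: "F = (\<Prod>j\<in>A. 1 - fps_const (y j) * fps_X)"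
  shows "(\<forall>i. pcoeff (\<Prod>j\<in>A. [:- y j, 1:]) i \<in> S) \<longleftrightarrow> (\<forall>n. F $ n \<in> S)"
proof -
  define G where "G = (\<Prod>j\<in>A. [:- y j, 1:])"
  have deg: "pdeg G = card A" unfolding G_def using A by (simp add: degree_prod_eq_sum_degree)
  have "F = fps_of_poly (reflect_poly G)"
    unfolding F G_def reflect_poly_prod fps_of_poly_prod
    by (intro prod.cong) (auto simp: reflect_poly_pCons fps_of_poly_pCons algebra_simps fps_eq_iff reflect_poly_def fps_of_poly_const fps_const_neg[symmetric] simp del: fps_const_neg)
  hence nth: "F $ n = (if n > card A then 0 else pcoeff G (card A - n))" for n
    by (simp add: coeff_reflect_poly deg)
  have "pcoeff G i = F $ (card A - i)" if "i \<le> card A" for i using that by (simp add: nth)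
  moreover have "pcoeff G i = 0" if "\<not> i \<le> card A" for i using that deg by (intro coeff_eq_0) simp
  ultimately have "pcoeff G i \<in> S" if "\<forall>n. F $ n \<in> S" for i using that S_basic(1) by (cases "i \<le> card A") auto
  moreover have "F $ n \<in> S" if "\<forall>i. pcoeff G i \<in> S" for n using that S_basic(1) by (auto simp: nth)
  ultimately show ?thesis unfolding G_def by blast
qed

lemma power_sums_imp_coeffs:
  fixes y :: "'b \<Rightarrow> 'a"
  assumes A: "finite A" and ps: "\<And>k. k > 0 \<Longrightarrow> (\<Sum>j\<in>A. y j ^ k) \<in> S"
  shows "pcoeff (\<Prod>j\<in>A. [:- y j, 1:]) i \<in> S"
proof -
  define F where "F = (\<Prod>j\<in>A. 1 - fps_const (y j) * fps_X)"
  have "F $ n \<in> S" for n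
  proof (induction n rule: less_induct)
    case (less n)
    show ?case
    proof (cases "n = 0")
      case False
      have "of_nat n * F $ n \<in> S" unfolding Newton_recurrence(1)[OF A F_def]
        by (intro S_basic(3) S_sum S_mult[OF less ps]) auto
      hence "of_rat (1 / of_nat n) * (of_nat n * F $ n) \<in> S" by (rule S_mult[OF S_rat])
      moreover have "of_rat (1 / of_nat n) * (of_nat n * F $ n) = F $ n"
        using False by (simp add: of_rat_divide)
      ultimately show ?thesis by simp
    qed (simp add: Newton_recurrence(2)[OF A F_def] S_basic)
  qed
  thus ?thesis using coeffs_iff_fps[OF A F_def] by blast
qed

lemma coeffs_imp_power_sums:
  fixes y :: "'b \<Rightarrow> 'a"
  assumes A: "finite A" and co: "\<And>i. pcoeff (\<Prod>j\<in>A. [:- y j, 1:]) i \<in> S"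
  shows "(\<Sum>j\<in>A. y j ^ k) \<in> S"
proof (cases "k = 0")
  case False
  define F where "F = (\<Prod>j\<in>A. 1 - fps_const (y j) * fps_X)"
  have FS: "F $ n \<in> S" for n using coeffs_iff_fps[OF A F_def] co by blast
  show ?thesis using False
  proof (induction k rule: less_induct)
    case (less n)
    define p where "p = (\<lambda>k. \<Sum>j\<in>A. y j ^ k)"
    obtain m where m: "n = Suc m" using less by (cases n) auto
    have "of_nat n * F $ n = - (\<Sum>i<n. F $ i * p (n - i))" using Newton_recurrence(1)[OF A F_def] by (simp add: p_def)
    \<comment> \<open>The term with index 0 is the power sum sought, because
      \<open>F $ 0 = 1\<close>.\<close>
    also have "(\<Sum>i<n. F $ i * p (n - i)) = p n + (\<Sum>i<m. F $ Suc i * p (n - Suc i))"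
      unfolding m sum.lessThan_Suc_shift by (simp add: Newton_recurrence(2)[OF A F_def])
    finally have eq: "of_nat n * F $ n = - (p n + (\<Sum>i<m. F $ Suc i * p (n - Suc i)))" .
    have eq2: "p n = - (of_nat n * F $ n) - (\<Sum>i<m. F $ Suc i * p (n - Suc i))" unfolding eq by simp
    have "p (n - Suc i) \<in> S" if "i < m" for i using less.IH[of "n - Suc i"] that m by (simp add: p_def)
    hence "(\<Sum>i<m. F $ Suc i * p (n - Suc i)) \<in> S" by (intro S_sum S_mult FS) simp
    hence "p n \<in> S" unfolding eq2 by (intro S_basic(3,5) S_mult[OF S_basic(4) FS])
    thus ?case by (simp add: p_def)
  qed
qed (simp add: S_basic)

end

lemma (in subfield_set) rat_algebra: "rat_algebra K"
  by unfold_locales (auto intro: K_of_rat K_add K_mult)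

section \<open>Weak approximation\<close>

context subfield_abs begin

definition lim_to :: "(nat \<Rightarrow> 'a) \<Rightarrow> 'a \<Rightarrow> bool" where
  "lim_to s l \<longleftrightarrow> (\<forall>n. s n \<in> K) \<and> l \<in> K \<and> (\<lambda>n. \<phi> (s n - l)) \<longlonglongrightarrow> 0"

lemma lim_toI: "(\<And>n. s n \<in> K) \<Longrightarrow> l \<in> K \<Longrightarrow> (\<lambda>n. \<phi> (s n - l)) \<longlonglongrightarrow> 0 \<Longrightarrow> lim_to s l"
  by (simp add: lim_to_def)

lemma abs_diff: "x \<in> K \<Longrightarrow> y \<in> K \<Longrightarrow> \<bar>\<phi> x - \<phi> y\<bar> \<le> \<phi> (x - y)"
  using add[of "x - y" y] add[of "y - x" x] uminus[of "x - y"] K_diff by force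

lemma null_sandwich:
  assumes "\<And>n. x n \<in> K" "\<And>n. \<phi> (x n) \<le> b n" "b \<longlonglongrightarrow> 0"
  shows "(\<lambda>n. \<phi> (x n)) \<longlonglongrightarrow> 0"
  by (rule tendsto_sandwich[OF _ _ tendsto_const assms(3)])
    (use assms(1,2) nonneg in \<open>auto intro: always_eventually\<close>)

lemma lim_to_abs:
  assumes "lim_to s l" shows "(\<lambda>n. \<phi> (s n)) \<longlonglongrightarrow> \<phi> l"
proof -
  have s: "\<And>n. s n \<in> K" "l \<in> K" "(\<lambda>n. \<phi> (s n - l)) \<longlonglongrightarrow> 0" using assms by (auto simp: lim_to_def)
  have "(\<lambda>n. \<phi> (s n) - \<phi> l) \<longlonglongrightarrow> 0"
    by (rule tendsto_rabs_zero_cancel[OF tendsto_sandwich[OF _ _ tendsto_const s(3)]])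
      (use abs_diff s in \<open>auto intro: always_eventually\<close>)
  thus ?thesis using LIM_zero_iff by blast
qed

lemma lim_to_const: "x \<in> K \<Longrightarrow> lim_to (\<lambda>n. x) x"
  by (simp add: lim_to_def)

lemma lim_to_add:
  assumes "lim_to s l" "lim_to t k" shows "lim_to (\<lambda>n. s n + t n) (l + k)"
proof -
  have s: "s n \<in> K" "t n \<in> K" "l \<in> K" "k \<in> K" for n using assms by (auto simp: lim_to_def)
  have "(\<lambda>n. \<phi> (s n - l) + \<phi> (t n - k)) \<longlonglongrightarrow> 0 + 0"
    using assms by (intro tendsto_add) (auto simp: lim_to_def)
  hence lim: "(\<lambda>n. \<phi> (s n - l) + \<phi> (t n - k)) \<longlonglongrightarrow> 0" by simp
  have "\<phi> (s n + t n - (l + k)) \<le> \<phi> (s n - l) + \<phi> (t n - k)" for n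
    using add[of "s n - l" "t n - k"] s K_diff by (simp add: algebra_simps)
  from null_sandwich[OF _ this lim] show ?thesis
    using s K_add K_diff by (intro lim_toI) auto
qed

lemma lim_to_mult:
  assumes "lim_to s l" "lim_to t k" shows "lim_to (\<lambda>n. s n * t n) (l * k)"
proof -
  have s: "s n \<in> K" "t n \<in> K" "l \<in> K" "k \<in> K" for n using assms by (auto simp: lim_to_def)
  have "(\<lambda>n. \<phi> (s n) * \<phi> (t n - k) + \<phi> (s n - l) * \<phi> k) \<longlonglongrightarrow> \<phi> l * 0 + 0 * \<phi> k"
    using assms by (intro tendsto_intros lim_to_abs) (auto simp: lim_to_def)
  hence lim: "(\<lambda>n. \<phi> (s n) * \<phi> (t n - k) + \<phi> (s n - l) * \<phi> k) \<longlonglongrightarrow> 0" by simp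
  have "\<phi> (s n * t n - l * k) \<le> \<phi> (s n) * \<phi> (t n - k) + \<phi> (s n - l) * \<phi> k" for n
  proof -
    have "s n * t n - l * k = s n * (t n - k) + (s n - l) * k" by (simp add: algebra_simps)
    thus ?thesis using add[of "s n * (t n - k)" "(s n - l) * k"] s by (simp add: mult K_mult K_diff)
  qed
  from null_sandwich[OF _ this lim] show ?thesis
    using s K_mult K_diff by (intro lim_toI) auto
qed

lemma lim_to_sum: "(\<And>i. i \<in> A \<Longrightarrow> lim_to (s i) (l i)) \<Longrightarrow> lim_to (\<lambda>n. \<Sum>i\<in>A. s i n) (\<Sum>i\<in>A. l i)"
  by (induction A rule: infinite_finite_induct) (auto intro: lim_to_const lim_to_add K_zero)

lemma lim_to_prod_coeff:
  assumes "finite A" "\<And>j. j \<in> A \<Longrightarrow> lim_to (y j) (l j)"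
  shows "lim_to (\<lambda>n. pcoeff (\<Prod>j\<in>A. [:- y j n, 1:]) i) (pcoeff (\<Prod>j\<in>A. [:- l j, 1:]) i)"
  using assms
proof (induction A arbitrary: i rule: finite_induct)
  case empty
  show ?case by (auto intro: lim_to_const simp: Polynomial.coeff_1 K_zero K_one)
next
  case (insert j A)
  have um: "lim_to (\<lambda>n. (- 1) * s n) ((- 1) * k)" if "lim_to s k" for s k
    using that by (intro lim_to_mult lim_to_const K_uminus K_one)
  have eq: "pcoeff (\<Prod>j\<in>insert j A. [:- f j, 1:]) i =
    ((- 1) * f j) * pcoeff (\<Prod>j\<in>A. [:- f j, 1:]) i + (if i = 0 then 0 else pcoeff (\<Prod>j\<in>A. [:- f j, 1:]) (i - 1))"
    for f :: "'b \<Rightarrow> 'a"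
    using insert(1,2) by (cases i) (simp_all add: mult_pCons_left)
  show ?case unfolding eq
    using insert by (intro lim_to_add lim_to_mult[OF um]) (auto intro: lim_to_const K_zero)
qed

text \<open>\<open>x ^ n / (1 + x ^ n)\<close> acts as a switch. Its distance from 1 is the value of
  \<open>inverse (1 + x ^ n)\<close>, which tends to 0 where \<open>x\<close> is large; where
  \<open>x\<close> is small the quotient itself tends to 0.\<close>

lemma approx_one:
  assumes x: "x \<in> K" "\<phi> x > 1"
  shows "lim_to (\<lambda>n. x ^ n / (1 + x ^ n)) 1"
proof (rule lim_toI)
  have xn: "x ^ n \<in> K" "1 + x ^ n \<in> K" for n using x by (auto intro: K_power K_add K_one)
  thus "x ^ n / (1 + x ^ n) \<in> K" for n by (intro K_divide)
  have "filterlim (\<lambda>n. \<phi> x ^ n - 1) at_top sequentially"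
  proof -
    have "filterlim (\<lambda>n. \<phi> x ^ n) at_top sequentially"
      using x by (intro filterlim_at_infinity_imp_filterlim_at_top filterlim_realpow_sequentially_gt1) auto
    from filterlim_tendsto_add_at_top[OF tendsto_const this, of "- 1"] show ?thesis by simp
  qed
  hence lim: "(\<lambda>n. inverse (\<phi> x ^ n - 1)) \<longlonglongrightarrow> 0" by (rule tendsto_inverse_0_at_top)
  have "\<forall>\<^sub>F n in sequentially. \<phi> (x ^ n / (1 + x ^ n) - 1) \<le> inverse (\<phi> x ^ n - 1)"
    using eventually_gt_at_top[of 0]
  proof eventually_elim
    case (elim n)
    have gt: "\<phi> x ^ n > 1" using x elim by (simp add: one_less_power)
    have ge: "\<phi> (1 + x ^ n) \<ge> \<phi> x ^ n - 1"
      using diff[of "1 + x ^ n" 1] xn K_one x by (simp add: power)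
    hence nz: "1 + x ^ n \<noteq> 0" using gt by auto
    have "x ^ n / (1 + x ^ n) - 1 = - inverse (1 + x ^ n)" using nz by (simp add: field_simps)
    hence "\<phi> (x ^ n / (1 + x ^ n) - 1) = inverse (\<phi> (1 + x ^ n))"
      using xn by (simp add: K_inverse inverse)
    thus ?case using ge gt by (simp add: le_imp_inverse_le)
  qed
  thus "(\<lambda>n. \<phi> (x ^ n / (1 + x ^ n) - 1)) \<longlonglongrightarrow> 0"
    by (rule tendsto_sandwich[OF _ _ tendsto_const lim, rotated])
      (use xn in \<open>auto intro!: always_eventually nonneg K_diff K_divide K_one\<close>)
qed (rule K_one)

lemma approx_zero:
  assumes x: "x \<in> K" "\<phi> x < 1"
  shows "lim_to (\<lambda>n. x ^ n / (1 + x ^ n)) 0"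
proof (rule lim_toI)
  have xn: "x ^ n \<in> K" "1 + x ^ n \<in> K" for n using x by (auto intro: K_power K_add K_one)
  thus xk: "x ^ n / (1 + x ^ n) \<in> K" for n by (intro K_divide)
  have "(\<lambda>n. \<phi> x ^ n / (1 - \<phi> x ^ n)) \<longlonglongrightarrow> 0 / (1 - 0)"
    using x nonneg by (intro tendsto_intros LIMSEQ_realpow_zero) auto
  hence lim: "(\<lambda>n. \<phi> x ^ n / (1 - \<phi> x ^ n)) \<longlonglongrightarrow> 0" by simp
  have "\<forall>\<^sub>F n in sequentially. \<phi> (x ^ n / (1 + x ^ n) - 0) \<le> \<phi> x ^ n / (1 - \<phi> x ^ n)"
    using eventually_gt_at_top[of 0]
  proof eventually_elim
    case (elim n)
    have lt: "\<phi> x ^ n < 1" using x elim nonneg[OF x(1)] by (simp add: power_Suc_less_one power_less_one_iff)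
    have "\<phi> (1 + x ^ n) \<ge> 1 - \<phi> x ^ n"
      using diff[of "1 + x ^ n" "x ^ n"] xn K_one x by (simp add: power)
    thus ?case using lt xn x nonneg[OF x(1)] by (simp add: divide power frac_le)
  qed
  thus "(\<lambda>n. \<phi> (x ^ n / (1 + x ^ n) - 0)) \<longlonglongrightarrow> 0"
    by (rule tendsto_sandwich[OF _ _ tendsto_const lim, rotated])
      (use xk in \<open>auto intro!: always_eventually nonneg\<close>)
qed (rule K_zero)

lemma power_int: "x \<in> K \<Longrightarrow> \<phi> (x powi m) = \<phi> x powi m"
  by (cases m rule: int_cases2) (auto simp: power_int_minus inverse power K_power)

lemma K_power_int: "x \<in> K \<Longrightarrow> x powi m \<in> K"
  by (cases m rule: int_cases2) (auto simp: power_int_minus intro: K_inverse K_power)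

end

text \<open>The common value at \<open>b\<close> fixes the scale, so any \<open>x\<close> with
  different values separates. If \<open>\<phi> x < \<psi> x\<close>, take a rational
  \<open>m / n\<close> between the logarithms of both to the base \<open>\<phi> b\<close>: then
  \<open>b powi m / x ^ n\<close> is large at \<phi> and small at \<psi>. Otherwise
  \<open>inverse x\<close> takes the place of \<open>x\<close>.\<close>

lemma weak_separation:
  assumes "subfield_abs K \<phi>" "subfield_abs K \<psi>" and b: "b \<in> K" "\<phi> b > 1" "\<psi> b = \<phi> b" and x: "x \<in> K" "\<phi> x \<noteq> \<psi> x"
  shows "\<exists>y\<in>K. \<phi> y > 1 \<and> \<psi> y < 1"
proof -
  interpret \<phi>: subfield_abs K \<phi> by fact
  interpret \<psi>: subfield_abs K \<psi> by fact
  have *: ?thesis if x: "x \<in> K" "\<phi> x < \<psi> x" for x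
  proof -
    have pos: "\<phi> x > 0" "\<psi> x > 0"
    proof -
      have "x \<noteq> 0" using x by auto
      thus "\<phi> x > 0" "\<psi> x > 0" using x \<phi>.pos \<psi>.pos by auto
    qed
    define \<beta> where "\<beta> = \<phi> b"
    have lb: "ln \<beta> > 0" using b by (simp add: \<beta>_def)
    have "ln (\<phi> x) / ln \<beta> < ln (\<psi> x) / ln \<beta>" using x pos lb by (simp add: divide_strict_right_mono)
    then obtain r where r: "ln (\<phi> x) / ln \<beta> < real_of_rat r" "real_of_rat r < ln (\<psi> x) / ln \<beta>"
      using of_rat_dense by blast
    obtain m k where mk: "quotient_of r = (m, k)" by force
    define n where "n = nat k"
    have k: "k > 0" using quotient_of_denom_pos[OF mk] .
    hence n: "n > 0" by (simp add: n_def)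
    have rr: "real_of_rat r = of_int m / real n" using quotient_of_div[OF mk] k by (simp add: n_def of_rat_divide)
    have "real n * ln (\<phi> x) < of_int m * ln \<beta>" "of_int m * ln \<beta> < real n * ln (\<psi> x)"
      using r n lb by (simp_all add: rr field_simps)
    hence "ln (\<phi> x ^ n) < ln (\<beta> powr of_int m)" "ln (\<beta> powr of_int m) < ln (\<psi> x ^ n)"
      using pos b by (simp_all add: ln_realpow ln_powr \<beta>_def)
    moreover have "\<beta> powr of_int m = \<beta> powi m" using b by (simp add: powr_real_of_int' \<beta>_def)
    moreover have "\<beta> powi m > 0" using b by (simp add: \<beta>_def)
    ultimately have lt: "\<phi> x ^ n < \<beta> powi m" "\<beta> powi m < \<psi> x ^ n" using pos by simp_all
    define y where "y = b powi m / x ^ n"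
    have "\<phi> y = \<beta> powi m / \<phi> x ^ n" "\<psi> y = \<beta> powi m / \<psi> x ^ n"
      unfolding y_def \<beta>_def using b x
      by (simp_all add: \<phi>.divide \<psi>.divide \<phi>.K_power \<phi>.K_power_int \<phi>.power \<psi>.power \<phi>.power_int \<psi>.power_int)
    moreover have "y \<in> K" unfolding y_def using b x by (intro \<phi>.K_divide \<phi>.K_power \<phi>.K_power_int)
    ultimately show ?thesis using lt pos by (intro bexI[of _ y]) simp_all
  qed
  show ?thesis
  proof (cases "\<phi> x < \<psi> x")
    case False
    hence lt: "\<psi> x < \<phi> x" using x by simp
    show ?thesis
    proof (cases "\<psi> x = 0")
      case True
      hence "x = 0" using x \<psi>.eq_0_iff by blast
      thus ?thesis using lt by simp
    next
      case False
      hence "\<psi> x > 0" using \<psi>.nonneg[OF x(1)] by simp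
      hence "\<phi> (inverse x) < \<psi> (inverse x)" using x lt by (simp add: \<phi>.inverse \<psi>.inverse)
      thus ?thesis using *[of "inverse x"] x \<phi>.K_inverse by blast
    qed
  qed (use * x in blast)
qed

lemma weak_dominance:
  assumes "subfield_abs K \<phi>" "finite V" and b: "b \<in> K" "\<phi> b > 1"
    and V: "\<And>\<psi>. \<psi> \<in> V \<Longrightarrow> subfield_abs K \<psi> \<and> \<psi> b = \<phi> b \<and> (\<exists>x\<in>K. \<phi> x \<noteq> \<psi> x)"
  shows "\<exists>x\<in>K. \<phi> x > 1 \<and> (\<forall>\<psi>\<in>V. \<psi> x < 1)"
  using assms(2) V
proof (induction V rule: finite_induct)
  case empty
  thus ?case using b by auto
next
  case (insert u V)
  interpret \<phi>: subfield_abs K \<phi> by fact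
  have V: "subfield_abs K \<psi>" if "\<psi> \<in> insert u V" for \<psi> using insert.prems[OF that] by simp
  interpret u: subfield_abs K u using V by blast
  obtain x where x: "x \<in> K" "\<phi> x > 1" "\<And>\<psi>. \<psi> \<in> V \<Longrightarrow> \<psi> x < 1" using insert by auto
  obtain z where z: "z \<in> K" "\<phi> z \<noteq> u z" using insert.prems[of u] by auto
  obtain y where y: "y \<in> K" "\<phi> y > 1" "u y < 1"
    using weak_separation[OF assms(1) V[of u] b _ z] insert.prems[of u] by auto
  show ?case
  proof (cases "u x \<le> 1")
    case True
    \<comment> \<open>If \<open>u x \<le> 1\<close>, high powers of \<open>x\<close> make
      \<open>V\<close> small without enlarging \<open>u\<close>, and the factor \<open>y\<close>
      takes care of \<open>u\<close>.\<close>
    have "\<forall>\<psi>\<in>V. \<forall>\<^sub>F n in sequentially. \<psi> (x ^ n * y) < 1"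
    proof
      fix \<psi> assume psi: "\<psi> \<in> V"
      interpret \<psi>: subfield_abs K \<psi> using V psi by blast
      have "(\<lambda>n. \<psi> x ^ n * \<psi> y) \<longlonglongrightarrow> 0 * \<psi> y"
        using x psi \<psi>.nonneg by (intro tendsto_intros LIMSEQ_realpow_zero) auto
      hence "(\<lambda>n. \<psi> (x ^ n * y)) \<longlonglongrightarrow> 0" using x y by (simp add: \<psi>.mult \<psi>.power \<phi>.K_power)
      thus "\<forall>\<^sub>F n in sequentially. \<psi> (x ^ n * y) < 1" by (intro order_tendstoD) auto
    qed
    hence "\<forall>\<^sub>F n in sequentially. \<forall>\<psi>\<in>V. \<psi> (x ^ n * y) < 1"
      using insert.hyps by (simp add: eventually_ball_finite)
    then obtain n where n: "\<forall>\<psi>\<in>V. \<psi> (x ^ n * y) < 1" by (auto simp: eventually_sequentially)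
    have "u (x ^ n * y) \<le> 1 * u y"
      using True x y u.nonneg by (simp add: u.mult u.power \<phi>.K_power mult_left_le_one_le power_le_one)
    moreover have "\<phi> (x ^ n * y) > 1"
    proof -
      have "1 * 1 < \<phi> x ^ n * \<phi> y" using x y by (intro mult_le_less_imp_less one_le_power) auto
      thus ?thesis using x y by (simp add: \<phi>.mult \<phi>.power \<phi>.K_power)
    qed
    ultimately show ?thesis using n x y by (intro bexI[of _ "x ^ n * y"]) (auto intro: \<phi>.K_mult \<phi>.K_power)
  next
    case False
    \<comment> \<open>If \<open>u x > 1\<close>, powers of \<open>x\<close> would spoil
      \<open>u\<close>. The switch tends to 1 at both \<phi> and \<open>u\<close>, where
      \<open>y\<close> then decides, and to 0 on \<open>V\<close>.\<close>
    define t where "t = (\<lambda>n. x ^ n / (1 + x ^ n))"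
    have yl: "subfield_abs.lim_to K \<psi> (\<lambda>n. y) y" if "subfield_abs K \<psi>" for \<psi>
      using subfield_abs.lim_to_const[OF that y(1)] .
    have "(\<lambda>n. \<phi> (t n * y)) \<longlonglongrightarrow> \<phi> (1 * y)" "(\<lambda>n. u (t n * y)) \<longlonglongrightarrow> u (1 * y)"
      unfolding t_def using x y False
      by (intro \<phi>.lim_to_abs \<phi>.lim_to_mult \<phi>.approx_one yl[OF assms(1)] u.lim_to_abs u.lim_to_mult
          u.approx_one yl[OF V[OF insertI1]]; simp)+
    hence 1: "\<forall>\<^sub>F n in sequentially. \<phi> (t n * y) > 1" "\<forall>\<^sub>F n in sequentially. u (t n * y) < 1"
      using y by (auto intro: order_tendstoD)
    have "\<forall>\<psi>\<in>V. \<forall>\<^sub>F n in sequentially. \<psi> (t n * y) < 1"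
    proof
      fix \<psi> assume psi: "\<psi> \<in> V"
      interpret \<psi>: subfield_abs K \<psi> using V psi by blast
      have "(\<lambda>n. \<psi> (t n * y)) \<longlonglongrightarrow> \<psi> (0 * y)"
        unfolding t_def using x y psi
        by (intro \<psi>.lim_to_abs \<psi>.lim_to_mult \<psi>.approx_zero \<psi>.lim_to_const) auto
      thus "\<forall>\<^sub>F n in sequentially. \<psi> (t n * y) < 1" by (intro order_tendstoD) auto
    qed
    hence 2: "\<forall>\<^sub>F n in sequentially. \<forall>\<psi>\<in>V. \<psi> (t n * y) < 1"
      using insert.hyps by (simp add: eventually_ball_finite)
    have "\<forall>\<^sub>F n in sequentially. \<phi> (t n * y) > 1 \<and> u (t n * y) < 1 \<and> (\<forall>\<psi>\<in>V. \<psi> (t n * y) < 1)"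
      using 1 2 by eventually_elim blast
    then obtain n where n: "\<phi> (t n * y) > 1 \<and> u (t n * y) < 1 \<and> (\<forall>\<psi>\<in>V. \<psi> (t n * y) < 1)"
      by (auto simp: eventually_sequentially)
    have "t n * y \<in> K" unfolding t_def using x y
      by (intro \<phi>.K_mult \<phi>.K_divide \<phi>.K_add \<phi>.K_power \<phi>.K_one)
    thus ?thesis using n by (intro bexI[of _ "t n * y"]) auto
  qed
qed

text \<open>The targets 1 at \<phi> and 0 elsewhere suffice: in a trace, such a factor isolates the
  conjugates that induce \<phi>.\<close>

theorem weak_approximation:
  assumes "subfield_abs K \<phi>" "finite V" and b: "b \<in> K" "\<phi> b > 1"
    and V: "\<And>\<psi>. \<psi> \<in> V \<Longrightarrow> subfield_abs K \<psi> \<and> \<psi> b = \<phi> b \<and> (\<exists>x\<in>K. \<phi> x \<noteq> \<psi> x)"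
  shows "\<exists>s. subfield_abs.lim_to K \<phi> s 1 \<and> (\<forall>\<psi>\<in>V. subfield_abs.lim_to K \<psi> s 0)"
proof -
  obtain x where x: "x \<in> K" "\<phi> x > 1" "\<And>\<psi>. \<psi> \<in> V \<Longrightarrow> \<psi> x < 1"
    using weak_dominance[OF assms] by blast
  have "subfield_abs.lim_to K \<phi> (\<lambda>n. x ^ n / (1 + x ^ n)) 1"
    using subfield_abs.approx_one[OF assms(1) x(1,2)] .
  moreover have "subfield_abs.lim_to K \<psi> (\<lambda>n. x ^ n / (1 + x ^ n)) 0" if "\<psi> \<in> V" for \<psi>
    using subfield_abs.approx_zero[of K \<psi> x] V[OF that] x(1) x(3)[OF that] by blast
  ultimately show ?thesis by blast
qed

section \<open>Number fields as sets of complex numbers\<close>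

lemma complex_field_simps [simp]:
  "carrier complex_field = UNIV" "x \<otimes>\<^bsub>complex_field\<^esub> y = x * y" "x \<oplus>\<^bsub>complex_field\<^esub> y = x + y"
  "\<one>\<^bsub>complex_field\<^esub> = 1" "\<zero>\<^bsub>complex_field\<^esub> = 0"
  by (simp_all add: ring_of_type_algebra_def)

lemma field_complex_field: "field complex_field"
  by (rule field_from_type_algebra)

interpretation CF: cring complex_field
  by (rule cring_from_type_algebra)

lemma complex_field_minus [simp]: "\<ominus>\<^bsub>complex_field\<^esub> x = - x"
  by (rule CF.minus_equality) simp_all

lemma complex_field_diff [simp]: "x \<ominus>\<^bsub>complex_field\<^esub> y = x - y"
  by (simp add: a_minus_def)

lemma complex_field_pow [simp]: "x [^]\<^bsub>complex_field\<^esub> (n::nat) = x ^ n"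
  by (induction n) (simp_all add: CF.nat_pow_Suc mult.commute)

lemma complex_field_inv: "x \<noteq> 0 \<Longrightarrow> inv\<^bsub>complex_field\<^esub> x = inverse x"
  by (rule CF.comm_inv_char) simp_all

lemma subfield_complex_iff: "subfield K complex_field \<longleftrightarrow> subfield_set K"
proof
  assume K: "subfield K complex_field"
  note s = subringE[OF subfieldE(1)[OF K]]
  show "subfield_set K"
  proof
    fix x assume x: "x \<in> K"
    show "inverse x \<in> K"
    proof (cases "x = 0")
      case False
      thus ?thesis using CF.subfield_m_inv(1)[OF K, of x] x by (simp add: complex_field_inv)
    qed (use x in simp)
    show "- x \<in> K" using s(5)[OF x] by simp
  qed (use s(2,3,6,7) in simp_all)
next
  assume "subfield_set K"
  then interpret subfield_set K .
  have "subring K complex_field"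
    by (rule CF.subringI) (auto intro: K_one K_uminus K_mult K_add)
  thus "subfield K complex_field"
    by (rule field.subfieldI'[OF field_complex_field]) (auto simp: complex_field_inv intro: K_inverse)
qed

interpretation Q: subfield_set "\<rat> :: complex set"
  by unfold_locales auto

lemma subfield_rat: "subfield \<rat> complex_field"
  using subfield_complex_iff Q.subfield_set_axioms by blast

lemma field_of_simps [simp]:
  "carrier (field_of K) = K" "x \<otimes>\<^bsub>field_of K\<^esub> y = x * y" "x \<oplus>\<^bsub>field_of K\<^esub> y = x + y"
  "\<one>\<^bsub>field_of K\<^esub> = 1" "\<zero>\<^bsub>field_of K\<^esub> = 0"
  by simp_all

lemma field_of_field: "subfield_set K \<Longrightarrow> field (field_of K)"
  using CF.subfield_iff(2)[of K] subfield_complex_iff by blast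

lemma field_of_diff:
  assumes "subfield_set K" "x \<in> K" "y \<in> K"
  shows "x \<ominus>\<^bsub>field_of K\<^esub> y = x - y"
proof -
  interpret subfield_set K by fact
  interpret F: field "field_of K" using field_of_field assms by blast
  have "\<ominus>\<^bsub>field_of K\<^esub> y = - y" by (rule F.minus_equality) (use assms K_uminus in auto)
  thus ?thesis by (simp add: a_minus_def)
qed

lemma field_of_abs_iff:
  assumes "subfield_set K"
  shows "abs_valued_field (field_of K) \<phi> \<longleftrightarrow> subfield_abs K \<phi>"
  using assms field_of_field[OF assms]
  by (simp add: abs_valued_field_def abs_valued_field_axioms_def subfield_abs_def subfield_abs_axioms_def)

text \<open>The polynomials of HOL-Algebra are lists with the leading coefficient first, hence the
  reversal.\<close>

lemma eval_complex: "CF.eval p x = poly (Poly (rev p)) x"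
  by (induction p) (auto simp: Poly_append poly_monom)

lemma algebraic_complex_iff:
  assumes K: "subfield_set K"
  shows "(CF.algebraic over K) x \<longleftrightarrow> (\<exists>p. poly_over K p \<and> p \<noteq> 0 \<and> poly p x = 0)"
proof
  interpret subfield_set K by fact
  have sub: "subring K complex_field" using subfield_complex_iff K subfieldE(1) by blast
  {
    assume "(CF.algebraic over K) x"
    then obtain p where p: "p \<in> carrier (K[X]\<^bsub>complex_field\<^esub>)" "p \<noteq> []" "CF.eval p x = 0"
      using domain.algebraicE[OF field.axioms(1)[OF field_complex_field] sub, of x] by auto
    have pK: "set p \<subseteq> K" "hd p \<noteq> 0" using p(1,2) by (auto simp: univ_poly_def polynomial_def)
    have "poly_over K (Poly (rev p))" unfolding poly_over_def
    proof
      fix i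
      show "pcoeff (Poly (rev p)) i \<in> K"
      proof (cases "i < length p")
        case True
        hence "rev p ! i \<in> set p" using nth_mem[of i "rev p"] by simp
        thus ?thesis using True pK(1) by (auto simp: nth_default_def)
      qed (simp add: nth_default_def K_zero)
    qed
    moreover have "Poly (rev p) \<noteq> 0"
    proof
      assume "Poly (rev p) = 0"
      then obtain n where n: "rev p = replicate n 0" by (auto simp: Poly_eq_0)
      hence "last (rev p) = 0" using p(2) by (cases n) (auto simp: last_replicate)
      thus False using pK(2) p(2) by (simp add: last_rev)
    qed
    ultimately show "\<exists>p. poly_over K p \<and> p \<noteq> 0 \<and> poly p x = 0" using p(3) by (auto simp: eval_complex)
  }
  assume "\<exists>p. poly_over K p \<and> p \<noteq> 0 \<and> poly p x = 0"
  then obtain p where p: "poly_over K p" "p \<noteq> 0" "poly p x = 0" by blast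
  have "set (coeffs p) \<subseteq> K" using p(1) unfolding coeffs_def poly_over_def by auto
  moreover have "last (coeffs p) \<noteq> 0" using p(2) by (simp add: last_coeffs_eq_coeff_degree)
  ultimately have "rev (coeffs p) \<in> carrier (K[X]\<^bsub>complex_field\<^esub>)" "rev (coeffs p) \<noteq> []"
    using p(2) by (auto simp: univ_poly_def polynomial_def hd_rev)
  moreover have "CF.eval (rev (coeffs p)) x = 0" using p(3) by (simp add: eval_complex)
  ultimately show "(CF.algebraic over K) x" using CF.algebraicI by auto
qed

definition alg_numbers :: "complex set" where
  "alg_numbers = {x. \<exists>p. poly_over \<rat> p \<and> p \<noteq> 0 \<and> poly p x = 0}"

lemma alg_numbers_subfield: "subfield_set alg_numbers"
proof -
  have "alg_numbers = {x \<in> carrier complex_field. (CF.algebraic over \<rat>) x}"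
    by (simp add: alg_numbers_def algebraic_complex_iff[OF Q.subfield_set_axioms])
  thus ?thesis using field.subfield_of_algebraics[OF field_complex_field subfield_rat] subfield_complex_iff by simp
qed

text \<open>\<open>w\<close> is one of possibly many extensions. Once it is fixed, every absolute
  value of a number field above \<alpha> is obtained from it through an embedding.\<close>

theorem abs_extends_to_alg_numbers:
  assumes "subfield_abs UNIV \<alpha>"
  shows "\<exists>w. subfield_abs alg_numbers w \<and> (\<forall>q. w (of_rat q) = \<alpha> q)"
proof -
  interpret \<alpha>: subfield_abs UNIV \<alpha> by fact
  let ?L = "field_of alg_numbers"
  interpret L: field ?L by (rule field_of_field[OF alg_numbers_subfield])
  \<comment> \<open>\<alpha> read on the rationals inside the complex numbers; injectivity of
    \<open>of_rat\<close> makes the choice unique there.\<close>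
  define \<beta> where "\<beta> = (\<lambda>x::complex. \<alpha> (SOME q. x = of_rat q))"
  have beta: "\<beta> (of_rat q) = \<alpha> q" for q
  proof -
    have "(of_rat q :: complex) = of_rat (SOME r. of_rat q = (of_rat r :: complex))" by (rule someI[of _ q]) simp
    hence "q = (SOME r. of_rat q = (of_rat r :: complex))" by simp
    thus ?thesis by (simp add: \<beta>_def)
  qed
  have "abs_valued_field (field_of \<rat>) \<beta>"
    unfolding field_of_abs_iff[OF Q.subfield_set_axioms]
  proof
    fix x y :: complex assume "x \<in> \<rat>" "y \<in> \<rat>"
    then obtain p q where x: "x = of_rat p" and y: "y = of_rat q" by (auto elim!: Rats_cases)
    show "0 \<le> \<beta> x" using \<alpha>.nonneg by (simp add: x beta)
    show "\<beta> x = 0 \<longleftrightarrow> x = 0" using \<alpha>.eq_0_iff by (simp add: x beta)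
    show "\<beta> (x * y) = \<beta> x * \<beta> y" using \<alpha>.mult by (simp add: x y beta of_rat_mult[symmetric] del: of_rat_mult)
    show "\<beta> (x + y) \<le> \<beta> x + \<beta> y" using \<alpha>.add by (simp add: x y beta of_rat_add[symmetric] del: of_rat_add)
  qed
  moreover have sub: "\<rat> \<subseteq> alg_numbers"
    using subfield_set.K_of_rat[OF alg_numbers_subfield] by (auto elim!: Rats_cases)
  have sr: "subring alg_numbers complex_field"
    using alg_numbers_subfield subfield_complex_iff subfieldE(1) by blast
  have "subfield \<rat> ?L"
  proof (rule L.subfield_iff(1))
    show "field (?L\<lparr>carrier := \<rat>\<rparr>)" using field_of_field[OF Q.subfield_set_axioms] by simp
    show "\<rat> \<subseteq> carrier ?L" using sub by simp
  qed
  moreover have "(ring.algebraic ?L over \<rat>) x" if "x \<in> carrier ?L" for x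
    using that CF.algebraic_consistent[OF sr] algebraic_complex_iff[OF Q.subfield_set_axioms, of x]
    by (simp add: alg_numbers_def)
  ultimately have "abs_extension ?L \<rat> \<beta>"
    unfolding abs_extension_def abs_extension_axioms_def using L.field_axioms by simp
  then obtain w where w: "abs_valued_field ?L w" "\<forall>c\<in>\<rat>. w c = \<beta> c"
    using abs_extension.abs_extension_exists by blast
  thus ?thesis using field_of_abs_iff[OF alg_numbers_subfield] beta by (intro exI[of _ w]) auto
qed

section \<open>Conjugate embeddings, traces and norms\<close>

locale primitive_field = subfield_set K for K :: "complex set" +
  fixes \<theta> and \<mu> :: "complex poly"
  assumes min_poly: "Q.is_min_poly \<theta> \<mu>" and K_adjoin: "K = Q.adjoin \<theta>"
begin

definition conj_roots :: "complex set" where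
  "conj_roots = {z. poly \<mu> z = 0}"

text \<open>The embedding of \<open>K\<close> that sends the primitive element to its conjugate \<open>z\<close>.\<close>

definition emb :: "complex \<Rightarrow> complex \<Rightarrow> complex" where
  "emb z x = poly (SOME p. poly_over \<rat> p \<and> poly p \<theta> = x) z"

lemma mu: "poly_over \<rat> \<mu>" "Polynomial.lead_coeff \<mu> = 1" "poly \<mu> \<theta> = 0" "\<mu> \<noteq> 0" "pdeg \<mu> > 0"
  using Q.min_polyD[OF min_poly] by auto

lemma conj_roots: "finite conj_roots" "card conj_roots = pdeg \<mu>" "\<mu> = (\<Prod>z\<in>conj_roots. [:- z, 1:])" "\<theta> \<in> conj_roots"
  using rsquarefree_roots_card[OF Q.min_poly_rsquarefree[OF min_poly] mu(2)] mu(3)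
  by (auto simp: conj_roots_def)

lemma poly_in_K: "poly_over \<rat> p \<Longrightarrow> poly p \<theta> \<in> K"
  unfolding K_adjoin Q.adjoin_def by blast

lemma theta_K: "\<theta> \<in> K"
  unfolding K_adjoin by (rule Q.adjoin_self)

lemma K_poly:
  assumes "x \<in> K" obtains p where "poly_over \<rat> p" "x = poly p \<theta>"
  using assms unfolding K_adjoin Q.adjoin_def by blast

text \<open>Two rational polynomials with the same value at \<theta> differ by a multiple of \<mu>,
  which vanishes at \<open>z\<close>; so the choice made in \<open>emb\<close> does not
  matter.\<close>

lemma emb_poly:
  assumes z: "z \<in> conj_roots" and p: "poly_over \<rat> p"
  shows "emb z (poly p \<theta>) = poly p z"
proof -
  define q where "q = (SOME q. poly_over \<rat> q \<and> poly q \<theta> = poly p \<theta>)"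
  have q: "poly_over \<rat> q \<and> poly q \<theta> = poly p \<theta>" unfolding q_def by (rule someI[of _ p]) (use p in simp)
  have "poly_over \<rat> (q - p)" "poly (q - p) \<theta> = 0" using p q by (auto intro: Q.poly_over_diff)
  then obtain r where "q - p = \<mu> * r" using Q.min_polyD(6)[OF min_poly] by blast
  hence "poly (q - p) z = poly \<mu> z * poly r z" by simp
  hence "poly q z = poly p z" using z by (simp add: conj_roots_def)
  thus ?thesis by (simp add: emb_def q_def)
qed

lemma emb_theta: "x \<in> K \<Longrightarrow> emb \<theta> x = x"
  by (erule K_poly) (use emb_poly[OF conj_roots(4)] in simp)

lemma emb_hom:
  assumes z: "z \<in> conj_roots"
  shows "x \<in> K \<Longrightarrow> y \<in> K \<Longrightarrow> emb z (x + y) = emb z x + emb z y"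
    "x \<in> K \<Longrightarrow> y \<in> K \<Longrightarrow> emb z (x * y) = emb z x * emb z y" "emb z (of_rat q) = of_rat q"
proof -
  show "emb z (of_rat q) = of_rat q" using emb_poly[OF z, of "[:of_rat q:]"] by simp
  assume "x \<in> K" "y \<in> K"
  then obtain p r where p: "poly_over \<rat> p" "x = poly p \<theta>" and r: "poly_over \<rat> r" "y = poly r \<theta>" by (metis K_poly)
  have "emb z (poly (p + r) \<theta>) = poly (p + r) z" "emb z (poly (p * r) \<theta>) = poly (p * r) z"
    using p r by (intro emb_poly[OF z] Q.poly_over_add Q.poly_over_mult; simp)+
  thus "emb z (x + y) = emb z x + emb z y" "emb z (x * y) = emb z x * emb z y"
    using p r emb_poly[OF z] by simp_all
qed

lemma emb_more:
  assumes z: "z \<in> conj_roots"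
  shows "emb z 0 = 0" "emb z 1 = 1" "x \<in> K \<Longrightarrow> emb z (- x) = - emb z x" "x \<in> K \<Longrightarrow> y \<in> K \<Longrightarrow> emb z (x - y) = emb z x - emb z y"
    "x \<in> K \<Longrightarrow> emb z (x ^ n) = emb z x ^ n" "x \<in> K \<Longrightarrow> emb z x = 0 \<longleftrightarrow> x = 0"
proof -
  show 01: "emb z 0 = 0" "emb z 1 = 1" using emb_hom(3)[OF z, of 0] emb_hom(3)[OF z, of 1] by simp_all
  have um: "emb z (- x) = - emb z x" if "x \<in> K" for x
    using emb_hom(1)[OF z that K_uminus[OF that]] 01 by (simp add: add_eq_0_iff)
  thus "x \<in> K \<Longrightarrow> emb z (- x) = - emb z x" .
  show "x \<in> K \<Longrightarrow> y \<in> K \<Longrightarrow> emb z (x - y) = emb z x - emb z y"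
    using emb_hom(1)[OF z, of x "- y"] um[of y] K_uminus by simp
  show "x \<in> K \<Longrightarrow> emb z (x ^ n) = emb z x ^ n"
    by (induction n) (auto simp: 01 emb_hom(2)[OF z] K_power)
  show "x \<in> K \<Longrightarrow> emb z x = 0 \<longleftrightarrow> x = 0"
    using emb_hom(2)[OF z, of x "inverse x"] 01 K_inverse by (cases "x = 0") auto
qed

lemma emb_algebraic:
  assumes z: "z \<in> conj_roots" and x: "x \<in> K"
  shows "emb z x \<in> alg_numbers"
proof -
  have A: "z \<in> alg_numbers" using mu z by (auto simp: alg_numbers_def conj_roots_def)
  obtain p where p: "poly_over \<rat> p" "x = poly p \<theta>" using K_poly[OF x] .
  have "\<rat> \<subseteq> alg_numbers"
    using subfield_set.K_of_rat[OF alg_numbers_subfield] by (auto elim!: Rats_cases)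
  hence "poly p z \<in> alg_numbers"
    using subfield_set.poly_closed[OF alg_numbers_subfield poly_over_mono[OF p(1)] A] by blast
  thus ?thesis using emb_poly[OF z p(1)] p(2) by simp
qed

text \<open>The trace is a rational combination of power sums of the roots of \<mu>, and these are
  rational by Newton's identities; no Galois closure is involved.\<close>

lemma trace_rat: 
  assumes x: "x \<in> K" shows "(\<Sum>z\<in>conj_roots. emb z x) \<in> \<rat>"
proof -
  obtain p where p: "poly_over \<rat> p" "x = poly p \<theta>" using K_poly[OF x] .
  interpret R: rat_algebra "\<rat> :: complex set" by (rule Q.rat_algebra)
  have ps: "(\<Sum>z\<in>conj_roots. z ^ k) \<in> \<rat>" for k
    by (rule R.coeffs_imp_power_sums[OF conj_roots(1)]) (use mu(1) conj_roots(3) in \<open>simp add: poly_over_def\<close>)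
  have "(\<Sum>z\<in>conj_roots. emb z x) = (\<Sum>z\<in>conj_roots. poly p z)"
    using emb_poly[OF _ p(1)] p(2) by simp
  also have "\<dots> = (\<Sum>i\<le>pdeg p. pcoeff p i * (\<Sum>z\<in>conj_roots. z ^ i))"
    unfolding poly_altdef by (subst sum.swap) (simp add: sum_distrib_left)
  also have "\<dots> \<in> \<rat>" using p(1) by (intro Q.K_sum Q.K_mult[OF _ ps]) (auto simp: poly_over_def)
  finally show ?thesis .
qed

text \<open>Newton's identities in the other direction: from the traces of the powers of
  \<open>x\<close> to the coefficients.\<close>

lemma char_poly_rat:
  assumes x: "x \<in> K" shows "pcoeff (\<Prod>z\<in>conj_roots. [:- emb z x, 1:]) i \<in> \<rat>"
proof -
  interpret R: rat_algebra "\<rat> :: complex set" by (rule Q.rat_algebra)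
  show ?thesis
  proof (rule R.power_sums_imp_coeffs[OF conj_roots(1)])
    fix k :: nat
    have "(\<Sum>z\<in>conj_roots. emb z x ^ k) = (\<Sum>z\<in>conj_roots. emb z (x ^ k))"
      using emb_more(5)[OF _ x] by simp
    thus "(\<Sum>z\<in>conj_roots. emb z x ^ k) \<in> \<rat>" using trace_rat[OF K_power[OF x]] by simp
  qed
qed

lemma norm_rat:
  assumes x: "x \<in> K" shows "(\<Prod>z\<in>conj_roots. emb z x) \<in> \<rat>"
proof -
  have "pcoeff (\<Prod>z\<in>conj_roots. [:- emb z x, 1:]) 0 = (\<Prod>z\<in>conj_roots. - emb z x)"
    unfolding poly_0_coeff_0[symmetric] by (simp add: poly_prod)
  also have "\<dots> = (- 1) ^ card conj_roots * (\<Prod>z\<in>conj_roots. emb z x)" by (simp add: prod_uminus)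
  finally have "(- 1) ^ card conj_roots * (\<Prod>z\<in>conj_roots. emb z x) \<in> \<rat>" using char_poly_rat[OF x, of 0] by simp
  thus ?thesis by (cases "even (card conj_roots)") simp_all
qed

lemma char_poly_root:
  assumes x: "x \<in> K" shows "poly (\<Prod>z\<in>conj_roots. [:- emb z x, 1:]) x = 0"
  using conj_roots(1,4) emb_theta[OF x] by (auto simp: poly_prod intro!: bexI[of _ \<theta>])

end

section \<open>Absolute values of a number field above a given one\<close>

context subfield_abs begin

lemma lim_to_power: "lim_to s l \<Longrightarrow> lim_to (\<lambda>n. s n ^ k) (l ^ k)"
  by (induction k) (auto intro: lim_to_const lim_to_mult K_one)

lemma lim_to_0_iff: "lim_to s 0 \<longleftrightarrow> (\<forall>n. s n \<in> K) \<and> (\<lambda>n. \<phi> (s n)) \<longlonglongrightarrow> 0"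
  by (simp add: lim_to_def K_zero)

end

lemma (in subfield_set) poly_over_prod: "(\<And>i. i \<in> A \<Longrightarrow> poly_over K (p i)) \<Longrightarrow> poly_over K (prod p A)"
  by (induction A rule: infinite_finite_induct) (auto intro: poly_over_mult)

locale rat_place = primitive_field K \<theta> \<mu> + w: subfield_abs alg_numbers w
  for K \<theta> \<mu> and w :: "complex \<Rightarrow> real" +
  fixes \<alpha> :: "rat \<Rightarrow> real"
  assumes usual: "\<alpha> \<in> usual_abs_rat" and w_rat: "w (of_rat q) = \<alpha> q"
begin

definition pull :: "complex \<Rightarrow> complex \<Rightarrow> real" where
  "pull z x = w (emb z x)"

lemma pull_abs: "z \<in> conj_roots \<Longrightarrow> subfield_abs K (pull z)"
  by unfold_locales
    (auto simp: pull_def emb_hom emb_more emb_algebraic w.nonneg w.eq_0_iff w.mult w.add)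

lemma pull_rat: "z \<in> conj_roots \<Longrightarrow> pull z (of_rat q) = \<alpha> q"
  by (simp add: pull_def emb_hom w_rat)

lemma root_algebraic: "z \<in> conj_roots \<Longrightarrow> z \<in> alg_numbers"
  using mu by (auto simp: alg_numbers_def conj_roots_def)

lemma witness: obtains b where "b \<in> K" "b \<in> \<rat>" "w b > 1"
proof -
  obtain q where "\<alpha> q > 1" using usual_abs_rat_witness[OF usual] by blast
  thus ?thesis using that[of "of_rat q"] K_of_rat w_rat by simp
qed

end

section \<open>The conjugates that induce a given absolute value\<close>

locale place_above = rat_place K \<theta> \<mu> w \<alpha> + phi: subfield_abs K \<phi> for K \<theta> \<mu> w \<alpha> and \<phi> :: "complex \<Rightarrow> real" +
  assumes phi_rat: "\<phi> (of_rat q) = \<alpha> q"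
begin

lemma rat_eq: "x \<in> \<rat> \<Longrightarrow> w x = \<phi> x"
  by (erule Rats_cases) (simp add: w_rat phi_rat)

definition conjs :: "complex set" where
  "conjs = {z \<in> conj_roots. \<forall>x\<in>K. pull z x = \<phi> x}"

text \<open>Each conjugate outside \<open>conjs\<close> has a \<open>pull z\<close> that differs
  from \<phi> somewhere on \<open>K\<close>, while a rational witness gives all of them and \<phi> a
  common value above 1.\<close>

lemma approximation:
  "\<exists>s. phi.lim_to s 1 \<and> (\<forall>z\<in>conj_roots - conjs. subfield_abs.lim_to K (pull z) s 0)"
proof -
  obtain b where b: "b \<in> K" "b \<in> \<rat>" "w b > 1" using witness .
  have "subfield_abs K \<psi> \<and> \<psi> b = \<phi> b \<and> (\<exists>x\<in>K. \<phi> x \<noteq> \<psi> x)" if psi: "\<psi> \<in> pull ` (conj_roots - conjs)" for \<psi>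
  proof -
    obtain z where z: "z \<in> conj_roots" "z \<notin> conjs" "\<psi> = pull z" using psi by blast
    have "\<psi> b = \<phi> b" using b(2) z by (auto elim!: Rats_cases simp: pull_rat phi_rat)
    moreover obtain x where "x \<in> K" "pull z x \<noteq> \<phi> x" using z(1,2) by (auto simp: conjs_def)
    hence "\<exists>x\<in>K. \<phi> x \<noteq> \<psi> x" unfolding z(3) by (intro bexI[of _ x]) auto
    ultimately show ?thesis using pull_abs z by blast
  qed
  moreover have "finite (pull ` (conj_roots - conjs))" using conj_roots(1) by simp
  moreover have "\<phi> b > 1" using b rat_eq by simp
  ultimately obtain s where "phi.lim_to s 1" "\<forall>\<psi>\<in>pull ` (conj_roots - conjs). subfield_abs.lim_to K \<psi> s 0"
    using weak_approximation[OF phi.subfield_abs_axioms _ b(1)] by blast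
  thus ?thesis by blast
qed

lemma pull_lim_to:
  assumes z: "z \<in> conj_roots" and s: "subfield_abs.lim_to K (pull z) s l"
  shows "w.lim_to (\<lambda>n. emb z (s n)) (emb z l)"
proof -
  interpret p: subfield_abs K "pull z" using pull_abs[OF z] .
  have s': "\<And>n. s n \<in> K" "l \<in> K" "(\<lambda>n. pull z (s n - l)) \<longlonglongrightarrow> 0" using s by (auto simp: p.lim_to_def)
  thus ?thesis using z by (intro w.lim_toI emb_algebraic) (auto simp: pull_def emb_more)
qed

lemma conjs_lim_to:
  assumes z: "z \<in> conjs" and s: "phi.lim_to s l"
  shows "w.lim_to (\<lambda>n. emb z (s n)) (emb z l)"
proof -
  have z': "z \<in> conj_roots" using z by (simp add: conjs_def)
  have s': "\<And>n. s n \<in> K" "l \<in> K" "(\<lambda>n. \<phi> (s n - l)) \<longlonglongrightarrow> 0" using s by (auto simp: phi.lim_to_def)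
  moreover have "\<phi> (s n - l) = pull z (s n - l)" for n using z s' K_diff by (simp add: conjs_def)
  ultimately show ?thesis using z'
    by (intro pull_lim_to) (auto simp: subfield_abs.lim_to_def[OF pull_abs[OF z']])
qed

text \<open>Otherwise weak approximation yields elements close to 1 at \<phi> whose conjugates all
  tend to 0 under \<open>w\<close>. The lower coefficients of their characteristic polynomials then
  tend to 0, at \<phi> as well because they are rational, and the characteristic equation makes
  \<open>s n ^ d\<close> tend to 0 at \<phi>, against the limit 1.\<close>

theorem conjs_ne: "conjs \<noteq> {}"
proof
  assume emp: "conjs = {}"
  obtain s where s: "phi.lim_to s 1" "\<And>z. z \<in> conj_roots \<Longrightarrow> subfield_abs.lim_to K (pull z) s 0"
    using approximation emp by auto
  have sK: "s n \<in> K" for n using s(1) by (simp add: phi.lim_to_def)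
  define c where "c = (\<lambda>i n. pcoeff (\<Prod>z\<in>conj_roots. [:- emb z (s n), 1:]) i)"
  define d where "d = card conj_roots"
  have deg: "pdeg (\<Prod>z\<in>conj_roots. [:- f z, 1:]) = d" for f :: "complex \<Rightarrow> complex"
    by (simp add: d_def degree_prod_eq_sum_degree)
  have lead: "pcoeff (\<Prod>z\<in>conj_roots. [:- f z, 1:]) d = 1" for f :: "complex \<Rightarrow> complex"
    using deg[of f] Polynomial.lead_coeff_prod[of "\<lambda>z. [:- f z, 1:]" conj_roots] by simp
  have cQ: "c i n \<in> \<rat>" for i n unfolding c_def using char_poly_rat[OF sK] .
  have "phi.lim_to (c i) 0" if i: "i < d" for i
  proof -
    have "w.lim_to (c i) (pcoeff (\<Prod>z\<in>conj_roots. [:- 0, 1:]) i)"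
      unfolding c_def
      using pull_lim_to[OF _ s(2)] emb_more(1) by (intro w.lim_to_prod_coeff conj_roots(1)) force
    moreover have "(\<Prod>z\<in>conj_roots. [:- 0, 1:]) = (monom 1 d :: complex poly)"
      by (simp add: d_def monom_altdef)
    ultimately have "w.lim_to (c i) 0" using i by simp
    moreover have "c i n \<in> K" for n using cQ[of i n] K_of_rat by (metis Rats_cases)
    ultimately show ?thesis using cQ by (simp add: w.lim_to_0_iff phi.lim_to_0_iff rat_eq)
  qed
  hence "phi.lim_to (\<lambda>n. \<Sum>i<d. c i n * s n ^ i) (\<Sum>i<d. 0 * 1 ^ i)"
    using s(1) by (intro phi.lim_to_sum phi.lim_to_mult phi.lim_to_power) auto
  hence "(\<lambda>n. \<phi> (\<Sum>i<d. c i n * s n ^ i)) \<longlonglongrightarrow> 0" using phi.lim_to_abs by fastforce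
  moreover have "\<phi> (\<Sum>i<d. c i n * s n ^ i) = \<phi> (s n ^ d)" for n
  proof -
    have "0 = (\<Sum>i\<le>d. c i n * s n ^ i)"
      using char_poly_root[OF sK[of n]] unfolding poly_altdef deg c_def by simp
    also have "\<dots> = (\<Sum>i<d. c i n * s n ^ i) + s n ^ d"
      unfolding lessThan_Suc_atMost[symmetric] using lead by (simp add: c_def)
    finally have "(\<Sum>i<d. c i n * s n ^ i) = - (s n ^ d)" by (simp add: eq_neg_iff_add_eq_0)
    thus ?thesis using K_power[OF sK] by simp
  qed
  moreover have "(\<lambda>n. \<phi> (s n ^ d)) \<longlonglongrightarrow> \<phi> (1 ^ d)" using phi.lim_to_abs[OF phi.lim_to_power[OF s(1)]] .
  ultimately show False using LIMSEQ_unique by fastforce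
qed

lemma conjs_finite: "finite conjs" and conjs_sub: "conjs \<subseteq> conj_roots"
  using conj_roots(1) by (auto simp: conjs_def)

lemma conjs_poly:
  assumes "z \<in> conjs" "poly_over \<rat> p" shows "w (poly p z) = \<phi> (poly p \<theta>)"
  using assms poly_in_K[OF assms(2)] emb_poly[of z p] by (auto simp: conjs_def pull_def)

text \<open>It turns out to be the dimension of the completion, with the powers of \<theta> below
  this exponent as a basis.\<close>

definition local_dim :: nat where
  "local_dim = card conjs"

lemma local_dim_pos: "local_dim > 0"
  using conjs_ne conjs_finite by (simp add: local_dim_def card_gt_0_iff)

text \<open>Lagrange interpolation at \<open>conjs\<close>: at each of these points a rational
  polynomial has the same absolute value as at \<theta>. The bound gives the independence of the
  powers of \<theta>, and it makes coefficient sequences Cauchy when the values at \<theta>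
  are.\<close>

lemma coeff_bound:
  "\<exists>C\<ge>0. \<forall>P. poly_over \<rat> P \<longrightarrow> pdeg P < local_dim \<longrightarrow> (\<forall>i. \<phi> (pcoeff P i) \<le> C * \<phi> (poly P \<theta>))"
proof -
  \<comment> \<open>The Lagrange basis polynomials. Their coefficients are algebraic numbers, so
    \<open>w\<close> can measure them.\<close>
  define L where "L = (\<lambda>z. \<Prod>y\<in>conjs - {z}. Polynomial.smult (inverse (z - y)) [:- y, 1:])"
  have A: "z \<in> alg_numbers" if "z \<in> conjs" for z using that root_algebraic conjs_sub by blast
  have L_alg: "poly_over alg_numbers (L z)" if z: "z \<in> conjs" for z
  proof -
    have "poly_over alg_numbers (Polynomial.smult (inverse (z - y)) [:- y, 1:])" if "y \<in> conjs" for y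
      using A[OF z] A[OF that] w.K_one w.poly_over_0
      by (intro w.poly_over_smult) (auto intro: w.K_inverse w.K_diff w.K_uminus)
    thus ?thesis unfolding L_def by (intro w.poly_over_prod) auto
  qed
  have L_deg: "pdeg (L z) < local_dim" if z: "z \<in> conjs" for z
  proof -
    have "pdeg (L z) \<le> (\<Sum>y\<in>conjs - {z}. pdeg (Polynomial.smult (inverse (z - y)) [:- y, 1:]))"
      unfolding L_def by (rule order_trans[OF degree_prod_sum_le]) (use conjs_finite in \<open>auto simp: o_def\<close>)
    also have "\<dots> \<le> (\<Sum>y\<in>conjs - {z}. 1)" by (intro sum_mono) auto
    also have "\<dots> < local_dim" using z conjs_finite local_dim_pos by (simp add: local_dim_def)
    finally show ?thesis .
  qed
  have L_val: "poly (L z) y = (if y = z then 1 else 0)" if "y \<in> conjs" "z \<in> conjs" for y z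
  proof (cases "y = z")
    case True
    have "poly (L z) z = (\<Prod>y\<in>conjs - {z}. 1)" unfolding L_def poly_prod
      by (intro prod.cong) (auto simp: field_simps)
    thus ?thesis using True by simp
  next
    case False
    thus ?thesis unfolding L_def poly_prod using that conjs_finite by (auto intro!: bexI[of _ y])
  qed
  define C where "C = (\<lambda>i. \<Sum>z\<in>conjs. w (pcoeff (L z) i))"
  have LA: "pcoeff (L z) i \<in> alg_numbers" if "z \<in> conjs" for z i using L_alg[OF that] by (simp add: poly_over_def)
  have C0: "C i \<ge> 0" for i unfolding C_def using LA w.nonneg by (intro sum_nonneg) auto
  have main: "\<phi> (pcoeff P i) \<le> C i * \<phi> (poly P \<theta>)" if P: "poly_over \<rat> P" "pdeg P < local_dim" for P i
  proof -
    have "P = (\<Sum>z\<in>conjs. Polynomial.smult (poly P z) (L z))"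
    proof (rule poly_eqI_degree[of conjs])
      fix y assume y: "y \<in> conjs"
      have "poly (\<Sum>z\<in>conjs. Polynomial.smult (poly P z) (L z)) y = (\<Sum>z\<in>conjs. if y = z then poly P z else 0)"
        using y by (simp add: poly_sum L_val if_distrib cong: if_cong)
      also have "\<dots> = poly P y" using y conjs_finite by simp
      finally show "poly P y = poly (\<Sum>z\<in>conjs. Polynomial.smult (poly P z) (L z)) y" by simp
    next
      show "pdeg P < card conjs" using P by (simp add: local_dim_def)
      have "pdeg (\<Sum>z\<in>conjs. Polynomial.smult (poly P z) (L z)) \<le> local_dim - 1"
      proof (rule degree_sum_le[OF conjs_finite])
        fix z assume "z \<in> conjs"
        thus "pdeg (Polynomial.smult (poly P z) (L z)) \<le> local_dim - 1"
          using L_deg[of z] degree_smult_le[of "poly P z" "L z"] by linarith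
      qed
      thus "pdeg (\<Sum>z\<in>conjs. Polynomial.smult (poly P z) (L z)) < card conjs" using local_dim_pos by (simp add: local_dim_def)
    qed
    hence "pcoeff P i = pcoeff (\<Sum>z\<in>conjs. Polynomial.smult (poly P z) (L z)) i" by simp
    also have "\<dots> = (\<Sum>z\<in>conjs. poly P z * pcoeff (L z) i)" by (simp add: coeff_sum)
    finally have eq: "pcoeff P i = (\<Sum>z\<in>conjs. poly P z * pcoeff (L z) i)" .
    have PA: "poly P z \<in> alg_numbers" if "z \<in> conjs" for z
      using w.poly_closed[OF poly_over_mono[OF P(1)] A[OF that]] w.K_of_rat by (auto elim!: Rats_cases)
    have "\<phi> (pcoeff P i) = w (pcoeff P i)" using P(1) rat_eq by (simp add: poly_over_def)
    also have "\<dots> \<le> (\<Sum>z\<in>conjs. w (poly P z * pcoeff (L z) i))"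
      unfolding eq using PA LA by (intro w.sum_le w.K_mult) auto
    also have "\<dots> = (\<Sum>z\<in>conjs. \<phi> (poly P \<theta>) * w (pcoeff (L z) i))"
      using PA LA conjs_poly[OF _ P(1)] by (intro sum.cong) (auto simp: w.mult)
    also have "\<dots> = C i * \<phi> (poly P \<theta>)" by (simp add: C_def sum_distrib_left[symmetric] mult.commute)
    finally show ?thesis .
  qed
  define D where "D = (\<Sum>i<local_dim. C i)"
  have "\<phi> (pcoeff P i) \<le> D * \<phi> (poly P \<theta>)" if P: "poly_over \<rat> P" "pdeg P < local_dim" for P i
  proof (cases "i < local_dim")
    case True
    have "C i \<le> D" unfolding D_def using True C0 by (intro member_le_sum) auto
    hence "C i * \<phi> (poly P \<theta>) \<le> D * \<phi> (poly P \<theta>)"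
      using phi.nonneg[OF poly_in_K[OF P(1)]] by (intro mult_right_mono)
    thus ?thesis using main[OF P, of i] by simp
  next
    case False
    hence "pcoeff P i = 0" using P(2) by (intro coeff_eq_0) simp
    moreover have "D \<ge> 0" unfolding D_def using C0 by (intro sum_nonneg) auto
    ultimately show ?thesis using phi.nonneg[OF poly_in_K[OF P(1)]] by simp
  qed
  moreover have "D \<ge> 0" unfolding D_def using C0 by (intro sum_nonneg) auto
  ultimately show ?thesis by blast
qed

text \<open>The closure in \<open>K\<close> of the rational span of the powers of \<theta> below
  \<open>local_dim\<close>. That it is all of \<open>K\<close> is the spanning half of the basis
  statement, expressed by approximations because \<open>K\<close> is not complete.\<close>

definition approximable :: "complex \<Rightarrow> bool" where
  "approximable x \<longleftrightarrow> x \<in> K \<and> (\<forall>e>0. \<exists>P. poly_over \<rat> P \<and> pdeg P < local_dim \<and> \<phi> (x - poly P \<theta>) < e)"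

lemma approximable_poly: "poly_over \<rat> P \<Longrightarrow> pdeg P < local_dim \<Longrightarrow> approximable (poly P \<theta>)"
  unfolding approximable_def using poly_in_K by (auto intro!: exI[of _ P])

lemma approximable_limit:
  assumes x: "x \<in> K" and lim: "\<And>e. e > 0 \<Longrightarrow> \<exists>y. approximable y \<and> \<phi> (x - y) < e"
  shows "approximable x"
  unfolding approximable_def
proof (intro conjI allI impI x)
  fix e :: real assume e: "e > 0"
  obtain y where y: "approximable y" "\<phi> (x - y) < e / 2" using lim[of "e / 2"] e by auto
  obtain P where P: "poly_over \<rat> P" "pdeg P < local_dim" "\<phi> (y - poly P \<theta>) < e / 2"
    using y(1) e unfolding approximable_def by (meson half_gt_zero)
  have yK: "y \<in> K" using y by (simp add: approximable_def)
  have "\<phi> (x - poly P \<theta>) < e"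
    using phi.add[of "x - y" "y - poly P \<theta>"] y P K_diff x yK poly_in_K[OF P(1)] by simp
  thus "\<exists>P. poly_over \<rat> P \<and> pdeg P < local_dim \<and> \<phi> (x - poly P \<theta>) < e" using P by blast
qed

lemma approximable_add:
  assumes x: "approximable x" and y: "approximable y"
  shows "approximable (x + y)"
  unfolding approximable_def
proof (intro conjI allI impI)
  have xK: "x \<in> K" "y \<in> K" using x y by (auto simp: approximable_def)
  thus "x + y \<in> K" by (intro K_add)
  fix e :: real assume e: "e > 0"
  obtain P where P: "poly_over \<rat> P" "pdeg P < local_dim" "\<phi> (x - poly P \<theta>) < e / 2"
    using x e unfolding approximable_def by (meson half_gt_zero)
  obtain R where R: "poly_over \<rat> R" "pdeg R < local_dim" "\<phi> (y - poly R \<theta>) < e / 2"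
    using y e unfolding approximable_def by (meson half_gt_zero)
  have "\<phi> (x + y - poly (P + R) \<theta>) < e"
    using phi.add[of "x - poly P \<theta>" "y - poly R \<theta>"] P R K_diff xK poly_in_K[OF P(1)] poly_in_K[OF R(1)]
    by (simp add: algebra_simps)
  moreover have "pdeg (P + R) < local_dim" using P R by (intro degree_add_less)
  ultimately show "\<exists>P. poly_over \<rat> P \<and> pdeg P < local_dim \<and> \<phi> (x + y - poly P \<theta>) < e"
    using Q.poly_over_add[OF P(1) R(1)] by blast
qed

lemma approximable_smult:
  assumes q: "q \<in> \<rat>" and x: "approximable x"
  shows "approximable (q * x)"
  unfolding approximable_def
proof (intro conjI allI impI)
  have xK: "x \<in> K" using x by (auto simp: approximable_def)
  have qK: "q \<in> K" using q K_of_rat by (auto elim!: Rats_cases)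
  show "q * x \<in> K" using xK qK by (rule K_mult[rotated])
  fix e :: real assume e: "e > 0"
  have q1: "\<phi> q + 1 > 0" using phi.nonneg[OF qK] by simp
  obtain P where P: "poly_over \<rat> P" "pdeg P < local_dim" "\<phi> (x - poly P \<theta>) < e / (\<phi> q + 1)"
    using x e q1 unfolding approximable_def by (meson divide_pos_pos)
  have "\<phi> (q * x - poly (Polynomial.smult q P) \<theta>) = \<phi> q * \<phi> (x - poly P \<theta>)"
    using qK xK poly_in_K[OF P(1)] K_diff by (simp add: phi.mult[symmetric] algebra_simps)
  also have "\<dots> \<le> (\<phi> q + 1) * \<phi> (x - poly P \<theta>)"
    using phi.nonneg[of "x - poly P \<theta>"] xK poly_in_K[OF P(1)] K_diff by (intro mult_right_mono) auto
  also have "\<dots> < e" using P(3) q1 by (simp add: field_simps)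
  finally have "\<phi> (q * x - poly (Polynomial.smult q P) \<theta>) < e" .
  moreover have "pdeg (Polynomial.smult q P) < local_dim" using P(2) degree_smult_le le_less_trans by blast
  ultimately show "\<exists>P. poly_over \<rat> P \<and> pdeg P < local_dim \<and> \<phi> (q * x - poly P \<theta>) < e"
    using Q.poly_over_smult[OF q P(1)] by blast
qed

text \<open>The elementary symmetric functions of the conjugates above \<open>\<phi>\<close> are limits of rationals,
  since their power sums are limits of traces of suitable approximations.\<close>

lemma conjs_coeff_limit:
  "\<exists>s. (\<forall>n. s n \<in> \<rat>) \<and> w.lim_to s (pcoeff (\<Prod>z\<in>conjs. [:- z, 1:]) i)"
proof -
  define R where "R = {l. \<exists>s. (\<forall>n. s n \<in> \<rat>) \<and> w.lim_to s l}"
  interpret R: rat_algebra R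
  proof
    fix q show "of_rat q \<in> R"
      unfolding R_def using w.lim_to_const[OF w.K_of_rat, of q] by (auto intro!: exI[of _ "\<lambda>n. of_rat q"])
    fix x y assume "x \<in> R" "y \<in> R"
    then obtain s t where st: "\<forall>n. s n \<in> \<rat>" "w.lim_to s x" "\<forall>n. t n \<in> \<rat>" "w.lim_to t y" unfolding R_def by blast
    have "\<forall>n. s n + t n \<in> \<rat>" "\<forall>n. s n * t n \<in> \<rat>" using st by (simp_all add: Rats_add Rats_mult)
    moreover have "w.lim_to (\<lambda>n. s n + t n) (x + y)" "w.lim_to (\<lambda>n. s n * t n) (x * y)"
      using w.lim_to_add[OF st(2) st(4)] w.lim_to_mult[OF st(2) st(4)] .
    ultimately show "x + y \<in> R" "x * y \<in> R"
      unfolding R_def by (auto intro: exI[of _ "\<lambda>n. s n + t n"] exI[of _ "\<lambda>n. s n * t n"])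
  qed
  obtain s where s: "phi.lim_to s 1" "\<And>z. z \<in> conj_roots - conjs \<Longrightarrow> subfield_abs.lim_to K (pull z) s 0"
    using approximation by blast
  have sK: "s n \<in> K" for n using s(1) by (simp add: phi.lim_to_def)
  have "(\<Sum>z\<in>conjs. z ^ k) \<in> R" for k
  proof -
    \<comment> \<open>A sequence of traces, hence rational; its terms at conjugates outside
      \<open>conjs\<close> fade away and the others tend to \<open>z ^ k\<close>.\<close>
    define t where "t = (\<lambda>n. \<Sum>z\<in>conj_roots. emb z (\<theta> ^ k * s n))"
    have emb: "emb z (\<theta> ^ k * s n) = z ^ k * emb z (s n)" if "z \<in> conj_roots" for z n
      using that emb_poly[OF that, of "[:0, 1:]"] sK theta_K
      by (simp add: emb_hom emb_more K_power)
    have "w.lim_to (\<lambda>n. \<Sum>z\<in>conj_roots. z ^ k * emb z (s n)) (\<Sum>z\<in>conj_roots. z ^ k * (if z \<in> conjs then 1 else 0))"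
    proof (intro w.lim_to_sum w.lim_to_mult w.lim_to_const w.K_power root_algebraic)
      fix z assume z: "z \<in> conj_roots"
      show "w.lim_to (\<lambda>n. emb z (s n)) (if z \<in> conjs then 1 else 0)"
        using conjs_lim_to[OF _ s(1), of z] pull_lim_to[OF z s(2)] z emb_more(1,2)[OF z] by auto
    qed
    moreover have "(\<Sum>z\<in>conj_roots. z ^ k * (if z \<in> conjs then 1 else 0)) = (\<Sum>z\<in>conjs. z ^ k)"
      using conj_roots(1) conjs_sub by (intro sum.mono_neutral_cong_right) auto
    moreover have "t = (\<lambda>n. \<Sum>z\<in>conj_roots. z ^ k * emb z (s n))" unfolding t_def using emb by simp
    ultimately have "w.lim_to t (\<Sum>z\<in>conjs. z ^ k)" by simp
    moreover have "t n \<in> \<rat>" for n unfolding t_def using sK theta_K by (intro trace_rat K_mult K_power)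
    ultimately show ?thesis unfolding R_def by blast
  qed
  hence "pcoeff (\<Prod>z\<in>conjs. [:- z, 1:]) i \<in> R" by (intro R.power_sums_imp_coeffs conjs_finite)
  thus ?thesis unfolding R_def by blast
qed

text \<open>The monic polynomial with root set \<open>conjs\<close> is approximated by rational
  monic polynomials. Being rational, these have the same absolute value at \<theta> under \<phi> as
  at any \<open>z\<close> in \<open>conjs\<close> under \<open>w\<close>, and at \<open>z\<close>
  they tend to 0.\<close>

lemma approximable_theta_power: "approximable (\<theta> ^ local_dim)"
  unfolding approximable_def
proof (intro conjI allI impI)
  show "\<theta> ^ local_dim \<in> K" using theta_K by (rule K_power)
  define g where "g = (\<Prod>z\<in>conjs. [:- z, 1:])"
  have gdeg: "pdeg g = local_dim" by (simp add: g_def local_dim_def degree_prod_eq_sum_degree)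
  have glead: "pcoeff g local_dim = 1"
    using gdeg Polynomial.lead_coeff_prod[of "\<lambda>z. [:- z, 1:]" conjs] by (simp add: g_def)
  obtain s where s: "\<And>i n. s i n \<in> \<rat>" "\<And>i. w.lim_to (s i) (pcoeff g i)"
    using conjs_coeff_limit unfolding g_def by metis
  obtain z where z: "z \<in> conjs" using conjs_ne by blast
  have zA: "z \<in> alg_numbers" using z conjs_sub root_algebraic by blast
  define P where "P = (\<lambda>n. \<Sum>i<local_dim. monom (- s i n) i)"
  have P: "poly_over \<rat> (P n)" "pdeg (P n) < local_dim" "poly (P n) x = - (\<Sum>i<local_dim. s i n * x ^ i)" for n x
  proof -
    have co: "pcoeff (P n) i = (if i < local_dim then - s i n else 0)" for i
      by (simp add: P_def coeff_sum if_distrib cong: if_cong)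
    show "poly_over \<rat> (P n)" unfolding poly_over_def co using s(1) by simp
    have "pdeg (P n) \<le> local_dim - 1" by (rule degree_le) (auto simp: co)
    thus "pdeg (P n) < local_dim" using local_dim_pos by simp
    show "poly (P n) x = - (\<Sum>i<local_dim. s i n * x ^ i)" by (simp add: P_def poly_sum poly_monom sum_negf)
  qed
  have "w.lim_to (\<lambda>n. z ^ local_dim + (\<Sum>i<local_dim. s i n * z ^ i)) (z ^ local_dim + (\<Sum>i<local_dim. pcoeff g i * z ^ i))"
    using s(2) zA by (intro w.lim_to_add w.lim_to_sum w.lim_to_mult w.lim_to_const w.K_power)
  moreover have "z ^ local_dim + (\<Sum>i<local_dim. pcoeff g i * z ^ i) = poly g z"
    unfolding poly_altdef gdeg lessThan_Suc_atMost[symmetric] by (simp add: glead)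
  moreover have "poly g z = 0" using z conjs_finite by (auto simp: g_def poly_prod)
  ultimately have "(\<lambda>n. w (z ^ local_dim + (\<Sum>i<local_dim. s i n * z ^ i))) \<longlonglongrightarrow> 0"
    by (simp add: w.lim_to_0_iff)
  moreover have "w (z ^ local_dim + (\<Sum>i<local_dim. s i n * z ^ i)) = \<phi> (\<theta> ^ local_dim - poly (P n) \<theta>)" for n
  proof -
    have "poly_over \<rat> (monom 1 local_dim :: complex poly)" by (simp add: poly_over_def)
    hence "poly_over \<rat> (monom 1 local_dim - P n)" using P(1) by (intro Q.poly_over_diff)
    from conjs_poly[OF z this] show ?thesis by (simp add: P(3) poly_monom)
  qed
  ultimately have lim: "(\<lambda>n. \<phi> (\<theta> ^ local_dim - poly (P n) \<theta>)) \<longlonglongrightarrow> 0" by simp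
  fix e :: real assume "e > 0"
  hence "\<forall>\<^sub>F n in sequentially. \<phi> (\<theta> ^ local_dim - poly (P n) \<theta>) < e" using lim by (intro order_tendstoD)
  then obtain n where "\<phi> (\<theta> ^ local_dim - poly (P n) \<theta>) < e" by (auto simp: eventually_sequentially)
  thus "\<exists>P. poly_over \<rat> P \<and> pdeg P < local_dim \<and> \<phi> (\<theta> ^ local_dim - poly P \<theta>) < e" using P(1,2) by blast
qed

lemma approximable_theta_mult:
  assumes x: "approximable x" shows "approximable (\<theta> * x)"
proof (rule approximable_limit)
  have xK: "x \<in> K" using x by (simp add: approximable_def)
  thus "\<theta> * x \<in> K" using theta_K by (intro K_mult)
  fix e :: real assume e: "e > 0"
  \<comment> \<open>The summand 1 avoids a division by zero when \<theta> is 0.\<close>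
  have t1: "\<phi> \<theta> + 1 > 0" using phi.nonneg[OF theta_K] by simp
  obtain P where P: "poly_over \<rat> P" "pdeg P < local_dim" "\<phi> (x - poly P \<theta>) < e / (\<phi> \<theta> + 1)"
    using x e t1 unfolding approximable_def by (meson divide_pos_pos)
  \<comment> \<open>\<open>pCons 0 P\<close> may reach degree \<open>local_dim\<close>; its top term
    is split off and treated by \<open>approximable_theta_power\<close>.\<close>
  define c where "c = pcoeff P (local_dim - 1)"
  define R where "R = pCons 0 P - monom c local_dim"
  have cQ: "c \<in> \<rat>" using P(1) by (simp add: c_def poly_over_def)
  have "poly_over \<rat> (monom c local_dim)" using cQ by (simp add: poly_over_def)
  hence R: "poly_over \<rat> R" unfolding R_def using P(1) by (intro Q.poly_over_diff) auto
  have "pcoeff R i = 0" if "i > local_dim - 1" for i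
  proof (cases i)
    case (Suc j)
    show ?thesis
    proof (cases "i = local_dim")
      case True
      hence d: "local_dim = Suc j" using Suc by simp
      show ?thesis unfolding R_def c_def True d by simp
    next
      case False
      hence "pdeg P < j" using P(2) that Suc by linarith
      thus ?thesis using False Suc by (simp add: R_def coeff_eq_0)
    qed
  qed (use that in simp)
  hence "pdeg R \<le> local_dim - 1" by (intro degree_le) simp
  hence "approximable (poly R \<theta> + c * \<theta> ^ local_dim)"
    using R cQ local_dim_pos by (intro approximable_add approximable_poly approximable_smult approximable_theta_power) auto
  moreover have "poly R \<theta> + c * \<theta> ^ local_dim = \<theta> * poly P \<theta>" by (simp add: R_def poly_monom)
  ultimately have "approximable (\<theta> * poly P \<theta>)" by simp
  moreover have "\<phi> (\<theta> * x - \<theta> * poly P \<theta>) < e"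
  proof -
    have "\<phi> (\<theta> * x - \<theta> * poly P \<theta>) = \<phi> \<theta> * \<phi> (x - poly P \<theta>)"
      using theta_K xK poly_in_K[OF P(1)] K_diff by (simp add: phi.mult[symmetric] right_diff_distrib)
    also have "\<dots> \<le> (\<phi> \<theta> + 1) * \<phi> (x - poly P \<theta>)"
      using phi.nonneg[of "x - poly P \<theta>"] xK poly_in_K[OF P(1)] K_diff by (intro mult_right_mono) auto
    also have "\<dots> < e" using P(3) t1 by (simp add: field_simps)
    finally show ?thesis .
  qed
  ultimately show "\<exists>y. approximable y \<and> \<phi> (\<theta> * x - y) < e" by blast
qed

theorem approximable_all:
  assumes "x \<in> K" shows "approximable x"
proof -
  have "approximable (poly p \<theta>)" if "poly_over \<rat> p" for p
    using that
  proof (induction p)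
    case 0
    show ?case using approximable_poly[of 0] local_dim_pos by simp
  next
    case (pCons a p)
    have "approximable (poly [:a:] \<theta>)" using pCons local_dim_pos by (intro approximable_poly) auto
    moreover have "approximable (\<theta> * poly p \<theta>)" using pCons by (intro approximable_theta_mult) auto
    ultimately show ?case using approximable_add by fastforce
  qed
  thus ?thesis using K_poly[OF assms] by blast
qed

end

section \<open>Local degrees\<close>

context place_above begin

lemma abs_valued: "abs_valued_field (field_of K) \<phi>"
  using field_of_abs_iff[OF subfield_set_axioms] phi.subfield_abs_axioms by blast

interpretation V: abs_valued_field "field_of K" \<phi>
  by (rule abs_valued)

interpretation KV: field V.compl
  by (rule V.field_compl)

text \<open>The counterpart of \<open>local_base\<close> for \<phi> itself, so that places stay out
  of the computation of the dimension.\<close>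

definition base_field :: "(nat \<Rightarrow> complex) set set" where
  "base_field = {C \<in> carrier V.compl. \<exists>f\<in>C. range f \<subseteq> \<rat>}"

lemma V_minus: "x \<in> K \<Longrightarrow> y \<in> K \<Longrightarrow> x \<ominus>\<^bsub>field_of K\<^esub> y = x - y"
  by (rule field_of_diff[OF subfield_set_axioms])

lemma V_inv: "x \<in> K \<Longrightarrow> x \<noteq> 0 \<Longrightarrow> inv\<^bsub>field_of K\<^esub> x = inverse x"
  by (rule V.comm_inv_char) (auto intro: K_inverse)

lemma rat_K: "q \<in> \<rat> \<Longrightarrow> q \<in> K"
  using K_of_rat by (auto elim!: Rats_cases)

lemma cauchy_iff:
  "f \<in> carrier V.cauchy_seqs \<longleftrightarrow> (\<forall>n. f n \<in> K) \<and> (\<forall>e>0. \<exists>k. \<forall>m\<ge>k. \<forall>n\<ge>k. \<phi> (f m - f n) < e)"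
  unfolding V.cauchy_carrier field_of_simps by (auto simp: V_minus)

lemma base_field_iff:
  "C \<in> base_field \<longleftrightarrow> (\<exists>f. f \<in> carrier V.cauchy_seqs \<and> range f \<subseteq> \<rat> \<and> C = V.cls f)"
proof
  assume C: "C \<in> base_field"
  then obtain g where g: "g \<in> carrier V.cauchy_seqs" "C = V.cls g" unfolding base_field_def V.compl_carrier by blast
  obtain f where f: "f \<in> C" "range f \<subseteq> \<rat>" using C unfolding base_field_def by blast
  have "f \<in> carrier V.cauchy_seqs" "(\<lambda>n. \<phi> (f n \<ominus>\<^bsub>field_of K\<^esub> g n)) \<longlonglongrightarrow> 0"
    using f(1) V.mem_cls[OF g(1)] g(2) by auto
  hence "f \<in> carrier V.cauchy_seqs" "V.cls f = C" using V.cls_eq_iff[of f g] g by auto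
  thus "\<exists>f. f \<in> carrier V.cauchy_seqs \<and> range f \<subseteq> \<rat> \<and> C = V.cls f" using f by blast
next
  assume "\<exists>f. f \<in> carrier V.cauchy_seqs \<and> range f \<subseteq> \<rat> \<and> C = V.cls f"
  then obtain f where f: "f \<in> carrier V.cauchy_seqs" "range f \<subseteq> \<rat>" "C = V.cls f" by blast
  have "f \<in> V.cls f" using V.mem_cls[OF f(1)] f(1) V.cauchyD[OF f(1)] by (simp add: V_minus)
  thus "C \<in> base_field" using f V.cls_in unfolding base_field_def by blast
qed

lemma base_field_subfield: "subfield base_field V.compl"
proof (rule KV.subfieldI')
  have mem: "V.cls f \<in> base_field" if "f \<in> carrier V.cauchy_seqs" "\<And>n. f n \<in> \<rat>" for f
    unfolding base_field_iff using that by blast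
  have mult: "C \<otimes>\<^bsub>V.compl\<^esub> D \<in> base_field" "C \<oplus>\<^bsub>V.compl\<^esub> D \<in> base_field"
    if C: "C \<in> base_field" and D: "D \<in> base_field" for C D
  proof -
    obtain f where f: "f \<in> carrier V.cauchy_seqs" "range f \<subseteq> \<rat>" "C = V.cls f" using C base_field_iff by blast
    obtain g where g: "g \<in> carrier V.cauchy_seqs" "range g \<subseteq> \<rat>" "D = V.cls g" using D base_field_iff by blast
    have q: "f n \<in> \<rat>" "g n \<in> \<rat>" for n using f g by auto
    show "C \<otimes>\<^bsub>V.compl\<^esub> D \<in> base_field"
      using mem[OF V.cauchy_mult[OF f(1) g(1)]] q f g by (simp add: V.compl_simps)
    show "C \<oplus>\<^bsub>V.compl\<^esub> D \<in> base_field"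
      using mem[OF V.cauchy_add[OF f(1) g(1)]] q f g by (simp add: V.compl_simps)
  qed
  have sub: "base_field \<subseteq> carrier V.compl" by (auto simp: base_field_def)
  have one: "\<one>\<^bsub>V.compl\<^esub> \<in> base_field"
    unfolding V.compl_simps(3) using V.cauchy_const[of 1] by (intro mem) (auto simp: K_one)
  have m1: "V.cls (\<lambda>n. - 1) \<in> base_field"
    using V.cauchy_const[of "- 1"] K_uminus[OF K_one] by (intro mem) auto
  have "V.cls (\<lambda>n. - 1) \<oplus>\<^bsub>V.compl\<^esub> \<one>\<^bsub>V.compl\<^esub> = \<zero>\<^bsub>V.compl\<^esub>"
    using V.cauchy_const[of "- 1"] V.cauchy_const[of 1] V.cauchy_const[of 0] K_uminus[OF K_one] K_one K_zero
      V.cls_zero_iff[of "\<lambda>n. 0"] by (simp add: V.compl_simps(2,3))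
  hence neg: "\<ominus>\<^bsub>V.compl\<^esub> \<one>\<^bsub>V.compl\<^esub> = V.cls (\<lambda>n. - 1)"
    using m1 sub KV.minus_equality by blast
  show "subring base_field V.compl"
  proof (rule KV.subringI)
    fix C assume C: "C \<in> base_field"
    have "\<ominus>\<^bsub>V.compl\<^esub> C = (\<ominus>\<^bsub>V.compl\<^esub> \<one>\<^bsub>V.compl\<^esub>) \<otimes>\<^bsub>V.compl\<^esub> C"
      using C sub by (simp add: KV.l_minus subset_iff)
    thus "\<ominus>\<^bsub>V.compl\<^esub> C \<in> base_field" using mult(1)[OF m1 C] neg by simp
  qed (use sub one mult in auto)
  fix C assume "C \<in> base_field - {\<zero>\<^bsub>V.compl\<^esub>}"
  hence C: "C \<in> base_field" "C \<noteq> \<zero>\<^bsub>V.compl\<^esub>" by auto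
  obtain f where f: "f \<in> carrier V.cauchy_seqs" "range f \<subseteq> \<rat>" "C = V.cls f" using C(1) base_field_iff by blast
  \<comment> \<open>The termwise description of the inverse shows that its terms are again
    rational.\<close>
  obtain g where g: "g \<in> carrier V.cauchy_seqs" "C \<otimes>\<^bsub>V.compl\<^esub> V.cls g = \<one>\<^bsub>V.compl\<^esub>"
    "\<And>n. g n = 0 \<or> f n \<noteq> 0 \<and> g n = inv\<^bsub>field_of K\<^esub> (f n)"
    using V.cls_inverse[OF f(1)] C(2) f(3) by auto
  have "g n \<in> \<rat>" for n
  proof -
    have "f n \<in> \<rat>" using f by auto
    thus ?thesis using g(3)[of n] V_inv[of "f n"] rat_K by auto
  qed
  hence "V.cls g \<in> base_field" using mem g(1) by blast
  moreover have "inv\<^bsub>V.compl\<^esub> C = V.cls g"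
    using g C sub V.cls_in[OF g(1)] by (intro KV.comm_inv_char) auto
  ultimately show "inv\<^bsub>V.compl\<^esub> C \<in> base_field" by simp
qed

text \<open>The factor \<open>c\<close> is a generalisation for the induction: dropping the first
  coefficient replaces it by \<open>c * \<theta>\<close>.\<close>

lemma combine_cls:
  assumes "set ks \<subseteq> carrier V.cauchy_seqs" "c \<in> K"
  shows "KV.combine (map V.cls ks) (map (\<lambda>i. completion_embed (field_of K) \<phi> (c * \<theta> ^ i)) [0..<length ks])
    = V.cls (\<lambda>n. c * poly (Poly (map (\<lambda>k. k n) ks)) \<theta>)
    \<and> (\<lambda>n. c * poly (Poly (map (\<lambda>k. k n) ks)) \<theta>) \<in> carrier V.cauchy_seqs"
  using assms
proof (induction ks arbitrary: c)
  case Nil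
  have z: "(\<lambda>n. 0) \<in> carrier V.cauchy_seqs" using V.cauchy_const[of 0] K_zero by simp
  hence "V.cls (\<lambda>n. 0) = \<zero>\<^bsub>V.compl\<^esub>" using V.cls_zero_iff[OF z] by simp
  thus ?case using z by simp
next
  case (Cons k ks)
  let ?e = "completion_embed (field_of K) \<phi>"
  have kC: "k \<in> carrier V.cauchy_seqs" and ksC: "set ks \<subseteq> carrier V.cauchy_seqs" using Cons.prems by auto
  have cK: "c * \<theta> \<in> K" using Cons.prems theta_K K_mult by blast
  have cC: "(\<lambda>n. c) \<in> carrier V.cauchy_seqs" using V.cauchy_const[of c] Cons.prems by simp
  define T where "T = (\<lambda>n. c * \<theta> * poly (Poly (map (\<lambda>k. k n) ks)) \<theta>)"
  have IH: "KV.combine (map V.cls ks) (map (\<lambda>i. ?e (c * \<theta> * \<theta> ^ i)) [0..<length ks]) = V.cls T"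
    "T \<in> carrier V.cauchy_seqs" using Cons.IH[OF ksC cK] by (auto simp: T_def)
  have kc: "(\<lambda>n. k n * c) \<in> carrier V.cauchy_seqs" using V.cauchy_mult[OF kC cC] by simp
  have sum: "(\<lambda>n. k n * c + T n) \<in> carrier V.cauchy_seqs" using V.cauchy_add[OF kc IH(2)] by simp
  have "KV.combine (map V.cls (k # ks)) (map (\<lambda>i. ?e (c * \<theta> ^ i)) [0..<length (k # ks)])
     = (V.cls k \<otimes>\<^bsub>V.compl\<^esub> ?e c) \<oplus>\<^bsub>V.compl\<^esub> V.cls T"
    using IH(1) by (simp add: map_upt_Suc mult.assoc del: upt_Suc)
  also have "\<dots> = V.cls (\<lambda>n. k n * c + T n)"
    using kC cC kc IH(2) by (simp add: V.embed_eq V.compl_simps)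
  finally have "KV.combine (map V.cls (k # ks)) (map (\<lambda>i. ?e (c * \<theta> ^ i)) [0..<length (k # ks)]) = V.cls (\<lambda>n. k n * c + T n)" .
  moreover have "(\<lambda>n. k n * c + T n) = (\<lambda>n. c * poly (Poly (map (\<lambda>k. k n) (k # ks))) \<theta>)"
    by (simp add: T_def algebra_simps)
  ultimately show ?case using sum by simp
qed

definition local_basis :: "(nat \<Rightarrow> complex) set list" where
  "local_basis = map (\<lambda>i. completion_embed (field_of K) \<phi> (\<theta> ^ i)) [0..<local_dim]"

lemma local_basis_carrier: "set local_basis \<subseteq> carrier V.compl"
proof -
  have "completion_embed (field_of K) \<phi> (\<theta> ^ i) \<in> carrier V.compl" for i
    using ring_hom_closed[OF V.embed_hom, of "\<theta> ^ i"] K_power[OF theta_K] by simp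
  thus ?thesis by (auto simp: local_basis_def)
qed

lemma combine_basis:
  assumes "set ks \<subseteq> carrier V.cauchy_seqs" "length ks = local_dim"
  shows "KV.combine (map V.cls ks) local_basis = V.cls (\<lambda>n. poly (Poly (map (\<lambda>k. k n) ks)) \<theta>)"
    "(\<lambda>n. poly (Poly (map (\<lambda>k. k n) ks)) \<theta>) \<in> carrier V.cauchy_seqs"
  using combine_cls[OF assms(1) K_one] by (simp_all add: local_basis_def assms(2))

lemma base_field_list:
  assumes "set Ks \<subseteq> base_field"
  shows "\<exists>ks. Ks = map V.cls ks \<and> set ks \<subseteq> carrier V.cauchy_seqs \<and> (\<forall>k\<in>set ks. range k \<subseteq> \<rat>)"
  using assms
proof (induction Ks)
  case (Cons C Ks)
  then obtain ks where ks: "Ks = map V.cls ks" "set ks \<subseteq> carrier V.cauchy_seqs" "\<forall>k\<in>set ks. range k \<subseteq> \<rat>" by auto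
  obtain f where "f \<in> carrier V.cauchy_seqs" "range f \<subseteq> \<rat>" "C = V.cls f" using Cons.prems base_field_iff by auto
  thus ?case using ks by (intro exI[of _ "f # ks"]) auto
qed simp

text \<open>A vanishing combination amounts to rational polynomials whose values at \<theta> tend to
  0; \<open>coeff_bound\<close> then makes every coefficient sequence a null sequence.\<close>

lemma independent_basis: "KV.independent base_field local_basis"
proof (rule KV.trivial_combine_imp_independent[OF base_field_subfield local_basis_carrier])
  fix Ks assume Ks: "set Ks \<subseteq> base_field" "KV.combine Ks local_basis = \<zero>\<^bsub>V.compl\<^esub>"
  have len: "length local_basis = local_dim" by (simp add: local_basis_def)
  have zero: "\<zero>\<^bsub>V.compl\<^esub> \<in> base_field" using subringE(2)[OF subfieldE(1)[OF base_field_subfield]] .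
  \<comment> \<open>\<open>combine\<close> ignores excess entries, and missing ones count as zero,
    so the coefficient list may be brought to length \<open>local_dim\<close>.\<close>
  define Ls where "Ls = take local_dim (Ks @ replicate local_dim \<zero>\<^bsub>V.compl\<^esub>)"
  have Ls: "set Ls \<subseteq> base_field" "length Ls = local_dim" "set (take local_dim Ks) \<subseteq> set Ls"
    using Ks(1) zero set_take_subset[of local_dim Ks] by (auto simp: Ls_def dest!: in_set_takeD)
  have "KV.combine Ls local_basis = \<zero>\<^bsub>V.compl\<^esub>"
    using KV.combine_take[of local_basis] KV.combine_append_replicate[OF local_basis_carrier] Ks(2)
    by (simp add: Ls_def len)
  moreover obtain ks where ks: "Ls = map V.cls ks" "set ks \<subseteq> carrier V.cauchy_seqs" "\<forall>k\<in>set ks. range k \<subseteq> \<rat>"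
    using base_field_list[OF Ls(1)] by blast
  have lk: "length ks = local_dim" using ks(1) Ls(2) by simp
  define P where "P = (\<lambda>n. Poly (map (\<lambda>k. k n) ks))"
  have co: "pcoeff (P n) i = (if i < local_dim then (ks ! i) n else 0)" for n i
    by (simp add: P_def nth_default_def lk)
  have PQ: "poly_over \<rat> (P n)" for n
    unfolding poly_over_def co using ks(3) lk nth_mem by (auto simp: image_subset_iff)
  have "pdeg (P n) \<le> local_dim - 1" for n by (rule degree_le) (auto simp: co)
  hence Pd: "pdeg (P n) < local_dim" for n using local_dim_pos le_less_trans by fastforce
  have "V.cls (\<lambda>n. poly (P n) \<theta>) = \<zero>\<^bsub>V.compl\<^esub>" "(\<lambda>n. poly (P n) \<theta>) \<in> carrier V.cauchy_seqs"
    using combine_basis[OF ks(2) lk] calculation ks(1) by (auto simp: P_def)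
  hence lim: "(\<lambda>n. \<phi> (poly (P n) \<theta>)) \<longlonglongrightarrow> 0" using V.cls_zero_iff by blast
  obtain C where C: "C \<ge> 0" "\<And>P i. poly_over \<rat> P \<Longrightarrow> pdeg P < local_dim \<Longrightarrow> \<phi> (pcoeff P i) \<le> C * \<phi> (poly P \<theta>)"
    using coeff_bound by metis
  have lim': "(\<lambda>n. C * \<phi> (poly (P n) \<theta>)) \<longlonglongrightarrow> 0" using tendsto_mult[OF tendsto_const lim, of C] by simp
  have "V.cls k = \<zero>\<^bsub>V.compl\<^esub>" if k: "k \<in> set ks" for k
  proof -
    obtain i where i: "i < local_dim" "k = ks ! i" using k lk by (metis in_set_conv_nth)
    have kC: "k \<in> carrier V.cauchy_seqs" using k ks(2) by blast
    have "(\<lambda>n. \<phi> (k n)) \<longlonglongrightarrow> 0"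
    proof (rule phi.null_sandwich[OF _ _ lim'])
      show "k n \<in> K" for n using kC by (simp add: cauchy_iff)
      show "\<phi> (k n) \<le> C * \<phi> (poly (P n) \<theta>)" for n using C(2)[OF PQ Pd, of n i] i by (simp add: co)
    qed
    thus ?thesis using V.cls_zero_iff[OF kC] by blast
  qed
  hence "set Ls \<subseteq> {\<zero>\<^bsub>V.compl\<^esub>}" using ks(1) by auto
  thus "set (take (length local_basis) Ks) \<subseteq> {\<zero>\<^bsub>V.compl\<^esub>}" using Ls(3) len by simp
qed

text \<open>The terms of a Cauchy sequence are approximated by rational polynomials of degree below
  \<open>local_dim\<close>. Applied to their differences, \<open>coeff_bound\<close> makes the
  coefficient sequences Cauchy, so that these define the coefficients in
  \<open>base_field\<close>.\<close>

lemma Span_basis: "KV.Span base_field local_basis = carrier V.compl"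
proof
  show "KV.Span base_field local_basis \<subseteq> carrier V.compl"
    by (rule KV.Span_in_carrier[OF _ local_basis_carrier]) (auto simp: base_field_def)
  show "carrier V.compl \<subseteq> KV.Span base_field local_basis"
  proof
    fix A assume "A \<in> carrier V.compl"
    then obtain x where x: "x \<in> carrier V.cauchy_seqs" "A = V.cls x" unfolding V.compl_carrier by blast
    have xK: "x n \<in> K" for n using x(1) by (simp add: cauchy_iff)
    have "\<forall>n::nat. \<exists>P. poly_over \<rat> P \<and> pdeg P < local_dim \<and> \<phi> (x n - poly P \<theta>) < (1/2) ^ n"
      using approximable_all[OF xK] unfolding approximable_def by simp
    then obtain P where P: "\<And>n. poly_over \<rat> (P n)" "\<And>n. pdeg (P n) < local_dim" "\<And>n::nat. \<phi> (x n - poly (P n) \<theta>) < (1/2) ^ n"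
      by metis
    define y where "y = (\<lambda>n. poly (P n) \<theta>)"
    have yK: "y n \<in> K" for n unfolding y_def by (rule poly_in_K[OF P(1)])
    have half: "(\<lambda>n. (1/2::real) ^ n) \<longlonglongrightarrow> 0" by (rule LIMSEQ_realpow_zero) auto
    have "(\<lambda>n. \<phi> (x n - y n)) \<longlonglongrightarrow> 0"
      by (rule phi.null_sandwich[OF _ _ half]) (use P(3) xK yK K_diff in \<open>auto simp: y_def less_imp_le\<close>)
    moreover have "\<phi> (y n - x n) = \<phi> (x n - y n)" for n
      using phi.uminus[of "x n - y n"] xK yK K_diff by simp
    ultimately have yx: "(\<lambda>n. \<phi> (y n - x n)) \<longlonglongrightarrow> 0" by simp
    have y_cau: "\<exists>k. \<forall>m\<ge>k. \<forall>n\<ge>k. \<phi> (y m - y n) < e" if e: "e > 0" for e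
    proof -
      obtain k where k: "\<forall>m\<ge>k. \<forall>n\<ge>k. \<phi> (x m - x n) < e / 3"
        using x(1) e unfolding cauchy_iff by (meson zero_less_divide_iff zero_less_numeral)
      have "\<forall>\<^sub>F n in sequentially. \<phi> (y n - x n) < e / 3" using yx e by (intro order_tendstoD) auto
      then obtain l where l: "\<forall>n\<ge>l. \<phi> (y n - x n) < e / 3" by (auto simp: eventually_sequentially)
      have "\<phi> (y m - y n) < e" if mn: "m \<ge> max k l" "n \<ge> max k l" for m n
      proof -
        have "\<phi> (y m - y n) = \<phi> ((y m - x m) + ((x m - x n) - (y n - x n)))" by simp
        also have "\<dots> \<le> \<phi> (y m - x m) + (\<phi> (x m - x n) + \<phi> (y n - x n))"
          using phi.add[of "y m - x m" "(x m - x n) - (y n - x n)"] phi.diff[of "x m - x n" "y n - x n"] xK yK K_diff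
          by force
        also have "\<dots> < e / 3 + (e / 3 + e / 3)" using k l mn by (intro add_strict_mono) auto
        finally show ?thesis by simp
      qed
      thus ?thesis by blast
    qed
    obtain C where C: "C \<ge> 0" "\<And>P i. poly_over \<rat> P \<Longrightarrow> pdeg P < local_dim \<Longrightarrow> \<phi> (pcoeff P i) \<le> C * \<phi> (poly P \<theta>)"
      using coeff_bound by metis
    define k where "k = (\<lambda>i n. pcoeff (P n) i)"
    have kQ: "k i n \<in> \<rat>" for i n using P(1)[of n] by (simp add: k_def poly_over_def)
    have kC: "k i \<in> carrier V.cauchy_seqs" for i unfolding cauchy_iff
    proof (intro conjI allI impI)
      show "k i n \<in> K" for n using kQ rat_K by blast
      fix e :: real assume e: "e > 0"
      have "e / (C + 1) > 0" using e C(1) by simp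
      from y_cau[OF this] obtain l where l: "\<forall>m\<ge>l. \<forall>n\<ge>l. \<phi> (y m - y n) < e / (C + 1)" by blast
      have "\<phi> (k i m - k i n) < e" if mn: "m \<ge> l" "n \<ge> l" for m n
      proof -
        have "\<phi> (pcoeff (P m - P n) i) \<le> C * \<phi> (poly (P m - P n) \<theta>)"
          by (intro C(2) Q.poly_over_diff P degree_diff_less)
        hence "\<phi> (k i m - k i n) \<le> C * \<phi> (y m - y n)" by (simp add: k_def y_def)
        also have "\<dots> \<le> (C + 1) * \<phi> (y m - y n)"
          using phi.nonneg[OF K_diff[OF yK yK]] by (intro mult_right_mono) auto
        also have "\<dots> < e" using l mn C(1) by (simp add: field_simps)
        finally show ?thesis .
      qed
      thus "\<exists>l. \<forall>m\<ge>l. \<forall>n\<ge>l. \<phi> (k i m - k i n) < e" by blast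
    qed
    define ks where "ks = map k [0..<local_dim]"
    have ks: "set ks \<subseteq> carrier V.cauchy_seqs" "length ks = local_dim" using kC by (auto simp: ks_def)
    have "Poly (map (\<lambda>k. k n) ks) = P n" for n
    proof (rule poly_eqI)
      fix i show "pcoeff (Poly (map (\<lambda>k. k n) ks)) i = pcoeff (P n) i"
        using P(2)[of n] by (auto simp: ks_def nth_default_def k_def coeff_eq_0)
    qed
    hence comb: "KV.combine (map V.cls ks) local_basis = V.cls y" "y \<in> carrier V.cauchy_seqs"
      using combine_basis[OF ks] by (auto simp: y_def)
    have "V.cls y = A"
      unfolding x(2) V.cls_eq_iff[OF comb(2) x(1)] using yx V_minus[OF yK xK] by simp
    moreover have "set (map V.cls ks) \<subseteq> base_field"
      using kC kQ by (auto simp: ks_def base_field_iff image_subset_iff)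
    ultimately show "A \<in> KV.Span base_field local_basis"
      unfolding KV.Span_eq_combine_set[OF base_field_subfield local_basis_carrier] using comb(1) by blast
  qed
qed

theorem dim_completion: "ring.dim V.compl base_field (carrier V.compl) = local_dim"
proof -
  have "KV.dimension (length local_basis) base_field (carrier V.compl)"
    by (rule KV.dimensionI[OF base_field_subfield independent_basis Span_basis])
  thus ?thesis using KV.dimI[OF base_field_subfield] by (simp add: over_def local_basis_def)
qed

end

section \<open>The global degree and the primitive element of a number field\<close>

context primitive_field begin

lemma combine_complex:
  "CF.combine Ks (map (\<lambda>i. c * \<theta> ^ i) [0..<length Ks]) = c * poly (Poly Ks) \<theta>"
proof (induction Ks arbitrary: c)
  case (Cons k Ks)
  have "CF.combine (k # Ks) (map (\<lambda>i. c * \<theta> ^ i) [0..<length (k # Ks)])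
    = k * c + CF.combine Ks (map (\<lambda>i. (c * \<theta>) * \<theta> ^ i) [0..<length Ks])"
    by (simp add: map_upt_Suc mult.assoc del: upt_Suc)
  thus ?case using Cons[of "c * \<theta>"] by (simp add: algebra_simps)
qed simp

theorem degree_nf_eq: "degree_nf K = pdeg \<mu>"
proof -
  define Us where "Us = map (\<lambda>i. \<theta> ^ i) [0..<pdeg \<mu>]"
  have comb: "CF.combine Ks Us = poly (Poly Ks) \<theta>" if "length Ks = pdeg \<mu>" for Ks
    using combine_complex[of Ks 1] that by (simp add: Us_def)
  have over: "poly_over \<rat> (Poly Ks)" if "set Ks \<subseteq> \<rat>" for Ks
    unfolding poly_over_def using that nth_mem by (auto simp: nth_default_def)
  have "CF.independent \<rat> Us"
  proof (rule CF.trivial_combine_imp_independent[OF subfield_rat])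
    fix Ks :: "complex list" assume Ks: "set Ks \<subseteq> \<rat>" "CF.combine Ks Us = \<zero>\<^bsub>complex_field\<^esub>"
    define Ls where "Ls = take (pdeg \<mu>) (Ks @ replicate (pdeg \<mu>) 0)"
    have Ls: "set Ls \<subseteq> \<rat>" "length Ls = pdeg \<mu>" "set (take (pdeg \<mu>) Ks) \<subseteq> set Ls"
      using Ks(1) set_take_subset[of "pdeg \<mu>" Ks] by (auto simp: Ls_def dest!: in_set_takeD)
    have lenU: "length Us = pdeg \<mu>" by (simp add: Us_def)
    have "CF.combine Ls Us = CF.combine (Ks @ replicate (pdeg \<mu>) 0) Us"
      unfolding Ls_def using CF.combine_take[of Us "Ks @ replicate (pdeg \<mu>) 0"] by (simp only: lenU)
    also have "\<dots> = 0" using CF.combine_append_replicate[of Us Ks "pdeg \<mu>"] Ks(2) by simp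
    finally have "CF.combine Ls Us = 0" .
    hence "poly (Poly Ls) \<theta> = 0" using comb Ls by simp
    moreover have "pdeg (Poly Ls) < pdeg \<mu>"
    proof -
      have "pdeg (Poly Ls) \<le> pdeg \<mu> - 1" by (rule degree_le) (auto simp: nth_default_def Ls)
      thus ?thesis using mu(5) by linarith
    qed
    ultimately have "Poly Ls = 0" using Q.min_poly_degree_less[OF min_poly over[OF Ls(1)]] by blast
    hence "set Ls \<subseteq> {0}" by (auto simp: Poly_eq_0)
    thus "set (take (length Us) Ks) \<subseteq> {\<zero>\<^bsub>complex_field\<^esub>}" using Ls(3) by (simp add: Us_def)
  qed simp
  moreover have "CF.Span \<rat> Us = K"
  proof -
    have "CF.Span \<rat> Us = {CF.combine Ks Us |Ks. length Ks = length Us \<and> set Ks \<subseteq> \<rat>}"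
      by (rule CF.Span_eq_combine_set_length_version[OF subfield_rat]) simp
    also have "\<dots> = K"
    proof (intro equalityI subsetI)
      fix x assume "x \<in> {CF.combine Ks Us |Ks. length Ks = length Us \<and> set Ks \<subseteq> \<rat>}"
      then obtain Ks where "x = CF.combine Ks Us" "length Ks = pdeg \<mu>" "set Ks \<subseteq> \<rat>" by (auto simp: Us_def)
      thus "x \<in> K" using comb poly_in_K[OF over] by simp
    next
      fix x assume "x \<in> K"
      then obtain p where p: "poly_over \<rat> p" "x = poly p \<theta>" by (rule K_poly)
      obtain q r where qr: "p = \<mu> * q + r" "poly_over \<rat> r" "\<forall>i\<ge>pdeg \<mu>. pcoeff r i = 0"
        using Q.poly_over_division[OF mu(1,2) p(1)] by blast
      define Ks where "Ks = map (pcoeff r) [0..<pdeg \<mu>]"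
      have "Poly Ks = r" by (rule poly_eqI) (use qr(3) in \<open>auto simp: Ks_def nth_default_def\<close>)
      moreover have "x = poly r \<theta>" using p qr mu(3) by simp
      moreover have "length Ks = length Us" "set Ks \<subseteq> \<rat>" using qr(2) by (auto simp: Ks_def Us_def poly_over_def)
      ultimately have "x = CF.combine Ks Us" using comb[of Ks] by (simp add: Us_def)
      thus "x \<in> {CF.combine Ks Us |Ks. length Ks = length Us \<and> set Ks \<subseteq> \<rat>}"
        using \<open>length Ks = length Us\<close> \<open>set Ks \<subseteq> \<rat>\<close> by blast
    qed
    finally show ?thesis .
  qed
  ultimately have "CF.dimension (length Us) \<rat> K" by (rule CF.dimensionI[OF subfield_rat])
  thus ?thesis using CF.dimI[OF subfield_rat] by (simp add: degree_nf_def over_def Us_def)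
qed

end

theorem number_field_primitive:
  assumes "number_field K"
  obtains \<theta> \<mu> where "primitive_field K \<theta> \<mu>"
proof -
  have K: "subfield_set K" and fd: "CF.finite_dimension \<rat> K"
    using assms subfield_complex_iff by (auto simp: number_field_def)
  have sr: "subring K complex_field" using K subfield_complex_iff subfieldE(1) by blast
  interpret subfield_set K by fact
  have QK: "\<rat> \<subseteq> K" using K_of_rat by (auto elim!: Rats_cases)
  have alg: "\<exists>\<mu>. Q.is_min_poly y \<mu>" if y: "y \<in> K" for y
  proof -
    have "(CF.algebraic over \<rat>) y" by (rule CF.finite_dimension_imp_algebraic[OF subfield_rat sr fd y])
    then obtain p where "poly_over \<rat> p" "p \<noteq> 0" "poly p y = 0"
      using algebraic_complex_iff[OF Q.subfield_set_axioms] by blast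
    thus ?thesis by (rule Q.min_poly_exists)
  qed
  obtain n where "CF.dimension n \<rat> K" using fd by (auto simp: CF.finite_dimension_def)
  then obtain us where us: "CF.Span \<rat> us = K" using CF.exists_base[OF subfield_rat] by blast
  have usK: "set us \<subseteq> K" using CF.Span_base_incl[OF subfield_rat, of us] us by simp
  \<comment> \<open>\<open>Q.adjoin c\<close> is closed under rational combinations, so it is enough
    that it contains the finitely many elements of a basis.\<close>
  obtain c where c: "c \<in> K" "set us \<subseteq> Q.adjoin c"
    using primitive_list[OF K Q.subfield_set_axioms QK alg usK] by blast
  have sub: "Q.adjoin c \<subseteq> K"
    unfolding Q.adjoin_def using c(1) QK poly_closed poly_over_mono by blast
  interpret A: subfield_set "Q.adjoin c" by (rule Q.adjoin_subfield) (use sub alg in blast)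
  have comb: "CF.combine Ks vs \<in> Q.adjoin c" if "set Ks \<subseteq> \<rat>" "set vs \<subseteq> Q.adjoin c" for Ks vs
    using that
  proof (induction Ks vs rule: CF.combine.induct)
    case (1 k Ks u Us)
    have "k \<in> Q.adjoin c" using 1 Q.adjoin_base by auto
    thus ?case using 1 by (auto intro: A.K_add A.K_mult)
  qed (auto intro: A.K_zero)
  have "K \<subseteq> Q.adjoin c"
    unfolding us[symmetric] using CF.Span_eq_combine_set[OF subfield_rat, of us] comb c(2) by auto
  moreover obtain \<mu> where "Q.is_min_poly c \<mu>" using alg c(1) by blast
  ultimately have "primitive_field K c \<mu>" using sub by unfold_locales auto
  thus ?thesis by (rule that)
qed

section \<open>Places and the product formula\<close>

text \<open>The functions are extensional, so they are members of places and distinct ones differ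
  somewhere on \<open>K\<close>.\<close>

definition normalized_abs :: "complex set \<Rightarrow> (rat \<Rightarrow> real) \<Rightarrow> (complex \<Rightarrow> real) set" where
  "normalized_abs K \<alpha> = {\<phi> \<in> extensional K. subfield_abs K \<phi> \<and> (\<forall>q. \<phi> (of_rat q) = \<alpha> q)}"

lemma usual_nat_le: "\<alpha> \<in> usual_abs_rat \<Longrightarrow> \<alpha> (of_nat n) \<le> real n"
  using subfield_abs.of_nat_le[OF usual_subfield_abs] by blast

lemma abs_equivD:
  assumes "(\<phi>, \<psi>) \<in> abs_equiv R"
  shows "\<phi> \<in> nontrivial_abs_values R" "\<psi> \<in> nontrivial_abs_values R"
    "\<exists>s>0. \<forall>x\<in>carrier R. \<psi> x = \<phi> x powr s"
  using assms by (auto simp: abs_equiv_def)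

lemma nontrivial_nonneg: "\<phi> \<in> nontrivial_abs_values R \<Longrightarrow> x \<in> carrier R \<Longrightarrow> 0 \<le> \<phi> x"
  by (auto simp: nontrivial_abs_values_def abs_values_def)

lemma equiv_abs_equiv: "equiv (nontrivial_abs_values R) (abs_equiv R)"
proof (rule equivI)
  show "abs_equiv R \<subseteq> nontrivial_abs_values R \<times> nontrivial_abs_values R" by (auto simp: abs_equiv_def)
  show "refl_on (nontrivial_abs_values R) (abs_equiv R)"
  proof (rule refl_onI)
    fix \<phi> assume "\<phi> \<in> nontrivial_abs_values R"
    thus "(\<phi>, \<phi>) \<in> abs_equiv R"
      unfolding abs_equiv_def by (auto intro!: exI[of _ 1] simp: abs_of_nonneg nontrivial_nonneg)
  qed
  show "sym (abs_equiv R)"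
  proof (rule symI)
    fix \<phi> \<psi> assume a: "(\<phi>, \<psi>) \<in> abs_equiv R"
    obtain s where s: "s > 0" "\<forall>x\<in>carrier R. \<psi> x = \<phi> x powr s" using abs_equivD(3)[OF a] by blast
    have "\<forall>x\<in>carrier R. \<phi> x = \<psi> x powr (1 / s)"
      using s nontrivial_nonneg[OF abs_equivD(1)[OF a]] by (simp add: powr_powr)
    moreover have "1 / s > 0" using s by simp
    ultimately show "(\<psi>, \<phi>) \<in> abs_equiv R"
      using abs_equivD(1,2)[OF a] unfolding abs_equiv_def by blast
  qed
  show "trans (abs_equiv R)"
  proof (rule transI)
    fix \<phi> \<psi> \<chi> assume a: "(\<phi>, \<psi>) \<in> abs_equiv R" "(\<psi>, \<chi>) \<in> abs_equiv R"
    obtain s where s: "s > 0" "\<forall>x\<in>carrier R. \<psi> x = \<phi> x powr s" using abs_equivD(3)[OF a(1)] by blast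
    obtain t where t: "t > 0" "\<forall>x\<in>carrier R. \<chi> x = \<psi> x powr t" using abs_equivD(3)[OF a(2)] by blast
    have "\<forall>x\<in>carrier R. \<chi> x = \<phi> x powr (s * t)" using s t by (simp add: powr_powr)
    moreover have "s * t > 0" using s t by simp
    ultimately show "(\<phi>, \<chi>) \<in> abs_equiv R"
      using abs_equivD[OF a(1)] abs_equivD[OF a(2)] unfolding abs_equiv_def by blast
  qed
qed

context primitive_field begin

lemma abs_values_iff: "\<phi> \<in> abs_values (field_of K) \<longleftrightarrow> subfield_abs K \<phi> \<and> \<phi> \<in> extensional K"
  using abs_valued_field_iff[OF field_of_field[OF subfield_set_axioms]] field_of_abs_iff[OF subfield_set_axioms]
  by simp

text \<open>If \<open>x\<close> had value above 1, its \<open>d\<close>-th power would dominate all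
  lower terms of the characteristic equation, against the ultrametric inequality.\<close>

lemma integral_bound:
  assumes "subfield_abs K \<phi>" and bd: "\<And>n. \<phi> (of_nat n) \<le> 1" and x: "x \<in> K"
    and co: "\<And>i. \<phi> (pcoeff (\<Prod>z\<in>conj_roots. [:- emb z x, 1:]) i) \<le> 1"
  shows "\<phi> x \<le> 1"
proof (rule ccontr)
  interpret phi: subfield_abs K \<phi> by fact
  assume n: "\<not> ?thesis"
  define G where "G = (\<Prod>z\<in>conj_roots. [:- emb z x, 1:])"
  define d where "d = card conj_roots"
  have d0: "d > 0" using conj_roots(1,4) by (auto simp: d_def card_gt_0_iff)
  have deg: "pdeg G = d" by (simp add: G_def d_def degree_prod_eq_sum_degree)
  have lead: "pcoeff G d = 1"
    using deg Polynomial.lead_coeff_prod[of "\<lambda>z. [:- emb z x, 1:]" conj_roots] by (simp add: G_def)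
  have cK: "pcoeff G i \<in> K" for i using char_poly_rat[OF x, of i] K_of_rat by (auto simp: G_def elim!: Rats_cases)
  have "0 = (\<Sum>i\<le>d. pcoeff G i * x ^ i)"
    using char_poly_root[OF x] unfolding G_def[symmetric] poly_altdef deg by simp
  also have "\<dots> = (\<Sum>i<d. pcoeff G i * x ^ i) + x ^ d"
    unfolding lessThan_Suc_atMost[symmetric] using lead by simp
  finally have "x ^ d = - (\<Sum>i<d. pcoeff G i * x ^ i)" by (simp add: eq_neg_iff_add_eq_0 add.commute)
  hence "\<phi> x ^ d = \<phi> (\<Sum>i<d. pcoeff G i * x ^ i)"
    using x cK by (simp add: phi.power[symmetric] K_sum K_mult K_power)
  also have "\<dots> \<le> \<phi> x ^ (d - 1)"
  proof (rule phi.ultrametric_sum[OF bd])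
    fix i assume i: "i \<in> {..<d}"
    show "pcoeff G i * x ^ i \<in> K" using cK x by (intro K_mult K_power)
    have "\<phi> (pcoeff G i * x ^ i) \<le> 1 * \<phi> x ^ i"
      using co[of i] cK x phi.nonneg[OF x] by (simp add: phi.mult phi.power K_power G_def mult_left_le_one_le phi.nonneg)
    also have "\<dots> \<le> \<phi> x ^ (d - 1)" using i n by (auto intro!: power_increasing)
    finally show "\<phi> (pcoeff G i * x ^ i) \<le> \<phi> x ^ (d - 1)" .
  qed (use phi.nonneg[OF x] in simp)
  finally have "\<phi> x ^ d \<le> \<phi> x ^ (d - 1)" .
  moreover have "\<phi> x ^ (d - 1) < \<phi> x ^ d" using n d0 by (intro power_strict_increasing) auto
  ultimately show False by simp
qed

text \<open>If \<phi> were trivial on the rationals, the coefficients of every characteristic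
  polynomial would have value at most 1, and then so would every element of \<open>K\<close>,
  inverses included.\<close>

lemma nontrivial_on_rat:
  assumes phi: "subfield_abs K \<phi>" and x: "x \<in> K" "x \<noteq> 0" "\<phi> x \<noteq> 1"
  shows "\<exists>q. q \<noteq> 0 \<and> \<phi> (of_rat q) \<noteq> 1"
proof (rule ccontr)
  interpret phi: subfield_abs K \<phi> by fact
  assume "\<not> ?thesis"
  hence one: "\<phi> (of_rat q) = 1" if "q \<noteq> 0" for q using that by blast
  have Qle: "\<phi> c \<le> 1" if c: "c \<in> \<rat>" for c
  proof -
    obtain q where "c = of_rat q" using c by (rule Rats_cases)
    thus ?thesis using one[of q] by (cases "q = 0") auto
  qed
  have le: "\<phi> y \<le> 1" if "y \<in> K" for y
    by (rule integral_bound[OF phi _ that]) (use Qle char_poly_rat[OF that] in auto)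
  have "\<phi> x \<le> 1" "inverse (\<phi> x) \<le> 1" using le[of x] le[of "inverse x"] x K_inverse by (auto simp: phi.inverse)
  moreover have "\<phi> x > 0" using phi.pos x by blast
  ultimately have "\<phi> x = 1" by (simp add: inverse_le_1_iff)
  thus False using x by simp
qed

lemma normalized_nontrivial:
  assumes "\<alpha> \<in> usual_abs_rat" "\<phi> \<in> normalized_abs K \<alpha>"
  shows "\<phi> \<in> nontrivial_abs_values (field_of K)"
proof -
  obtain b where b: "\<alpha> b > 1" using usual_abs_rat_witness[OF assms(1)] by blast
  have "b \<noteq> 0" using b subfield_abs.zero[OF usual_subfield_abs[OF assms(1)]] by auto
  thus ?thesis using assms b K_of_rat unfolding nontrivial_abs_values_def normalized_abs_def
    by (auto simp: abs_values_iff intro!: bexI[of _ "of_rat b"])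
qed

lemma normalized_unique:
  assumes "\<alpha> \<in> usual_abs_rat" "\<phi> \<in> normalized_abs K \<alpha>" "\<beta> \<in> usual_abs_rat" "\<psi> \<in> normalized_abs K \<beta>"
    and "(\<phi>, \<psi>) \<in> abs_equiv (field_of K)"
  shows "\<psi> = \<phi>"
proof -
  obtain s where s: "s > 0" "\<forall>x\<in>K. \<psi> x = \<phi> x powr s" using abs_equivD(3)[OF assms(5)] by auto
  have "\<beta> q = \<alpha> q powr s" for q using assms(2,4) s(2) K_of_rat[of q] by (auto simp: normalized_abs_def)
  hence "s = 1" using usual_abs_rat_unique[OF assms(1,3) s(1)] by blast
  hence "\<psi> x = \<phi> x" if "x \<in> K" for x
    using s(2) that assms(2) subfield_abs.nonneg[of K \<phi> x] by (simp add: normalized_abs_def)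
  thus ?thesis using assms(2,4) by (intro extensionalityI[of _ K]) (auto simp: normalized_abs_def)
qed

lemma normalized_rep_iff:
  assumes "\<phi> \<in> v" "v \<in> places K" "\<alpha> \<in> usual_abs_rat"
  shows "\<phi> \<in> normalized_abs K \<alpha> \<longleftrightarrow> (\<forall>q. \<phi> (of_rat q) = \<alpha> q)"
proof -
  have "v \<subseteq> nontrivial_abs_values (field_of K)"
    using assms(2) in_quotient_imp_subset[OF equiv_abs_equiv] unfolding places_def by blast
  hence "\<phi> \<in> abs_values (field_of K)" using assms(1) by (auto simp: nontrivial_abs_values_def)
  thus ?thesis unfolding normalized_abs_def by (auto simp: abs_values_iff)
qed

text \<open>Makes the definite description \<open>norm_at\<close> meaningful. Ostrowski's theorem
  attaches an exponent \<open>s\<close> to any representative, and its power with exponent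
  \<open>1 / s\<close> is still an absolute value by \<open>powr_subfield_abs\<close>.\<close>

lemma norm_at_unique:
  assumes v: "v \<in> places K"
  shows "\<exists>!\<phi>. \<phi> \<in> v \<and> (\<exists>\<alpha>\<in>usual_abs_rat. \<forall>x. \<phi> (of_rat x) = \<alpha> x)"
proof -
  let ?E = "abs_equiv (field_of K)"
  have v': "v \<in> nontrivial_abs_values (field_of K) // ?E" using v by (simp add: places_def)
  then obtain \<phi>0 where phi0: "\<phi>0 \<in> nontrivial_abs_values (field_of K)" "v = ?E `` {\<phi>0}" by (rule quotientE)
  have abs0: "subfield_abs K \<phi>0" using phi0 by (simp add: nontrivial_abs_values_def abs_values_iff)
  interpret p: subfield_abs K \<phi>0 by fact
  obtain x where x: "x \<in> K" "x \<noteq> 0" "\<phi>0 x \<noteq> 1" using phi0(1) by (auto simp: nontrivial_abs_values_def)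
  obtain q0 where q0: "q0 \<noteq> 0" "\<phi>0 (of_rat q0) \<noteq> 1" using nontrivial_on_rat[OF abs0 x] by blast
  have "subfield_abs UNIV (\<lambda>q. \<phi>0 (of_rat q))"
    by unfold_locales (auto simp: of_rat_mult of_rat_add p.nonneg p.eq_0_iff p.mult p.add K_of_rat)
  from Ostrowski[OF this q0] obtain \<alpha> s where as: "\<alpha> \<in> usual_abs_rat" "s > 0" "\<And>q. \<phi>0 (of_rat q) = \<alpha> q powr s" by blast
  have nn: "0 \<le> \<alpha> q" for q using subfield_abs.nonneg[OF usual_subfield_abs[OF as(1)]] by simp
  define \<phi> where "\<phi> = restrict (\<lambda>x. \<phi>0 x powr (1 / s)) K"
  have "subfield_abs K (\<lambda>x. \<phi>0 x powr (1 / s))"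
  proof (rule p.powr_subfield_abs[OF as(2)])
    fix n :: nat
    have "\<phi>0 (of_nat n) = \<alpha> (of_nat n) powr s" using as(3)[of "of_nat n"] by simp
    also have "\<dots> \<le> real n powr s" using usual_nat_le[OF as(1)] nn as(2) by (intro powr_mono2) auto
    finally show "\<phi>0 (of_nat n) \<le> real n powr s" .
  qed
  then interpret q: subfield_abs K "\<lambda>x. \<phi>0 x powr (1 / s)" .
  have phi_abs: "subfield_abs K \<phi>"
    unfolding \<phi>_def by unfold_locales (auto simp: p.eq_0_iff q.mult q.add K_mult K_add)
  have rat: "\<phi> (of_rat q) = \<alpha> q" for q using as nn K_of_rat by (simp add: \<phi>_def powr_powr)
  have norm: "\<phi> \<in> normalized_abs K \<alpha>" using phi_abs rat by (simp add: normalized_abs_def \<phi>_def)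
  have "(\<phi>0, \<phi>) \<in> ?E"
    unfolding abs_equiv_def using phi0(1) normalized_nontrivial[OF as(1) norm] as(2)
    by (auto simp: \<phi>_def intro!: exI[of _ "1 / s"])
  hence mem: "\<phi> \<in> v" by (simp add: phi0)
  show ?thesis
  proof (rule ex1I[of _ \<phi>])
    show "\<phi> \<in> v \<and> (\<exists>\<alpha>\<in>usual_abs_rat. \<forall>x. \<phi> (of_rat x) = \<alpha> x)" using mem rat as by blast
    fix \<psi> assume psi: "\<psi> \<in> v \<and> (\<exists>\<alpha>\<in>usual_abs_rat. \<forall>x. \<psi> (of_rat x) = \<alpha> x)"
    then obtain \<beta> where b: "\<beta> \<in> usual_abs_rat" "\<forall>x. \<psi> (of_rat x) = \<beta> x" by blast
    have "\<psi> \<in> normalized_abs K \<beta>" using normalized_rep_iff[OF _ v b(1)] psi b by blast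
    moreover have "(\<phi>, \<psi>) \<in> ?E"
      using quotient_eq_iff[OF equiv_abs_equiv v' v' mem] psi by blast
    ultimately show "\<psi> = \<phi>" using normalized_unique[OF as(1) norm b(1)] by blast
  qed
qed

lemma norm_at_place:
  assumes v: "v \<in> places K"
  shows "norm_at v \<in> v" "\<exists>\<alpha>\<in>usual_abs_rat. norm_at v \<in> normalized_abs K \<alpha>"
proof -
  have *: "norm_at v \<in> v \<and> (\<exists>\<alpha>\<in>usual_abs_rat. \<forall>x. norm_at v (of_rat x) = \<alpha> x)"
    unfolding norm_at_def by (rule theI'[OF norm_at_unique[OF v]])
  thus "norm_at v \<in> v" by blast
  thus "\<exists>\<alpha>\<in>usual_abs_rat. norm_at v \<in> normalized_abs K \<alpha>" using * normalized_rep_iff[OF _ v] by blast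
qed

text \<open>Lets products over places be regrouped by the rational absolute value below.\<close>

lemma norm_at_bij: "bij_betw norm_at (places K) (\<Union>\<alpha>\<in>usual_abs_rat. normalized_abs K \<alpha>)"
proof (rule bij_betwI')
  let ?E = "abs_equiv (field_of K)"
  fix u v assume uv: "u \<in> places K" "v \<in> places K"
  show "norm_at u = norm_at v \<longleftrightarrow> u = v"
  proof
    assume "norm_at u = norm_at v"
    hence "norm_at u \<in> u \<inter> v" using norm_at_place(1)[OF uv(1)] norm_at_place(1)[OF uv(2)] by simp
    thus "u = v" using quotient_disj[OF equiv_abs_equiv, of u "field_of K" v] uv unfolding places_def by blast
  qed simp
next
  fix v assume "v \<in> places K"
  thus "norm_at v \<in> (\<Union>\<alpha>\<in>usual_abs_rat. normalized_abs K \<alpha>)" using norm_at_place(2) by blast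
next
  let ?E = "abs_equiv (field_of K)"
  fix \<phi> assume "\<phi> \<in> (\<Union>\<alpha>\<in>usual_abs_rat. normalized_abs K \<alpha>)"
  then obtain \<alpha> where a: "\<alpha> \<in> usual_abs_rat" "\<phi> \<in> normalized_abs K \<alpha>" by blast
  have nt: "\<phi> \<in> nontrivial_abs_values (field_of K)" by (rule normalized_nontrivial[OF a])
  define v where "v = ?E `` {\<phi>}"
  have v: "v \<in> places K" unfolding v_def places_def using nt by (rule quotientI)
  have mem: "\<phi> \<in> v" unfolding v_def using equiv_class_self[OF equiv_abs_equiv nt] .
  obtain \<beta> where b: "\<beta> \<in> usual_abs_rat" "norm_at v \<in> normalized_abs K \<beta>" using norm_at_place(2)[OF v] by blast
  have "(\<phi>, norm_at v) \<in> ?E" using norm_at_place(1)[OF v] by (simp add: v_def)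
  hence "norm_at v = \<phi>" using normalized_unique[OF a b] by blast
  thus "\<exists>v\<in>places K. \<phi> = norm_at v" using v by blast
qed

lemma rat_place_exists:
  assumes "\<alpha> \<in> usual_abs_rat"
  obtains w where "rat_place K \<theta> \<mu> w \<alpha>"
proof -
  obtain w where w: "subfield_abs alg_numbers w" "\<forall>q. w (of_rat q) = \<alpha> q"
    using abs_extends_to_alg_numbers[OF usual_subfield_abs[OF assms]] by blast
  have "rat_place K \<theta> \<mu> w \<alpha>"
    using assms w primitive_field_axioms by (simp add: rat_place_def rat_place_axioms_def)
  thus ?thesis by (rule that)
qed

lemma place_aboveI:
  assumes "rat_place K \<theta> \<mu> w \<alpha>" "\<phi> \<in> normalized_abs K \<alpha>"
  shows "place_above K \<theta> \<mu> w \<alpha> \<phi>"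
  using assms by (simp add: place_above_def place_above_axioms_def normalized_abs_def)

definition abs_degree :: "(complex \<Rightarrow> real) \<Rightarrow> nat" where
  "abs_degree \<phi> = ring.dim (field_completion (field_of K) \<phi>)
     {C \<in> carrier (field_completion (field_of K) \<phi>). \<exists>f\<in>C. range f \<subseteq> \<rat>}
     (carrier (field_completion (field_of K) \<phi>))"

lemma local_degree_eq: "local_degree K v = abs_degree (norm_at v)"
  unfolding local_degree_def local_base_def local_field_def abs_degree_def ..

text \<open>The embeddings are grouped by the absolute value that they induce. Each group has
  \<open>abs_degree \<phi>\<close> members, so the total product is the value under \<open>w\<close>
  of the product of all conjugates of \<open>x\<close>, a rational number.\<close>

lemma normalized_product:
  assumes a: "\<alpha> \<in> usual_abs_rat" and x: "x \<in> K" and q: "(\<Prod>z\<in>conj_roots. emb z x) = of_rat q"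
  shows "finite (normalized_abs K \<alpha>)" "(\<Prod>\<phi>\<in>normalized_abs K \<alpha>. \<phi> x ^ abs_degree \<phi>) = \<alpha> q"
proof -
  obtain w where w: "rat_place K \<theta> \<mu> w \<alpha>" using rat_place_exists[OF a] .
  interpret W: rat_place K \<theta> \<mu> w \<alpha> by (rule w)
  define g where "g = (\<lambda>z. restrict (W.pull z) K)"
  have fp: "place_above K \<theta> \<mu> w \<alpha> \<phi>" if "\<phi> \<in> normalized_abs K \<alpha>" for \<phi> by (rule place_aboveI[OF w that])
  have eq: "place_above.conjs K \<theta> \<mu> w \<phi> = {z \<in> conj_roots. g z = \<phi>}" if phi: "\<phi> \<in> normalized_abs K \<alpha>" for \<phi>
  proof -
    have ext: "\<phi> \<in> extensional K" using phi by (simp add: normalized_abs_def)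
    have "(\<forall>x\<in>K. W.pull z x = \<phi> x) \<longleftrightarrow> g z = \<phi>" for z
    proof
      assume "\<forall>x\<in>K. W.pull z x = \<phi> x"
      thus "g z = \<phi>" using ext by (intro extensionalityI[of _ K]) (auto simp: g_def)
    qed (auto simp: g_def)
    thus ?thesis unfolding place_above.conjs_def[OF fp[OF phi]] by blast
  qed
  have sub: "normalized_abs K \<alpha> \<subseteq> g ` conj_roots"
  proof
    fix \<phi> assume phi: "\<phi> \<in> normalized_abs K \<alpha>"
    have "{z \<in> conj_roots. g z = \<phi>} \<noteq> {}" using eq[OF phi] place_above.conjs_ne[OF fp[OF phi]] by simp
    thus "\<phi> \<in> g ` conj_roots" by blast
  qed
  thus fin: "finite (normalized_abs K \<alpha>)" using conj_roots(1) finite_surj by blast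
  have sup: "g ` conj_roots \<subseteq> normalized_abs K \<alpha>"
  proof
    fix \<phi> assume "\<phi> \<in> g ` conj_roots"
    then obtain z where z: "z \<in> conj_roots" "\<phi> = g z" by blast
    interpret p: subfield_abs K "W.pull z" by (rule W.pull_abs[OF z(1)])
    have "subfield_abs K (g z)"
      unfolding g_def by unfold_locales (auto simp: p.nonneg p.eq_0_iff p.mult p.add K_mult K_add)
    thus "\<phi> \<in> normalized_abs K \<alpha>" using z W.pull_rat[OF z(1)] K_of_rat by (simp add: normalized_abs_def g_def)
  qed
  have "(\<Prod>\<phi>\<in>normalized_abs K \<alpha>. \<phi> x ^ abs_degree \<phi>) = (\<Prod>\<phi>\<in>normalized_abs K \<alpha>. \<Prod>z\<in>{z \<in> conj_roots. g z = \<phi>}. W.pull z x)"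
  proof (rule prod.cong[OF refl])
    fix \<phi> assume phi: "\<phi> \<in> normalized_abs K \<alpha>"
    interpret F: place_above K \<theta> \<mu> w \<alpha> \<phi> by (rule fp[OF phi])
    have "abs_degree \<phi> = card {z \<in> conj_roots. g z = \<phi>}"
      using F.dim_completion unfolding abs_degree_def F.base_field_def[symmetric] F.local_dim_def eq[OF phi] .
    moreover have "W.pull z x = \<phi> x" if "g z = \<phi>" for z using that x by (auto simp: g_def)
    hence "(\<Prod>z\<in>{z \<in> conj_roots. g z = \<phi>}. W.pull z x) = (\<Prod>z\<in>{z \<in> conj_roots. g z = \<phi>}. \<phi> x)"
      by (intro prod.cong) auto
    ultimately show "\<phi> x ^ abs_degree \<phi> = (\<Prod>z\<in>{z \<in> conj_roots. g z = \<phi>}. W.pull z x)" by simp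
  qed
  also have "\<dots> = (\<Prod>z\<in>conj_roots. W.pull z x)" by (rule prod.group[OF conj_roots(1) fin sup])
  also have "\<dots> = w (\<Prod>z\<in>conj_roots. emb z x)"
    unfolding W.pull_def using emb_algebraic[OF _ x] by (simp add: W.w.prod_eq)
  also have "\<dots> = \<alpha> q" by (simp add: q W.w_rat)
  finally show "(\<Prod>\<phi>\<in>normalized_abs K \<alpha>. \<phi> x ^ abs_degree \<phi>) = \<alpha> q" .
qed

lemma usual_nonarchimedean:
  assumes "\<alpha> \<in> usual_abs_rat" "\<alpha> \<noteq> (\<lambda>x. real_of_rat \<bar>x\<bar>)"
  shows "\<alpha> (of_nat n) \<le> 1"
  using assms padic_abs_int_le[of _ "int n"] unfolding usual_abs_rat_def by auto

text \<open>By \<open>integral_bound\<close>, a value above 1 requires \<alpha> to be archimedean or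
  some coefficient of the characteristic polynomial to have value above 1 under \<alpha>; a nonzero
  rational has value different from 1 at finitely many \<alpha> only.\<close>

lemma bounded_almost_everywhere:
  assumes x: "x \<in> K"
  shows "finite {\<alpha> \<in> usual_abs_rat. \<exists>\<phi>\<in>normalized_abs K \<alpha>. \<phi> x > 1}"
proof -
  define c where "c = (\<lambda>i. pcoeff (\<Prod>z\<in>conj_roots. [:- emb z x, 1:]) i)"
  define d where "d = card conj_roots"
  have "\<forall>i. \<exists>q. c i = of_rat q" unfolding c_def using char_poly_rat[OF x] by (meson Rats_cases)
  then obtain q where q: "\<And>i. c i = of_rat (q i)" by metis
  define B where "B = insert (\<lambda>x. real_of_rat \<bar>x\<bar>) (\<Union>i\<le>d. {\<alpha> \<in> usual_abs_rat. q i \<noteq> 0 \<and> \<alpha> (q i) \<noteq> 1})"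
  have "finite {\<alpha> \<in> usual_abs_rat. q i \<noteq> 0 \<and> \<alpha> (q i) \<noteq> 1}" for i
    using rat_product_formula[of "q i"] by (cases "q i = 0") auto
  hence "finite B" by (simp add: B_def)
  moreover have "{\<alpha> \<in> usual_abs_rat. \<exists>\<phi>\<in>normalized_abs K \<alpha>. \<phi> x > 1} \<subseteq> B"
  proof (rule subsetI, rule ccontr)
    fix \<alpha> assume "\<alpha> \<in> {\<alpha> \<in> usual_abs_rat. \<exists>\<phi>\<in>normalized_abs K \<alpha>. \<phi> x > 1}" and nB: "\<alpha> \<notin> B"
    then obtain \<phi> where a: "\<alpha> \<in> usual_abs_rat" "\<phi> \<in> normalized_abs K \<alpha>" "\<phi> x > 1" by blast
    have rat: "\<phi> (of_rat q) = \<alpha> q" for q using a by (simp add: normalized_abs_def)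
    have "\<phi> x \<le> 1"
    proof (rule integral_bound[OF _ _ x])
      show "subfield_abs K \<phi>" using a by (simp add: normalized_abs_def)
      have "\<alpha> \<noteq> (\<lambda>x. real_of_rat \<bar>x\<bar>)" using nB by (auto simp: B_def)
      thus "\<phi> (of_nat n) \<le> 1" for n using usual_nonarchimedean[OF a(1)] rat[of "of_nat n"] by simp
      fix i
      have "\<alpha> (q i) \<le> 1"
      proof (cases "i \<le> d")
        case True
        thus ?thesis using nB a(1) subfield_abs.zero[OF usual_subfield_abs[OF a(1)]] by (cases "q i = 0") (auto simp: B_def)
      next
        case False
        have "c i = 0" unfolding c_def using False
          by (intro coeff_eq_0) (simp add: d_def degree_prod_eq_sum_degree)
        hence "q i = 0" using q by simp
        thus ?thesis using subfield_abs.zero[OF usual_subfield_abs[OF a(1)]] by simp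
      qed
      thus "\<phi> (pcoeff (\<Prod>z\<in>conj_roots. [:- emb z x, 1:]) i) \<le> 1" using q[of i] rat by (simp add: c_def)
    qed
    thus False using a by simp
  qed
  ultimately show ?thesis by (rule finite_subset[rotated])
qed

theorem product_formula:
  assumes x: "x \<in> K" "x \<noteq> 0"
  shows "finite {v \<in> places K. norm_at v x \<noteq> 1}"
    "(\<Prod>v\<in>{v \<in> places K. norm_at v x \<noteq> 1}. norm_at v x ^ local_degree K v) = 1"
proof -
  obtain q where q: "(\<Prod>z\<in>conj_roots. emb z x) = of_rat q" using norm_rat[OF x(1)] by (rule Rats_cases)
  have "(\<Prod>z\<in>conj_roots. emb z x) \<noteq> 0" using x conj_roots(1) emb_more(6) by simp
  hence q0: "q \<noteq> 0" using q by auto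
  \<comment> \<open>Outside \<open>A\<close> both \<open>x\<close> and its inverse have value at
    most 1, hence exactly 1. The last set makes the product of the \<open>\<alpha> q\<close> over
    \<open>A\<close> a full product over the rationals.\<close>
  define A where "A = {\<alpha> \<in> usual_abs_rat. \<exists>\<phi>\<in>normalized_abs K \<alpha>. \<phi> x > 1} \<union>
    {\<alpha> \<in> usual_abs_rat. \<exists>\<phi>\<in>normalized_abs K \<alpha>. \<phi> (inverse x) > 1} \<union> {\<alpha> \<in> usual_abs_rat. \<alpha> q \<noteq> 1}"
  have A: "finite A" "A \<subseteq> usual_abs_rat"
    unfolding A_def using bounded_almost_everywhere[OF x(1)] bounded_almost_everywhere[OF K_inverse[OF x(1)]]
      rat_product_formula[OF q0] by auto
  define T where "T = (\<Union>\<alpha>\<in>A. normalized_abs K \<alpha>)"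
  have finT: "finite T" unfolding T_def using A normalized_product(1)[OF _ x(1) q] by blast
  have "(\<Prod>\<phi>\<in>T. \<phi> x ^ abs_degree \<phi>) = (\<Prod>\<alpha>\<in>A. \<Prod>\<phi>\<in>normalized_abs K \<alpha>. \<phi> x ^ abs_degree \<phi>)"
    unfolding T_def
  proof (rule prod.UNION_disjoint)
    show "\<forall>\<alpha>\<in>A. finite (normalized_abs K \<alpha>)" using A normalized_product(1)[OF _ x(1) q] by blast
    show "\<forall>\<alpha>\<in>A. \<forall>\<beta>\<in>A. \<alpha> \<noteq> \<beta> \<longrightarrow> normalized_abs K \<alpha> \<inter> normalized_abs K \<beta> = {}"
      unfolding normalized_abs_def by fastforce
  qed (rule A)
  also have "\<dots> = (\<Prod>\<alpha>\<in>A. \<alpha> q)" using A normalized_product(2)[OF _ x(1) q] by (intro prod.cong) auto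
  also have "\<dots> = (\<Prod>\<alpha>\<in>{\<alpha> \<in> usual_abs_rat. \<alpha> q \<noteq> 1}. \<alpha> q)"
    using A by (intro prod.mono_neutral_right) (auto simp: A_def)
  also have "\<dots> = 1" using rat_product_formula[OF q0] by blast
  finally have prodT: "(\<Prod>\<phi>\<in>T. \<phi> x ^ abs_degree \<phi>) = 1" .
  have out: "\<phi> x = 1" if a: "\<alpha> \<in> usual_abs_rat" "\<phi> \<in> normalized_abs K \<alpha>" and nT: "\<phi> \<notin> T" for \<alpha> \<phi>
  proof -
    have nA: "\<alpha> \<notin> A" using a nT by (auto simp: T_def)
    interpret p: subfield_abs K \<phi> using a by (simp add: normalized_abs_def)
    have "\<phi> x \<le> 1" "\<phi> (inverse x) \<le> 1" using nA a unfolding A_def by force+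
    moreover have "\<phi> x > 0" using p.pos x by blast
    ultimately show ?thesis using x by (simp add: p.inverse inverse_le_1_iff)
  qed
  have sub: "norm_at ` {v \<in> places K. norm_at v x \<noteq> 1} \<subseteq> T"
  proof
    fix \<phi> assume "\<phi> \<in> norm_at ` {v \<in> places K. norm_at v x \<noteq> 1}"
    then obtain v where v: "v \<in> places K" "norm_at v x \<noteq> 1" "\<phi> = norm_at v" by blast
    obtain \<alpha> where "\<alpha> \<in> usual_abs_rat" "norm_at v \<in> normalized_abs K \<alpha>" using norm_at_place(2)[OF v(1)] by blast
    thus "\<phi> \<in> T" using out v by blast
  qed
  have inj: "inj_on norm_at {v \<in> places K. norm_at v x \<noteq> 1}"
    using norm_at_bij by (auto simp: bij_betw_def intro: inj_on_subset)
  show "finite {v \<in> places K. norm_at v x \<noteq> 1}"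
    using finite_subset[OF sub finT] finite_imageD[OF _ inj] by blast
  have "(\<Prod>v\<in>{v \<in> places K. norm_at v x \<noteq> 1}. norm_at v x ^ local_degree K v)
    = (\<Prod>\<phi>\<in>norm_at ` {v \<in> places K. norm_at v x \<noteq> 1}. \<phi> x ^ abs_degree \<phi>)"
    by (simp add: prod.reindex[OF inj] local_degree_eq)
  also have "\<dots> = (\<Prod>\<phi>\<in>T. \<phi> x ^ abs_degree \<phi>)"
  proof (rule prod.mono_neutral_left[OF finT sub])
    show "\<forall>\<phi>\<in>T - norm_at ` {v \<in> places K. norm_at v x \<noteq> 1}. \<phi> x ^ abs_degree \<phi> = 1"
    proof
      fix \<phi> assume phi: "\<phi> \<in> T - norm_at ` {v \<in> places K. norm_at v x \<noteq> 1}"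
      hence "\<phi> \<in> (\<Union>\<alpha>\<in>usual_abs_rat. normalized_abs K \<alpha>)" using A(2) by (auto simp: T_def)
      hence "\<phi> \<in> norm_at ` places K" using norm_at_bij by (simp add: bij_betw_def)
      then obtain v where "v \<in> places K" "\<phi> = norm_at v" by blast
      hence "\<phi> x = 1" using phi by blast
      thus "\<phi> x ^ abs_degree \<phi> = 1" by simp
    qed
  qed
  finally show "(\<Prod>v\<in>{v \<in> places K. norm_at v x \<noteq> 1}. norm_at v x ^ local_degree K v) = 1" using prodT by simp
qed

end

section \<open>The local invariant\<close>

lemma finite_monomials: "finite (monomials N M)"
proof -
  have "monomials N M \<subseteq> mset ` {xs. set xs \<subseteq> {..<N} \<and> length xs = M}"
  proof
    fix m assume m: "m \<in> monomials N M"
    obtain xs where xs: "m = mset xs" using ex_mset by metis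
    thus "m \<in> mset ` {xs. set xs \<subseteq> {..<N} \<and> length xs = M}" using m by (auto simp: monomials_def)
  qed
  thus ?thesis using finite_lists_length_eq[of "{..<N}" M] by (meson finite_imageI finite_lessThan finite_subset)
qed

lemma sum_count_monomial:
  assumes "m \<in> monomials N M" shows "(\<Sum>i<N. count m i) = M"
proof -
  have "(\<Sum>i<N. count m i) = sum (count m) (set_mset m)"
    using assms by (intro sum.mono_neutral_right) (auto simp: monomials_def not_in_iff)
  thus ?thesis using assms by (simp add: monomials_def size_multiset_overloaded_eq)
qed

context abs_valued_field begin

abbreviation "mono_val N m z \<equiv> (\<Otimes>i\<in>{..<N}. z i [^] count m i)"

lemma mono_val_closed: "z \<in> {..<N} \<rightarrow> carrier R \<Longrightarrow> mono_val N m z \<in> carrier R"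
  by (rule finprod_closed) auto

lemma form_eval_closed:
  assumes "S \<in> forms R N M" "z \<in> {..<N} \<rightarrow> carrier R"
  shows "form_eval R N M S z \<in> carrier R"
  unfolding form_eval_def using assms by (intro finsum_closed) (auto simp: forms_def intro!: m_closed mono_val_closed)

lemma finprod_pow:
  assumes "finite A" "c \<in> carrier R"
  shows "(\<Otimes>i\<in>A. c [^] (k i :: nat)) = c [^] (\<Sum>i\<in>A. k i)"
  using assms(1)
proof (induction A rule: finite_induct)
  case (insert i A)
  thus ?case using assms(2) by (simp add: nat_pow_mult)
qed simp

lemma mono_val_scale:
  assumes m: "m \<in> monomials N M" and z: "z \<in> {..<N} \<rightarrow> carrier R" and c: "c \<in> carrier R"
  shows "mono_val N m (\<lambda>i. c \<otimes> z i) = c [^] M \<otimes> mono_val N m z"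
proof -
  have "mono_val N m (\<lambda>i. c \<otimes> z i) = (\<Otimes>i\<in>{..<N}. c [^] count m i \<otimes> z i [^] count m i)"
    using z c by (intro finprod_cong') (auto simp: nat_pow_distrib Pi_iff)
  also have "\<dots> = (\<Otimes>i\<in>{..<N}. c [^] count m i) \<otimes> mono_val N m z"
    using z c by (intro finprod_multf) auto
  also have "(\<Otimes>i\<in>{..<N}. c [^] count m i) = c [^] M"
    using finprod_pow[of "{..<N}" c "count m"] c sum_count_monomial[OF m] by simp
  finally show ?thesis .
qed

lemma form_eval_scale:
  assumes S: "S \<in> forms R N M" and z: "z \<in> {..<N} \<rightarrow> carrier R" and c: "c \<in> carrier R"
  shows "form_eval R N M S (\<lambda>i. c \<otimes> z i) = c [^] M \<otimes> form_eval R N M S z"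
proof -
  have Sc: "S m \<in> carrier R" for m using S by (simp add: forms_def)
  have "form_eval R N M S (\<lambda>i. c \<otimes> z i) = (\<Oplus>m\<in>monomials N M. c [^] M \<otimes> (S m \<otimes> mono_val N m z))"
    unfolding form_eval_def
  proof (rule finsum_cong')
    fix m assume m: "m \<in> monomials N M"
    show "S m \<otimes> mono_val N m (\<lambda>i. c \<otimes> z i) = c [^] M \<otimes> (S m \<otimes> mono_val N m z)"
      unfolding mono_val_scale[OF m z c] using Sc c mono_val_closed[OF z] by (simp add: m_lcomm)
  qed (use Sc c mono_val_closed[OF z] in auto)
  also have "\<dots> = c [^] M \<otimes> form_eval R N M S z"
    unfolding form_eval_def using Sc c mono_val_closed[OF z]
    by (intro finsum_rdistr[symmetric] finite_monomials) auto
  finally show ?thesis .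
qed

lemma forms_minus: "S \<in> forms R N M \<Longrightarrow> f \<in> forms R N M \<Longrightarrow> (\<lambda>m. S m \<ominus> f m) \<in> forms R N M"
  by (auto simp: forms_def a_minus_def)

lemma form_eval_minus:
  assumes S: "S \<in> forms R N M" and f: "f \<in> forms R N M" and z: "z \<in> {..<N} \<rightarrow> carrier R"
  shows "form_eval R N M (\<lambda>m. S m \<ominus> f m) z = form_eval R N M S z \<ominus> form_eval R N M f z"
proof -
  have c: "S m \<in> carrier R" "f m \<in> carrier R" for m using S f by (auto simp: forms_def)
  note mc = mono_val_closed[OF z]
  have "form_eval R N M (\<lambda>m. S m \<ominus> f m) z \<oplus> form_eval R N M f z
      = (\<Oplus>m\<in>monomials N M. (S m \<ominus> f m) \<otimes> mono_val N m z \<oplus> f m \<otimes> mono_val N m z)"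
    unfolding form_eval_def using c mc by (intro finsum_addf[symmetric]) auto
  also have "\<dots> = form_eval R N M S z"
    unfolding form_eval_def
  proof (rule finsum_cong')
    fix m assume "m \<in> monomials N M"
    have "(S m \<ominus> f m) \<otimes> mono_val N m z \<oplus> f m \<otimes> mono_val N m z = ((S m \<ominus> f m) \<oplus> f m) \<otimes> mono_val N m z"
      using c mc by (simp add: l_distr)
    also have "(S m \<ominus> f m) \<oplus> f m = S m" using c[of m] by (simp add: a_minus_def a_assoc l_neg)
    finally show "(S m \<ominus> f m) \<otimes> mono_val N m z \<oplus> f m \<otimes> mono_val N m z = S m \<otimes> mono_val N m z" .
  qed (use c mc in auto)
  finally have eq: "form_eval R N M (\<lambda>m. S m \<ominus> f m) z \<oplus> form_eval R N M f z = form_eval R N M S z" .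
  show ?thesis unfolding eq[symmetric]
    using form_eval_closed[OF forms_minus[OF S f] z] form_eval_closed[OF f z]
    by (simp add: a_minus_def a_assoc r_neg)
qed

lemma abs_finsum_le:
  assumes "finite A" "\<And>i. i \<in> A \<Longrightarrow> g i \<in> carrier R"
  shows "\<phi> (\<Oplus>i\<in>A. g i) \<le> (\<Sum>i\<in>A. \<phi> (g i))"
  using assms
proof (induction A rule: finite_induct)
  case (insert i A)
  have "\<phi> (g i \<oplus> (\<Oplus>i\<in>A. g i)) \<le> \<phi> (g i) + \<phi> (\<Oplus>i\<in>A. g i)"
    using insert by (intro abs_add finsum_closed) auto
  thus ?case using insert by (simp add: finsum_insert Pi_def)
qed simp

lemma abs_finprod:
  assumes "finite A" "\<And>i. i \<in> A \<Longrightarrow> g i \<in> carrier R"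
  shows "\<phi> (\<Otimes>i\<in>A. g i) = (\<Prod>i\<in>A. \<phi> (g i))"
  using assms
proof (induction A rule: finite_induct)
  case (insert i A)
  thus ?case by (simp add: finprod_insert abs_mult finprod_closed Pi_def)
qed simp

lemma abs_form_eval_le:
  assumes S: "S \<in> forms R N M" and z: "z \<in> {..<N} \<rightarrow> carrier R" "\<And>i. i < N \<Longrightarrow> \<phi> (z i) \<le> 1"
  shows "\<phi> (form_eval R N M S z) \<le> (\<Sum>m\<in>monomials N M. \<phi> (S m))"
proof -
  have Sc: "S m \<in> carrier R" for m using S by (simp add: forms_def)
  note mc = mono_val_closed[OF z(1)]
  have zc: "z i \<in> carrier R" if "i < N" for i using z(1) that by auto
  have "\<phi> (form_eval R N M S z) \<le> (\<Sum>m\<in>monomials N M. \<phi> (S m \<otimes> mono_val N m z))"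
    unfolding form_eval_def using Sc mc by (intro abs_finsum_le finite_monomials) auto
  also have "\<dots> \<le> (\<Sum>m\<in>monomials N M. \<phi> (S m))"
  proof (rule sum_mono)
    fix m
    have "\<phi> (mono_val N m z) = (\<Prod>i<N. \<phi> (z i [^] count m i))" using zc by (intro abs_finprod) auto
    also have "\<dots> \<le> 1" using zc z(2) abs_nonneg
      by (intro prod_le_1) (auto simp: abs_pow intro: power_le_one)
    finally show "\<phi> (S m \<otimes> mono_val N m z) \<le> \<phi> (S m)"
      using Sc mc abs_nonneg by (simp add: abs_mult mult_left_le)
  qed
  finally show ?thesis .
qed

text \<open>The infimum is attained by replacing \<open>S\<close> with the multiple of the \<open>M\<close>-th power of a
  coordinate of maximal absolute value which has the same value at \<open>a\<close>.\<close>

theorem local_U_formula: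
  assumes S: "S \<in> forms R N M" and a: "a \<in> {..<N} \<rightarrow> carrier R" and nz: "n0 < N" "a n0 \<noteq> \<zero>" and r: "r > 0"
  defines "\<alpha> \<equiv> \<lambda>x. \<phi> x powr r"
  shows "local_height \<alpha> N a > 0" "local_height \<alpha> N a ^ M * local_U R \<alpha> N M a S = \<alpha> (form_eval R N M S a)"
proof -
  define H where "H = local_height \<alpha> N a"
  have fin: "finite ((\<lambda>n. \<alpha> (z n)) ` {..<N})" "(\<lambda>n. \<alpha> (z n)) ` {..<N} \<noteq> {}" for z using nz(1) by auto
  have ac: "a i \<in> carrier R" if "i < N" for i using a that by auto
  have \<alpha>0: "0 \<le> \<alpha> x" for x by (simp add: \<alpha>_def)
  have \<alpha>_mult: "\<alpha> (x \<otimes> y) = \<alpha> x * \<alpha> y" if "x \<in> carrier R" "y \<in> carrier R" for x y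
    using that abs_nonneg by (simp add: \<alpha>_def abs_mult powr_mult)
  have \<alpha>_pow: "\<alpha> (x [^] k) = \<alpha> x ^ k" if "x \<in> carrier R" for x and k :: nat
    using that by (induction k) (auto simp: \<alpha>_mult, simp add: \<alpha>_def)
  have \<alpha>_inv: "\<alpha> (inv x) = inverse (\<alpha> x)" if "x \<in> carrier R" "x \<noteq> \<zero>" for x
    using that abs_nonneg by (simp add: \<alpha>_def abs_inv inverse_powr)
  have \<alpha>_pos: "\<alpha> x > 0" if "x \<in> carrier R" "x \<noteq> \<zero>" for x
    using that abs_eq_0_iff by (simp add: \<alpha>_def)
  have \<alpha>_le_1: "\<phi> x \<le> 1" if "x \<in> carrier R" "\<alpha> x \<le> 1" for x
  proof (rule ccontr)
    assume "\<not> ?thesis"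
    hence "1 < \<phi> x powr r" using r by simp
    thus False using that by (simp add: \<alpha>_def)
  qed
  have le_H: "\<alpha> (a i) \<le> H" if "i < N" for i
    unfolding H_def local_height_def using fin(1) that by (intro Max_ge) auto
  have "H \<in> (\<lambda>n. \<alpha> (a n)) ` {..<N}" unfolding H_def local_height_def by (rule Max_in[OF fin])
  then obtain n where n: "n < N" "\<alpha> (a n) = H" by auto
  define c where "c = a n"
  have Hpos: "H > 0" using le_H[OF nz(1)] \<alpha>_pos[OF ac[OF nz(1)] nz(2)] by linarith
  thus "local_height \<alpha> N a > 0" by (simp add: H_def)
  have c: "c \<in> carrier R" "\<alpha> c = H" using ac n by (auto simp: c_def)
  have c0: "c \<noteq> \<zero>"
  proof
    assume "c = \<zero>"
    hence "H = 0" using c(2) r by (simp add: \<alpha>_def)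
    thus False using Hpos by simp
  qed
  have ic: "inv c \<in> carrier R" using c c0 by (simp add: field_Units)
  define V where "V = (\<lambda>S. {\<alpha> (form_eval R N M S z) |z. z \<in> {..<N} \<rightarrow> carrier R \<and> local_height \<alpha> N z \<le> 1})"
  have height_le: "\<alpha> (z i) \<le> 1" if "local_height \<alpha> N z \<le> 1" "i < N" for z i
  proof -
    have "\<alpha> (z i) \<in> (\<lambda>n. \<alpha> (z n)) ` {..<N}" using that by blast
    hence "\<alpha> (z i) \<le> local_height \<alpha> N z" unfolding local_height_def by (rule Max_ge[OF fin(1)])
    thus ?thesis using that by simp
  qed
  \<comment> \<open>The triangle inequality is at hand for \<phi> and not for its power \<alpha>, so
    boundedness is shown for \<phi> and transferred by monotonicity.\<close>
  have bdd: "bdd_above (V S)" if S: "S \<in> forms R N M" for S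
  proof (rule bdd_aboveI)
    fix y assume "y \<in> V S"
    then obtain z where z: "y = \<alpha> (form_eval R N M S z)" "z \<in> {..<N} \<rightarrow> carrier R" "local_height \<alpha> N z \<le> 1"
      unfolding V_def by blast
    have "\<phi> (form_eval R N M S z) \<le> (\<Sum>m\<in>monomials N M. \<phi> (S m))"
      using z height_le \<alpha>_le_1 by (intro abs_form_eval_le[OF S]) auto
    thus "y \<le> (\<Sum>m\<in>monomials N M. \<phi> (S m)) powr r"
      unfolding z(1) \<alpha>_def using r abs_nonneg[OF form_eval_closed[OF S z(2)]] by (intro powr_mono2) auto
  qed
  have norm_ge: "\<alpha> (form_eval R N M S z) \<le> form_norm R \<alpha> N M S"
    if "S \<in> forms R N M" "z \<in> {..<N} \<rightarrow> carrier R" "local_height \<alpha> N z \<le> 1" for S z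
  proof -
    have "\<alpha> (form_eval R N M S z) \<in> V S" unfolding V_def using that(2,3) by blast
    hence "\<alpha> (form_eval R N M S z) \<le> Sup (V S)" using bdd[OF that(1)] by (rule cSup_upper)
    thus ?thesis by (simp add: form_norm_def V_def)
  qed
  define W where "W = {form_norm R \<alpha> N M (\<lambda>m. S m \<ominus> f m) |f. f \<in> forms R N M \<and> form_eval R N M f a = \<zero>}"
  \<comment> \<open>Chosen so that \<open>t \<otimes> c [^] M\<close> is the value of
    \<open>S\<close> at \<open>a\<close>.\<close>
  define t where "t = form_eval R N M S a \<otimes> (inv c) [^] M"
  have Sa: "form_eval R N M S a \<in> carrier R" by (rule form_eval_closed[OF S a])
  have t: "t \<in> carrier R" using Sa ic by (simp add: t_def)
  have \<alpha>t: "\<alpha> t = \<alpha> (form_eval R N M S a) / H ^ M"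
    using Sa ic c c0 by (simp add: t_def \<alpha>_mult \<alpha>_pow \<alpha>_inv divide_inverse power_inverse)
  have lower: "\<alpha> t \<le> y" if y: "y \<in> W" for y
  proof -
    obtain f where f: "y = form_norm R \<alpha> N M (\<lambda>m. S m \<ominus> f m)" "f \<in> forms R N M" "form_eval R N M f a = \<zero>"
      using y unfolding W_def by blast
    define b where "b = (\<lambda>i. inv c \<otimes> a i)"
    have bc: "b \<in> {..<N} \<rightarrow> carrier R" using ac ic by (auto simp: b_def)
    have "\<alpha> (b i) \<le> 1" if "i < N" for i
      using le_H[OF that] Hpos ac[OF that] ic c c0 by (simp add: b_def \<alpha>_mult \<alpha>_inv field_simps)
    hence hb: "local_height \<alpha> N b \<le> 1"
      unfolding local_height_def using fin by (subst Max_le_iff) auto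
    have "form_eval R N M (\<lambda>m. S m \<ominus> f m) b = (inv c) [^] M \<otimes> form_eval R N M (\<lambda>m. S m \<ominus> f m) a"
      unfolding b_def by (rule form_eval_scale[OF forms_minus[OF S f(2)] a ic])
    also have "form_eval R N M (\<lambda>m. S m \<ominus> f m) a = form_eval R N M S a"
      using form_eval_minus[OF S f(2) a] f(3) Sa by (simp add: a_minus_def)
    finally have "form_eval R N M (\<lambda>m. S m \<ominus> f m) b = t" using Sa ic by (simp add: t_def m_comm)
    thus ?thesis using norm_ge[OF forms_minus[OF S f(2)] bc hb] by (simp add: f(1))
  qed
  \<comment> \<open>The monomial that is the \<open>M\<close>-th power of the variable with index
    \<open>n\<close>.\<close>
  define m0 where "m0 = replicate_mset M n"
  define g where "g = (\<lambda>m. if m = m0 then t else \<zero>)"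
  define f where "f = (\<lambda>m. S m \<ominus> g m)"
  have m0: "m0 \<in> monomials N M" using n by (auto simp: m0_def monomials_def)
  have gf: "g \<in> forms R N M" using t m0 by (auto simp: g_def forms_def)
  have geval: "form_eval R N M g z = t \<otimes> z n [^] M" if z: "z \<in> {..<N} \<rightarrow> carrier R" for z
  proof -
    have zc: "z i \<in> carrier R" if "i < N" for i using z that by auto
    have "form_eval R N M g z = (\<Oplus>m\<in>monomials N M. if m0 = m then t \<otimes> mono_val N m z else \<zero>)"
      unfolding form_eval_def using t mono_val_closed[OF z] by (intro finsum_cong') (auto simp: g_def)
    also have "\<dots> = t \<otimes> mono_val N m0 z"
      using add.finprod_singleton[OF m0 finite_monomials, of "\<lambda>m. t \<otimes> mono_val N m z"] t mono_val_closed[OF z]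
      by simp
    also have "mono_val N m0 z = (\<Otimes>i\<in>{..<N}. if n = i then z i [^] M else \<one>)"
      using zc n by (intro finprod_cong') (auto simp: m0_def)
    also have "\<dots> = z n [^] M"
      using finprod_singleton[of n "{..<N}" "\<lambda>i. z i [^] M"] n zc by auto
    finally show ?thesis .
  qed
  have cc: "(inv c) [^] M \<otimes> c [^] M = \<one>"
    using c c0 ic by (simp add: nat_pow_distrib[symmetric] field_Units)
  have ga: "form_eval R N M g a = form_eval R N M S a"
    unfolding geval[OF a] t_def c_def[symmetric] using Sa ic c cc by (simp add: m_assoc)
  have ff: "f \<in> forms R N M" unfolding f_def by (rule forms_minus[OF S gf])
  have "form_eval R N M f a = \<zero>"
    unfolding f_def form_eval_minus[OF S gf a] ga using Sa by (simp add: a_minus_def r_neg)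
  moreover have "(\<lambda>m. S m \<ominus> f m) = g"
  proof
    fix m
    have "S m \<in> carrier R" "g m \<in> carrier R" using S gf by (auto simp: forms_def)
    thus "S m \<ominus> f m = g m" unfolding f_def by algebra
  qed
  ultimately have gW: "form_norm R \<alpha> N M g \<in> W" unfolding W_def using ff by (intro CollectI exI[of _ f]) auto
  have "form_norm R \<alpha> N M g \<le> \<alpha> t" unfolding form_norm_def
  proof (rule cSup_least)
    have "local_height \<alpha> N (\<lambda>i. \<zero>) \<le> 1"
      unfolding local_height_def using fin[of "\<lambda>i. \<zero>"] by (subst Max_le_iff) (auto simp: \<alpha>_def)
    thus "{\<alpha> (form_eval R N M g z) |z. z \<in> {..<N} \<rightarrow> carrier R \<and> local_height \<alpha> N z \<le> 1} \<noteq> {}"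
      by (auto intro!: exI[of _ "\<lambda>i. \<zero>"])
    fix y assume "y \<in> {\<alpha> (form_eval R N M g z) |z. z \<in> {..<N} \<rightarrow> carrier R \<and> local_height \<alpha> N z \<le> 1}"
    then obtain z where z: "y = \<alpha> (form_eval R N M g z)" "z \<in> {..<N} \<rightarrow> carrier R" "local_height \<alpha> N z \<le> 1" by blast
    have zn: "z n \<in> carrier R" using z n by auto
    have "y = \<alpha> t * \<alpha> (z n) ^ M" using z zn t by (simp add: geval \<alpha>_mult \<alpha>_pow)
    also have "\<dots> \<le> \<alpha> t * 1"
      using height_le[OF z(3) n(1)] \<alpha>0 by (intro mult_left_mono power_le_one) auto
    finally show "y \<le> \<alpha> t" by simp
  qed
  hence eq: "form_norm R \<alpha> N M g = \<alpha> t" using lower[OF gW] by simp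
  have "local_U R \<alpha> N M a S = \<alpha> t"
    unfolding local_U_def W_def[symmetric]
    by (rule cInf_eq_minimum) (use gW eq lower in auto)
  thus "local_height \<alpha> N a ^ M * local_U R \<alpha> N M a S = \<alpha> (form_eval R N M S a)"
    using Hpos \<alpha>t by (simp add: H_def)
qed

end

section \<open>Algebraic closures of complete fields\<close>

text \<open>The base field is not a subset of its algebraic closure, so its absolute value and its
  completeness are transported along \<open>indexed_const\<close> to the image \<open>F\<close>.
  Existence and uniqueness of the extension then justify the definite description.\<close>

theorem alg_closure_abs_props:
  fixes R :: "'a ring"
  assumes R: "abs_valued_field R \<phi>" and complete: "complete_abs R \<phi>"
  shows "abs_valued_field (field.alg_closure R) (alg_closure_abs R \<phi>)"
    "x \<in> carrier R \<Longrightarrow> alg_closure_abs R \<phi> (ring.indexed_const R x) = \<phi> x"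
proof -
  interpret R: abs_valued_field R \<phi> by fact
  define A where "A = R.alg_closure"
  define i :: "'a \<Rightarrow> ('a list \<times> nat) multiset \<Rightarrow> 'a" where "i = R.indexed_const"
  define F where "F = i ` carrier R"
  interpret A: algebraic_closure A F
    unfolding A_def F_def i_def by (rule R.alg_closureE(1))
  have hom: "i \<in> ring_hom R A" unfolding A_def i_def by (rule R.alg_closureE(2))
  have sub: "subfield F A" by (rule A.subfield_axioms)
  have AF: "field (A\<lparr>carrier := F\<rparr>)" using A.subfield_iff(2)[OF sub] .
  interpret AF: field "A\<lparr>carrier := F\<rparr>" by (rule AF)
  have homF: "i \<in> ring_hom R (A\<lparr>carrier := F\<rparr>)"
    using hom unfolding ring_hom_def F_def by auto
  interpret h: ring_hom_ring R "A\<lparr>carrier := F\<rparr>" i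
    by (rule ring_hom_ringI2[OF R.ring_axioms AF.ring_axioms homF])
  define \<beta> where "\<beta> = (\<lambda>y. \<phi> (inv_into UNIV i y))"
  have "inj i" unfolding i_def by (rule injI) simp
  hence beta: "\<beta> (i x) = \<phi> x" for x by (simp add: \<beta>_def)
  have Fi: "\<exists>x\<in>carrier R. y = i x" if "y \<in> F" for y using that by (auto simp: F_def)
  have absF: "abs_valued_field (A\<lparr>carrier := F\<rparr>) \<beta>"
  proof unfold_locales
    fix y assume "y \<in> carrier (A\<lparr>carrier := F\<rparr>)"
    then obtain u where u: "u \<in> carrier R" "y = i u" using Fi by auto
    show "0 \<le> \<beta> y" using u R.abs_nonneg by (simp add: beta)
    have "i u = i \<zero>\<^bsub>R\<^esub> \<longleftrightarrow> u = \<zero>\<^bsub>R\<^esub>" by (rule inj_eq[OF \<open>inj i\<close>])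
    thus "\<beta> y = 0 \<longleftrightarrow> y = \<zero>\<^bsub>A\<lparr>carrier := F\<rparr>\<^esub>"
      using u R.abs_eq_0_iff h.hom_zero by (simp add: beta)
    fix z assume "z \<in> carrier (A\<lparr>carrier := F\<rparr>)"
    then obtain v where v: "v \<in> carrier R" "z = i v" using Fi by auto
    have "y \<otimes>\<^bsub>A\<lparr>carrier := F\<rparr>\<^esub> z = i (u \<otimes>\<^bsub>R\<^esub> v)" "y \<oplus>\<^bsub>A\<lparr>carrier := F\<rparr>\<^esub> z = i (u \<oplus>\<^bsub>R\<^esub> v)"
      using u v h.hom_mult h.hom_add by auto
    thus "\<beta> (y \<otimes>\<^bsub>A\<lparr>carrier := F\<rparr>\<^esub> z) = \<beta> y * \<beta> z"
      "\<beta> (y \<oplus>\<^bsub>A\<lparr>carrier := F\<rparr>\<^esub> z) \<le> \<beta> y + \<beta> z"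
      using u v R.abs_mult R.abs_add by (simp_all only: beta)
  qed
  have ext: "abs_extension A F \<beta>"
    unfolding abs_extension_def abs_extension_axioms_def
    using A.field_axioms sub absF A.algebraic_extension by blast
  have completeF: "complete_abs (A\<lparr>carrier := F\<rparr>) \<beta>"
    unfolding complete_abs_def
  proof (intro allI impI)
    fix f :: "nat \<Rightarrow> _" assume f: "range f \<subseteq> carrier (A\<lparr>carrier := F\<rparr>)"
      and cau: "\<forall>e>0. \<exists>k. \<forall>m\<ge>k. \<forall>n\<ge>k. \<beta> (f m \<ominus>\<^bsub>A\<lparr>carrier := F\<rparr>\<^esub> f n) < e"
    have "\<forall>n. \<exists>u\<in>carrier R. f n = i u" using f Fi by auto
    then obtain u where u: "\<And>n. u n \<in> carrier R" "\<And>n. f n = i (u n)" by metis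
    have diff: "i s \<ominus>\<^bsub>A\<lparr>carrier := F\<rparr>\<^esub> i t = i (s \<ominus>\<^bsub>R\<^esub> t)" if "s \<in> carrier R" "t \<in> carrier R" for s t
      unfolding a_minus_def using that h.hom_add[of s "\<ominus>\<^bsub>R\<^esub> t"] h.hom_a_inv[of t] by simp
    have "\<forall>e>0. \<exists>k. \<forall>m\<ge>k. \<forall>n\<ge>k. \<phi> (u m \<ominus>\<^bsub>R\<^esub> u n) < e"
      using cau unfolding u(2) diff[OF u(1) u(1)] beta .
    then obtain c where c: "c \<in> carrier R" "(\<lambda>n. \<phi> (u n \<ominus>\<^bsub>R\<^esub> c)) \<longlonglongrightarrow> 0"
      using complete u(1) unfolding complete_abs_def by (metis image_subsetI)
    have "(\<lambda>n. \<beta> (f n \<ominus>\<^bsub>A\<lparr>carrier := F\<rparr>\<^esub> i c)) \<longlonglongrightarrow> 0"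
      unfolding u(2) diff[OF u(1) c(1)] beta by (rule c(2))
    thus "\<exists>c\<in>carrier (A\<lparr>carrier := F\<rparr>). (\<lambda>n. \<beta> (f n \<ominus>\<^bsub>A\<lparr>carrier := F\<rparr>\<^esub> c)) \<longlonglongrightarrow> 0"
      using c(1) by (intro bexI[of _ "i c"]) (auto simp: F_def)
  qed
  define P where "P = (\<lambda>\<psi>. \<psi> \<in> abs_values A \<and> (\<forall>x\<in>carrier R. \<psi> (i x) = \<phi> x))"
  have iA: "i x \<in> carrier A" if "x \<in> carrier R" for x using hom that by (rule ring_hom_closed)
  obtain \<psi> where psi: "abs_valued_field A \<psi>" "\<forall>c\<in>F. \<psi> c = \<beta> c"
    using abs_extension.abs_extension_exists[OF ext] by blast
  have ex: "P (restrict \<psi> (carrier A))"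
    unfolding P_def using abs_valued_field.restrict_in_abs_values[OF psi(1)] psi(2) iA beta by (simp add: F_def)
  \<comment> \<open>Every candidate equals the spectral seminorm on the carrier, so any two
    candidates agree.\<close>
  have spec: "\<chi> y = abs_extension.spectral A F \<beta> y" if "P \<chi>" "y \<in> carrier A" for \<chi> y
  proof -
    have "abs_valued_field A \<chi>" using that(1) abs_valued_field_iff[OF A.field_axioms] by (simp add: P_def)
    moreover have "\<chi> c = \<beta> c" if "c \<in> F" for c using that \<open>P \<chi>\<close> beta by (auto simp: P_def F_def)
    ultimately have "complete_abs_extension A F \<beta> \<chi>"
      unfolding complete_abs_extension_def complete_abs_extension_axioms_def using ext completeF by blast
    from complete_abs_extension.abs_extension_unique[OF this that(2)] show ?thesis .
  qed
  have "P (THE \<psi>. P \<psi>)"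
  proof (rule theI[of P, OF ex])
    fix \<chi> assume chi: "P \<chi>"
    show "\<chi> = restrict \<psi> (carrier A)"
    proof (rule extensionalityI[of _ "carrier A"])
      show "\<chi> \<in> extensional (carrier A)" using chi by (simp add: P_def abs_values_def)
      fix y assume "y \<in> carrier A"
      thus "\<chi> y = restrict \<psi> (carrier A) y" using spec[OF chi] spec[OF ex] by simp
    qed simp
  qed
  hence P: "P (alg_closure_abs R \<phi>)" unfolding alg_closure_abs_def P_def A_def i_def .
  show "abs_valued_field (field.alg_closure R) (alg_closure_abs R \<phi>)"
    using P abs_valued_field_iff[OF A.field_axioms] by (simp add: P_def A_def)
  show "x \<in> carrier R \<Longrightarrow> alg_closure_abs R \<phi> (ring.indexed_const R x) = \<phi> x"
    using P by (simp add: P_def i_def)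
qed

section \<open>The places of a number field\<close>

text \<open>Values of forms can be computed among complex numbers and embedded afterwards; this
  makes the local values of the form the images of one global number.\<close>

lemma (in field) hom_form_eval:
  assumes K: "subfield_set K" and h: "h \<in> ring_hom (field_of K) R"
    and T: "\<And>m. T m \<in> K" and a: "\<And>n. n < N \<Longrightarrow> a n \<in> K"
  shows "form_eval R N M (\<lambda>m. h (T m)) (\<lambda>n. h (a n)) = h (form_eval complex_field N M T a)"
    "form_eval complex_field N M T a \<in> K"
proof -
  interpret K: subfield_set K by fact
  interpret F: field "field_of K" by (rule field_of_field[OF K])
  interpret h: ring_hom_ring "field_of K" R h
    by (rule ring_hom_ringI2[OF F.ring_axioms ring_axioms h])
  have sum: "(\<Oplus>i\<in>A. h (g i)) = h (\<Sum>i\<in>A. g i)" if "finite A" "\<And>i. i \<in> A \<Longrightarrow> g i \<in> K" for A and g :: "'c \<Rightarrow> complex"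
    using that
  proof (induction A rule: finite_induct)
    case empty
    show ?case using h.hom_zero by simp
  next
    case (insert i A)
    have "(\<Sum>i\<in>A. g i) \<in> K" using insert by (intro K.K_sum) auto
    thus ?case using insert h.hom_add[of "g i" "\<Sum>i\<in>A. g i"] h.hom_closed by (simp add: finsum_insert Pi_def)
  qed
  have prod: "(\<Otimes>i\<in>A. h (g i)) = h (\<Prod>i\<in>A. g i)" if "finite A" "\<And>i. i \<in> A \<Longrightarrow> g i \<in> K" for A and g :: "'c \<Rightarrow> complex"
    using that
  proof (induction A rule: finite_induct)
    case empty
    show ?case using h.hom_one by simp
  next
    case (insert i A)
    have "(\<Prod>i\<in>A. g i) \<in> K" using insert by (intro K.K_prod) auto
    thus ?case using insert h.hom_mult[of "g i" "\<Prod>i\<in>A. g i"] h.hom_closed by (simp add: finprod_insert Pi_def)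
  qed
  have pow: "h x [^] (k::nat) = h (x ^ k)" if "x \<in> K" for x k
  proof (induction k)
    case (Suc k)
    thus ?case using h.hom_mult[of "x ^ k" x] that K.K_power[OF that] by (simp add: mult.commute)
  qed (use h.hom_one in simp)
  have csum: "(\<Oplus>\<^bsub>complex_field\<^esub>i\<in>A. g i) = (\<Sum>i\<in>A. g i)" if "finite A" for A and g :: "'c \<Rightarrow> complex"
    using that by (induction A rule: finite_induct) (simp_all add: CF.finsum_insert)
  have cprod: "(\<Otimes>\<^bsub>complex_field\<^esub>i\<in>A. g i) = (\<Prod>i\<in>A. g i)" if "finite A" for A and g :: "'c \<Rightarrow> complex"
    using that by (induction A rule: finite_induct) (simp_all add: CF.finprod_insert)
  have ev: "form_eval complex_field N M T a = (\<Sum>m\<in>monomials N M. T m * (\<Prod>i<N. a i ^ count m i))"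
    unfolding form_eval_def by (simp add: csum[OF finite_monomials] cprod)
  have mK: "(\<Prod>i<N. a i ^ count m i) \<in> K" for m using a by (intro K.K_prod K.K_power) auto
  show "form_eval complex_field N M T a \<in> K" unfolding ev using T mK by (intro K.K_sum K.K_mult)
  have mono: "(\<Otimes>i\<in>{..<N}. h (a i) [^] count m i) = h (\<Prod>i<N. a i ^ count m i)" for m
  proof -
    have "(\<Otimes>i\<in>{..<N}. h (a i) [^] count m i) = (\<Otimes>i\<in>{..<N}. h (a i ^ count m i))"
      using a pow h.hom_closed K.K_power by (intro finprod_cong') auto
    also have "\<dots> = h (\<Prod>i<N. a i ^ count m i)" using a by (intro prod K.K_power) auto
    finally show ?thesis .
  qed
  have "form_eval R N M (\<lambda>m. h (T m)) (\<lambda>n. h (a n)) = (\<Oplus>m\<in>monomials N M. h (T m * (\<Prod>i<N. a i ^ count m i)))"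
    unfolding form_eval_def mono using h.hom_mult[OF _ _] T mK by simp
  also have "\<dots> = h (form_eval complex_field N M T a)"
    unfolding ev using T mK by (intro sum finite_monomials K.K_mult)
  finally show "form_eval R N M (\<lambda>m. h (T m)) (\<lambda>n. h (a n)) = h (form_eval complex_field N M T a)" .
qed

text \<open>Each of the three embeddings, into the completion, into its algebraic closure and into
  the completion of that, preserves the absolute value; so on \<open>K\<close> everything can be
  computed by \<open>norm_at\<close>.\<close>

lemma Omega_props:
  assumes K: "subfield_set K" and abs: "subfield_abs K (norm_at v)"
  shows "abs_valued_field (Omega K v) (completion_abs (local_closure_abs K v))"
    "embed_at K v \<in> ring_hom (field_of K) (Omega K v)"
    "x \<in> K \<Longrightarrow> completion_abs (local_closure_abs K v) (embed_at K v x) = norm_at v x"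
proof -
  have V: "abs_valued_field (field_of K) (norm_at v)" using field_of_abs_iff[OF K] abs by blast
  interpret V: abs_valued_field "field_of K" "norm_at v" by (rule V)
  have L: "abs_valued_field (local_field K v) (completion_abs (norm_at v))"
    "complete_abs (local_field K v) (completion_abs (norm_at v))"
    unfolding local_field_def by (rule V.abs_valued_compl, rule V.compl_complete)
  have C: "abs_valued_field (local_closure K v) (local_closure_abs K v)"
    unfolding local_closure_def local_closure_abs_def by (rule alg_closure_abs_props(1)[OF L])
  interpret C: abs_valued_field "local_closure K v" "local_closure_abs K v" by (rule C)
  show "abs_valued_field (Omega K v) (completion_abs (local_closure_abs K v))"
    unfolding Omega_def by (rule C.abs_valued_compl)
  let ?i = "ring.indexed_const (local_field K v)"
  have i: "?i \<in> ring_hom (local_field K v) (local_closure K v)"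
    unfolding local_closure_def by (rule field.alg_closureE(2)) (use L in \<open>simp add: abs_valued_field_def\<close>)
  have e: "completion_embed (field_of K) (norm_at v) \<in> ring_hom (field_of K) (local_field K v)"
    unfolding local_field_def by (rule V.embed_hom)
  have E: "embed_at K v = completion_embed (local_closure K v) (local_closure_abs K v) \<circ> (?i \<circ> completion_embed (field_of K) (norm_at v))"
    by (rule ext) (simp add: embed_at_def)
  show "embed_at K v \<in> ring_hom (field_of K) (Omega K v)"
    unfolding E Omega_def by (rule ring_hom_trans[OF ring_hom_trans[OF e i] C.embed_hom])
  assume x: "x \<in> K"
  have ex: "completion_embed (field_of K) (norm_at v) x \<in> carrier (local_field K v)"
    using ring_hom_closed[OF e] x by simp
  have "completion_abs (local_closure_abs K v) (embed_at K v x) = local_closure_abs K v (?i (completion_embed (field_of K) (norm_at v) x))"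
    unfolding embed_at_def by (rule C.completion_abs_embed[OF ring_hom_closed[OF i ex]])
  also have "\<dots> = completion_abs (norm_at v) (completion_embed (field_of K) (norm_at v) x)"
    unfolding local_closure_abs_def by (rule alg_closure_abs_props(2)[OF L ex])
  also have "\<dots> = norm_at v x" using V.completion_abs_embed[of x] x by simp
  finally show "completion_abs (local_closure_abs K v) (embed_at K v x) = norm_at v x" .
qed

section \<open>The local identities and their product over all places\<close>

context primitive_field begin

lemma local_degree_pos: "v \<in> places K \<Longrightarrow> local_degree K v > 0"
proof -
  assume v: "v \<in> places K"
  obtain \<alpha> where a: "\<alpha> \<in> usual_abs_rat" "norm_at v \<in> normalized_abs K \<alpha>" using norm_at_place(2)[OF v] by blast
  obtain w where w: "rat_place K \<theta> \<mu> w \<alpha>" using rat_place_exists[OF a(1)] .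
  interpret F: place_above K \<theta> \<mu> w \<alpha> "norm_at v" by (rule place_aboveI[OF w a(2)])
  show ?thesis
    using F.dim_completion F.local_dim_pos unfolding local_degree_eq abs_degree_def F.base_field_def[symmetric] by simp
qed

lemma local_identity:
  assumes v: "v \<in> places K" and N: "n0 < N" "a n0 \<noteq> 0" and a: "\<And>n. n < N \<Longrightarrow> a n \<in> K"
    and T: "T \<in> forms complex_field N M" "\<And>m. T m \<in> K"
  shows "height_at K v N a > 0"
    "height_at K v N a ^ M * U_at K v N M a T =
       norm_at v (form_eval complex_field N M T a) powr (real (local_degree K v) / real (degree_nf K))"
proof -
  obtain \<alpha> where "\<alpha> \<in> usual_abs_rat" "norm_at v \<in> normalized_abs K \<alpha>" using norm_at_place(2)[OF v] by blast
  hence abs: "subfield_abs K (norm_at v)" by (simp add: normalized_abs_def)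
  note P = Omega_props[OF subfield_set_axioms abs]
  interpret O: abs_valued_field "Omega K v" "completion_abs (local_closure_abs K v)" by (rule P(1))
  interpret p: subfield_abs K "norm_at v" by (rule abs)
  define r where "r = real (local_degree K v) / real (degree_nf K)"
  have r: "r > 0" using local_degree_pos[OF v] mu(5) by (simp add: r_def degree_nf_eq)
  have abs_at: "abs_at K v = (\<lambda>x. completion_abs (local_closure_abs K v) x powr r)"
    by (rule ext) (simp add: abs_at_def r_def)
  have closed: "embed_at K v x \<in> carrier (Omega K v)" if "x \<in> K" for x
    using ring_hom_closed[OF P(2)] that by simp
  have zero: "embed_at K v 0 = \<zero>\<^bsub>Omega K v\<^esub>"
    using ring_hom_zero[OF P(2)] field_of_field[OF subfield_set_axioms] O.ring_axioms
    by (simp add: field.is_ring)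
  have S: "(\<lambda>m. embed_at K v (T m)) \<in> forms (Omega K v) N M"
    using T closed zero by (auto simp: forms_def)
  have A: "(\<lambda>n. embed_at K v (a n)) \<in> {..<N} \<rightarrow> carrier (Omega K v)" using a closed by auto
  have nz: "embed_at K v (a n0) \<noteq> \<zero>\<^bsub>Omega K v\<^esub>"
  proof
    assume "embed_at K v (a n0) = \<zero>\<^bsub>Omega K v\<^esub>"
    hence "norm_at v (a n0) = 0" using P(3)[OF a[OF N(1)]] O.abs_zero by simp
    thus False using p.eq_0_iff[OF a[OF N(1)]] N(2) by simp
  qed
  note U = O.local_U_formula[OF S A N(1) nz r]
  show "height_at K v N a > 0" unfolding height_at_def abs_at by (rule U(1))
  have ev: "form_eval (Omega K v) N M (\<lambda>m. embed_at K v (T m)) (\<lambda>n. embed_at K v (a n)) = embed_at K v (form_eval complex_field N M T a)"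
    "form_eval complex_field N M T a \<in> K"
    by (rule O.hom_form_eval[OF subfield_set_axioms P(2) T(2) a]; assumption)+
  show "height_at K v N a ^ M * U_at K v N M a T =
       norm_at v (form_eval complex_field N M T a) powr (real (local_degree K v) / real (degree_nf K))"
    using U(2) unfolding height_at_def U_at_def abs_at ev(1) P(3)[OF ev(2)] by (simp add: r_def)
qed

text \<open>Confines the height to the finitely many places where some nonzero coordinate has value
  different from 1; elsewhere the maximum runs over zeros and at least one 1.\<close>

lemma height_at_eq_1:
  assumes v: "v \<in> places K" and a: "\<And>n. n < N \<Longrightarrow> a n \<in> K" and n0: "n0 < N" "a n0 \<noteq> 0"
    and one: "\<And>n. n < N \<Longrightarrow> a n \<noteq> 0 \<Longrightarrow> norm_at v (a n) = 1"
  shows "height_at K v N a = 1"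
proof -
  obtain \<alpha> where "\<alpha> \<in> usual_abs_rat" "norm_at v \<in> normalized_abs K \<alpha>" using norm_at_place(2)[OF v] by blast
  hence abs: "subfield_abs K (norm_at v)" by (simp add: normalized_abs_def)
  interpret p: subfield_abs K "norm_at v" by (rule abs)
  have val: "abs_at K v (embed_at K v (a n)) = (if a n = 0 then 0 else 1)" if "n < N" for n
    using one[OF that] a[OF that] Omega_props(3)[OF subfield_set_axioms abs, of "a n"] p.zero by (simp add: abs_at_def)
  show ?thesis unfolding height_at_def local_height_def
    by (rule Max_eqI) (use val n0 in \<open>force split: if_splits\<close>)+
qed

theorem global_identity:
  assumes N: "N > 0" and M: "M > 0" and a: "\<And>n. n < N \<Longrightarrow> a n \<in> K"
    and T: "T \<in> forms complex_field N M" "\<And>m. T m \<in> K"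
    and nz: "form_eval complex_field N M T a \<noteq> 0"
  shows "global_height K N a ^ M * U_global K N M a T = 1"
proof -
  define t where "t = form_eval complex_field N M T a"
  define d where "d = real (degree_nf K)"
  have d: "d > 0" using mu(5) by (simp add: d_def degree_nf_eq)
  \<comment> \<open>Since \<open>M > 0\<close>, a form vanishes at the origin, so \<open>a\<close>
    has a nonzero coordinate.\<close>
  have "\<exists>n<N. a n \<noteq> 0"
  proof (rule ccontr)
    assume "\<not> ?thesis"
    hence az: "a n = 0" if "n < N" for n using that by blast
    have mono: "(\<Otimes>\<^bsub>complex_field\<^esub>i\<in>{..<N}. a i [^]\<^bsub>complex_field\<^esub> count m i) = 0" if m: "m \<in> monomials N M" for m
    proof -
      obtain j where j: "j \<in># m" using m M by (auto simp: monomials_def) (metis multiset_nonemptyE size_empty less_numeral_extra(3))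
      hence jN: "j < N" using m by (auto simp: monomials_def)
      have "(\<Otimes>\<^bsub>complex_field\<^esub>i\<in>A. a i [^]\<^bsub>complex_field\<^esub> count m i) = (\<Prod>i\<in>A. a i ^ count m i)" if "finite A" for A
        using that by (induction A rule: finite_induct) (simp_all add: CF.finprod_insert)
      moreover have "(\<Prod>i<N. a i ^ count m i) = 0" using jN az j by (auto intro!: prod_zero bexI[of _ j])
      ultimately show ?thesis by simp
    qed
    have "form_eval complex_field N M T a = (\<Oplus>\<^bsub>complex_field\<^esub>m\<in>monomials N M. \<zero>\<^bsub>complex_field\<^esub>)"
      unfolding form_eval_def by (rule CF.finsum_cong') (use mono in simp_all)
    thus False using nz CF.finsum_zero[of "monomials N M"] by simp
  qed
  then obtain n0 where n0: "n0 < N" "a n0 \<noteq> 0" by blast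
  have tK: "t \<in> K"
  proof -
    have "id \<in> ring_hom (field_of K) complex_field" by (rule ring_hom_memI) simp_all
    thus ?thesis unfolding t_def
      by (rule field.hom_form_eval(2)[OF field_complex_field subfield_set_axioms]) (use T(2) a in auto)
  qed
  have t0: "t \<noteq> 0" using nz by (simp add: t_def)
  define P where "P = places K"
  \<comment> \<open>Outside \<open>B\<close> the height is 1, and outside
    \<open>A \<union> B\<close> the local identity makes \<open>U_at\<close> equal to 1 as well; so
    this finite set carries both products.\<close>
  define A where "A = {v \<in> P. norm_at v t \<noteq> 1}"
  define B where "B = (\<Union>n\<in>{n. n < N \<and> a n \<noteq> 0}. {v \<in> P. norm_at v (a n) \<noteq> 1})"
  have finA: "finite A" unfolding A_def P_def by (rule product_formula(1)[OF tK t0])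
  have finB: "finite B" unfolding B_def P_def using product_formula(1) a by auto
  have loc: "height_at K v N a ^ M * U_at K v N M a T = norm_at v t powr (real (local_degree K v) / d)"
    if "v \<in> places K" for v
    using local_identity(2)[of v n0 N a T M] that n0 a T unfolding t_def d_def by blast
  have H1: "height_at K v N a = 1" if "v \<in> P" "v \<notin> B" for v
    using height_at_eq_1[of v N a n0] that a n0 by (auto simp: P_def B_def)
  have U1: "U_at K v N M a T = 1" if "v \<in> P" "v \<notin> A \<union> B" for v
    using loc[of v] H1[of v] that by (simp add: A_def P_def)
  have "global_height K N a = (\<Prod>v\<in>A \<union> B. height_at K v N a)"
    unfolding global_height_def prod_places_def P_def[symmetric]
    using finA finB H1 by (intro prod.mono_neutral_left) (auto simp: A_def B_def)
  moreover have "U_global K N M a T = (\<Prod>v\<in>A \<union> B. U_at K v N M a T)"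
    unfolding U_global_def prod_places_def P_def[symmetric]
    using finA finB U1 by (intro prod.mono_neutral_left) (auto simp: A_def B_def)
  ultimately have "global_height K N a ^ M * U_global K N M a T
      = (\<Prod>v\<in>A \<union> B. height_at K v N a ^ M * U_at K v N M a T)"
    by (simp add: prod.distrib prod_power_distrib)
  also have "\<dots> = (\<Prod>v\<in>A \<union> B. norm_at v t powr (real (local_degree K v) / d))"
  proof (rule prod.cong[OF refl])
    fix v assume "v \<in> A \<union> B"
    hence "v \<in> places K" by (auto simp: A_def B_def P_def)
    thus "height_at K v N a ^ M * U_at K v N M a T = norm_at v t powr (real (local_degree K v) / d)"
      by (rule loc)
  qed
  also have "\<dots> = (\<Prod>v\<in>A. norm_at v t powr (real (local_degree K v) / d))"
    using finA finB by (intro prod.mono_neutral_right) (auto simp: A_def B_def)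
  \<comment> \<open>The local degree goes into an integral power, as in the product formula, and the
    common exponent \<open>1 / d\<close> can be taken out of the product.\<close>
  also have "\<dots> = (\<Prod>v\<in>A. (norm_at v t ^ local_degree K v) powr (1 / d))"
  proof (rule prod.cong[OF refl])
    fix v assume "v \<in> A"
    hence v: "v \<in> places K" by (simp add: A_def P_def)
    obtain \<alpha> where "\<alpha> \<in> usual_abs_rat" "norm_at v \<in> normalized_abs K \<alpha>" using norm_at_place(2)[OF v] by blast
    hence "norm_at v t > 0" using subfield_abs.pos[of K "norm_at v" t] tK t0 by (simp add: normalized_abs_def)
    thus "norm_at v t powr (real (local_degree K v) / d) = (norm_at v t ^ local_degree K v) powr (1 / d)"
      by (simp add: powr_realpow[symmetric] powr_powr)
  qed
  also have "\<dots> = (\<Prod>v\<in>A. norm_at v t ^ local_degree K v) powr (1 / d)"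
  proof -
    have nn: "norm_at v t ^ local_degree K v \<ge> 0" if "v \<in> A" for v
    proof -
      have v: "v \<in> places K" using that by (simp add: A_def P_def)
      obtain \<alpha> where "\<alpha> \<in> usual_abs_rat" "norm_at v \<in> normalized_abs K \<alpha>" using norm_at_place(2)[OF v] by blast
      thus ?thesis using subfield_abs.nonneg[of K "norm_at v" t] tK by (simp add: normalized_abs_def)
    qed
    show ?thesis using finA nn
    proof (induction A rule: finite_induct)
      case (insert v F)
      thus ?case by (simp add: powr_mult prod_nonneg)
    qed simp
  qed
  also have "\<dots> = 1" using product_formula(2)[OF tK t0] unfolding A_def P_def by simp
  finally show ?thesis .
qed

end

theorem theorem2p2:
  fixes M N :: nat
    and a :: "nat \<Rightarrow> complex"
    and T :: "nat multiset \<Rightarrow> complex"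
    and K :: "complex set"
  assumes "M > 0" and "N > 0"
    and "\<forall>n<N. algebraic (a n)"
    and "T \<in> forms complex_field N M" and "\<forall>m. algebraic (T m)"
    and "form_eval complex_field N M T a \<noteq> 0"
    and "number_field K"
    and "\<forall>n<N. a n \<in> K" and "\<forall>m. T m \<in> K"
  shows "1 = global_height K N a ^ M * U_global K N M a T"
proof -
  obtain \<theta> \<mu> where "primitive_field K \<theta> \<mu>"
    using number_field_primitive[OF assms(7)] .
  then interpret primitive_field K \<theta> \<mu> .
  show ?thesis using global_identity[OF assms(2,1) _ assms(4) _ assms(6)] assms(8,9) by simp
qed

end
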